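(* Let $G(x,y,t,p_x,p_y)$, with $x,p_x\in\mathbb{R}^n$ and $y,t,p_y\in\mathbb{R}$, satisfy the following assumptions. (H1) $G$ is a continuous function on $\mathbb{R}^{2n+3}$, $\mathbb{Z}^n$-periodic in $x$, and $1$-periodic in $y$ and in $t$. (H2) Either $G$ is independent of $t$ and $G(x,y,p_x,p_y)\to+\infty$ as $|p_x|\to+\infty$, uniformly with respect to $(x,y)\in\mathbb{R}^n\times\mathbb{R}$ and $|p_y|\le R$, for every $R>0$; or $G$ depends on $t$ and there exist constants $C_1,C_2>0$ such that $G(x,y,t,p_x,0)\ge C_1|p_x|-C_2$ for all $(x,y,t,p_x)\in\mathbb{R}^n\times\mathbb{R}\times\mathbb{R}\times\mathbb{R}^n$. (H3) $G$ is locally Lipschitz continuous with respect to $y$, $t$, $p_y$, and there exist $l\in\mathbb{R}$ and $C_3,C_4,C_5\ge 0$ such that, for almost every $\xi=(x,y,t,p_x,p_y)\in\mathbb{R}^{2n+3}$, $|D_yG(\xi)|\le C_3|p_y+l|$, $|D_tG(\xi)|\le C_4(1+|p_y|+|G(\xi)|)$, $|D_{p_y}G(\xi)|\le C_5$. Then: (i) For any $\alpha>0$, there exists a unique continuous, space-time periodic solution $w^\alpha$ of $w^\alpha_t+G(x,y,t,D_xw^\alpha,D_yw^\alpha)+\alpha w^\alpha=0$ in $\mathbb{R}^{n+1}\times\mathbb{R}$, which is independent of $t$ if $G$ is independent of $t$. (ii) There exists a constant $K=K(G)$, depending on $G$ only through $C_0:=\|G(x,y,t,0,0)\|_\infty$,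 $l$, and the coercivity property of $G$ in $p_x$ stated in (H2) (i.e. the growth $G\to+\infty$ as $|p_x|\to+\infty$ uniformly for $|p_y|\le R$ in the $t$-independent case, or the constants $C_1,C_2$ with $G(x,y,t,p_x,0)\ge C_1|p_x|-C_2$ in the $t$-dependent case), such that $\max_{\mathbb{R}^{n+1}\times\mathbb{R}}w^\alpha-\min_{\mathbb{R}^{n+1}\times\mathbb{R}}w^\alpha\le K$. In particular, if $G$ depends on $t$, then $K=K(C_0,C_1,C_2,l)$. (iii) There exists a unique constant $\overline\lambda$ such that the equation $w_t+G(x,y,t,D_xw,D_yw)=\overline\lambda$ in $\mathbb{R}^{n+1}\times\mathbb{R}$ admits bounded, possibly discontinuous, (viscosity) sub- and supersolutions. (iv) If $v_0$ is bounded and uniformly continuous in $\mathbb{R}^{n+1}$, there exists a unique (viscosity) solution $v$ of $v_t+G(x,y,t,D_xv,D_yv)=0$ in $\mathbb{R}^{n+1}\times(0,+\infty)$ with $v(x,y,0)=v_0(x,y)$ in $\mathbb{R}^{n+1}$, which is bounded and uniformly continuous in $\mathbb{R}^{n+1}\times[0,T]$ for all $T>0$; moreover $\lim_{t\to+\infty}t^{-1}v(x,y,t)=-\overline\lambda$, uniformly in $\mathbb{R}^{n+1}$.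
   Context: Non-coercive ergodic problem for first-order Hamilton-Jacobi equations in the viscosity solutions framework; $G$ is coercive in $p_x$ but not necessarily in $p_y$. Solutions are understood in the viscosity sense. *)

theory Defs
  imports "HOL-Analysis.Analysis"
begin

text \<open>Points of space-time: (x, y, t) with x in R^n, y, t in R.
  The Hamiltonian is G x y t px py with px in R^n, py in R.\<close>

type_synonym 'n ham = "real^('n::finite) \<Rightarrow> real \<Rightarrow> real \<Rightarrow> real^'n \<Rightarrow> real \<Rightarrow> real"
type_synonym 'n stfun = "real^('n::finite) \<Rightarrow> real \<Rightarrow> real \<Rightarrow> real"

definition int_vec :: "real^('n::finite) \<Rightarrow> bool" where
  "int_vec k \<longleftrightarrow> (\<forall>i. k $ i \<in> \<int>)"

definition H1 :: "('n::finite) ham \<Rightarrow> bool" where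
  "H1 G \<longleftrightarrow>
     continuous_on UNIV (\<lambda>(x, y, t, px, py). G x y t px py) \<and>
     (\<forall>x y t px py k. int_vec k \<longrightarrow> G (x + k) y t px py = G x y t px py) \<and>
     (\<forall>x y t px py. G x (y + 1) t px py = G x y t px py) \<and>
     (\<forall>x y t px py. G x y (t + 1) px py = G x y t px py)"

definition t_indep :: "('n::finite) ham \<Rightarrow> bool" where
  "t_indep G \<longleftrightarrow> (\<forall>x y t s px py. G x y t px py = G x y s px py)"

definition coercive_px :: "('n::finite) ham \<Rightarrow> bool" where
  "coercive_px G \<longleftrightarrow>
     (\<forall>R>0. \<forall>M. \<exists>Q. \<forall>x y t px py. \<bar>py\<bar> \<le> R \<and> Q \<le> norm px \<longrightarrow> M \<le> G x y t px py)"

text \<open>The same coercivity, with an explicit modulus Q (data on which the constant K may depend).\<close>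
definition coercive_px_with :: "('n::finite) ham \<Rightarrow> (real \<Rightarrow> real \<Rightarrow> real) \<Rightarrow> bool" where
  "coercive_px_with G Q \<longleftrightarrow>
     (\<forall>R>0. \<forall>M. \<forall>x y t px py. \<bar>py\<bar> \<le> R \<and> Q R M \<le> norm px \<longrightarrow> M \<le> G x y t px py)"

definition lin_coercive :: "('n::finite) ham \<Rightarrow> real \<Rightarrow> real \<Rightarrow> bool" where
  "lin_coercive G C1 C2 \<longleftrightarrow> (\<forall>x y t px. C1 * norm px - C2 \<le> G x y t px 0)"

definition H2 :: "('n::finite) ham \<Rightarrow> bool" where
  "H2 G \<longleftrightarrow> (t_indep G \<and> coercive_px G) \<or>
             (\<not> t_indep G \<and> (\<exists>C1>0. \<exists>C2>0. lin_coercive G C1 C2))"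

definition loc_lip_ytpy :: "('n::finite) ham \<Rightarrow> bool" where
  "loc_lip_ytpy G \<longleftrightarrow>
     (\<forall>B :: ((real^('n::finite)) \<times> real \<times> real \<times> (real^('n::finite)) \<times> real) set. bounded B \<longrightarrow>
        (\<exists>L. \<forall>x y t px py y' t' py'.
            (x, y, t, px, py) \<in> B \<and> (x, y', t', px, py') \<in> B \<longrightarrow>
            \<bar>G x y t px py - G x y' t' px py'\<bar> \<le> L * (\<bar>y - y'\<bar> + \<bar>t - t'\<bar> + \<bar>py - py'\<bar>)))"

definition H3 :: "('n::finite) ham \<Rightarrow> real \<Rightarrow> bool" where
  "H3 G l \<longleftrightarrow> loc_lip_ytpy G \<and>
     (\<exists>C3\<ge>0. \<exists>C4\<ge>0. \<exists>C5\<ge>0.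
        AE \<xi> in (lborel :: ((real^('n::finite)) \<times> real \<times> real \<times> (real^('n::finite)) \<times> real) measure).
          (case \<xi> of (x, y, t, px, py) \<Rightarrow>
             (\<forall>d. ((\<lambda>s. G x s t px py) has_real_derivative d) (at y) \<longrightarrow> \<bar>d\<bar> \<le> C3 * \<bar>py + l\<bar>) \<and>
             (\<forall>d. ((\<lambda>s. G x y s px py) has_real_derivative d) (at t) \<longrightarrow>
                    \<bar>d\<bar> \<le> C4 * (1 + \<bar>py\<bar> + \<bar>G x y t px py\<bar>)) \<and>
             (\<forall>d. ((\<lambda>s. G x y t px s) has_real_derivative d) (at py) \<longrightarrow> \<bar>d\<bar> \<le> C5)))"

text \<open>Viscosity solutions, general first-order equation F z r D = 0 on an open set \<Omega>,
  where D is the (Frechet) derivative of the test function at z. C^1 test functions.\<close>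

definition C1_test :: "('a::euclidean_space \<Rightarrow> real) \<Rightarrow> ('a \<Rightarrow> 'a \<Rightarrow> real) \<Rightarrow> bool" where
  "C1_test \<phi> \<phi>' \<longleftrightarrow> (\<forall>z. (\<phi> has_derivative \<phi>' z) (at z)) \<and> (\<forall>h. continuous_on UNIV (\<lambda>z. \<phi>' z h))"

definition usc_env :: "'a::euclidean_space set \<Rightarrow> ('a \<Rightarrow> real) \<Rightarrow> 'a \<Rightarrow> real" where
  "usc_env \<Omega> u z = real_of_ereal (max (ereal (u z)) (Limsup (at z within \<Omega>) (\<lambda>w. ereal (u w))))"

definition lsc_env :: "'a::euclidean_space set \<Rightarrow> ('a \<Rightarrow> real) \<Rightarrow> 'a \<Rightarrow> real" where
  "lsc_env \<Omega> u z = real_of_ereal (min (ereal (u z)) (Liminf (at z within \<Omega>) (\<lambda>w. ereal (u w))))"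

definition visc_sub :: "('a::euclidean_space \<Rightarrow> real \<Rightarrow> ('a \<Rightarrow> real) \<Rightarrow> real) \<Rightarrow> 'a set \<Rightarrow> ('a \<Rightarrow> real) \<Rightarrow> bool" where
  "visc_sub F \<Omega> u \<longleftrightarrow>
     (\<forall>z\<in>\<Omega>. \<forall>\<phi> \<phi>'. C1_test \<phi> \<phi>' \<and>
        (\<exists>e>0. \<forall>w\<in>ball z e \<inter> \<Omega>. usc_env \<Omega> u w - \<phi> w \<le> usc_env \<Omega> u z - \<phi> z)
        \<longrightarrow> F z (usc_env \<Omega> u z) (\<phi>' z) \<le> 0)"

definition visc_super :: "('a::euclidean_space \<Rightarrow> real \<Rightarrow> ('a \<Rightarrow> real) \<Rightarrow> real) \<Rightarrow> 'a set \<Rightarrow> ('a \<Rightarrow> real) \<Rightarrow> bool" where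
  "visc_super F \<Omega> u \<longleftrightarrow>
     (\<forall>z\<in>\<Omega>. \<forall>\<phi> \<phi>'. C1_test \<phi> \<phi>' \<and>
        (\<exists>e>0. \<forall>w\<in>ball z e \<inter> \<Omega>. lsc_env \<Omega> u z - \<phi> z \<le> lsc_env \<Omega> u w - \<phi> w)
        \<longrightarrow> 0 \<le> F z (lsc_env \<Omega> u z) (\<phi>' z))"

definition visc_sol :: "('a::euclidean_space \<Rightarrow> real \<Rightarrow> ('a \<Rightarrow> real) \<Rightarrow> real) \<Rightarrow> 'a set \<Rightarrow> ('a \<Rightarrow> real) \<Rightarrow> bool" where
  "visc_sol F \<Omega> u \<longleftrightarrow> continuous_on \<Omega> u \<and> visc_sub F \<Omega> u \<and> visc_super F \<Omega> u"

definition eqF :: "('n::finite) ham \<Rightarrow> real \<Rightarrow> real \<Rightarrow> ((real^('n::finite)) \<times> real \<times> real) \<Rightarrow> real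
                   \<Rightarrow> (((real^('n::finite)) \<times> real \<times> real) \<Rightarrow> real) \<Rightarrow> real" where
  "eqF G \<alpha> c z r D = (case z of (x, y, t) \<Rightarrow>
      D (0, 0, 1) + G x y t (\<chi> i. D (axis i 1, 0, 0)) (D (0, 1, 0)) + \<alpha> * r - c)"

definition uncurry3 :: "('n::finite) stfun \<Rightarrow> ((real^('n::finite)) \<times> real \<times> real) \<Rightarrow> real" where
  "uncurry3 w = (\<lambda>(x, y, t). w x y t)"

definition st_periodic :: "('n::finite) stfun \<Rightarrow> bool" where
  "st_periodic w \<longleftrightarrow>
     (\<forall>x y t k. int_vec k \<longrightarrow> w (x + k) y t = w x y t) \<and>
     (\<forall>x y t. w x (y + 1) t = w x y t) \<and> (\<forall>x y t. w x y (t + 1) = w x y t)"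

definition discounted_sol :: "('n::finite) ham \<Rightarrow> real \<Rightarrow> ('n::finite) stfun \<Rightarrow> bool" where
  "discounted_sol G \<alpha> w \<longleftrightarrow>
     continuous_on UNIV (uncurry3 w) \<and> st_periodic w \<and> visc_sol (eqF G \<alpha> 0) UNIV (uncurry3 w)"

definition bounded_fun :: "('n::finite) stfun \<Rightarrow> bool" where
  "bounded_fun u \<longleftrightarrow> (\<exists>B. \<forall>x y t. \<bar>u x y t\<bar> \<le> B)"

definition ergodic_admissible :: "('n::finite) ham \<Rightarrow> real \<Rightarrow> bool" where
  "ergodic_admissible G lam \<longleftrightarrow>
     (\<exists>u. bounded_fun u \<and> visc_sub (eqF G 0 lam) UNIV (uncurry3 u)) \<and>
     (\<exists>u. bounded_fun u \<and> visc_super (eqF G 0 lam) UNIV (uncurry3 u))"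

definition pos_time :: "((real^('n::finite)) \<times> real \<times> real) set" where
  "pos_time = {z. 0 < snd (snd z)}"

definition cauchy_sol :: "('n::finite) ham \<Rightarrow> (real^('n::finite) \<Rightarrow> real \<Rightarrow> real) \<Rightarrow> ('n::finite) stfun \<Rightarrow> bool" where
  "cauchy_sol G v0 v \<longleftrightarrow>
     visc_sol (eqF G 0 0) pos_time (uncurry3 v) \<and>
     (\<forall>x y. v x y 0 = v0 x y) \<and>
     (\<forall>T>0. bounded (uncurry3 v ` {z. 0 \<le> snd (snd z) \<and> snd (snd z) \<le> T}) \<and>
            uniformly_continuous_on {z. 0 \<le> snd (snd z) \<and> snd (snd z) \<le> T} (uncurry3 v))"

end

theory Submission
  imports Defs
begin

text \<open>
  Write a solution in the coercive variable \<open>x\<close> and the non-coercive variables \<open>(y, t)\<close>. In the doubling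
  argument for the comparison principle the penalisation of \<open>x - x'\<close> is sent to infinity first, with that
  of \<open>(y, t) - (y', t')\<close> frozen: the subsolution inequality and the coercivity then keep \<open>p\<^sub>x\<close> bounded, so
  that mere continuity of \<open>G\<close> in \<open>x\<close> suffices, while the structure conditions on \<open>D\<^sub>yG\<close> and \<open>D\<^sub>tG\<close>
  absorb the errors in the remaining variables. The comparison is stated for pairs of nearby points and
  hence also yields uniform continuity of the solutions of the Cauchy problem.

  Since \<open>D\<^sub>yG\<close> vanishes at \<open>p\<^sub>y = -l\<close>, the function \<open>inf\<^sub>r w(x, y + sgn(l) r, t) + |l| r\<close> is again a
  supersolution; by comparison \<open>w\<close> oscillates by at most \<open>|l|\<close> in \<open>y\<close>. Testing \<open>w\<close> with functions of
  \<open>(x, t)\<close> only, for which \<open>p\<^sub>y = 0\<close>, then bounds the full oscillation by the coercivity, independently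
  of \<open>\<alpha>\<close>; half-relaxed limits as \<open>\<alpha>\<close> tends to 0 give the ergodic constant.
\<close>

section \<open>Increments of Lipschitz functions with an almost everywhere bound on the derivative\<close>

text \<open>The derivative bounds of \<open>H3\<close> hold almost everywhere and only where a
  derivative exists, so they say nothing about a prescribed line, whereas comparison needs
  increments of \<open>G\<close> between two prescribed points. These come from almost everywhere
  differentiability of Lipschitz functions of one variable, from Fubini, and from moving slightly to
  a generic parallel line.

  The obstacle in the doubling is that D_t G is controlled by |G|, and G is known from above only.
  With weight N on (y, t) and distance d, the common gradient there has size N d, and the
  subsolution inequality bounds G from above by that order. The errors have size N d^2, so this must
  be small for an N chosen before the weight on x is sent to infinity.

  In y one period is the largest shift ever needed, whence the oscillation |l|. In the other
  variables the time-independent case uses a steep smoothed cone in x. The time-dependent case uses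
  the finite speed \<open>C1\<close> hidden in the linear growth at p_y = 0: after time
  \<open>CARD('n) / C1\<close> the cone from any point covers a period cell.\<close>

lemma vitali_measure_compare:
  fixes \<mu> \<nu> :: "real measure" and q :: real
  assumes sets: "sets \<mu> = sets borel" "sets \<nu> = sets borel"
    and fin: "open S" "emeasure \<nu> S \<noteq> \<infinity>"
    and ac: "\<And>A. A \<in> null_sets lborel \<Longrightarrow> A \<in> null_sets \<mu>"
    and E: "E \<in> sets borel" "E \<subseteq> S" and q: "0 \<le> q"
    and small: "\<And>x d. x \<in> E \<Longrightarrow> 0 < d \<Longrightarrow> \<exists>c r. 0 < r \<and> r < d \<and> x \<in> cball c r \<and>
        emeasure \<mu> (cball c r) \<le> ennreal q * emeasure \<nu> (cball c r)"
  shows "emeasure \<mu> E \<le> ennreal q * emeasure \<nu> E"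
proof -
  \<comment> \<open>Outer regularity is applied to a finite measure. Since \<open>\<nu>\<close> is
    finite on \<open>S\<close> only, it is cut down to \<open>S\<close>; nothing is lost because
    \<open>E\<close> lies in \<open>S\<close>.\<close>
  let ?N = "density \<nu> (indicator S)"
  have S: "S \<in> sets \<nu>" using fin sets by auto
  have N: "emeasure ?N X = emeasure \<nu> (S \<inter> X)" if "X \<in> sets borel" for X
    using that sets S by (subst emeasure_density) (auto simp: nn_integral_indicator[symmetric] indicator_inter_arith[symmetric] Int_commute simp del: nn_integral_indicator)
  have finE: "emeasure \<nu> E < \<infinity>"
    using emeasure_mono[OF E(2) S] fin(2) by (auto simp: less_top top_unique)
  have "emeasure \<mu> E \<le> ennreal q * emeasure \<nu> E + ennreal e" if e: "e > 0" for e
  proof -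
    define e' where "e' = e / (q + 1)"
    have e': "e' > 0" "q * e' \<le> e" using e q by (auto simp: e'_def field_simps)
    have "emeasure ?N E = (INF U \<in> {U. E \<subseteq> U \<and> open U}. emeasure ?N U)"
      by (rule outer_regular) (use sets N[of UNIV] fin E sets_eq_imp_space_eq[OF sets(2)] in auto)
    moreover have "emeasure ?N E < emeasure ?N E + ennreal e'"
    proof -
      obtain m where m: "emeasure \<nu> E = ennreal m" "m \<ge> 0" using finE by (cases "emeasure \<nu> E") auto
      then show ?thesis using e' N[OF E(1)] E
        by (simp add: Int_absorb1 ennreal_plus[symmetric] ennreal_less_iff del: ennreal_plus)
    qed
    ultimately obtain U where U: "E \<subseteq> U" "open U" "emeasure ?N U < emeasure ?N E + ennreal e'"
      by (metis (no_types, lifting) INF_less_iff mem_Collect_eq)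
    let ?V = "U \<inter> S"
    have V: "open ?V" "E \<subseteq> ?V" "emeasure \<nu> ?V \<le> emeasure \<nu> E + ennreal e'"
      using U E fin N[of U] N[of E] by (auto simp: Int_commute Int_absorb1 Int_absorb2)
    \<comment> \<open>The balls must contain the point but need not be centred at it: later,
      intervals having the point as an end have to be admissible. Confinement to \<open>?V\<close>
      keeps the total \<open>\<nu>\<close>-mass of disjoint balls below
      \<open>\<nu> E + e'\<close>.\<close>
    let ?K = "{i. 0 < snd i \<and> cball (fst i) (snd i) \<subseteq> ?V \<and>
        emeasure \<mu> (cball (fst i) (snd i)) \<le> ennreal q * emeasure \<nu> (cball (fst i) (snd i))}"
    have fine: "\<exists>i. i \<in> ?K \<and> x \<in> cball (fst i) (snd i) \<and> snd i < d" if x: "x \<in> E" and d: "0 < d" for x d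
    proof -
      obtain h where h: "h > 0" "ball x h \<subseteq> ?V" using V x by (meson openE subsetD)
      obtain c r where cr: "0 < r" "r < min d (h/2)" "x \<in> cball c r"
        "emeasure \<mu> (cball c r) \<le> ennreal q * emeasure \<nu> (cball c r)"
        using small[OF x, of "min d (h/2)"] d h by auto
      have "cball c r \<subseteq> ball x h"
      proof
        fix y assume "y \<in> cball c r"
        then have "dist c y \<le> r" "dist x c \<le> r" using cr(3) by (auto simp: dist_commute)
        moreover have "dist x y \<le> dist x c + dist c y" by (rule dist_triangle)
        moreover have "r < h / 2" using cr(2) by simp
        ultimately show "y \<in> ball x h" unfolding mem_ball by linarith
      qed
      then show ?thesis using cr h by (intro exI[of _ "(c,r)"]) auto
    qed
    \<comment> \<open>Vitali selects disjoint balls covering \<open>E\<close> up to a Lebesgue null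
      set, which is null for \<open>\<mu>\<close> as well by \<open>ac\<close>. Summing the ball
      inequality over the family then gives the claim up to \<open>q * e'\<close>.\<close>
    obtain C where C: "countable C" "C \<subseteq> ?K"
      "pairwise (\<lambda>i j. disjnt (cball (fst i) (snd i)) (cball (fst j) (snd j))) C"
      "negligible (E - (\<Union>i \<in> C. cball (fst i) (snd i)))"
      by (rule Vitali_covering_theorem_cballs[where K="?K" and a=fst and r=snd and S=E]) (use fine in auto)
    let ?I = "\<lambda>i. cball (fst i) (snd i :: real)"
    let ?R = "E - (\<Union>i \<in> C. ?I i)"
    have Ub: "(\<Union>i \<in> C. ?I i) \<in> sets borel" by (intro sets.countable_UN'') (use C(1) in auto)
    have CK: "cball (fst i) (snd i) \<subseteq> ?V"
      "emeasure \<mu> (cball (fst i) (snd i)) \<le> ennreal q * emeasure \<nu> (cball (fst i) (snd i))" if "i \<in> C" for i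
      using C(2) that by blast+
    have CV: "(\<Union>i \<in> C. ?I i) \<subseteq> ?V" using CK(1) by blast
    have Rb: "?R \<in> sets borel" using E Ub by auto
    have "?R \<in> null_sets lborel"
      using C(4) Rb by (auto simp: negligible_iff_null_sets null_sets_def)
    then have R0: "emeasure \<mu> ?R = 0" using ac by auto
    have disj: "disjoint_family_on ?I C"
      using C(3) by (auto simp: disjoint_family_on_def pairwise_def disjnt_def)
    have "emeasure \<mu> E \<le> emeasure \<mu> ((\<Union>i \<in> C. ?I i) \<union> ?R)"
    proof (rule emeasure_mono)
      show "(\<Union>i \<in> C. ?I i) \<union> ?R \<in> sets \<mu>" unfolding sets(1) using Ub Rb by (rule sets.Un)
    qed blast
    also have "\<dots> \<le> emeasure \<mu> (\<Union>i \<in> C. ?I i) + emeasure \<mu> ?R"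
      by (rule emeasure_subadditive) (use Ub Rb sets(1) in simp_all)
    also have "\<dots> = emeasure \<mu> (\<Union>i \<in> C. ?I i)" using R0 by simp
    also have "\<dots> = (\<integral>\<^sup>+i. emeasure \<mu> (?I i) \<partial>count_space C)"
      using C(1) disj sets by (intro emeasure_UN_countable) auto
    also have "\<dots> \<le> (\<integral>\<^sup>+i. ennreal q * emeasure \<nu> (?I i) \<partial>count_space C)"
      by (intro nn_integral_mono) (use CK(2) in simp)
    also have "\<dots> = ennreal q * (\<integral>\<^sup>+i. emeasure \<nu> (?I i) \<partial>count_space C)"
      by (intro nn_integral_cmult) auto
    also have "(\<integral>\<^sup>+i. emeasure \<nu> (?I i) \<partial>count_space C) = emeasure \<nu> (\<Union>i \<in> C. ?I i)"
      using C(1) disj sets by (intro emeasure_UN_countable[symmetric]) auto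
    also have "ennreal q * emeasure \<nu> (\<Union>i \<in> C. ?I i) \<le> ennreal q * emeasure \<nu> ?V"
    proof (intro mult_left_mono emeasure_mono CV)
      show "?V \<in> sets \<nu>" using V(1) sets(2) by auto
    qed auto
    also have "\<dots> \<le> ennreal q * (emeasure \<nu> E + ennreal e')"
      using V by (intro mult_left_mono) auto
    also have "\<dots> = ennreal q * emeasure \<nu> E + ennreal (q * e')"
      using e' q by (simp add: distrib_left ennreal_mult)
    also have "\<dots> \<le> ennreal q * emeasure \<nu> E + ennreal e"
      by (intro add_left_mono ennreal_leI e')
    finally show ?thesis .
  qed
  then show ?thesis
    by (rule ennreal_le_epsilon) simp
qed

text \<open>Without a limit, liminf and limsup differ, and boundedness makes both finite. Rational
  levels in between are chosen so that the bad points will form a countable union.\<close>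

lemma no_limit_imp_oscillation:
  fixes g :: "'a \<Rightarrow> real"
  assumes F: "F \<noteq> bot" and b: "\<forall>\<^sub>F h in F. \<bar>g h\<bar> \<le> M" and nl: "\<nexists>l. (g \<longlongrightarrow> l) F"
  shows "\<exists>q p :: rat. q < p \<and> (\<exists>\<^sub>F h in F. g h < of_rat q) \<and> (\<exists>\<^sub>F h in F. of_rat p < g h)"
proof -
  let ?g = "\<lambda>h. ereal (g h)"
  have up: "Limsup F ?g \<le> ereal M" by (rule Limsup_bounded) (use b in \<open>auto elim: eventually_mono\<close>)
  have lo: "ereal (- M) \<le> Liminf F ?g" by (rule Liminf_bounded) (use b in \<open>auto elim: eventually_mono\<close>)
  have "Liminf F ?g \<noteq> Limsup F ?g"
  proof
    assume eq: "Liminf F ?g = Limsup F ?g"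
    obtain l where l: "Limsup F ?g = ereal l"
      using up lo eq by (cases "Limsup F ?g") auto
    have "(?g \<longlongrightarrow> ereal l) F" using tendsto_iff_Liminf_eq_Limsup[OF F, of ?g "ereal l"] eq l by metis
    then show False using nl by (auto simp: lim_ereal)
  qed
  then have lt: "Liminf F ?g < Limsup F ?g" using Liminf_le_Limsup[OF F, of ?g] by auto
  obtain p :: rat where p: "Liminf F ?g < real_of_rat p" "real_of_rat p < Limsup F ?g"
    using ereal_dense3[OF lt] by auto
  obtain q :: rat where q: "Liminf F ?g < real_of_rat q" "ereal (real_of_rat q) < real_of_rat p"
    using ereal_dense3[OF p(1)] by auto
  have "\<exists>\<^sub>F h in F. g h < of_rat q"
  proof (rule ccontr)
    assume "\<not> ?thesis"
    then have "\<forall>\<^sub>F h in F. real_of_rat q \<le> g h" by (auto simp: not_frequently elim: eventually_mono)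
    then have "ereal (real_of_rat q) \<le> Liminf F ?g" by (intro Liminf_bounded) (auto elim: eventually_mono)
    then show False using q by auto
  qed
  moreover have "\<exists>\<^sub>F h in F. of_rat p < g h"
  proof (rule ccontr)
    assume "\<not> ?thesis"
    then have "\<forall>\<^sub>F h in F. g h \<le> real_of_rat p" by (auto simp: not_frequently elim: eventually_mono)
    then have "Limsup F ?g \<le> ereal (real_of_rat p)" by (intro Limsup_bounded) (auto elim: eventually_mono)
    then show False using p by auto
  qed
  moreover have "q < p" using q by (simp add: of_rat_less)
  ultimately show ?thesis by blast
qed

lemma increment_le_of_AE_deriv_le:
  fixes f :: "real \<Rightarrow> real"
  assumes lip: "\<And>x y. \<bar>f x - f y\<bar> \<le> L * \<bar>x - y\<bar>" and L: "0 \<le> L"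
    and ae: "AE s in lborel. a < s \<and> s < b \<longrightarrow> (\<forall>d. (f has_real_derivative d) (at s) \<longrightarrow> d \<le> C)"
    and ab: "a < b" and C: "0 \<le> C"
  shows "f b - f a \<le> C * (b - a)"
proof -
  (* F is bi-Lipschitz and strictly increasing; \<mu> A is the Lebesgue measure of F ` A, and covering
     twice by Vitali's theorem shows that the points where the difference quotients of F oscillate are null. *)
  define F where "F s = f s + (L + 1) * s" for s
  have F_up: "F y - F x \<le> (2 * L + 1) * (y - x)" and F_lo: "y - x \<le> F y - F x" if "x \<le> y" for x y
    using lip[of y x] that by (auto simp: F_def algebra_simps)
  have smono: "strict_mono F"
    by (rule strict_monoI) (use F_lo in \<open>metis diff_gt_0_iff_gt le_less less_le_trans\<close>)
  have inj: "inj F" using smono by (rule strict_mono_imp_inj_on)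
  have Fle: "F x \<le> F y \<longleftrightarrow> x \<le> y" for x y using smono by (simp add: strict_mono_less_eq)
  have fcont: "continuous_on UNIV f"
    by (rule lipschitz_on_continuous_on[of L], rule lipschitz_onI) (use lip L in \<open>auto simp: dist_real_def\<close>)
  then have Fcont: "continuous_on UNIV F" unfolding F_def by (intro continuous_intros)
  have surj: "surj F"
  proof -
    have "\<exists>x. F x = y" for y
    proof -
      have "F (- \<bar>y - F 0\<bar>) \<le> y" "y \<le> F \<bar>y - F 0\<bar>"
        using F_lo[of "- \<bar>y - F 0\<bar>" 0] F_lo[of 0 "\<bar>y - F 0\<bar>"] by auto
      then show ?thesis
        using IVT'[of F "- \<bar>y - F 0\<bar>" y "\<bar>y - F 0\<bar>"] continuous_on_subset[OF Fcont] by auto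
    qed
    then show ?thesis by (metis surjI)
  qed
  define Gi where "Gi = inv F"
  have GF: "Gi (F x) = x" for x unfolding Gi_def using inj by simp
  have FG: "F (Gi x) = x" for x unfolding Gi_def using surj by (simp add: surj_f_inv_f)
  have Gvim: "Gi -` A = F ` A" for A using GF FG by (auto simp: image_iff) metis+
  have Gmono: "mono Gi" by (rule monoI) (use Fle FG in metis)
  have Gmeas: "Gi \<in> borel_measurable lborel" using borel_measurable_mono[OF Gmono] by simp
  \<comment> \<open>Defined as a push-forward under the inverse, so that countable additivity comes
    for free.\<close>
  define \<mu> where "\<mu> = distr lborel borel Gi"
  have sets\<mu>: "sets \<mu> = sets borel" by (simp add: \<mu>_def)
  have e\<mu>: "emeasure \<mu> A = emeasure lborel (F ` A)" if "A \<in> sets borel" for A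
    using that Gmeas by (simp add: \<mu>_def emeasure_distr Gvim)
  have Fimg: "F ` {x..y} = {F x..F y}" if "x \<le> y" for x y
  proof -
    have "Gi -` {x..y} = {F x..F y}" using Fle FG by (auto simp: ) (metis Fle FG)+
    then show ?thesis using Gvim by simp
  qed
  have \<mu>I: "emeasure \<mu> {x..y} = ennreal (F y - F x)" if "x \<le> y" for x y
    using e\<mu>[of "{x..y}"] Fimg[OF that] Fle that by simp
  have ac: "A \<in> null_sets \<mu>" if "A \<in> null_sets lborel" for A
  proof -
    have A: "A \<in> sets borel" "negligible A" using that by (auto simp: negligible_iff_null_sets null_sets_completionI)
    have "negligible (F ` A)"
    proof (rule negligible_locally_Lipschitz_image)
      show "\<exists>T B. open T \<and> x \<in> T \<and> (\<forall>y\<in>A \<inter> T. norm (F y - F x) \<le> B * norm (y - x))" if "x \<in> A" for x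
      proof (intro exI[of _ UNIV] exI[of _ "2*L+1"] conjI ballI)
        fix y assume "y \<in> A \<inter> UNIV"
        show "norm (F y - F x) \<le> (2 * L + 1) * norm (y - x)"
          using F_up[of x y] F_up[of y x] F_lo[of x y] F_lo[of y x] by (cases "x \<le> y") (auto simp: abs_if)
      qed auto
    qed (use A in auto)
    moreover have "F ` A \<in> sets borel" using measurable_sets[OF Gmeas A(1)] Gvim by simp
    ultimately have "emeasure lborel (F ` A) = 0" by (auto simp: negligible_iff_null_sets null_sets_def)
    then show ?thesis using A e\<mu> sets\<mu> by auto
  qed
  define sl where "sl x h = (F (x + h) - F x) / h" for x h
  have slb: "1 \<le> sl x h" "sl x h \<le> 2 * L + 1" if "h \<noteq> 0" for x h
  proof -
    have "1 \<le> sl x h \<and> sl x h \<le> 2 * L + 1"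
    proof (cases "h > 0")
      case True
      then show ?thesis using F_up[of x "x+h"] F_lo[of x "x+h"] by (auto simp: sl_def field_simps)
    next
      case False
      then have "h < 0" using that by auto
      then show ?thesis using F_up[of "x+h" x] F_lo[of "x+h" x] by (auto simp: sl_def field_simps)
    qed
    then show "1 \<le> sl x h" "sl x h \<le> 2 * L + 1" by auto
  qed
  \<comment> \<open>The segment between \<open>x\<close> and \<open>x + h\<close> is a closed ball
    containing \<open>x\<close>, so a difference quotient of \<open>F\<close> is exactly the ratio
    of \<open>\<mu>\<close> to Lebesgue measure on a ball admissible in
    \<open>vitali_measure_compare\<close>. Both signs of \<open>h\<close> are covered.\<close>
  have ivl: "\<exists>c r. r = \<bar>h\<bar>/2 \<and> x \<in> cball c r \<and> emeasure \<mu> (cball c r) = ennreal (sl x h * \<bar>h\<bar>) \<and>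
      emeasure lborel (cball c r) = ennreal \<bar>h\<bar>" if "h \<noteq> 0" for x h
  proof (intro exI conjI)
    show "\<bar>h\<bar>/2 = \<bar>h\<bar>/2" ..
    show "x \<in> cball (x + h/2) (\<bar>h\<bar>/2)" by (auto simp: dist_real_def)
    have eq: "cball (x + h/2) (\<bar>h\<bar>/2) = (if h > 0 then {x..x+h} else {x+h..x})"
      by (auto simp: cball_eq_atLeastAtMost)
    show "emeasure \<mu> (cball (x + h/2) (\<bar>h\<bar>/2)) = ennreal (sl x h * \<bar>h\<bar>)"
      unfolding eq using that by (auto simp: \<mu>I sl_def abs_if)
    show "emeasure lborel (cball (x + h/2) (\<bar>h\<bar>/2)) = ennreal \<bar>h\<bar>"
      unfolding eq using that by auto
  qed
  have op: "open {x. sl x h < q}" "open {x. q < sl x h}" for q h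
  proof -
    have c: "continuous_on UNIV (\<lambda>x. sl x h)"
      unfolding sl_def by (cases "h = 0") (auto intro!: continuous_intros continuous_on_compose2[OF Fcont])
    show "open {x. sl x h < q}" "open {x. q < sl x h}"
      by (rule open_Collect_less[OF c continuous_on_const], rule open_Collect_less[OF continuous_on_const c])
  qed
  define B where "B q p = {x. a < x \<and> x < b \<and> (\<exists>\<^sub>F h in at 0. sl x h < q) \<and> (\<exists>\<^sub>F h in at 0. p < sl x h)}" for q p
  \<comment> \<open>Only the radii \<open>1 / Suc n\<close> are kept. This writes \<open>B\<close>
    with countable intersections of unions of open sets; those unions over \<open>h\<close> are
    uncountable but open, so \<open>B\<close> is Borel.\<close>
  have freq: "(\<exists>\<^sub>F h in at (0::real). P h) \<longleftrightarrow> (\<forall>n::nat. \<exists>h. h \<noteq> 0 \<and> \<bar>h\<bar> < 1 / Suc n \<and> P h)" for P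
  proof
    assume "\<exists>\<^sub>F h in at (0::real). P h"
    then show "\<forall>n::nat. \<exists>h. h \<noteq> 0 \<and> \<bar>h\<bar> < 1 / Suc n \<and> P h"
      unfolding frequently_at by (auto simp: dist_real_def)
  next
    assume *: "\<forall>n::nat. \<exists>h. h \<noteq> 0 \<and> \<bar>h\<bar> < 1 / Suc n \<and> P h"
    show "\<exists>\<^sub>F h in at (0::real). P h"
      unfolding frequently_at
    proof (intro allI impI)
      fix d :: real assume "d > 0"
      then obtain n where "1 / Suc n < d" using nat_approx_posE by (metis of_nat_Suc)
      moreover obtain h where "h \<noteq> 0" "\<bar>h\<bar> < 1 / Suc n" "P h" using * by blast
      ultimately show "\<exists>h\<in>UNIV. h \<noteq> 0 \<and> dist h 0 < d \<and> P h"
        by (intro bexI[of _ h]) auto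
    qed
  qed
  have Bborel: "B q p \<in> sets borel" for q p
  proof -
    have "B q p = {a<..<b} \<inter> (\<Inter>n::nat. \<Union>h\<in>{h. h \<noteq> 0 \<and> \<bar>h\<bar> < 1 / Suc n}. {x. sl x h < q})
        \<inter> (\<Inter>n::nat. \<Union>h\<in>{h. h \<noteq> 0 \<and> \<bar>h\<bar> < 1 / Suc n}. {x. p < sl x h})"
      unfolding B_def freq by auto
    also have "\<dots> \<in> sets borel"
      by (intro sets.Int sets.countable_INT'' borel_open open_UN ballI op) auto
    finally show ?thesis .
  qed
  have Bsub: "B q p \<subseteq> {a<..<b}" for q p by (auto simp: B_def)
  have fin\<mu>: "emeasure \<mu> {a<..<b} \<noteq> \<infinity>"
  proof -
    have "emeasure \<mu> {a<..<b} \<le> emeasure \<mu> {a..b}" by (intro emeasure_mono) (auto simp: sets\<mu>)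
    also have "\<dots> < \<infinity>" using \<mu>I[of a b] ab by simp
    finally show ?thesis by simp
  qed
  have finl: "emeasure lborel {a<..<b} \<noteq> \<infinity>" using ab by simp
  \<comment> \<open>At every point of \<open>B q p\<close> the quotients fall below \<open>q\<close>
    and rise above \<open>p\<close> at arbitrarily small scales, so both comparisons apply. With
    \<open>m\<close> the Lebesgue measure of the set this gives \<open>p * m \<le> q * m\<close>,
    hence \<open>m = 0\<close>. For \<open>q \<le> 0\<close> the set is empty because all quotients
    are at least 1.\<close>
  have Bnull: "B q p \<in> null_sets lborel" if qp: "q < p" for q p
  proof (cases "0 < q")
    case True
    have q0: "0 \<le> q" and p0: "0 \<le> 1 / p" using True qp by auto
    have 1: "emeasure \<mu> (B q p) \<le> ennreal q * emeasure lborel (B q p)"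
    proof (rule vitali_measure_compare[OF sets\<mu> sets_lborel open_greaterThanLessThan finl ac Bborel Bsub q0])
      fix x d :: real assume x: "x \<in> B q p" and d: "0 < d"
      then obtain h where h: "h \<noteq> 0" "\<bar>h\<bar> < d" "sl x h < q"
        by (auto simp: B_def frequently_at dist_real_def)
      obtain c r where cr: "r = \<bar>h\<bar>/2" "x \<in> cball c r" "emeasure \<mu> (cball c r) = ennreal (sl x h * \<bar>h\<bar>)"
        "emeasure lborel (cball c r) = ennreal \<bar>h\<bar>" using ivl[OF h(1)] by blast
      show "\<exists>c r. 0 < r \<and> r < d \<and> x \<in> cball c r \<and>
         emeasure \<mu> (cball c r) \<le> ennreal q * emeasure lborel (cball c r)"
        using cr h True by (intro exI[of _ c] exI[of _ r]) (auto simp: ennreal_mult[symmetric] intro!: ennreal_leI mult_right_mono)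
    qed
    have 2: "emeasure lborel (B q p) \<le> ennreal (1/p) * emeasure \<mu> (B q p)"
    proof (rule vitali_measure_compare[OF sets_lborel sets\<mu> open_greaterThanLessThan fin\<mu> _ Bborel Bsub p0])
      fix x d :: real assume x: "x \<in> B q p" and d: "0 < d"
      then obtain h where h: "h \<noteq> 0" "\<bar>h\<bar> < d" "p < sl x h"
        by (auto simp: B_def frequently_at dist_real_def)
      obtain c r where cr: "r = \<bar>h\<bar>/2" "x \<in> cball c r" "emeasure \<mu> (cball c r) = ennreal (sl x h * \<bar>h\<bar>)"
        "emeasure lborel (cball c r) = ennreal \<bar>h\<bar>" using ivl[OF h(1)] by blast
      have "\<bar>h\<bar> \<le> 1 / p * (sl x h * \<bar>h\<bar>)" using h True qp by (simp add: field_simps)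
      then show "\<exists>c r. 0 < r \<and> r < d \<and> x \<in> cball c r \<and>
         emeasure lborel (cball c r) \<le> ennreal (1/p) * emeasure \<mu> (cball c r)"
        using cr h True qp slb[OF h(1), of x] by (intro exI[of _ c] exI[of _ r]) (auto simp: ennreal_mult[symmetric] intro!: ennreal_leI)
    qed
    have fl: "emeasure lborel (B q p) < \<infinity>"
      using emeasure_mono[OF Bsub[of q p], of lborel] ab by (auto intro: le_less_trans)
    then obtain m where m: "emeasure lborel (B q p) = ennreal m" "m \<ge> 0" by (cases "emeasure lborel (B q p)") auto
    have "ennreal m \<le> ennreal (1/p) * (ennreal q * ennreal m)"
      using 2 1 m by (metis mult_left_mono order_trans zero_le)
    then have "m \<le> 1/p * (q * m)" using m True qp by (auto simp: ennreal_mult[symmetric] ennreal_le_iff)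
    then have "p * m \<le> q * m" using True qp by (simp add: field_simps)
    then have "m = 0" using m qp by (simp add: mult_le_cancel_right)
    then show ?thesis using m Bborel by auto
  next
    case False
    have "B q p = {}"
    proof -
      have "\<not> (\<exists>\<^sub>F h in at 0. sl x h < q)" for x
      proof
        assume "\<exists>\<^sub>F h in at 0. sl x h < q"
        then obtain h where "h \<noteq> 0" "sl x h < q" unfolding frequently_at using zero_less_one by blast
        then show False using slb(1)[of h x] False by linarith
      qed
      then show ?thesis by (auto simp: B_def)
    qed
    then show ?thesis by simp
  qed
  define Q where "Q = {(q, p). q < (p :: rat)}"
  have Qn: "(\<Union>i\<in>Q. B (of_rat (fst i)) (of_rat (snd i))) \<in> null_sets lborel"
    by (intro null_sets_UN') (auto simp: Q_def of_rat_less intro!: Bnull)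
  define P where "P s \<longleftrightarrow> (a < s \<and> s < b \<longrightarrow> (\<forall>d. (f has_real_derivative d) (at s) \<longrightarrow> d \<le> C))" for s
  have "AE s in lborel. P s" unfolding P_def by (rule ae)
  then obtain N where "{s \<in> space lborel. \<not> P s} \<subseteq> N" "emeasure lborel N = 0" "N \<in> sets lborel"
    by (rule AE_E)
  then have N: "N \<in> null_sets lborel" "{s. \<not> P s} \<subseteq> N" by auto
  \<comment> \<open>At a point of the interval outside \<open>Z\<close> the quotients of
    \<open>F\<close> converge. So \<open>f\<close> is differentiable there, and only then does the
    conditional bound on its derivative say anything.\<close>
  define Z where "Z = N \<union> (\<Union>i\<in>Q. B (of_rat (fst i)) (of_rat (snd i)))"
  have Z: "Z \<in> null_sets lborel" unfolding Z_def using N Qn by auto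
  have Zb: "Z \<in> sets borel" using Z by auto
  have "f b - f a \<le> C * (b - a) + e" if e: "e > 0" for e
  proof -
    define e' where "e' = e / (b - a)"
    have e': "e' > 0" "e' * (b - a) = e" using e ab by (auto simp: e'_def)
    \<comment> \<open>\<open>C + L + 1\<close> bounds the derivative of \<open>F\<close>, whose
      linear part has slope \<open>L + 1\<close>. The margin \<open>e'\<close> turns the bound on
      the limit into a bound at all small scales.\<close>
    let ?q = "C + L + 1 + e'"
    have GZ: "{a<..<b} - Z \<in> sets borel" using Zb by (intro sets.Diff) auto
    have GZs: "{a<..<b} - Z \<subseteq> {a<..<b}" by blast
    have Q0: "0 \<le> ?q" using C L e' by simp
    have main: "emeasure \<mu> ({a<..<b} - Z) \<le> ennreal ?q * emeasure lborel ({a<..<b} - Z)"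
    proof (rule vitali_measure_compare[OF sets\<mu> sets_lborel open_greaterThanLessThan finl ac GZ GZs Q0])
      fix x d :: real assume x: "x \<in> {a<..<b} - Z" and d: "0 < d"
      have "\<exists>l. (sl x \<longlongrightarrow> l) (at 0)"
      proof (rule ccontr)
        assume "\<nexists>l. (sl x \<longlongrightarrow> l) (at 0)"
        moreover have "\<forall>\<^sub>F h in at 0. \<bar>sl x h\<bar> \<le> 2 * L + 1"
        proof -
          have "\<bar>sl x h\<bar> \<le> 2 * L + 1" if "h \<noteq> 0" for h using slb[OF that, of x] by linarith
          then show ?thesis unfolding eventually_at by (intro exI[of _ 1]) auto
        qed
        ultimately obtain q p :: rat where "q < p" "\<exists>\<^sub>F h in at 0. sl x h < of_rat q" "\<exists>\<^sub>F h in at 0. of_rat p < sl x h"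
          using no_limit_imp_oscillation[OF trivial_limit_at] by blast
        then have "x \<in> B (of_rat q) (of_rat p)" "(q,p) \<in> Q" using x by (auto simp: B_def Q_def)
        then show False using x unfolding Z_def by force
      qed
      then obtain l where l: "(sl x \<longlongrightarrow> l) (at 0)" by auto
      have "((\<lambda>h. (f (x + h) - f x) / h) \<longlongrightarrow> l - (L + 1)) (at 0)"
      proof (rule Lim_transform_eventually)
        show "((\<lambda>h. sl x h - (L + 1)) \<longlongrightarrow> l - (L + 1)) (at 0)" by (intro tendsto_intros l)
        show "\<forall>\<^sub>F h in at 0. sl x h - (L + 1) = (f (x + h) - f x) / h"
          unfolding eventually_at by (rule exI[of _ 1]) (auto simp: sl_def F_def field_simps)
      qed
      then have "(f has_real_derivative (l - (L+1))) (at x)" by (simp add: DERIV_def)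
      moreover have "P x" using x N(2) unfolding Z_def by blast
      ultimately have "l - (L + 1) \<le> C" using x unfolding P_def by simp
      then have "l < ?q" using e' by auto
      from order_tendstoD(2)[OF l this] obtain d0 where d0: "d0 > 0" "\<And>h. h \<noteq> 0 \<Longrightarrow> \<bar>h\<bar> < d0 \<Longrightarrow> sl x h < ?q"
        unfolding eventually_at by (auto simp: dist_real_def)
      define h where "h = min d d0 / 2"
      have h: "h \<noteq> 0" "\<bar>h\<bar> < d" "sl x h < ?q" using d d0(1) d0(2)[of h] by (auto simp: h_def)
      obtain c r where cr: "r = \<bar>h\<bar>/2" "x \<in> cball c r" "emeasure \<mu> (cball c r) = ennreal (sl x h * \<bar>h\<bar>)"
        "emeasure lborel (cball c r) = ennreal \<bar>h\<bar>" using ivl[OF h(1)] by blast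
      show "\<exists>c r. 0 < r \<and> r < d \<and> x \<in> cball c r \<and>
         emeasure \<mu> (cball c r) \<le> ennreal ?q * emeasure lborel (cball c r)"
        using cr h slb[OF h(1), of x]
        by (intro exI[of _ c] exI[of _ r]) (auto simp: ennreal_mult[symmetric] intro!: ennreal_leI mult_right_mono)
    qed
    have "ennreal (F b - F a) = emeasure \<mu> {a..b}" using \<mu>I ab by simp
    also have "\<dots> \<le> emeasure \<mu> (({a<..<b} - Z) \<union> (Z \<union> {a,b}))"
      using Zb by (intro emeasure_mono) (auto simp: sets\<mu>)
    also have "\<dots> \<le> emeasure \<mu> ({a<..<b} - Z) + emeasure \<mu> (Z \<union> {a,b})"
      using Zb by (intro emeasure_subadditive) (auto simp: sets\<mu>)
    also have "emeasure \<mu> (Z \<union> {a,b}) = 0"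
    proof -
      have "Z \<union> {a,b} \<in> null_sets lborel" using Z by (rule null_sets.Un[OF _ finite_imp_null_set_lborel]) simp
      then show ?thesis using ac by auto
    qed
    also have "emeasure \<mu> ({a<..<b} - Z) + 0 \<le> ennreal ?q * emeasure lborel ({a<..<b} - Z)" using main by simp
    also have "\<dots> \<le> ennreal ?q * emeasure lborel {a<..<b}"
      using Zb by (intro mult_left_mono emeasure_mono) auto
    also have "\<dots> = ennreal (?q * (b - a))" using ab C L e' by (simp add: ennreal_mult)
    finally have "F b - F a \<le> ?q * (b - a)" using ab C L e' by (simp add: ennreal_le_iff)
    then show ?thesis using e' by (simp add: F_def algebra_simps)
  qed
  then show ?thesis by (rule field_le_epsilon)
qed

(* Fubini on the product of the ambient space with a line avoids permuting coordinates. *)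
lemma AE_line_notin_null:
  fixes e :: "'a::euclidean_space"
  assumes N: "N \<in> null_sets lborel"
  shows "AE \<xi> in lborel. AE s in (lborel :: real measure). \<xi> + s *\<^sub>R e \<notin> N"
proof -
  have Nb: "N \<in> sets borel" using N by auto
  have sl: "AE \<xi> in lborel. \<xi> + s *\<^sub>R e \<notin> N" for s :: real
  proof -
    have m: "(+) (s *\<^sub>R e) \<in> measurable lborel borel" by simp
    have "emeasure lborel ((+) (s *\<^sub>R e) -` N \<inter> space lborel) = emeasure (distr lborel borel ((+) (s *\<^sub>R e))) N"
      using emeasure_distr[OF m Nb] by simp
    also have "\<dots> = 0" using null_setsD1[OF N] by (simp add: lborel_distr_plus)
    finally have "(+) (s *\<^sub>R e) -` N \<inter> space lborel \<in> null_sets lborel"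
      using measurable_sets[OF m Nb] by (intro null_setsI) auto
    moreover have "{\<xi> \<in> space lborel. \<not> \<xi> + s *\<^sub>R e \<notin> N} \<subseteq> (+) (s *\<^sub>R e) -` N \<inter> space lborel"
      by (auto simp: add.commute)
    ultimately show ?thesis by (rule AE_I')
  qed
  have meas: "(\<lambda>z. fst z + snd z *\<^sub>R e) \<in> measurable (lborel \<Otimes>\<^sub>M lborel) borel" by simp
  have "{z \<in> space ((lborel :: 'a measure) \<Otimes>\<^sub>M (lborel :: real measure)). fst z + snd z *\<^sub>R e \<notin> N}
      = (\<lambda>z. fst z + snd z *\<^sub>R e) -` (- N) \<inter> space (lborel \<Otimes>\<^sub>M lborel)" by auto
  also have "\<dots> \<in> sets (lborel \<Otimes>\<^sub>M lborel)" by (rule measurable_sets[OF meas]) (use Nb in auto)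
  finally have "{z \<in> space ((lborel :: 'a measure) \<Otimes>\<^sub>M (lborel :: real measure)). fst z + snd z *\<^sub>R e \<notin> N}
     \<in> sets (lborel \<Otimes>\<^sub>M lborel)" .
  then show ?thesis
    using lborel_pair.AE_commute[of "\<lambda>\<xi> s. \<xi> + s *\<^sub>R e \<notin> N"] sl by simp
qed

text \<open>No ball is negligible, so a property that holds almost everywhere holds arbitrarily
  close to any point.\<close>

lemma AE_lborel_dense:
  fixes x :: "'a::euclidean_space"
  assumes "AE \<xi> in lborel. P \<xi>" "d > 0"
  shows "\<exists>\<xi>. dist x \<xi> < d \<and> P \<xi>"
proof (rule ccontr)
  assume neg: "\<not> ?thesis"
  obtain N where N: "{\<xi> \<in> space lborel. \<not> P \<xi>} \<subseteq> N" "emeasure lborel N = 0" "N \<in> sets lborel"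
    by (rule AE_E[OF assms(1)])
  have "ball x d \<subseteq> N"
  proof
    fix y assume "y \<in> ball x d"
    then have "\<not> P y" using neg unfolding mem_ball by blast
    then show "y \<in> N" using N(1) unfolding space_lborel space_borel by blast
  qed
  then have "negligible (ball x d)"
  proof (rule negligible_subset[rotated])
    have "N \<in> null_sets lborel" using N(2,3) by (rule null_setsI)
    then show "negligible N" by (simp add: negligible_iff_null_sets null_sets_completionI)
  qed
  then show False using open_not_negligible[of "ball x d"] assms(2) by simp
qed

text \<open>The line through \<open>\<xi>\<close> itself may lie entirely in the exceptional set. A
  nearby parallel line meets that set in a null set by Fubini; the one-dimensional estimate is
  applied there to the function and to its negative, and continuity of \<open>h\<close> and
  \<open>M\<close> brings the result back to \<open>\<xi>\<close>.\<close>

lemma increment_le_of_AE_line_deriv_le: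
  fixes h M :: "'a::euclidean_space \<Rightarrow> real"
  assumes hc: "continuous_on UNIV h" and Mc: "continuous_on UNIV M" and M0: "\<And>\<xi>. 0 \<le> M \<xi>"
    and lip: "\<And>B. bounded B \<Longrightarrow> \<exists>L. \<forall>\<xi> s s'. \<xi> + s *\<^sub>R e \<in> B \<and> \<xi> + s' *\<^sub>R e \<in> B \<longrightarrow>
      \<bar>h (\<xi> + s *\<^sub>R e) - h (\<xi> + s' *\<^sub>R e)\<bar> \<le> L * \<bar>s - s'\<bar>"
    and ae: "AE \<xi> in lborel. \<forall>d. ((\<lambda>s. h (\<xi> + s *\<^sub>R e)) has_real_derivative d) (at 0) \<longrightarrow> \<bar>d\<bar> \<le> M \<xi>"
    and bd: "\<And>s. 0 \<le> s \<Longrightarrow> s \<le> \<tau> \<Longrightarrow> M (\<xi> + s *\<^sub>R e) \<le> C" and \<tau>: "0 \<le> \<tau>"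
  shows "\<bar>h (\<xi> + \<tau> *\<^sub>R e) - h \<xi>\<bar> \<le> C * \<tau>"
proof (cases "\<tau> = 0")
  case False
  then have \<tau>: "\<tau> > 0" using \<tau> by simp
  have C0: "0 \<le> C" using bd[of 0] M0[of \<xi>] \<tau> by simp
  define P where "P \<xi> \<longleftrightarrow> (\<forall>d. ((\<lambda>s. h (\<xi> + s *\<^sub>R e)) has_real_derivative d) (at 0) \<longrightarrow> \<bar>d\<bar> \<le> M \<xi>)" for \<xi>
  have "AE \<xi> in lborel. P \<xi>" using ae by (simp add: P_def)
  then obtain N where "{\<xi> \<in> space lborel. \<not> P \<xi>} \<subseteq> N" "emeasure lborel N = 0" "N \<in> sets lborel"
    by (rule AE_E)
  then have N: "N \<in> null_sets lborel" "\<And>\<xi>. \<xi> \<notin> N \<Longrightarrow> P \<xi>" by auto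
  have "\<bar>h (\<xi> + \<tau> *\<^sub>R e) - h \<xi>\<bar> \<le> C * \<tau> + \<epsilon>" if \<epsilon>: "\<epsilon> > 0" for \<epsilon>
  proof -
    \<comment> \<open>One \<open>\<epsilon>'\<close> is spent on the bound \<open>M\<close> per unit
      of length, and one at each of the two end points when returning to the original line.\<close>
    define \<epsilon>' where "\<epsilon>' = \<epsilon> / (\<tau> + 2)"
    have "\<epsilon>' * (\<tau> + 2) = \<epsilon>" using \<tau> by (simp add: \<epsilon>'_def)
    then have \<epsilon>': "\<epsilon>' > 0" "\<epsilon>' * \<tau> + 2 * \<epsilon>' = \<epsilon>" using \<epsilon> \<tau> by (simp add: \<epsilon>'_def, simp add: distrib_left mult.commute)
    define K where "K = cball \<xi> (1 + \<tau> * norm e)"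
    have K: "compact K" "bounded K" by (auto simp: K_def)
    have inK: "\<xi>' + s *\<^sub>R e \<in> K" if "dist \<xi> \<xi>' \<le> 1" "0 \<le> s" "s \<le> \<tau>" for \<xi>' s
    proof -
      have "dist \<xi> (\<xi>' + s *\<^sub>R e) \<le> dist \<xi> \<xi>' + norm (s *\<^sub>R e)"
        by (metis dist_add_cancel dist_triangle norm_conv_dist add.right_neutral dist_commute)
      also have "\<dots> \<le> 1 + \<tau> * norm e" using that by (auto intro!: add_mono mult_right_mono)
      finally show ?thesis by (simp add: K_def)
    qed
    have "uniformly_continuous_on K M" "uniformly_continuous_on K h"
      using K by (auto intro!: compact_uniformly_continuous continuous_on_subset[OF Mc] continuous_on_subset[OF hc])
    then obtain d1 d2 where d: "d1 > 0" "d2 > 0"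
      "\<And>a b. a \<in> K \<Longrightarrow> b \<in> K \<Longrightarrow> dist a b < d1 \<Longrightarrow> dist (M a) (M b) < \<epsilon>'"
      "\<And>a b. a \<in> K \<Longrightarrow> b \<in> K \<Longrightarrow> dist a b < d2 \<Longrightarrow> dist (h a) (h b) < \<epsilon>'"
      unfolding uniformly_continuous_on_def using \<epsilon>'(1) by metis
    obtain \<xi>' where \<xi>': "dist \<xi> \<xi>' < min 1 (min d1 d2)" "AE s in lborel. \<xi>' + s *\<^sub>R e \<notin> N"
      using AE_lborel_dense[OF AE_line_notin_null[OF N(1), of e], of "min 1 (min d1 d2)" \<xi>] d by auto
    have Mb: "M (\<xi>' + s *\<^sub>R e) \<le> C + \<epsilon>'" if "0 \<le> s" "s \<le> \<tau>" for s
    proof -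
      have "dist (\<xi> + s *\<^sub>R e) (\<xi>' + s *\<^sub>R e) < d1" using \<xi>' by (simp add: dist_norm)
      then show ?thesis using d(3)[OF inK inK, of \<xi> s \<xi>' s] that \<xi>' bd[of s] by (auto simp: dist_real_def)
    qed
    obtain L where L: "\<And>\<xi> s s'. \<xi> + s *\<^sub>R e \<in> K \<Longrightarrow> \<xi> + s' *\<^sub>R e \<in> K \<Longrightarrow>
      \<bar>h (\<xi> + s *\<^sub>R e) - h (\<xi> + s' *\<^sub>R e)\<bar> \<le> L * \<bar>s - s'\<bar>" using lip[OF K(2)] by blast
    \<comment> \<open>Clamping the parameter to \<open>{0..\<tau>}\<close> makes the restriction
      globally Lipschitz, as the one-dimensional lemma requires, although \<open>h\<close> is only
      locally Lipschitz.\<close>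
    define cl where "cl s = max 0 (min \<tau> s)" for s
    have cl: "0 \<le> cl s" "cl s \<le> \<tau>" "\<bar>cl s - cl s'\<bar> \<le> \<bar>s - s'\<bar>" for s s' using \<tau> by (auto simp: cl_def)
    define f where "f s = h (\<xi>' + cl s *\<^sub>R e)" for s
    have lipf: "\<bar>f s - f s'\<bar> \<le> max 0 L * \<bar>s - s'\<bar>" for s s'
    proof -
      have "\<bar>f s - f s'\<bar> \<le> L * \<bar>cl s - cl s'\<bar>"
        unfolding f_def by (rule L; rule inK) (use cl \<xi>' in auto)
      also have "\<dots> \<le> max 0 L * \<bar>s - s'\<bar>" using cl by (intro mult_mono) auto
      finally show ?thesis .
    qed
    have der: "\<bar>d\<bar> \<le> C + \<epsilon>'" if s: "0 < s" "s < \<tau>" "\<xi>' + s *\<^sub>R e \<notin> N" and D: "(f has_real_derivative d) (at s)" for s d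
    proof -
      have D': "((\<lambda>r. f (r + s)) has_real_derivative d) (at 0)" using D DERIV_shift[of f d 0 s] by simp
      have "\<forall>\<^sub>F r in nhds 0. f (r + s) = h ((\<xi>' + s *\<^sub>R e) + r *\<^sub>R e)"
      proof -
        have "h (\<xi>' + cl (r + s) *\<^sub>R e) = h ((\<xi>' + s *\<^sub>R e) + r *\<^sub>R e)" if "dist r 0 < min s (\<tau> - s)" for r
        proof -
          have "cl (r + s) = r + s" using that s by (auto simp: cl_def)
          then show ?thesis by (simp add: algebra_simps)
        qed
        then show ?thesis unfolding eventually_nhds_metric f_def using s by (intro exI[of _ "min s (\<tau> - s)"]) auto
      qed
      then have "((\<lambda>r. h ((\<xi>' + s *\<^sub>R e) + r *\<^sub>R e)) has_real_derivative d) (at 0)"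
        using D' DERIV_cong_ev[of 0 0 "\<lambda>r. f (r + s)" "\<lambda>r. h ((\<xi>' + s *\<^sub>R e) + r *\<^sub>R e)" d d] by simp
      then have "\<bar>d\<bar> \<le> M (\<xi>' + s *\<^sub>R e)" using N(2)[OF s(3)] unfolding P_def by blast
      then show ?thesis using Mb[of s] s by auto
    qed
    have "f \<tau> - f 0 \<le> (C + \<epsilon>') * (\<tau> - 0)"
    proof (rule increment_le_of_AE_deriv_le[OF lipf])
      show "AE s in lborel. 0 < s \<and> s < \<tau> \<longrightarrow> (\<forall>d. (f has_real_derivative d) (at s) \<longrightarrow> d \<le> C + \<epsilon>')"
        using \<xi>'(2) by eventually_elim (use der abs_le_iff in blast)
    qed (use \<tau> C0 \<epsilon>' in auto)
    moreover have "- f \<tau> - (- f 0) \<le> (C + \<epsilon>') * (\<tau> - 0)"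
    proof (rule increment_le_of_AE_deriv_le[where f="\<lambda>s. - f s"])
      show "\<bar>- f x - - f y\<bar> \<le> max 0 L * \<bar>x - y\<bar>" for x y using lipf[of x y] by (simp add: abs_minus_commute)
      have *: "d \<le> C + \<epsilon>'" if "0 < s" "s < \<tau>" "\<xi>' + s *\<^sub>R e \<notin> N" "((\<lambda>s. - f s) has_real_derivative d) (at s)" for s d
        using der[OF that(1-3), of "- d"] DERIV_minus[OF that(4)] by simp
      show "AE s in lborel. 0 < s \<and> s < \<tau> \<longrightarrow> (\<forall>d. ((\<lambda>s. - f s) has_real_derivative d) (at s) \<longrightarrow> d \<le> C + \<epsilon>')"
        using \<xi>'(2) by eventually_elim (use * in blast)
    qed (use \<tau> C0 \<epsilon>' in auto)
    ultimately have "\<bar>f \<tau> - f 0\<bar> \<le> (C + \<epsilon>') * \<tau>" by auto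
    moreover have "f \<tau> = h (\<xi>' + \<tau> *\<^sub>R e)" "f 0 = h \<xi>'" using \<tau> by (auto simp: f_def cl_def)
    moreover have "dist (h \<xi>) (h \<xi>') < \<epsilon>'"
      using d(4)[OF inK inK, of \<xi> 0 \<xi>' 0] \<xi>' \<tau> by auto
    moreover have "dist (h (\<xi> + \<tau> *\<^sub>R e)) (h (\<xi>' + \<tau> *\<^sub>R e)) < \<epsilon>'"
      using d(4)[OF inK inK, of \<xi> \<tau> \<xi>' \<tau>] \<xi>' \<tau> by (auto simp: dist_norm)
    ultimately have "\<bar>h (\<xi> + \<tau> *\<^sub>R e) - h \<xi>\<bar> \<le> (C + \<epsilon>') * \<tau> + 2 * \<epsilon>'"
      by (auto simp: dist_real_def)
    then show ?thesis using \<epsilon>' by (simp add: algebra_simps)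
  qed
  then show ?thesis by (rule field_le_epsilon)
qed simp

lemma increment_le_of_AE_line_deriv_le_abs:
  fixes h M :: "'a::euclidean_space \<Rightarrow> real"
  assumes hc: "continuous_on UNIV h" and Mc: "continuous_on UNIV M" and M0: "\<And>\<xi>. 0 \<le> M \<xi>"
    and lip: "\<And>B. bounded B \<Longrightarrow> \<exists>L. \<forall>\<xi> s s'. \<xi> + s *\<^sub>R e \<in> B \<and> \<xi> + s' *\<^sub>R e \<in> B \<longrightarrow>
      \<bar>h (\<xi> + s *\<^sub>R e) - h (\<xi> + s' *\<^sub>R e)\<bar> \<le> L * \<bar>s - s'\<bar>"
    and ae: "AE \<xi> in lborel. \<forall>d. ((\<lambda>s. h (\<xi> + s *\<^sub>R e)) has_real_derivative d) (at 0) \<longrightarrow> \<bar>d\<bar> \<le> M \<xi>"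
    and bd: "\<And>s. \<bar>s\<bar> \<le> \<bar>\<tau>\<bar> \<Longrightarrow> M (\<xi> + s *\<^sub>R e) \<le> C"
  shows "\<bar>h (\<xi> + \<tau> *\<^sub>R e) - h \<xi>\<bar> \<le> C * \<bar>\<tau>\<bar>"
proof (cases "0 \<le> \<tau>")
  case True
  then show ?thesis
    using increment_le_of_AE_line_deriv_le[OF hc Mc M0 lip ae, of \<tau> \<xi> C] bd by auto
next
  case False
  have "\<bar>h ((\<xi> + \<tau> *\<^sub>R e) + (- \<tau>) *\<^sub>R e) - h (\<xi> + \<tau> *\<^sub>R e)\<bar> \<le> C * (- \<tau>)"
  proof (rule increment_le_of_AE_line_deriv_le[OF hc Mc M0 lip ae])
    fix s assume "0 \<le> s" "s \<le> - \<tau>"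
    then have "M (\<xi> + (\<tau> + s) *\<^sub>R e) \<le> C" by (intro bd) auto
    then show "M (\<xi> + \<tau> *\<^sub>R e + s *\<^sub>R e) \<le> C" by (simp add: algebra_simps)
  qed (use False in auto)
  then show ?thesis using False by (simp add: abs_minus_commute algebra_simps)
qed

text \<open>The bound in \<open>t\<close> involves |G| along the whole segment. It is closed up at a
  maximum point of |G| on the interval of radius \<open>\<bar>t' - t\<bar>\<close>: when
  \<open>C4 * \<bar>t' - t\<bar> \<le> 1 / 2\<close>, half of the maximum is absorbed on the left,
  which produces the factor \<open>2 * C4\<close> and the value of G at the centre only.\<close>

lemma H3_increments:
  fixes G :: "('n::finite) ham"
  assumes H1: "H1 G" and H3: "H3 G l"
  shows "\<exists>C3 C4 C5. 0 \<le> C3 \<and> 0 \<le> C4 \<and> 0 \<le> C5 \<and>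
    (\<forall>x y y' t p q. \<bar>G x y' t p q - G x y t p q\<bar> \<le> C3 * \<bar>q + l\<bar> * \<bar>y' - y\<bar>) \<and>
    (\<forall>x y t t' p q. C4 * \<bar>t' - t\<bar> \<le> 1 / 2 \<longrightarrow>
        \<bar>G x y t' p q - G x y t p q\<bar> \<le> 2 * C4 * (1 + \<bar>q\<bar> + \<bar>G x y t p q\<bar>) * \<bar>t' - t\<bar>) \<and>
    (\<forall>x y t p q q'. \<bar>G x y t p q' - G x y t p q\<bar> \<le> C5 * \<bar>q' - q\<bar>)"
proof -
  let ?E = "lborel :: ((real^('n::finite)) \<times> real \<times> real \<times> (real^('n::finite)) \<times> real) measure"
  obtain C3 C4 C5 where C: "C3 \<ge> 0" "C4 \<ge> 0" "C5 \<ge> 0" and ae: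
    "AE \<xi> in ?E.
          (case \<xi> of (x, y, t, px, py) \<Rightarrow>
             (\<forall>d. ((\<lambda>s. G x s t px py) has_real_derivative d) (at y) \<longrightarrow> \<bar>d\<bar> \<le> C3 * \<bar>py + l\<bar>) \<and>
             (\<forall>d. ((\<lambda>s. G x y s px py) has_real_derivative d) (at t) \<longrightarrow>
                    \<bar>d\<bar> \<le> C4 * (1 + \<bar>py\<bar> + \<bar>G x y t px py\<bar>)) \<and>
             (\<forall>d. ((\<lambda>s. G x y t px s) has_real_derivative d) (at py) \<longrightarrow> \<bar>d\<bar> \<le> C5))"
    using H3 unfolding H3_def by blast
  have ll: "loc_lip_ytpy G" using H3 by (simp add: H3_def)
  define h where "h = (\<lambda>(x, y, t, px, py). G x y t px py)"
  have hc: "continuous_on UNIV h" using H1 by (simp add: H1_def h_def)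
  have hh: "h (x,y,t,p,q) = G x y t p q" for x y t p q by (simp add: h_def)
  have lip: "\<exists>L. \<forall>\<xi> s s'. \<xi> + s *\<^sub>R e \<in> B \<and> \<xi> + s' *\<^sub>R e \<in> B \<longrightarrow>
      \<bar>h (\<xi> + s *\<^sub>R e) - h (\<xi> + s' *\<^sub>R e)\<bar> \<le> L * \<bar>s - s'\<bar>"
    if B: "bounded B" and e: "e = (0, a, b, 0, c)" and abc: "\<bar>a\<bar> + \<bar>b\<bar> + \<bar>c\<bar> = 1" for B e a b c
  proof -
    obtain L where L: "\<And>x y t px py y' t' py'. (x, y, t, px, py) \<in> B \<Longrightarrow> (x, y', t', px, py') \<in> B \<Longrightarrow>
      \<bar>G x y t px py - G x y' t' px py'\<bar> \<le> L * (\<bar>y - y'\<bar> + \<bar>t - t'\<bar> + \<bar>py - py'\<bar>)"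
      using ll B unfolding loc_lip_ytpy_def by meson
    show ?thesis
    proof (intro exI allI impI)
      fix \<xi> s s' assume *: "\<xi> + s *\<^sub>R e \<in> B \<and> \<xi> + s' *\<^sub>R e \<in> B"
      obtain x y t p q where \<xi>: "\<xi> = (x,y,t,p,q)" by (cases \<xi>) auto
      have "\<bar>h (\<xi> + s *\<^sub>R e) - h (\<xi> + s' *\<^sub>R e)\<bar> \<le>
         L * (\<bar>(y + s * a) - (y + s' * a)\<bar> + \<bar>(t + s * b) - (t + s' * b)\<bar> + \<bar>(q + s * c) - (q + s' * c)\<bar>)"
        using * L[of x "y + s * a" "t + s * b" p "q + s * c" "y + s' * a" "t + s' * b" "q + s' * c"]
        by (simp add: \<xi> e hh)
      also have "\<dots> = L * ((\<bar>a\<bar> + \<bar>b\<bar> + \<bar>c\<bar>) * \<bar>s - s'\<bar>)"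
      proof -
        have "(r + s * k) - (r + s' * k) = k * (s - s')" for r k :: real by (simp add: algebra_simps)
        then show ?thesis by (simp only: abs_mult distrib_right)
      qed
      finally show "\<bar>h (\<xi> + s *\<^sub>R e) - h (\<xi> + s' *\<^sub>R e)\<bar> \<le> L * \<bar>s - s'\<bar>" by (simp add: abc)
    qed
  qed
  have lipy: "bounded B \<Longrightarrow> \<exists>L. \<forall>\<xi> s s'. \<xi> + s *\<^sub>R (0,1,0,0,0) \<in> B \<and> \<xi> + s' *\<^sub>R (0,1,0,0,0) \<in> B \<longrightarrow>
      \<bar>h (\<xi> + s *\<^sub>R (0,1,0,0,0)) - h (\<xi> + s' *\<^sub>R (0,1,0,0,0))\<bar> \<le> L * \<bar>s - s'\<bar>" for B
    by (rule lip[OF _ refl]) auto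
  have lipt: "bounded B \<Longrightarrow> \<exists>L. \<forall>\<xi> s s'. \<xi> + s *\<^sub>R (0,0,1,0,0) \<in> B \<and> \<xi> + s' *\<^sub>R (0,0,1,0,0) \<in> B \<longrightarrow>
      \<bar>h (\<xi> + s *\<^sub>R (0,0,1,0,0)) - h (\<xi> + s' *\<^sub>R (0,0,1,0,0))\<bar> \<le> L * \<bar>s - s'\<bar>" for B
    by (rule lip[OF _ refl]) auto
  have lipq: "bounded B \<Longrightarrow> \<exists>L. \<forall>\<xi> s s'. \<xi> + s *\<^sub>R (0,0,0,0,1) \<in> B \<and> \<xi> + s' *\<^sub>R (0,0,0,0,1) \<in> B \<longrightarrow>
      \<bar>h (\<xi> + s *\<^sub>R (0,0,0,0,1)) - h (\<xi> + s' *\<^sub>R (0,0,0,0,1))\<bar> \<le> L * \<bar>s - s'\<bar>" for B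
    by (rule lip[OF _ refl]) auto
  define My where "My = (\<lambda>\<xi>::(real^('n::finite)) \<times> real \<times> real \<times> (real^('n::finite)) \<times> real. C3 * \<bar>snd (snd (snd (snd \<xi>))) + l\<bar>)"
  define Mt where "Mt = (\<lambda>\<xi>::(real^('n::finite)) \<times> real \<times> real \<times> (real^('n::finite)) \<times> real. C4 * (1 + \<bar>snd (snd (snd (snd \<xi>)))\<bar> + \<bar>h \<xi>\<bar>))"
  have Mc: "continuous_on UNIV My" "continuous_on UNIV Mt" unfolding My_def Mt_def
    by (intro continuous_intros hc)+
  have Mp: "0 \<le> My \<xi>" "0 \<le> Mt \<xi>" for \<xi> using C by (auto simp: My_def Mt_def)
  have aey: "AE \<xi> in lborel. \<forall>d. ((\<lambda>s. h (\<xi> + s *\<^sub>R (0,1,0,0,0))) has_real_derivative d) (at 0) \<longrightarrow> \<bar>d\<bar> \<le> My \<xi>"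
    using ae
  proof eventually_elim
    case (elim \<xi>)
    obtain x y t p q where \<xi>: "\<xi> = (x,y,t,p,q)" by (cases \<xi>) auto
    show ?case using elim DERIV_shift[of "\<lambda>s. G x s t p q" _ 0 y] by (simp add: \<xi> hh My_def add.commute)
  qed
  have aet: "AE \<xi> in lborel. \<forall>d. ((\<lambda>s. h (\<xi> + s *\<^sub>R (0,0,1,0,0))) has_real_derivative d) (at 0) \<longrightarrow> \<bar>d\<bar> \<le> Mt \<xi>"
    using ae
  proof eventually_elim
    case (elim \<xi>)
    obtain x y t p q where \<xi>: "\<xi> = (x,y,t,p,q)" by (cases \<xi>) auto
    show ?case using elim DERIV_shift[of "\<lambda>s. G x y s p q" _ 0 t] by (simp add: \<xi> hh Mt_def add.commute)
  qed
  have aeq: "AE \<xi> in lborel. \<forall>d. ((\<lambda>s. h (\<xi> + s *\<^sub>R (0,0,0,0,1))) has_real_derivative d) (at 0) \<longrightarrow> \<bar>d\<bar> \<le> C5"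
    using ae
  proof eventually_elim
    case (elim \<xi>)
    obtain x y t p q where \<xi>: "\<xi> = (x,y,t,p,q)" by (cases \<xi>) auto
    show ?case using elim DERIV_shift[of "\<lambda>s. G x y t p s" _ 0 q] by (simp add: \<xi> hh add.commute)
  qed
  show ?thesis
  proof (intro exI conjI allI impI)
    fix x y y' t p q
    show "\<bar>G x y' t p q - G x y t p q\<bar> \<le> C3 * \<bar>q + l\<bar> * \<bar>y' - y\<bar>"
      using increment_le_of_AE_line_deriv_le_abs[OF hc Mc(1) Mp(1) lipy aey, of "y' - y" "(x,y,t,p,q)" "C3 * \<bar>q + l\<bar>"]
      by (simp add: hh My_def)
  next
    fix x y t p q q'
    show "\<bar>G x y t p q' - G x y t p q\<bar> \<le> C5 * \<bar>q' - q\<bar>"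
      using increment_le_of_AE_line_deriv_le_abs[where M="\<lambda>_. C5", OF hc continuous_on_const C(3) lipq aeq, where \<tau>="q' - q" and \<xi>="(x,y,t,p,q)" and C=C5]
      by (simp add: hh)
  next
    fix x y t t' p q assume small: "C4 * \<bar>t' - t\<bar> \<le> 1 / 2"
    let ?I = "{t - \<bar>t' - t\<bar>..t + \<bar>t' - t\<bar>}"
    define m where "m r = \<bar>G x y r p q\<bar>" for r
    have "continuous_on UNIV m"
    proof -
      have "continuous_on UNIV (\<lambda>r. h (x,y,r,p,q))"
        by (rule continuous_on_compose2[OF hc]) (auto intro!: continuous_intros)
      then show ?thesis unfolding m_def hh by (intro continuous_intros)
    qed
    then have "continuous_on ?I m" by (rule continuous_on_subset) auto
    then obtain r0 where r0: "r0 \<in> ?I" "\<And>r. r \<in> ?I \<Longrightarrow> m r \<le> m r0"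
      using continuous_attains_sup[of ?I m] by auto
    have inc: "\<bar>G x y r p q - G x y t p q\<bar> \<le> C4 * (1 + \<bar>q\<bar> + m r0) * \<bar>r - t\<bar>" if "\<bar>r - t\<bar> \<le> \<bar>t' - t\<bar>" for r
    proof -
      have "Mt ((x,y,t,p,q) + s *\<^sub>R (0,0,1,0,0)) \<le> C4 * (1 + \<bar>q\<bar> + m r0)" if "\<bar>s\<bar> \<le> \<bar>r - t\<bar>" for s
      proof -
        have "\<bar>s\<bar> \<le> \<bar>t' - t\<bar>" using that \<open>\<bar>r - t\<bar> \<le> \<bar>t' - t\<bar>\<close> by linarith
        then have "t + s \<in> ?I" unfolding atLeastAtMost_iff by linarith
        then have "m (t + s) \<le> m r0" by (rule r0(2))
        then show ?thesis using C by (simp add: Mt_def hh m_def mult_left_mono)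
      qed
      then show ?thesis
        using increment_le_of_AE_line_deriv_le_abs[OF hc Mc(2) Mp(2) lipt aet, of "r - t" "(x,y,t,p,q)" "C4 * (1 + \<bar>q\<bar> + m r0)"]
        by (simp add: hh)
    qed
    have r0t: "\<bar>r0 - t\<bar> \<le> \<bar>t' - t\<bar>" using r0(1) by auto
    have "m r0 \<le> m t + C4 * (1 + \<bar>q\<bar> + m r0) * \<bar>r0 - t\<bar>" using inc[OF r0t] by (simp add: m_def)
    also have "C4 * (1 + \<bar>q\<bar> + m r0) * \<bar>r0 - t\<bar> \<le> C4 * (1 + \<bar>q\<bar> + m r0) * \<bar>t' - t\<bar>"
      using r0t C by (intro mult_left_mono mult_nonneg_nonneg) (auto simp: m_def)
    also have "\<dots> = (C4 * \<bar>t' - t\<bar>) * (1 + \<bar>q\<bar> + m r0)" by (simp add: algebra_simps)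
    also have "\<dots> \<le> 1/2 * (1 + \<bar>q\<bar> + m r0)" using small by (intro mult_right_mono) (auto simp: m_def)
    finally have "1 + \<bar>q\<bar> + m r0 \<le> 2 * (1 + \<bar>q\<bar> + m t)" by (simp add: field_simps)
    then have "C4 * (1 + \<bar>q\<bar> + m r0) * \<bar>t' - t\<bar> \<le> C4 * (2 * (1 + \<bar>q\<bar> + m t)) * \<bar>t' - t\<bar>"
      using C by (intro mult_right_mono mult_left_mono) auto
    then show "\<bar>G x y t' p q - G x y t p q\<bar> \<le> 2 * C4 * (1 + \<bar>q\<bar> + \<bar>G x y t p q\<bar>) * \<bar>t' - t\<bar>"
      using inc[of t'] by (simp add: m_def algebra_simps)
  qed (use C in auto)
qed

section \<open>Viscosity sub- and supersolutions\<close>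

text \<open>The derivative is carried as a gradient field, so that norms and limits of gradients are
  at hand. \<open>C1_test_imp_test_fun\<close> and \<open>test_fun_imp_C1_test\<close> give the
  passage from and to \<open>C1_test\<close>.\<close>

definition test_fun :: "('a::euclidean_space \<Rightarrow> real) \<Rightarrow> ('a \<Rightarrow> 'a) \<Rightarrow> bool" where
  "test_fun \<phi> g \<longleftrightarrow> (\<forall>z. (\<phi> has_derivative (\<lambda>h. g z \<bullet> h)) (at z)) \<and> continuous_on UNIV g"

text \<open>No envelope is taken: the function itself is tested and semicontinuity is stated
  separately by \<open>usc_on\<close>. The notion with envelopes is recovered by inserting the
  envelope for \<open>u\<close>.\<close>

definition subsol :: "('a::euclidean_space \<Rightarrow> real \<Rightarrow> 'a \<Rightarrow> real) \<Rightarrow> 'a set \<Rightarrow> ('a \<Rightarrow> real) \<Rightarrow> bool" where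
  "subsol F \<Omega> u \<longleftrightarrow> (\<forall>z\<in>\<Omega>. \<forall>\<phi> g. test_fun \<phi> g \<and>
     (\<exists>e>0. \<forall>w\<in>ball z e \<inter> \<Omega>. u w - \<phi> w \<le> u z - \<phi> z) \<longrightarrow> F z (u z) (g z) \<le> 0)"

(* v is a supersolution of F = 0 iff - v is a subsolution of dual_eq F = 0. *)
definition dual_eq :: "('a::euclidean_space \<Rightarrow> real \<Rightarrow> 'a \<Rightarrow> real) \<Rightarrow> 'a \<Rightarrow> real \<Rightarrow> 'a \<Rightarrow> real" where
  "dual_eq F z r p = - F z (- r) (- p)"

definition supsol :: "('a::euclidean_space \<Rightarrow> real \<Rightarrow> 'a \<Rightarrow> real) \<Rightarrow> 'a set \<Rightarrow> ('a \<Rightarrow> real) \<Rightarrow> bool" where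
  "supsol F \<Omega> v \<longleftrightarrow> subsol (dual_eq F) \<Omega> (\<lambda>z. - v z)"

definition usc_on :: "'a::euclidean_space set \<Rightarrow> ('a \<Rightarrow> real) \<Rightarrow> bool" where
  "usc_on \<Omega> u \<longleftrightarrow> (\<forall>z\<in>\<Omega>. \<forall>e>0. \<forall>\<^sub>F w in nhds z. u w < u z + e)"

definition lsc_on :: "'a::euclidean_space set \<Rightarrow> ('a \<Rightarrow> real) \<Rightarrow> bool" where
  "lsc_on \<Omega> v \<longleftrightarrow> usc_on \<Omega> (\<lambda>z. - v z)"

lemma subsolD: "subsol F \<Omega> u \<Longrightarrow> z \<in> \<Omega> \<Longrightarrow> test_fun \<phi> g \<Longrightarrow> e > 0 \<Longrightarrow>
    (\<And>w. w \<in> ball z e \<Longrightarrow> w \<in> \<Omega> \<Longrightarrow> u w - \<phi> w \<le> u z - \<phi> z) \<Longrightarrow> F z (u z) (g z) \<le> 0"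
  unfolding subsol_def by (metis IntD1 IntD2)

lemma subsolI:
  "(\<And>z \<phi> g e. z \<in> \<Omega> \<Longrightarrow> test_fun \<phi> g \<Longrightarrow> e > 0 \<Longrightarrow>
    (\<And>w. w \<in> ball z e \<Longrightarrow> w \<in> \<Omega> \<Longrightarrow> u w - \<phi> w \<le> u z - \<phi> z) \<Longrightarrow> F z (u z) (g z) \<le> 0) \<Longrightarrow> subsol F \<Omega> u"
  unfolding subsol_def by (metis IntI)

lemma test_funI:
  assumes "\<And>z. (\<phi> has_derivative D z) (at z)" "\<And>z h. D z h = g z \<bullet> h" "continuous_on UNIV g"
  shows "test_fun \<phi> g"
proof -
  have "D z = (\<lambda>h. g z \<bullet> h)" for z using assms(2) by (rule ext)
  then show ?thesis using assms unfolding test_fun_def by metis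
qed

lemma test_funD: "test_fun \<phi> g \<Longrightarrow> (\<phi> has_derivative (\<lambda>h. g z \<bullet> h)) (at z)"
  by (simp add: test_fun_def)

lemma test_fun_contD: "test_fun \<phi> g \<Longrightarrow> continuous_on UNIV g"
  by (simp add: test_fun_def)

lemma test_fun_minus: "test_fun \<phi> g \<Longrightarrow> test_fun (\<lambda>w. - \<phi> w) (\<lambda>w. - g w)"
  by (rule test_funI[OF has_derivative_minus[OF test_funD]])
     (auto intro!: continuous_intros intro: test_fun_contD)

lemma test_fun_add: "test_fun \<phi> g \<Longrightarrow> test_fun \<psi> h \<Longrightarrow> test_fun (\<lambda>w. \<phi> w + \<psi> w) (\<lambda>w. g w + h w)"
  by (rule test_funI[OF has_derivative_add[OF test_funD test_funD]])
     (auto intro!: continuous_intros intro: test_fun_contD simp: inner_add_left)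

lemma test_fun_cmult: "test_fun \<phi> g \<Longrightarrow> test_fun (\<lambda>w. c * \<phi> w) (\<lambda>w. c *\<^sub>R g w)"
  by (rule test_funI[OF has_derivative_mult_right[OF test_funD]])
     (auto intro!: continuous_intros intro: test_fun_contD)

lemma test_fun_const: "test_fun (\<lambda>w. c) (\<lambda>w. 0)"
  by (rule test_funI[OF has_derivative_const]) auto

lemma test_fun_sqdist: "test_fun (\<lambda>w. (norm (w - z))\<^sup>2) (\<lambda>w. 2 *\<^sub>R (w - z))"
proof (rule test_funI)
  show "((\<lambda>w. (norm (w - z))\<^sup>2) has_derivative (\<lambda>h. (w - z) \<bullet> h + h \<bullet> (w - z))) (at w)" for w
    unfolding power2_norm_eq_inner by (auto intro!: derivative_eq_intros)
qed (auto intro!: continuous_intros simp: inner_commute)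

lemma test_fun_shift: "test_fun \<phi> g \<Longrightarrow> test_fun (\<lambda>w. \<phi> (w + k)) (\<lambda>w. g (w + k))"
proof -
  assume t: "test_fun \<phi> g"
  have 1: "((\<lambda>w. w + k) has_derivative (\<lambda>h. h)) (at z)" for z by (auto intro!: derivative_eq_intros)
  show ?thesis
  proof (rule test_funI)
    show "((\<lambda>w. \<phi> (w + k)) has_derivative (\<lambda>h. g (z + k) \<bullet> h)) (at z)" for z
      using has_derivative_compose[OF 1 test_funD[OF t, of "z + k"]] .
    show "continuous_on UNIV (\<lambda>w. g (w + k))"
      using t by (auto simp: test_fun_def intro!: continuous_intros continuous_on_compose2[of UNIV g])
  qed simp
qed

lemma test_fun_continuous: "test_fun \<phi> g \<Longrightarrow> continuous_on UNIV \<phi>" "test_fun \<phi> g \<Longrightarrow> continuous_on UNIV g"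
  unfolding test_fun_def by (auto intro: has_derivative_continuous_on)

lemma test_fun_isCont: "test_fun \<phi> g \<Longrightarrow> isCont \<phi> z" "test_fun \<phi> g \<Longrightarrow> isCont g z"
  using test_fun_continuous continuous_on_eq_continuous_at[OF open_UNIV] by blast+

text \<open>The differential of the difference vanishes at an interior maximum. This serves wherever
  a candidate coincides with a smooth function at the touching point: the gradient of the unknown
  test function is then known.\<close>

lemma test_fun_unique_gradient:
  fixes z :: "'a::euclidean_space"
  assumes "test_fun \<phi> g" "test_fun \<psi> h" "e > 0"
    and max: "\<And>w. w \<in> ball z e \<Longrightarrow> \<phi> w - \<psi> w \<le> \<phi> z - \<psi> z"
  shows "g z = h z"
proof -
  have "test_fun (\<lambda>w. \<phi> w + - \<psi> w) (\<lambda>w. g w + - h w)" using assms by (intro test_fun_add test_fun_minus)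
  then have D: "((\<lambda>w. \<phi> w + - \<psi> w) has_derivative (\<lambda>k. (g z + - h z) \<bullet> k)) (at z)" by (simp add: test_fun_def)
  have "(\<lambda>k. (g z + - h z) \<bullet> k) = (\<lambda>k. 0)"
    by (rule differential_zero_maxmin[where x=z and S="ball z e", OF _ open_ball D]) (use assms in auto)
  then have "(g z + - h z) \<bullet> (g z + - h z) = 0" by (rule fun_cong)
  then show ?thesis by simp
qed

text \<open>Difference quotients from the right converge to the directional derivative. Used with
  \<open>h\<close> and \<open>- h\<close>, it pins down components of the gradient of a test
  function touching a function that need not be differentiable.\<close>

lemma test_fun_directional:
  assumes t: "test_fun \<phi> g" and s0: "s0 > 0"
    and inc: "\<And>s. 0 < s \<Longrightarrow> s < s0 \<Longrightarrow> c * s \<le> \<phi> (z + s *\<^sub>R h) - \<phi> z"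
  shows "c \<le> g z \<bullet> h"
proof -
  have "((\<lambda>s. \<phi> (z + s *\<^sub>R h)) has_derivative (\<lambda>s. g (z + 0 *\<^sub>R h) \<bullet> (s *\<^sub>R h))) (at 0)"
    by (rule has_derivative_compose[of "\<lambda>s. z + s *\<^sub>R h" "\<lambda>s. s *\<^sub>R h" 0 UNIV \<phi>, unfolded o_def])
       (use t in \<open>auto simp: test_fun_def intro!: derivative_eq_intros\<close>)
  then have "((\<lambda>s. \<phi> (z + s *\<^sub>R h)) has_real_derivative (g z \<bullet> h)) (at 0)"
    by (rule has_derivative_imp_has_field_derivative) simp
  then have "((\<lambda>s. (\<phi> (z + s *\<^sub>R h) - \<phi> z) / s) \<longlongrightarrow> g z \<bullet> h) (at_right 0)"
    unfolding DERIV_def by (auto simp: filterlim_at_split)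
  moreover have "\<forall>\<^sub>F s in at_right 0. c \<le> (\<phi> (z + s *\<^sub>R h) - \<phi> z) / s"
    unfolding eventually_at_right_field using s0 inc by (intro exI[of _ s0]) (auto simp: field_simps)
  ultimately show ?thesis by (intro tendsto_lowerbound[of _ "g z \<bullet> h" "at_right 0"]) auto
qed

lemma supsolD:
  fixes e :: real
  shows "supsol F \<Omega> v \<Longrightarrow> z \<in> \<Omega> \<Longrightarrow> test_fun \<phi> g \<Longrightarrow> e > 0 \<Longrightarrow>
    (\<And>w. w \<in> ball z e \<Longrightarrow> w \<in> \<Omega> \<Longrightarrow> v z - \<phi> z \<le> v w - \<phi> w) \<Longrightarrow> 0 \<le> F z (v z) (g z)"
proof -
  assume *: "supsol F \<Omega> v" "z \<in> \<Omega>" "test_fun \<phi> g" "e > 0"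
    "\<And>w. w \<in> ball z e \<Longrightarrow> w \<in> \<Omega> \<Longrightarrow> v z - \<phi> z \<le> v w - \<phi> w"
  have "dual_eq F z (- v z) (- g z) \<le> 0"
  proof (rule subsolD[where u="\<lambda>z. - v z" and g="\<lambda>w. - g w", OF _ *(2) test_fun_minus[OF *(3)] *(4)])
    show "subsol (dual_eq F) \<Omega> (\<lambda>z. - v z)" using *(1) by (simp add: supsol_def)
    show "- v w - - \<phi> w \<le> - v z - - \<phi> z" if "w \<in> ball z e" "w \<in> \<Omega>" for w using *(5)[OF that] by simp
  qed
  then show ?thesis by (simp add: dual_eq_def)
qed

lemma supsolI:
  assumes "\<And>z \<phi> g e. z \<in> \<Omega> \<Longrightarrow> test_fun \<phi> g \<Longrightarrow> e > 0 \<Longrightarrow>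
    (\<And>w. w \<in> ball z e \<Longrightarrow> w \<in> \<Omega> \<Longrightarrow> v z - \<phi> z \<le> v w - \<phi> w) \<Longrightarrow> 0 \<le> F z (v z) (g z)"
  shows "supsol F \<Omega> v"
  unfolding supsol_def
proof (rule subsolI)
  fix z \<phi> g and e :: real assume *: "z \<in> \<Omega>" "test_fun \<phi> g" "e > 0"
    "\<And>w. w \<in> ball z e \<Longrightarrow> w \<in> \<Omega> \<Longrightarrow> - v w - \<phi> w \<le> - v z - \<phi> z"
  have "0 \<le> F z (v z) (- g z)"
    by (rule assms[OF *(1) test_fun_minus[OF *(2)] *(3)]) (use *(4) in force)
  then show "dual_eq F z (- v z) (g z) \<le> 0" by (simp add: dual_eq_def)
qed

lemma subsol_subset:
  assumes "subsol F \<Omega> u" "open \<Omega>'" "\<Omega>' \<subseteq> \<Omega>" shows "subsol F \<Omega>' u"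
proof (rule subsolI)
  fix z \<phi> g e assume *: "z \<in> \<Omega>'" "test_fun \<phi> g" "(e::real) > 0"
    "\<And>w. w \<in> ball z e \<Longrightarrow> w \<in> \<Omega>' \<Longrightarrow> u w - \<phi> w \<le> u z - \<phi> z"
  obtain d where "d > 0" "ball z d \<subseteq> \<Omega>'" using assms * openE by blast
  then show "F z (u z) (g z) \<le> 0"
    using * assms by (intro subsolD[OF assms(1), of z \<phi> g "min e d"]) auto
qed

lemma supsol_subset: "supsol F \<Omega> u \<Longrightarrow> open \<Omega>' \<Longrightarrow> \<Omega>' \<subseteq> \<Omega> \<Longrightarrow> supsol F \<Omega>' u"
  unfolding supsol_def by (rule subsol_subset)

lemma usc_onD: "usc_on \<Omega> u \<Longrightarrow> z \<in> \<Omega> \<Longrightarrow> e > 0 \<Longrightarrow> \<forall>\<^sub>F w in nhds z. u w < u z + e"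
  by (simp add: usc_on_def)

lemma continuous_imp_usc_on:
  assumes "open \<Omega>" "continuous_on \<Omega> u" shows "usc_on \<Omega> u"
  unfolding usc_on_def
proof (intro ballI allI impI)
  fix z and e :: real assume "z \<in> \<Omega>" "e > 0"
  then have "isCont u z" using assms continuous_on_eq_continuous_at by blast
  then have "(u \<longlongrightarrow> u z) (nhds z)" by (simp add: isCont_def tendsto_at_iff_tendsto_nhds)
  then show "\<forall>\<^sub>F w in nhds z. u w < u z + e" by (rule order_tendstoD) (use \<open>e > 0\<close> in simp)
qed

lemma continuous_imp_lsc_on: "open \<Omega> \<Longrightarrow> continuous_on \<Omega> u \<Longrightarrow> lsc_on \<Omega> u"
  unfolding lsc_on_def by (intro continuous_imp_usc_on continuous_intros)

lemma usc_on_subset: "usc_on \<Omega> u \<Longrightarrow> \<Omega>' \<subseteq> \<Omega> \<Longrightarrow> usc_on \<Omega>' u"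
  unfolding usc_on_def by blast

lemma usc_on_add:
  assumes "usc_on \<Omega> u" "usc_on \<Omega> v" shows "usc_on \<Omega> (\<lambda>w. u w + v w)"
  unfolding usc_on_def
proof (intro ballI allI impI)
  fix z and e :: real assume z: "z \<in> \<Omega>" and e: "e > 0"
  show "\<forall>\<^sub>F w in nhds z. u w + v w < u z + v z + e"
  proof -
    have "\<forall>\<^sub>F w in nhds z. u w < u z + e / 2" "\<forall>\<^sub>F w in nhds z. v w < v z + e / 2"
      using usc_onD[OF assms(1) z, of "e/2"] usc_onD[OF assms(2) z, of "e/2"] e by auto
    then show ?thesis by eventually_elim simp
  qed
qed

lemma usc_on_attains_max:
  assumes u: "usc_on \<Omega> u" and K: "compact K" "K \<noteq> {}" "K \<subseteq> \<Omega>"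
  shows "\<exists>x\<in>K. \<forall>y\<in>K. u y \<le> u x"
proof (rule ccontr)
  assume "\<not> ?thesis"
  then obtain Y where Y: "\<And>x. x \<in> K \<Longrightarrow> Y x \<in> K \<and> u x < u (Y x)" by (metis not_le)
  have "\<exists>N. open N \<and> x \<in> N \<and> (\<forall>w\<in>N. u w < u (Y x))" if x: "x \<in> K" for x
    using usc_onD[OF u, of x "u (Y x) - u x"] Y[OF x] x K(3) unfolding eventually_nhds by auto
  then obtain N where N: "\<And>x. x \<in> K \<Longrightarrow> open (N x) \<and> x \<in> N x \<and> (\<forall>w\<in>N x. u w < u (Y x))" by metis
  obtain D where D: "D \<subseteq> K" "finite D" "K \<subseteq> (\<Union>x\<in>D. N x)"
    using compactE_image[OF K(1), of K N] N by blast
  have "D \<noteq> {}" using D K by auto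
  then have "Max ((\<lambda>x. u (Y x)) ` D) \<in> (\<lambda>x. u (Y x)) ` D" using D by (intro Max_in) auto
  then obtain x where x: "x \<in> D" "u (Y x) = Max ((\<lambda>x. u (Y x)) ` D)" by auto
  obtain x' where x': "x' \<in> D" "Y x \<in> N x'" using D Y x by blast
  have "u (Y x) < u (Y x')" using N x' D by blast
  also have "\<dots> \<le> u (Y x)" unfolding x(2) using x' D by (intro Max_ge) auto
  finally show False by simp
qed

text \<open>Stability under half-relaxed limits: \<open>S1\<close> makes \<open>U\<close> an upper
  bound for the upper limit at every point, and \<open>S2\<close> says that this bound is realised
  at \<open>z\<close>. \<open>Fc\<close> speaks of subsequences because perturbed maximum points
  converge only along one.\<close>

lemma subsol_limit:
  fixes u :: "nat \<Rightarrow> 'a::euclidean_space \<Rightarrow> real"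
  assumes \<Omega>: "open \<Omega>" "z \<in> \<Omega>"
    and u: "\<And>k. usc_on \<Omega> (u k)" "\<And>k. subsol (Fk k) \<Omega> (u k)"
    and Fc: "\<And>r xs rs ps p. strict_mono r \<Longrightarrow> xs \<longlonglongrightarrow> z \<Longrightarrow> rs \<longlonglongrightarrow> U z \<Longrightarrow> ps \<longlonglongrightarrow> p \<Longrightarrow>
        (\<lambda>k. Fk (r k) (xs k) (rs k) (ps k)) \<longlonglongrightarrow> F z (U z) p"
    and S1: "\<And>w e. w \<in> \<Omega> \<Longrightarrow> e > 0 \<Longrightarrow> \<exists>d>0. \<exists>N::nat. \<forall>k\<ge>N. \<forall>w'\<in>ball w d. u k w' \<le> U w + e"
    and S2: "zs \<longlonglongrightarrow> z" "(\<lambda>k. u k (zs k)) \<longlonglongrightarrow> U z"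
    and t: "test_fun \<phi> g" and e: "e > 0" and max: "\<And>w. w \<in> ball z e \<Longrightarrow> w \<in> \<Omega> \<Longrightarrow> U w - \<phi> w \<le> U z - \<phi> z"
  shows "F z (U z) (g z) \<le> 0"
proof -
  obtain d where d: "d > 0" "ball z d \<subseteq> \<Omega>" using \<Omega> openE by blast
  define \<rho> where "\<rho> = min d e / 2"
  have \<rho>: "\<rho> > 0" "cball z \<rho> \<subseteq> \<Omega>" "cball z \<rho> \<subseteq> ball z e" using d e by (auto simp: \<rho>_def)
  \<comment> \<open>The quadratic term makes the maximum at \<open>z\<close> strict and leaves the
    gradient at \<open>z\<close> unchanged.\<close>
  define \<psi> where "\<psi> w = \<phi> w + (norm (w - z))\<^sup>2" for w
  have t\<psi>: "test_fun \<psi> (\<lambda>w. g w + 2 *\<^sub>R (w - z))"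
    unfolding \<psi>_def by (intro test_fun_add t test_fun_sqdist)
  have \<psi>c: "isCont \<psi> w" for w by (rule test_fun_isCont(1)[OF t\<psi>])
  have "\<exists>x\<in>cball z \<rho>. \<forall>y\<in>cball z \<rho>. u k y + - \<psi> y \<le> u k x + - \<psi> x" for k
    using \<rho> by (intro usc_on_attains_max[of \<Omega>] usc_on_add u continuous_imp_usc_on[OF \<Omega>(1)] continuous_intros
        continuous_on_subset[OF test_fun_continuous(1)[OF t\<psi>]]) auto
  then obtain W where W: "\<And>k. W k \<in> cball z \<rho>" "\<And>k y. y \<in> cball z \<rho> \<Longrightarrow> u k y - \<psi> y \<le> u k (W k) - \<psi> (W k)"
    by (metis uminus_add_conv_diff add.commute)
  obtain wb r where r: "wb \<in> cball z \<rho>" "strict_mono (r::nat\<Rightarrow>nat)" "(W \<circ> r) \<longlonglongrightarrow> wb"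
    using compact_cball[of z \<rho>] W(1) unfolding compact_def by metis
  have Wr: "(\<lambda>k. W (r k)) \<longlonglongrightarrow> wb" using r(3) by (simp add: o_def)
  have zr: "(\<lambda>k. zs (r k)) \<longlonglongrightarrow> z" "(\<lambda>k. u (r k) (zs (r k))) \<longlonglongrightarrow> U z"
    using LIMSEQ_subseq_LIMSEQ[OF S2(1) r(2)] LIMSEQ_subseq_LIMSEQ[OF S2(2) r(2)] by (auto simp: o_def)
  have up: "\<forall>\<^sub>F k in sequentially. u (r k) (W (r k)) \<le> U wb + \<epsilon>" if "\<epsilon> > 0" for \<epsilon>
  proof -
    have "wb \<in> \<Omega>" using r(1) \<rho>(2) by blast
    from S1[OF this that] obtain d N where
      dN: "d > 0" "\<And>k w'. k \<ge> N \<Longrightarrow> w' \<in> ball wb d \<Longrightarrow> u k w' \<le> U wb + \<epsilon>" by blast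
    have "\<forall>\<^sub>F k in sequentially. W (r k) \<in> ball wb d"
      using Wr dN(1) by (intro topological_tendstoD[OF Wr]) auto
    moreover have "\<forall>\<^sub>F k in sequentially. r k \<ge> N"
      using filterlim_subseq[OF r(2)] by (simp add: filterlim_at_top)
    ultimately show ?thesis by eventually_elim (use dN in auto)
  qed
  \<comment> \<open>Maximality at \<open>W (r k)\<close> is tested against the recovery sequence
    \<open>zs\<close>. In the limit this gives \<open>U z - \<psi> z \<le> U wb - \<psi> wb\<close>,
    and strictness forces \<open>wb = z\<close>. The same bound from below, with \<open>up\<close>
    from above, makes the values converge to \<open>U z\<close>.\<close>
  define lo where "lo k = u (r k) (zs (r k)) - \<psi> (zs (r k)) + \<psi> (W (r k))" for k
  have lo_lim: "lo \<longlonglongrightarrow> U z - \<psi> z + \<psi> wb"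
    unfolding lo_def by (intro tendsto_intros zr isCont_tendsto_compose[OF \<psi>c] Wr)
  have lo: "\<forall>\<^sub>F k in sequentially. lo k \<le> u (r k) (W (r k))"
  proof -
    have "\<forall>\<^sub>F k in sequentially. zs (r k) \<in> ball z \<rho>" using \<rho>(1) by (intro topological_tendstoD[OF zr(1)]) auto
    then show ?thesis
    proof eventually_elim
      case (elim k)
      then have "zs (r k) \<in> cball z \<rho>" by simp
      from W(2)[OF this, of "r k"] show ?case by (simp add: lo_def)
    qed
  qed
  have "U z - \<psi> z + \<psi> wb \<le> U wb + \<epsilon>" if "\<epsilon> > 0" for \<epsilon>
  proof (rule tendsto_upperbound[OF lo_lim])
    show "\<forall>\<^sub>F k in sequentially. lo k \<le> U wb + \<epsilon>" using lo up[OF that] by eventually_elim simp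
  qed simp
  then have "U z - \<psi> z + \<psi> wb \<le> U wb" by (rule field_le_epsilon)
  moreover have "U wb - \<phi> wb \<le> U z - \<phi> z" by (rule max) (use r \<rho> in auto)
  moreover have "\<psi> z = \<phi> z" "\<psi> wb = \<phi> wb + (norm (wb - z))\<^sup>2" by (simp_all add: \<psi>_def)
  ultimately have "(norm (wb - z))\<^sup>2 \<le> 0" by linarith
  then have wb: "wb = z" by simp
  have lim: "(\<lambda>k. u (r k) (W (r k))) \<longlonglongrightarrow> U z"
  proof (rule order_tendstoI)
    fix a assume "a < U z"
    then have "\<forall>\<^sub>F k in sequentially. a < lo k" using lo_lim wb by (intro order_tendstoD(1)[OF lo_lim]) auto
    with lo show "\<forall>\<^sub>F k in sequentially. a < u (r k) (W (r k))" by eventually_elim simp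
  next
    fix a assume "U z < a"
    then have "\<forall>\<^sub>F k in sequentially. u (r k) (W (r k)) \<le> U wb + (a - U z) / 2" by (intro up) simp
    then show "\<forall>\<^sub>F k in sequentially. u (r k) (W (r k)) < a"
      by eventually_elim (use \<open>U z < a\<close> wb in \<open>simp add: field_simps\<close>)
  qed
  have glim: "(\<lambda>k. g (W (r k)) + 2 *\<^sub>R (W (r k) - z)) \<longlonglongrightarrow> g z + 2 *\<^sub>R (z - z)"
    using Wr wb by (intro tendsto_intros isCont_tendsto_compose[OF test_fun_isCont(2)[OF t]]) auto
  have "(\<lambda>k. Fk (r k) (W (r k)) (u (r k) (W (r k))) (g (W (r k)) + 2 *\<^sub>R (W (r k) - z))) \<longlonglongrightarrow> F z (U z) (g z)"
    using Fc[OF r(2) _ lim glim] Wr wb by simp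
  moreover have "\<forall>\<^sub>F k in sequentially. Fk (r k) (W (r k)) (u (r k) (W (r k))) (g (W (r k)) + 2 *\<^sub>R (W (r k) - z)) \<le> 0"
  proof -
    have "\<forall>\<^sub>F k in sequentially. W (r k) \<in> ball z \<rho>" using \<rho>(1) wb by (intro topological_tendstoD[OF Wr]) auto
    then show ?thesis
    proof eventually_elim
      case (elim k)
      obtain d' where d': "d' > 0" "ball (W (r k)) d' \<subseteq> ball z \<rho>" using elim open_ball openE by blast
      show ?case
      proof (rule subsolD[OF u(2) _ t\<psi> d'(1)])
        show "W (r k) \<in> \<Omega>" using W(1) \<rho> by auto
        fix w assume "w \<in> ball (W (r k)) d'"
        then have "w \<in> cball z \<rho>" using d'(2) ball_subset_cball by blast
        then show "u (r k) w - \<psi> w \<le> u (r k) (W (r k)) - \<psi> (W (r k))" by (rule W(2))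
      qed
    qed
  qed
  ultimately show ?thesis by (intro tendsto_upperbound[of _ "F z (U z) (g z)" sequentially]) auto
qed

section \<open>Semicontinuous envelopes and Perron's method\<close>

lemma isCont_eventually_less:
  fixes f :: "'a::t2_space \<Rightarrow> real"
  assumes "isCont f z" "f z < a" shows "\<forall>\<^sub>F w in nhds z. f w < a"
proof -
  have "(f \<longlongrightarrow> f z) (nhds z)" using assms(1) by (simp add: isCont_def tendsto_at_iff_tendsto_nhds)
  then show ?thesis using assms(2) by (rule order_tendstoD)
qed

definition loc_bdd :: "'a::euclidean_space set \<Rightarrow> ('a \<Rightarrow> real) \<Rightarrow> bool" where
  "loc_bdd \<Omega> u \<longleftrightarrow> (\<forall>z\<in>\<Omega>. \<exists>e>0. \<exists>B. \<forall>w\<in>ball z e. \<bar>u w\<bar> \<le> B)"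

text \<open>Local boundedness makes the upper limit finite, so \<open>real_of_ereal\<close> returns
  the true envelope and not its default value 0 at an infinity. The limit in \<open>usc_env\<close>
  is punctured, which is why the value at the point enters separately.\<close>

lemma usc_env_props:
  fixes u :: "'a::euclidean_space \<Rightarrow> real"
  assumes \<Omega>: "open \<Omega>" "z \<in> \<Omega>" and u: "loc_bdd \<Omega> u"
  shows usc_env_ge: "u z \<le> usc_env \<Omega> u z"
    and usc_env_lt: "e > 0 \<Longrightarrow> \<forall>\<^sub>F w in nhds z. u w < usc_env \<Omega> u z + e"
    and usc_env_approx: "e > 0 \<Longrightarrow> d > 0 \<Longrightarrow> \<exists>w\<in>ball z d \<inter> \<Omega>. usc_env \<Omega> u z - e < u w"
proof -
  let ?f = "\<lambda>w. ereal (u w)"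
  have at: "at z within \<Omega> = at z" by (rule at_within_open[OF \<Omega>(2,1)])
  obtain d0 B where d0: "d0 > 0" "\<And>w. w \<in> ball z d0 \<Longrightarrow> \<bar>u w\<bar> \<le> B" using u \<Omega> unfolding loc_bdd_def by blast
  have evB: "\<forall>\<^sub>F w in at z. \<bar>u w\<bar> \<le> B"
    unfolding eventually_at using d0 by (intro exI[of _ d0]) (auto simp: dist_commute)
  define L where "L = Limsup (at z) ?f"
  have "L \<le> ereal B" unfolding L_def by (rule Limsup_bounded) (use evB in \<open>auto elim: eventually_mono\<close>)
  moreover have "ereal (- B) \<le> Liminf (at z) ?f" by (rule Liminf_bounded) (use evB in \<open>auto elim: eventually_mono\<close>)
  moreover have "Liminf (at z) ?f \<le> L" unfolding L_def by (rule Liminf_le_Limsup) simp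
  ultimately obtain l where l: "L = ereal l" by (cases L) auto
  have E: "usc_env \<Omega> u z = max (u z) l"
    unfolding usc_env_def at L_def[symmetric] l by (simp add: max_def)
  show "u z \<le> usc_env \<Omega> u z" by (simp add: E)
  show "\<forall>\<^sub>F w in nhds z. u w < usc_env \<Omega> u z + e" if "e > 0"
  proof -
    have "L < ereal (usc_env \<Omega> u z + e)" using that by (auto simp: l E)
    then have "\<forall>\<^sub>F w in at z. ?f w < ereal (usc_env \<Omega> u z + e)" unfolding L_def by (rule Limsup_lessD)
    then show ?thesis using that by (auto simp: eventually_nhds_conv_at E)
  qed
  show "\<exists>w\<in>ball z d \<inter> \<Omega>. usc_env \<Omega> u z - e < u w" if "e > 0" "d > 0"
  proof (cases "usc_env \<Omega> u z = u z")
    case True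
    then show ?thesis using that \<Omega> by (intro bexI[of _ z]) auto
  next
    case False
    then have El: "usc_env \<Omega> u z = l" by (auto simp: E)
    have "\<exists>\<^sub>F w in at z. l - e < u w"
    proof (rule ccontr)
      assume "\<not> ?thesis"
      then have "\<forall>\<^sub>F w in at z. ?f w \<le> ereal (l - e)" by (auto simp: not_frequently not_less)
      then have "L \<le> ereal (l - e)" unfolding L_def by (rule Limsup_bounded)
      then show False using that l by simp
    qed
    moreover have "\<forall>\<^sub>F w in at z. w \<in> ball z d \<inter> \<Omega>"
      using that \<Omega> by (intro eventually_at_in_open') auto
    ultimately have "\<exists>\<^sub>F w in at z. l - e < u w \<and> w \<in> ball z d \<inter> \<Omega>" by (rule frequently_eventually_frequently)
    then obtain w where "l - e < u w" "w \<in> ball z d \<inter> \<Omega>" using frequently_ex by blast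
    then show ?thesis unfolding El by blast
  qed
qed

lemma lsc_env_eq: 
  fixes u :: "'a::euclidean_space \<Rightarrow> real"
  shows "lsc_env \<Omega> u z = - usc_env \<Omega> (\<lambda>w. - u w) z"
proof -
  have "Limsup (at z within \<Omega>) (\<lambda>w. ereal (- u w)) = - Liminf (at z within \<Omega>) (\<lambda>w. ereal (u w))"
    by (simp add: ereal_Limsup_uminus[symmetric])
  moreover have "max (ereal (- a)) (- L) = - min (ereal a) L" for a L
    by (cases L) (auto simp: max_def min_def)
  ultimately have "max (ereal (- u z)) (Limsup (at z within \<Omega>) (\<lambda>w. ereal (- u w))) =
     - min (ereal (u z)) (Liminf (at z within \<Omega>) (\<lambda>w. ereal (u w)))"
    by simp
  then show ?thesis by (simp add: lsc_env_def usc_env_def)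
qed

lemma usc_on_usc_env:
  assumes \<Omega>: "open \<Omega>" and u: "loc_bdd \<Omega> u" shows "usc_on \<Omega> (usc_env \<Omega> u)"
  unfolding usc_on_def
proof (intro ballI allI impI)
  fix z and e :: real assume z: "z \<in> \<Omega>" and e: "e > 0"
  have "\<forall>\<^sub>F w in nhds z. u w < usc_env \<Omega> u z + e/2" by (rule usc_env_lt[OF \<Omega> z u]) (use e in simp)
  then obtain d where d: "d > 0" "\<And>w. dist w z < d \<Longrightarrow> u w < usc_env \<Omega> u z + e/2"
    unfolding eventually_nhds_metric by blast
  have "\<forall>\<^sub>F w in nhds z. w \<in> \<Omega> \<and> dist w z < d/2"
    using z \<Omega> d by (intro eventually_conj eventually_nhds_in_open) (auto simp: eventually_nhds_metric intro!: exI[of _ "d/2"])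
  then show "\<forall>\<^sub>F w in nhds z. usc_env \<Omega> u w < usc_env \<Omega> u z + e"
  proof eventually_elim
    case (elim w)
    obtain w' where w': "w' \<in> ball w (d/2)" "usc_env \<Omega> u w - e/2 < u w'"
      using usc_env_approx[OF \<Omega> _ u, of w "e/2" "d/2"] elim e d by auto
    have "dist w' z \<le> dist w' w + dist w z" by (rule dist_triangle)
    then have "u w' < usc_env \<Omega> u z + e/2" using w'(1) elim by (intro d(2)) (auto simp: dist_commute)
    then show ?case using w' by linarith
  qed
qed

lemma usc_env_le_of_le:
  assumes \<Omega>: "open \<Omega>" "z \<in> \<Omega>" and u: "loc_bdd \<Omega> u" and g: "isCont g z" and le: "\<And>w. w \<in> \<Omega> \<Longrightarrow> u w \<le> g w"
  shows "usc_env \<Omega> u z \<le> g z"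
proof (rule field_le_epsilon)
  fix e :: real assume e: "e > 0"
  obtain d where d: "d > 0" "\<And>w. dist w z < d \<Longrightarrow> dist (g w) (g z) < e/2"
    using g e unfolding continuous_at_eps_delta by (metis half_gt_zero)
  obtain w where w: "w \<in> ball z d \<inter> \<Omega>" "usc_env \<Omega> u z - e/2 < u w"
    using usc_env_approx[OF \<Omega> u, of "e/2" d] e d by auto
  then have "\<bar>g w - g z\<bar> < e/2" "u w \<le> g w" using d(2)[of w] le[of w] by (auto simp: dist_real_def dist_commute)
  then show "usc_env \<Omega> u z \<le> g z + e" using w(2) by linarith
qed

lemma continuous_imp_loc_bdd:
  assumes "open \<Omega>" "continuous_on \<Omega> (f :: 'a::euclidean_space \<Rightarrow> real)" "continuous_on \<Omega> g" "\<And>z. z \<in> \<Omega> \<Longrightarrow> f z \<le> u z" "\<And>z. z \<in> \<Omega> \<Longrightarrow> u z \<le> g z"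
  shows "loc_bdd \<Omega> u"
  unfolding loc_bdd_def
proof (intro ballI)
  fix z assume z: "z \<in> \<Omega>"
  then have "isCont f z" "isCont g z" using assms continuous_on_eq_continuous_at by blast+
  then have "\<forall>\<^sub>F w in nhds z. f z - 1 < f w" "\<forall>\<^sub>F w in nhds z. g w < g z + 1" "\<forall>\<^sub>F w in nhds z. w \<in> \<Omega>"
    using assms(1) z by (auto simp: isCont_def tendsto_at_iff_tendsto_nhds intro!: order_tendstoD eventually_nhds_in_open)
  then have "\<forall>\<^sub>F w in nhds z. \<bar>u w\<bar> \<le> \<bar>f z\<bar> + \<bar>g z\<bar> + 1"
  proof eventually_elim
    case (elim w)
    then show ?case using assms(4)[of w] assms(5)[of w] by auto
  qed
  then show "\<exists>e>0. \<exists>B. \<forall>w\<in>ball z e. \<bar>u w\<bar> \<le> B"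
    unfolding eventually_nhds_metric by (metis dist_commute mem_ball)
qed

lemma usc_env_continuous:
  assumes \<Omega>: "open \<Omega>" "z \<in> \<Omega>" and u: "continuous_on \<Omega> u"
  shows "usc_env \<Omega> u z = u z" "lsc_env \<Omega> u z = u z"
proof -
  have l: "loc_bdd \<Omega> u" "loc_bdd \<Omega> (\<lambda>w. - u w)"
    by (rule continuous_imp_loc_bdd[OF \<Omega>(1) u u]; simp) (rule continuous_imp_loc_bdd[OF \<Omega>(1), of "\<lambda>w. - u w" "\<lambda>w. - u w"], auto intro!: continuous_intros u)
  have c: "isCont u z" "isCont (\<lambda>w. - u w) z" using u \<Omega> continuous_on_eq_continuous_at by (blast intro: continuous_intros)+
  show "usc_env \<Omega> u z = u z" using usc_env_le_of_le[OF \<Omega> l(1) c(1)] usc_env_ge[OF \<Omega> l(1)] by auto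
  show "lsc_env \<Omega> u z = u z" unfolding lsc_env_eq
    using usc_env_le_of_le[OF \<Omega> l(2) c(2)] usc_env_ge[OF \<Omega> l(2)] by auto
qed

section \<open>Perron's method\<close>

lemma loc_bdd_uminus: "loc_bdd \<Omega> (\<lambda>w. - u w) \<longleftrightarrow> loc_bdd \<Omega> u" by (simp add: loc_bdd_def)

text \<open>The rim condition with \<open>\<delta> < \<rho>\<^sup>2\<close> forces
  \<open>W = E\<close> near the boundary of the ball, so the gluing is invisible from outside.
  Inside, a point belongs either to \<open>E\<close> or to a strict smooth subsolution.\<close>

lemma perron_bump:
  fixes F :: "'a::euclidean_space \<Rightarrow> real \<Rightarrow> 'a \<Rightarrow> real"
  assumes \<Omega>: "open \<Omega>" and E: "usc_on \<Omega> E" "subsol F \<Omega> E"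
    and ball: "ball z0 \<rho> \<subseteq> \<Omega>" "\<rho> > 0" and t: "test_fun \<psi> h"
    and neg: "\<And>w. w \<in> ball z0 \<rho> \<Longrightarrow> F w (\<psi> w) (h w) < 0"
    and rim: "\<And>w. w \<in> ball z0 \<rho> \<Longrightarrow> \<delta> < (norm (w - z0))\<^sup>2 \<Longrightarrow> \<psi> w < E w" and \<delta>: "\<delta> < \<rho>\<^sup>2"
  defines "W \<equiv> \<lambda>w. if w \<in> ball z0 \<rho> then max (E w) (\<psi> w) else E w"
  shows "usc_on \<Omega> W" "subsol F \<Omega> W"
proof -
  have \<psi>c: "isCont \<psi> w" for w by (rule test_fun_isCont(1)[OF t])
  show "usc_on \<Omega> W" unfolding usc_on_def
  proof (intro ballI allI impI)
    fix z and e :: real assume z: "z \<in> \<Omega>" and e: "e > 0"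
    have Ez: "\<forall>\<^sub>F w in nhds z. E w < E z + e" by (rule usc_onD[OF E(1) z e])
    show "\<forall>\<^sub>F w in nhds z. W w < W z + e"
    proof (cases "z \<in> ball z0 \<rho>")
      case True
      have "(\<psi> \<longlongrightarrow> \<psi> z) (nhds z)" using \<psi>c by (simp add: isCont_def tendsto_at_iff_tendsto_nhds)
      then have "\<forall>\<^sub>F w in nhds z. \<psi> w < \<psi> z + e" by (rule order_tendstoD) (use e in simp)
      moreover have "\<forall>\<^sub>F w in nhds z. w \<in> ball z0 \<rho>" using True by (intro eventually_nhds_in_open) auto
      ultimately show ?thesis using Ez by eventually_elim (use True in \<open>auto simp: W_def\<close>)
    next
      case False
      have "isCont (\<lambda>w. - (norm (w - z0))\<^sup>2) z" by (intro continuous_intros)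
      moreover have "\<delta> < (norm (z - z0))\<^sup>2"
      proof -
        have "\<rho>\<^sup>2 \<le> (norm (z - z0))\<^sup>2" using False ball(2) by (intro power_mono) (auto simp: dist_norm norm_minus_commute)
        then show ?thesis using \<delta> by simp
      qed
      ultimately have "\<forall>\<^sub>F w in nhds z. - (norm (w - z0))\<^sup>2 < - \<delta>" by (intro isCont_eventually_less) auto
      then have "\<forall>\<^sub>F w in nhds z. \<delta> < (norm (w - z0))\<^sup>2" by simp
      then show ?thesis using Ez
      proof eventually_elim
        case (elim w)
        have "W w = E w" using rim[of w] elim by (auto simp: W_def)
        moreover have "W z = E z" using False by (simp add: W_def)
        ultimately show ?case using elim by simp
      qed
    qed
  qed
  show "subsol F \<Omega> W"
  proof (rule subsolI)
    fix z \<phi> g and e :: real assume z: "z \<in> \<Omega>" and \<phi>: "test_fun \<phi> g" and e: "e > 0"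
      and max: "\<And>w. w \<in> ball z e \<Longrightarrow> w \<in> \<Omega> \<Longrightarrow> W w - \<phi> w \<le> W z - \<phi> z"
    show "F z (W z) (g z) \<le> 0"
    proof (cases "W z = E z")
      case True
      have "F z (E z) (g z) \<le> 0"
      proof (rule subsolD[OF E(2) z \<phi> e])
        fix w assume w: "w \<in> ball z e" "w \<in> \<Omega>"
        have "E w \<le> W w" by (auto simp: W_def)
        then show "E w - \<phi> w \<le> E z - \<phi> z" using max[OF w] True by simp
      qed
      then show ?thesis using True by simp
    next
      case False
      then have zb: "z \<in> ball z0 \<rho>" and Wz: "W z = \<psi> z" by (auto simp: W_def max_def split: if_splits)
      obtain d where d: "d > 0" "ball z d \<subseteq> ball z0 \<rho>" using zb open_ball openE by blast
      \<comment> \<open>Where \<open>W\<close> equals the smooth piece, the test function touches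
        that piece too. The gradients then agree and the strict inequality \<open>neg\<close> gives
        the claim.\<close>
      have "h z = g z"
      proof (rule test_fun_unique_gradient[OF t \<phi>, of "min e d"])
        fix w assume w: "w \<in> ball z (min e d)"
        then have wb: "w \<in> ball z0 \<rho>" "w \<in> \<Omega>" using d(2) ball(1) by auto
        then have "\<psi> w \<le> W w" by (simp add: W_def)
        then show "\<psi> w - \<phi> w \<le> \<psi> z - \<phi> z" using max[of w] w wb Wz by auto
      qed (use e d in auto)
      then show ?thesis using neg[OF zb] Wz by simp
    qed
  qed
qed

text \<open>The result is a pair: the largest subsolution below the upper barrier, and its lower
  envelope. If the lower envelope failed to be a supersolution, a bump would produce a larger
  competitor. That the two coincide, and are thus continuous, is left to comparison
  principles.\<close>

lemma perron:
  fixes F :: "'a::euclidean_space \<Rightarrow> real \<Rightarrow> 'a \<Rightarrow> real"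
  assumes Fc: "continuous_on UNIV (\<lambda>(z, r, p). F z r p)" and \<Omega>: "open \<Omega>"
    and f: "continuous_on \<Omega> f" "subsol F \<Omega> f" and g: "continuous_on \<Omega> g" "supsol F \<Omega> g"
    and fg: "\<And>z. z \<in> \<Omega> \<Longrightarrow> f z \<le> g z"
  shows "\<exists>U V. usc_on \<Omega> U \<and> lsc_on \<Omega> V \<and> subsol F \<Omega> U \<and> supsol F \<Omega> V \<and>
     (\<forall>z\<in>\<Omega>. f z \<le> V z \<and> V z \<le> U z \<and> U z \<le> g z)"
proof -
  \<comment> \<open>Competitors are semicontinuous and lie below the barrier. The upper envelope
    \<open>E\<close> of the supremum turns out to be a competitor as well, so it is the largest
    one.\<close>
  define S where "S = {u. usc_on \<Omega> u \<and> subsol F \<Omega> u \<and> (\<forall>z\<in>\<Omega>. u z \<le> g z)}"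
  have fS: "f \<in> S" using f \<Omega> fg by (auto simp: S_def intro: continuous_imp_usc_on)
  define U where "U z = (SUP u\<in>S. u z)" for z
  have bdd: "bdd_above ((\<lambda>u. u z) ` S)" if "z \<in> \<Omega>" for z
    using that by (intro bdd_aboveI[of _ "g z"]) (auto simp: S_def)
  have uU: "u z \<le> U z" if "u \<in> S" "z \<in> \<Omega>" for u z
    unfolding U_def using that bdd by (intro cSUP_upper) auto
  have Ug: "U z \<le> g z" if "z \<in> \<Omega>" for z
    unfolding U_def using that fS by (intro cSUP_least) (auto simp: S_def)
  have lbU: "loc_bdd \<Omega> U"
    using continuous_imp_loc_bdd[OF \<Omega> f(1) g(1), of U] uU[OF fS] Ug by blast
  define E where "E = usc_env \<Omega> U"
  have gc: "isCont g z" and fc: "isCont f z" if "z \<in> \<Omega>" for z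
    using that f g \<Omega> continuous_on_eq_continuous_at by blast+
  have EU: "U z \<le> E z" if "z \<in> \<Omega>" for z unfolding E_def by (rule usc_env_ge[OF \<Omega> that lbU])
  have Eg: "E z \<le> g z" if "z \<in> \<Omega>" for z
    unfolding E_def by (rule usc_env_le_of_le[OF \<Omega> that lbU gc[OF that] Ug])
  have Eusc: "usc_on \<Omega> E" unfolding E_def by (rule usc_on_usc_env[OF \<Omega> lbU])
  have Esub: "subsol F \<Omega> E"
  proof (rule subsolI)
    fix z \<phi> h and e :: real assume z: "z \<in> \<Omega>" and \<phi>: "test_fun \<phi> h" and e: "e > 0"
      and max: "\<And>w. w \<in> ball z e \<Longrightarrow> w \<in> \<Omega> \<Longrightarrow> E w - \<phi> w \<le> E z - \<phi> z"
    \<comment> \<open>Points where the envelope is nearly attained, with competitors nearly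
      attaining the supremum there, form the recovery sequence required by
      \<open>subsol_limit\<close>.\<close>
    have "\<exists>w u. w \<in> ball z (1 / Suc k) \<inter> \<Omega> \<and> u \<in> S \<and> E z - 1 / Suc k < u w" for k
    proof -
      obtain w where w: "w \<in> ball z (1 / Suc k) \<inter> \<Omega>" "E z - 1 / Suc k < U w"
        using usc_env_approx[OF \<Omega> z lbU, of "1 / Suc k" "1 / Suc k"] unfolding E_def by auto
      then obtain u where "u \<in> S" "E z - 1 / Suc k < u w"
        unfolding U_def using bdd fS by (subst (asm) less_cSUP_iff) auto
      then show ?thesis using w by blast
    qed
    then obtain zs us where zu: "\<And>k. zs k \<in> ball z (1 / Suc k) \<inter> \<Omega>" "\<And>k. us k \<in> S"
      "\<And>k. E z - 1 / Suc k < us k (zs k)" by metis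
    have zlim: "zs \<longlonglongrightarrow> z"
    proof (rule LIMSEQ_I)
      fix r :: real assume "r > 0"
      then obtain n where n: "1 / Suc n < r" using nat_approx_posE by (metis of_nat_Suc)
      have "norm (zs k - z) < r" if "k \<ge> n" for k
      proof -
        have "1 / Suc k \<le> 1 / Suc n" using that by (simp add: frac_le)
        then show ?thesis using zu(1)[of k] n by (simp add: dist_norm norm_minus_commute)
      qed
      then show "\<exists>no. \<forall>n\<ge>no. norm (zs n - z) < r" by blast
    qed
    have usE: "us k w \<le> E w" if "w \<in> \<Omega>" for k w using uU[OF zu(2) that] EU[OF that] by (rule order_trans)
    show "F z (E z) (h z) \<le> 0"
    proof (rule subsol_limit[where U=E and u=us and Fk="\<lambda>k. F" and F=F and zs=zs, OF \<Omega> z])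
      show "usc_on \<Omega> (us k)" "subsol F \<Omega> (us k)" for k using zu(2)[of k] by (auto simp: S_def)
      show "(\<lambda>k. F (xs k) (rs k) (ps k)) \<longlonglongrightarrow> F z (E z) p"
        if "xs \<longlonglongrightarrow> z" "rs \<longlonglongrightarrow> E z" "ps \<longlonglongrightarrow> p" for xs rs ps p
      proof -
        have "isCont (\<lambda>(z, r, p). F z r p) (z, E z, p)"
          using Fc continuous_on_eq_continuous_at[OF open_UNIV] by blast
        from isCont_tendsto_compose[OF this tendsto_Pair[OF that(1) tendsto_Pair[OF that(2,3)]]]
        show ?thesis by simp
      qed
      show "\<exists>d>0. \<exists>N::nat. \<forall>k\<ge>N. \<forall>w'\<in>ball w d. us k w' \<le> E w + \<epsilon>" if w: "w \<in> \<Omega>" and \<epsilon>: "\<epsilon> > 0" for w \<epsilon>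
      proof -
        have "\<forall>\<^sub>F w' in nhds w. E w' < E w + \<epsilon> \<and> w' \<in> \<Omega>"
          using usc_onD[OF Eusc w \<epsilon>] \<Omega> w by (intro eventually_conj eventually_nhds_in_open) auto
        then obtain d where d: "d > 0" "\<And>w'. dist w' w < d \<Longrightarrow> E w' < E w + \<epsilon> \<and> w' \<in> \<Omega>"
          unfolding eventually_nhds_metric by blast
        have "us k w' \<le> E w + \<epsilon>" if "w' \<in> ball w d" for k w'
          using d(2)[of w'] usE[of w' k] that by (simp add: dist_commute)
        then show ?thesis using d(1) by blast
      qed
      show "zs \<longlonglongrightarrow> z" by (rule zlim)
      show "(\<lambda>k. us k (zs k)) \<longlonglongrightarrow> E z"
      proof (rule order_tendstoI)
        fix a assume "a < E z"
        have "(\<lambda>k. E z - 1 / Suc k) \<longlonglongrightarrow> E z - 0" by (intro tendsto_intros LIMSEQ_Suc lim_1_over_n)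
        then have "\<forall>\<^sub>F k in sequentially. a < E z - 1 / Suc k" by (rule order_tendstoD(1)) (use \<open>a < E z\<close> in simp)
        then show "\<forall>\<^sub>F k in sequentially. a < us k (zs k)"
          by eventually_elim (use zu(3) less_trans in blast)
      next
        fix a assume "E z < a"
        then have "\<forall>\<^sub>F w in nhds z. E w < E z + (a - E z)" by (intro usc_onD[OF Eusc z]) simp
        then have "\<forall>\<^sub>F k in sequentially. E (zs k) < E z + (a - E z)" using zlim by (rule eventually_compose_filterlim)
        then show "\<forall>\<^sub>F k in sequentially. us k (zs k) < a"
        proof eventually_elim
          case (elim k)
          then show ?case using usE[of "zs k" k] zu(1)[of k] by auto
        qed
      qed
    qed (use \<phi> e max in auto)
  qed
  have ES: "E \<in> S" using Eusc Esub Eg by (auto simp: S_def)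
  have SE: "u z \<le> E z" if "u \<in> S" "z \<in> \<Omega>" for u z using uU[OF that] EU[OF that(2)] by (rule order_trans)
  have fE: "f z \<le> E z" if "z \<in> \<Omega>" for z by (rule SE[OF fS that])
  have lbE: "loc_bdd \<Omega> (\<lambda>w. - E w)"
    using continuous_imp_loc_bdd[OF \<Omega> f(1) g(1), of E] fE Eg by (simp add: loc_bdd_uminus)
  define N where "N = usc_env \<Omega> (\<lambda>w. - E w)"
  have Nge: "- E z \<le> N z" if "z \<in> \<Omega>" for z unfolding N_def by (rule usc_env_ge[OF \<Omega> that lbE])
  have Nf: "N z \<le> - f z" if "z \<in> \<Omega>" for z
    unfolding N_def by (rule usc_env_le_of_le[OF \<Omega> that lbE]) (use fc[OF that] fE in \<open>auto intro: continuous_intros\<close>)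
  have Nusc: "usc_on \<Omega> N" unfolding N_def by (rule usc_on_usc_env[OF \<Omega> lbE])
  have Nsub: "subsol (dual_eq F) \<Omega> N"
  proof (rule subsolI, rule ccontr)
    fix z0 \<phi> h and e :: real assume z0: "z0 \<in> \<Omega>" and \<phi>: "test_fun \<phi> h" and e: "e > 0"
      and max: "\<And>w. w \<in> ball z0 e \<Longrightarrow> w \<in> \<Omega> \<Longrightarrow> N w - \<phi> w \<le> N z0 - \<phi> z0"
      and "\<not> dual_eq F z0 (N z0) (h z0) \<le> 0"
    then have neg0: "F z0 (- N z0) (- h z0) < 0" by (simp add: dual_eq_def)
    \<comment> \<open>This vertical shift makes \<open>- \<phi> + c\<close> touch the lower envelope
      \<open>- N\<close> at \<open>z0\<close>. The quadratic term in \<open>\<psi>\<close> separates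
      it from \<open>E\<close> away from \<open>z0\<close>, which later yields the rim
      condition.\<close>
    define c where "c = \<phi> z0 - N z0"
    define \<psi> where "\<psi> w = - \<phi> w + - (norm (w - z0))\<^sup>2" for w
    define k where "k w = - h w + - (2 *\<^sub>R (w - z0))" for w
    have t: "test_fun \<psi> k" unfolding \<psi>_def k_def by (intro test_fun_add test_fun_minus test_fun_sqdist \<phi>)
    have tc: "test_fun (\<lambda>w. \<psi> w + (c + \<delta>)) k" for \<delta>
      using test_fun_add[OF t test_fun_const[of "c + \<delta>"]] by simp
    have \<psi>0: "\<psi> z0 + c = - N z0" "k z0 = - h z0" by (simp_all add: \<psi>_def k_def c_def)
    have below: "\<psi> w + c + (norm (w - z0))\<^sup>2 \<le> E w" if "w \<in> ball z0 e" "w \<in> \<Omega>" for w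
      using max[OF that] Nge[OF that(2)] by (simp add: \<psi>_def c_def)
    \<comment> \<open>There is room under the barrier: if \<open>- N\<close> met \<open>g\<close> at
      \<open>z0\<close>, the same test function would touch the supersolution \<open>g\<close> from
      below and contradict \<open>neg0\<close>.\<close>
    have lt: "- N z0 < g z0"
    proof (rule ccontr)
      assume "\<not> ?thesis"
      then have eq: "g z0 = - N z0" using Nge[OF z0] Eg[OF z0] by simp
      have "dual_eq F z0 (- g z0) (h z0) \<le> 0"
      proof (rule subsolD[where u="\<lambda>z. - g z", OF _ z0 \<phi> e])
        show "subsol (dual_eq F) \<Omega> (\<lambda>z. - g z)" using g(2) by (simp add: supsol_def)
        fix w assume w: "w \<in> ball z0 e" "w \<in> \<Omega>"
        then show "- g w - \<phi> w \<le> - g z0 - \<phi> z0" using max[OF w] Eg[OF w(2)] Nge[OF w(2)] eq by simp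
      qed
      then show False using neg0 eq by (simp add: dual_eq_def)
    qed
    have \<psi>c: "continuous_on UNIV \<psi>" "continuous_on UNIV k" using test_fun_continuous[OF t] .
    have "isCont (\<lambda>(w, \<delta>). F w (\<psi> w + c + \<delta>) (k w)) (z0, 0)"
    proof -
      have "continuous_on UNIV (\<lambda>x. (\<lambda>(z, r, p). F z r p) (fst x, \<psi> (fst x) + c + snd x, k (fst x)))"
        by (rule continuous_on_compose2[OF Fc]) (auto intro!: continuous_intros continuous_on_compose2[OF \<psi>c(1)] continuous_on_compose2[OF \<psi>c(2)])
      then show ?thesis using continuous_on_eq_continuous_at[OF open_UNIV] by (auto simp: case_prod_unfold)
    qed
    then have "\<forall>\<^sub>F x in nhds (z0, 0). (case x of (w, \<delta>) \<Rightarrow> F w (\<psi> w + c + \<delta>) (k w)) < 0"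
      by (rule isCont_eventually_less) (use neg0 \<psi>0 in simp)
    note ev1 = this
    have fs: "isCont (\<lambda>x. fst x) (z0, 0::real)" by (rule isCont_fst[OF continuous_ident])
    have "isCont (\<lambda>x. \<psi> (fst x)) (z0, 0::real)"
      by (rule isCont_o2[OF fs]) (simp add: test_fun_isCont(1)[OF t])
    moreover have "isCont (\<lambda>x. g (fst x)) (z0, 0::real)"
      by (rule isCont_o2[OF fs]) (simp add: gc[OF z0])
    ultimately have "isCont (\<lambda>(w, \<delta>). \<psi> w + c + \<delta> - g w) (z0, 0)"
      unfolding case_prod_unfold by (intro continuous_intros) auto
    then have "\<forall>\<^sub>F x in nhds (z0, 0). (case x of (w, \<delta>) \<Rightarrow> \<psi> w + c + \<delta> - g w) < 0"
      by (rule isCont_eventually_less) (use lt \<psi>0 in simp)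
    with ev1 have "\<forall>\<^sub>F x in nhds (z0, 0). (case x of (w, \<delta>) \<Rightarrow> F w (\<psi> w + c + \<delta>) (k w)) < 0 \<and>
       (case x of (w, \<delta>) \<Rightarrow> \<psi> w + c + \<delta> - g w) < 0" by (rule eventually_conj)
    then obtain \<eta> where \<eta>: "\<eta> > 0" "\<And>w \<delta>. dist (w, \<delta>) (z0, 0) < \<eta> \<Longrightarrow>
        F w (\<psi> w + c + \<delta>) (k w) < 0 \<and> \<psi> w + c + \<delta> - g w < 0"
      unfolding eventually_nhds_metric by fast
    obtain d where d: "d > 0" "ball z0 d \<subseteq> \<Omega>" using \<Omega> z0 openE by blast
    define \<rho> where "\<rho> = min (min d e) (\<eta>/2)"
    \<comment> \<open>The height of the bump is below \<open>\<rho>\<^sup>2\<close>, so the raised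
      function sinks under \<open>E\<close> before the rim. It is also at most
      \<open>\<eta>/2\<close>, so strictness and the bound by \<open>g\<close> persist on the whole
      ball.\<close>
    define \<delta> where "\<delta> = min (\<eta>/2) (\<rho>\<^sup>2/2)"
    have \<rho>: "\<rho> > 0" "\<rho> \<le> d" "\<rho> \<le> e" "\<rho> \<le> \<eta>/2" using d e \<eta> by (auto simp: \<rho>_def)
    have "\<rho>\<^sup>2 > 0" using \<rho>(1) by simp
    then have \<delta>: "\<delta> > 0" "\<delta> \<le> \<eta>/2" "\<delta> < \<rho>\<^sup>2" using \<eta>(1) unfolding \<delta>_def by linarith+
    have near: "dist (w, \<delta>) (z0, 0) < \<eta>" if "w \<in> ball z0 \<rho>" for w
    proof -
      have "dist (w, \<delta>) (z0, 0) \<le> dist w z0 + dist \<delta> 0"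
        unfolding dist_Pair_Pair by (rule sqrt_sum_squares_le_sum) auto
      then show ?thesis using that \<rho> \<delta> by (auto simp: dist_commute)
    qed
    have b\<Omega>: "ball z0 \<rho> \<subseteq> \<Omega>" using d \<rho> by auto
    define W where "W = (\<lambda>w. if w \<in> ball z0 \<rho> then max (E w) (\<psi> w + (c + \<delta>)) else E w)"
    have negW: "F w (\<psi> w + (c + \<delta>)) (k w) < 0" if w: "w \<in> ball z0 \<rho>" for w
      using \<eta>(2)[OF near[OF w]] by (simp add: algebra_simps)
    have rimW: "\<psi> w + (c + \<delta>) < E w" if "w \<in> ball z0 \<rho>" "\<delta> < (norm (w - z0))\<^sup>2" for w
    proof -
      have "w \<in> ball z0 e" "w \<in> \<Omega>" using that \<rho> b\<Omega> by auto
      then show ?thesis using below[of w] that(2) by linarith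
    qed
    have W: "usc_on \<Omega> W" "subsol F \<Omega> W" unfolding W_def
      using perron_bump[OF \<Omega> Eusc Esub b\<Omega> \<rho>(1) tc negW rimW \<delta>(3)] by blast+
    have "W \<in> S" unfolding S_def
    proof (intro CollectI conjI ballI W)
      fix w assume w: "w \<in> \<Omega>"
      show "W w \<le> g w" using Eg[OF w] \<eta>(2)[OF near, of w] by (auto simp: W_def)
    qed
    \<comment> \<open>The bump really raises \<open>E\<close>: some nearby point has
      \<open>E\<close> below the lower envelope at \<open>z0\<close> plus \<open>\<delta>/2\<close>,
      while the raised function is at least that high there. This contradicts maximality of
      \<open>E\<close> among the competitors.\<close>
    have "isCont \<psi> z0" by (rule test_fun_isCont(1)[OF t])
    then obtain d' where d': "d' > 0" "\<And>w. dist w z0 < d' \<Longrightarrow> dist (\<psi> w) (\<psi> z0) < \<delta>/2"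
      using \<delta>(1) unfolding continuous_at_eps_delta by (metis half_gt_zero)
    obtain w where w: "w \<in> ball z0 (min \<rho> d') \<inter> \<Omega>" "N z0 - \<delta>/2 < - E w"
      using usc_env_approx[OF \<Omega> z0 lbE, of "\<delta>/2" "min \<rho> d'"] \<delta>(1) d'(1) \<rho>(1) unfolding N_def by auto
    have "\<psi> w + (c + \<delta>) \<le> W w" using w by (simp add: W_def)
    also have "W w \<le> E w" using SE[OF \<open>W \<in> S\<close>] w by auto
    finally have "\<psi> w + (c + \<delta>) \<le> E w" .
    moreover have "\<bar>\<psi> w - \<psi> z0\<bar> < \<delta>/2" using w d'(2)[of w] by (auto simp: dist_real_def dist_commute)
    ultimately show False using w(2) \<psi>0(1) by linarith
  qed
  show ?thesis
  proof (rule exI[of _ E], rule exI[of _ "\<lambda>w. - N w"], intro conjI ballI)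
    show "usc_on \<Omega> E" "subsol F \<Omega> E" by (rule Eusc, rule Esub)
    show "lsc_on \<Omega> (\<lambda>w. - N w)" using Nusc by (simp add: lsc_on_def)
    show "supsol F \<Omega> (\<lambda>w. - N w)" using Nsub by (simp add: supsol_def)
    fix z assume z: "z \<in> \<Omega>"
    show "f z \<le> - N z" "- N z \<le> E z" "E z \<le> g z" using Nf[OF z] Nge[OF z] Eg[OF z] by auto
  qed
qed

section \<open>Comparison for Hamiltonians coercive in one group of variables\<close>

type_synonym 'n spt = "(real^'n) \<times> real \<times> real"

definition HJ :: "('n::finite) ham \<Rightarrow> real \<Rightarrow> real \<Rightarrow> 'n spt \<Rightarrow> real \<Rightarrow> 'n spt \<Rightarrow> real" where
  "HJ G \<alpha> c z r p = snd (snd p) + G (fst z) (fst (snd z)) (snd (snd z)) (fst p) (fst (snd p)) + \<alpha> * r - c"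

section \<open>Consequences of periodicity and of the structure conditions\<close>

lemma int_vec_floor_shift: "int_vec (\<chi> i. - of_int \<lfloor>x $ i\<rfloor>)"
  by (simp add: int_vec_def)

lemma periodic_int:
  fixes f :: "real \<Rightarrow> 'a"
  assumes "\<And>y. f (y + 1) = f y" shows "f (y + of_int k) = f y"
proof (induction k arbitrary: y rule: int_induct[where k=0])
  case (step1 i)
  then show ?case using assms[of "y + of_int i"] by (simp add: add.assoc)
next
  case (step2 i)
  then show ?case using assms[of "y + of_int (i - 1)"] by (simp add: algebra_simps)
qed simp

text \<open>Increments replace the almost everywhere derivatives, as provided by
  \<open>H3_increments\<close>. Both alternatives of \<open>H2\<close> enter as
  \<open>coercive\<close>; for \<open>G\<close> depending on t this is
  \<open>coercive_px_of_lin\<close>, where the Lipschitz bound in p_y carries the linear growth from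
  p_y = 0 to bounded p_y.\<close>

locale hj =
  fixes G :: "('n::finite) ham" and l C3 C4 :: real
  assumes cont: "continuous_on UNIV (\<lambda>(x, y, t, p, q). G x y t p q)"
    and per_x: "int_vec k \<Longrightarrow> G (x + k) y t p q = G x y t p q"
    and per_y: "G x (y + 1) t p q = G x y t p q"
    and per_t: "G x y (t + 1) p q = G x y t p q"
    and coercive: "coercive_px G"
    and C3: "0 \<le> C3" and C4: "0 \<le> C4"
    and y_incr: "\<bar>G x y' t p q - G x y t p q\<bar> \<le> C3 * \<bar>q + l\<bar> * \<bar>y' - y\<bar>"
    and t_incr: "C4 * \<bar>t' - t\<bar> \<le> 1 / 2 \<Longrightarrow>
      \<bar>G x y t' p q - G x y t p q\<bar> \<le> 2 * C4 * (1 + \<bar>q\<bar> + \<bar>G x y t p q\<bar>) * \<bar>t' - t\<bar>"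
begin

lemma G_shift:
  assumes "int_vec k" shows "G (x + k) (y + of_int i) (t + of_int j) p q = G x y t p q"
  using periodic_int[of "\<lambda>y. G (x + k) y (t + of_int j) p q", OF per_y]
    periodic_int[of "\<lambda>t. G (x + k) y t p q", OF per_t] per_x[OF assms] by metis

text \<open>In \<open>x\<close> the cell is three periods wide: a second point at distance less than
  1 must stay inside when shifted by the lattice vector of the first.\<close>

definition cell :: "real \<Rightarrow> ((real^'n) \<times> real \<times> real \<times> (real^'n) \<times> real) set" where
  "cell R = cbox (\<chi> i. -1) (\<chi> i. 2) \<times> {0..1} \<times> {0..1} \<times> cball 0 R \<times> cball 0 R"

lemma compact_cell: "compact (cell R)"
  unfolding cell_def by (intro compact_Times compact_cbox compact_cball compact_Icc)

lemma shift_into_cell: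
  assumes "norm p \<le> R" "\<bar>q\<bar> \<le> R" "dist x x' < 1"
  shows "(x' + (\<chi> i. - of_int \<lfloor>x $ i\<rfloor>), y + of_int (- \<lfloor>y\<rfloor>), t + of_int (- \<lfloor>t\<rfloor>), p, q) \<in> cell R"
proof -
  have "\<bar>x $ i - x' $ i\<bar> < 1" for i
    using component_le_norm_cart[of "x - x'" i] assms(3) by (simp add: dist_norm)
  then have "- 1 \<le> x' $ i - of_int \<lfloor>x $ i\<rfloor> \<and> x' $ i - of_int \<lfloor>x $ i\<rfloor> \<le> 2" for i
    using of_int_floor_le[of "x $ i"] real_of_int_floor_add_one_gt[of "x $ i"]
    by (smt (verit, best))
  then have "x' + (\<chi> i. - of_int \<lfloor>x $ i\<rfloor>) \<in> cbox (\<chi> i. -1) (\<chi> i. 2)"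
    by (simp add: mem_box_cart)
  moreover have "y + of_int (- \<lfloor>y\<rfloor>) \<in> {0..1}" for y :: real
    using of_int_floor_le[of y] real_of_int_floor_add_one_gt[of y] unfolding atLeastAtMost_iff of_int_minus by linarith
  ultimately show ?thesis unfolding cell_def using assms(1,2) by (auto simp: dist_norm)
qed

text \<open>Uniform continuity on the compact cell spreads over all base points by periodicity,
  since both points are moved by the same lattice vector. The radius \<open>R\<close> on the
  gradient variables is the one thing periodicity cannot supply.\<close>

lemma G_uniform:
  assumes e: "e > 0"
  shows "\<exists>d>0. \<forall>x x' y t p p' q q'. dist x x' < d \<and> dist p p' < d \<and> dist q q' < d \<and>
     norm p \<le> R \<and> norm p' \<le> R \<and> \<bar>q\<bar> \<le> R \<and> \<bar>q'\<bar> \<le> R \<longrightarrow> \<bar>G x y t p q - G x' y t p' q'\<bar> < e"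
proof -
  let ?h = "\<lambda>(x, y, t, p, q). G x y t p q"
  have "uniformly_continuous_on (cell R) ?h"
    by (rule compact_uniformly_continuous[OF continuous_on_subset[OF cont subset_UNIV] compact_cell])
  then obtain d where d: "d > 0" "\<And>a b. a \<in> cell R \<Longrightarrow> b \<in> cell R \<Longrightarrow> dist a b < d \<Longrightarrow> dist (?h a) (?h b) < e"
    unfolding uniformly_continuous_on_def using e by metis
  show ?thesis
  proof (intro exI[of _ "min 1 (d/3)"] conjI allI impI)
    fix x x' p p' :: "real^'n" and y t q q' :: real
    assume *: "dist x x' < min 1 (d / 3) \<and> dist p p' < min 1 (d / 3) \<and> dist q q' < min 1 (d / 3) \<and>
     norm p \<le> R \<and> norm p' \<le> R \<and> \<bar>q\<bar> \<le> R \<and> \<bar>q'\<bar> \<le> R"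
    define k :: "real^'n" where "k = (\<chi> i. - of_int \<lfloor>x $ i\<rfloor>)"
    have k: "int_vec k" unfolding k_def by (rule int_vec_floor_shift)
    define y0 where "y0 = y + of_int (- \<lfloor>y\<rfloor>)"
    define t0 where "t0 = t + of_int (- \<lfloor>t\<rfloor>)"
    have 1: "(x + k, y0, t0, p, q) \<in> cell R" "(x' + k, y0, t0, p', q') \<in> cell R"
      unfolding k_def y0_def t0_def by (rule shift_into_cell; use * in simp)+
    have "dist (x + k, y0, t0, p, q) (x' + k, y0, t0, p', q') \<le> dist x x' + (dist p p' + dist q q')"
    proof -
      have s: "sqrt (a\<^sup>2 + b\<^sup>2) \<le> a + b" if "0 \<le> a" "0 \<le> b" for a b :: real using that by (rule sqrt_sum_squares_le_sum)
      have "dist (p, q) (p', q') \<le> dist p p' + dist q q'" unfolding dist_Pair_Pair by (rule s) auto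
      moreover have "dist (x + k, y0, t0, p, q) (x' + k, y0, t0, p', q') = dist (x + k, p, q) (x' + k, p', q')"
        by (simp add: dist_Pair_Pair)
      moreover have "\<dots> \<le> dist x x' + dist (p,q) (p',q')"
        using s[of "dist x x'" "dist (p,q) (p',q')"] by (simp add: dist_Pair_Pair)
      ultimately show ?thesis by linarith
    qed
    then have "dist (x + k, y0, t0, p, q) (x' + k, y0, t0, p', q') < d" using * by auto
    from d(2)[OF 1 this] show "\<bar>G x y t p q - G x' y t p' q'\<bar> < e"
      unfolding y0_def t0_def by (simp add: G_shift[OF k] dist_real_def del: of_int_minus)
  qed (use d in auto)
qed

lemma G_bounded: "\<exists>M. \<forall>x y t p q. norm p \<le> R \<and> \<bar>q\<bar> \<le> R \<longrightarrow> \<bar>G x y t p q\<bar> \<le> M"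
proof -
  let ?h = "\<lambda>(x, y, t, p, q). G x y t p q"
  have "bounded (?h ` cell R)"
    by (intro compact_imp_bounded compact_continuous_image continuous_on_subset[OF cont subset_UNIV] compact_cell)
  then obtain M where "\<forall>b\<in>?h ` cell R. norm b \<le> M" unfolding bounded_iff by blast
  then have M: "\<bar>?h a\<bar> \<le> M" if "a \<in> cell R" for a using that by (metis imageI real_norm_def)
  show ?thesis
  proof (intro exI allI impI)
    fix x p :: "real^'n" and y t q :: real assume *: "norm p \<le> R \<and> \<bar>q\<bar> \<le> R"
    show "\<bar>G x y t p q\<bar> \<le> M"
      using M[OF shift_into_cell[of p R q x x y t]] * by (simp add: G_shift[OF int_vec_floor_shift] del: of_int_minus)
  qed
qed

text \<open>Only an upper bound for \<open>G\<close> is known in the doubling; \<open>G\<close> may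
  be very negative, and then \<open>t_incr\<close> from \<open>t\<close> is useless. If
  \<open>G\<close> exceeds \<open>Y\<close> at \<open>t'\<close>, it equals \<open>Y\<close> at some
  time in between, and the increment from there involves |Y| alone.\<close>

lemma t_incr_le:
  assumes Y: "G x y t p q \<le> Y" and small: "C4 * \<bar>t' - t\<bar> \<le> 1 / 2"
  shows "G x y t' p q \<le> Y + 2 * C4 * (1 + \<bar>q\<bar> + \<bar>Y\<bar>) * \<bar>t' - t\<bar>"
proof (cases "G x y t' p q \<le> Y")
  case True
  moreover have "0 \<le> 2 * C4 * (1 + \<bar>q\<bar> + \<bar>Y\<bar>) * \<bar>t' - t\<bar>" using C4 by simp
  ultimately show ?thesis by linarith
next
  case False
  have "continuous_on UNIV (\<lambda>s. (\<lambda>(x, y, t, p, q). G x y t p q) (x, y, s, p, q))"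
    by (rule continuous_on_compose2[OF cont]) (auto intro!: continuous_intros)
  then have c: "continuous_on S (\<lambda>s. G x y s p q)" for S by (auto intro: continuous_on_subset)
  have "\<exists>s. \<bar>t' - s\<bar> \<le> \<bar>t' - t\<bar> \<and> G x y s p q = Y"
  proof (cases "t \<le> t'")
    case True
    then obtain s where "t \<le> s" "s \<le> t'" "G x y s p q = Y"
      using IVT'[of "\<lambda>s. G x y s p q" t Y t'] Y False c by auto
    then show ?thesis by (intro exI[of _ s]) auto
  next
    case f: False
    then obtain s where "t' \<le> s" "s \<le> t" "G x y s p q = Y"
      using IVT2'[of "\<lambda>s. G x y s p q" t Y t'] Y False c by auto
    then show ?thesis by (intro exI[of _ s]) auto
  qed
  then obtain s where s: "\<bar>t' - s\<bar> \<le> \<bar>t' - t\<bar>" "G x y s p q = Y" by blast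
  have "C4 * \<bar>t' - s\<bar> \<le> C4 * \<bar>t' - t\<bar>" using s C4 by (intro mult_left_mono)
  then have "\<bar>G x y t' p q - Y\<bar> \<le> 2 * C4 * (1 + \<bar>q\<bar> + \<bar>Y\<bar>) * \<bar>t' - s\<bar>"
    using t_incr[of t' s x y p q] small s by simp
  also have "\<dots> \<le> 2 * C4 * (1 + \<bar>q\<bar> + \<bar>Y\<bar>) * \<bar>t' - t\<bar>" using s C4 by (intro mult_left_mono) auto
  finally show ?thesis by linarith
qed

end

text \<open>The order of quantifiers is the point: \<open>N\<close> is fixed first and the estimate
  then holds for all large \<open>k\<close>, so that the weight on \<open>x\<close> can still be
  sent to infinity.\<close>

lemma doubling_parameter:
  fixes S :: "nat \<Rightarrow> real \<Rightarrow> real"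
  assumes k: "\<And>k k' N. k \<le> k' \<Longrightarrow> 0 < N \<Longrightarrow> S k' N \<le> S k N"
    and N: "\<And>k N N'. 0 < N \<Longrightarrow> N \<le> N' \<Longrightarrow> S k N' \<le> S k N"
    and m: "\<And>k N. 0 < N \<Longrightarrow> m \<le> S k N" and e: "e > 0"
  shows "\<exists>N\<ge>N0. 0 < N \<and> (\<exists>k0. \<forall>k\<ge>k0. S k N - S k (2 * N) \<le> e)"
proof -
  \<comment> \<open>The infimum over \<open>k\<close> stands for the limit in \<open>k\<close>.
    Along powers of 2 it decreases and stays above \<open>m\<close>, so consecutive values approach
    each other.\<close>
  define a where "a j = (INF k. S k (2 ^ j))" for j :: nat
  have bb: "bdd_below (range (\<lambda>k. S k (2 ^ j)))" for j by (rule bdd_belowI[of _ m]) (auto intro!: m)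
  have am: "m \<le> a j" for j unfolding a_def by (rule cINF_greatest) (auto intro!: m)
  have dec: "decseq a"
    unfolding decseq_Suc_iff a_def
  proof (intro allI cINF_mono bb)
    fix j m :: nat
    show "\<exists>n\<in>UNIV. S n (2 ^ Suc j) \<le> S m (2 ^ j)" by (rule bexI[of _ m]) (auto intro!: N)
  qed auto
  have "convergent a" by (rule decseq_convergent[OF dec, of m]) (use am in \<open>auto intro: convergentI\<close>)
  then have "Cauchy a" by (rule convergent_Cauchy)
  then obtain M where M: "\<And>i j. i \<ge> M \<Longrightarrow> j \<ge> M \<Longrightarrow> dist (a i) (a j) < e / 2"
    using e unfolding Cauchy_def by (metis half_gt_zero)
  obtain n :: nat where n: "N0 < 2 ^ n" using real_arch_pow[of 2 N0] by auto
  define j where "j = max n M"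
  have j: "N0 \<le> 2 ^ j" "a j - a (Suc j) < e / 2"
  proof -
    have "(2::real) ^ n \<le> 2 ^ j" by (rule power_increasing) (auto simp: j_def)
    then show "N0 \<le> 2 ^ j" using n by linarith
    show "a j - a (Suc j) < e / 2" 
    proof -
      have "dist (a j) (a (Suc j)) < e / 2" by (rule M) (auto simp: j_def)
      then show ?thesis unfolding dist_real_def by linarith
    qed
  qed
  have "(INF k. S k (2 ^ j)) < a j + e / 2" using e by (simp add: a_def)
  then obtain k0 where k0: "S k0 (2 ^ j) < a j + e / 2" using bb by (subst (asm) cINF_less_iff) auto
  have "S k (2 ^ j) - S k (2 * 2 ^ j) \<le> e" if "k \<ge> k0" for k
  proof -
    have "a (Suc j) \<le> S k (2 ^ Suc j)" unfolding a_def by (rule cINF_lower[OF bb]) simp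
    moreover have "S k (2 ^ j) \<le> S k0 (2 ^ j)" using that by (intro k) auto
    ultimately show ?thesis using k0 j by simp
  qed
  then show ?thesis using j(1) by (intro exI[of _ "2 ^ j"]) auto
qed

section \<open>Penalty functions and attained maxima\<close>

lemma test_fun_sqdist_fst: "test_fun (\<lambda>w. (norm (fst w - a))\<^sup>2) (\<lambda>w. (2 *\<^sub>R (fst w - a), 0))"
proof (rule test_funI)
  show "((\<lambda>w. (norm (fst w - a))\<^sup>2) has_derivative (\<lambda>h. (fst w - a) \<bullet> fst h + fst h \<bullet> (fst w - a))) (at w)" for w
    unfolding power2_norm_eq_inner by (auto intro!: derivative_eq_intros)
qed (auto intro!: continuous_intros simp: inner_commute inner_prod_def)

lemma test_fun_sqdist_snd: "test_fun (\<lambda>w. (norm (snd w - a))\<^sup>2) (\<lambda>w. (0, 2 *\<^sub>R (snd w - a)))"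
proof (rule test_funI)
  show "((\<lambda>w. (norm (snd w - a))\<^sup>2) has_derivative (\<lambda>h. (snd w - a) \<bullet> snd h + snd h \<bullet> (snd w - a))) (at w)" for w
    unfolding power2_norm_eq_inner by (auto intro!: derivative_eq_intros)
qed (auto intro!: continuous_intros simp: inner_commute inner_prod_def)

text \<open>A smooth substitute for the norm: it grows at infinity while its gradient has norm at
  most 1, so a small multiple yields compactness at the price of a small error in the
  equation.\<close>

definition jb :: "'a::euclidean_space \<Rightarrow> real" where "jb z = sqrt (1 + (norm z)\<^sup>2)"

lemma jb_pos: "0 < jb z" and jb_ge_norm: "norm z \<le> jb z"
  unfolding jb_def by (auto intro!: real_le_rsqrt add_pos_nonneg)

lemma test_fun_jb: "test_fun jb (\<lambda>z. (1 / jb z) *\<^sub>R z)"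
proof (rule test_funI)
  have p: "0 < 1 + w \<bullet> w" for w :: 'a by (simp add: add_pos_nonneg)
  show "(jb has_derivative (\<lambda>h. (w \<bullet> h + h \<bullet> w) / (2 * sqrt (1 + w \<bullet> w)))) (at w)" for w :: 'a
    unfolding jb_def power2_norm_eq_inner
    by (rule derivative_eq_intros refl p)+ (auto simp: field_simps)
  have "continuous_on UNIV (jb :: 'a \<Rightarrow> real)" unfolding jb_def by (intro continuous_intros)
  moreover have "jb z \<noteq> 0" for z :: 'a using jb_pos[of z] by simp
  ultimately  show "continuous_on UNIV (\<lambda>z::'a. (1 / jb z) *\<^sub>R z)"
    by (intro continuous_intros) auto
qed (auto simp: jb_def power2_norm_eq_inner inner_commute)

lemma usc_on_compose:
  assumes "usc_on \<Omega> u" and f: "\<And>z. z \<in> \<Omega>' \<Longrightarrow> isCont f z" "f ` \<Omega>' \<subseteq> \<Omega>"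
  shows "usc_on \<Omega>' (\<lambda>z. u (f z))"
  unfolding usc_on_def
proof (intro ballI allI impI)
  fix z and e :: real assume z: "z \<in> \<Omega>'" and "e > 0"
  then have "\<forall>\<^sub>F w in nhds (f z). u w < u (f z) + e" using assms by (intro usc_onD[OF assms(1)]) auto
  moreover have "filterlim f (nhds (f z)) (nhds z)"
    using f(1)[OF z] by (simp add: isCont_def tendsto_at_iff_tendsto_nhds)
  ultimately show "\<forall>\<^sub>F w in nhds z. u (f w) < u (f z) + e" by (rule eventually_compose_filterlim)
qed

text \<open>\<open>K\<close> need not be compact. The term in \<open>jb\<close> confines the first
  point, and the quadratic penalty then confines the second one, so the upper level set of the
  doubled function lies in a compact set.\<close>

lemma doubling_maximum:
  fixes u v :: "'a::euclidean_space \<times> 'b::euclidean_space \<Rightarrow> real"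
  assumes u: "usc_on \<Omega> u" and v: "lsc_on \<Omega> v" and K: "closed K" "K \<subseteq> \<Omega>"
    and ub: "\<And>z. z \<in> K \<Longrightarrow> u z \<le> B" and vb: "\<And>z. z \<in> K \<Longrightarrow> - B \<le> v z"
    and kN: "0 < k" "0 < N" and \<sigma>: "0 < \<sigma>"
  defines "q \<equiv> \<lambda>z z'. k * (norm (fst z - fst z'))\<^sup>2 + N * (norm (snd z - snd z'))\<^sup>2"
  assumes z1: "z1 \<in> K" "z1' \<in> K" and s: "s \<le> u z1 - v z1' - q z1 z1'"
  shows "\<exists>\<beta> z z'. 0 < \<beta> \<and> \<beta> \<le> \<sigma> \<and> z \<in> K \<and> z' \<in> K \<and>
     (\<forall>w\<in>K. \<forall>w'\<in>K. u w - v w' - q w w' - \<beta> * jb w \<le> u z - v z' - q z z' - \<beta> * jb z) \<and>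
     s - \<sigma> \<le> u z - v z' - q z z' - \<beta> * jb z"
proof -
  \<comment> \<open>Dividing by \<open>jb z1\<close> makes the extra penalty cost at most
    \<open>\<sigma>\<close> at the given near-maximiser; the bound by \<open>\<sigma>\<close> itself
    controls the gradient of that penalty.\<close>
  define \<beta> where "\<beta> = min \<sigma> (\<sigma> / jb z1)"
  have \<beta>: "0 < \<beta>" "\<beta> \<le> \<sigma>" using \<sigma> jb_pos[of z1] by (auto simp: \<beta>_def)
  have \<beta>1: "\<beta> * jb z1 \<le> \<sigma>"
  proof -
    have "\<beta> * jb z1 \<le> \<sigma> / jb z1 * jb z1" by (intro mult_right_mono) (auto simp: \<beta>_def jb_pos less_imp_le)
    then show ?thesis using jb_pos[of z1] by simp
  qed
  define \<Phi> where "\<Phi> w w' = u w - v w' - q w w' - \<beta> * jb w" for w w'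
  define \<Phi>1 where "\<Phi>1 = \<Phi> z1 z1'"
  have q0: "0 \<le> q w w'" for w w' using kN by (simp add: q_def)
  define mn where "mn = min k N"
  have mn: "mn > 0" using kN by (simp add: mn_def)
  have qmn: "mn * (norm (w - w'))\<^sup>2 \<le> q w w'" for w w'
  proof -
    have "(norm (w - w'))\<^sup>2 = (norm (fst w - fst w'))\<^sup>2 + (norm (snd w - snd w'))\<^sup>2"
      by (simp add: norm_prod_def)
    moreover have "mn * (norm (fst w - fst w'))\<^sup>2 \<le> k * (norm (fst w - fst w'))\<^sup>2"
      "mn * (norm (snd w - snd w'))\<^sup>2 \<le> N * (norm (snd w - snd w'))\<^sup>2"
      by (auto simp: mn_def intro!: mult_right_mono)
    ultimately show ?thesis by (simp add: q_def distrib_left)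
  qed
  have up: "\<Phi> w w' \<le> 2 * B - q w w' - \<beta> * norm w" if "w \<in> K" "w' \<in> K" for w w'
  proof -
    have "\<beta> * norm w \<le> \<beta> * jb w" using \<beta> jb_ge_norm[of w] by (intro mult_left_mono) auto
    then show ?thesis using ub[OF that(1)] vb[OF that(2)] by (simp add: \<Phi>_def)
  qed
  define D where "D = 2 * B - \<Phi>1"
  have D: "q z1 z1' + \<beta> * norm z1 \<le> D" using up[OF z1] by (simp add: D_def \<Phi>1_def)
  have D0: "0 \<le> D" using D q0[of z1 z1'] \<beta> by (meson add_nonneg_nonneg less_imp_le mult_nonneg_nonneg norm_ge_zero order_trans)
  define R1 where "R1 = D / \<beta>"
  define R2 where "R2 = R1 + (D / mn + 1)"
  have inL: "norm w \<le> R1 \<and> norm w' \<le> R2" if w: "w \<in> K" "w' \<in> K" and ge: "\<Phi>1 \<le> \<Phi> w w'" for w w'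
  proof
    have le: "q w w' + \<beta> * norm w \<le> D" using up[OF w] ge by (simp add: D_def)
    then have "\<beta> * norm w \<le> D" using q0[of w w'] by linarith
    then show 1: "norm w \<le> R1" using \<beta> by (simp add: R1_def pos_le_divide_eq mult.commute)
    have "mn * (norm (w - w'))\<^sup>2 \<le> D" using qmn[of w w'] le \<beta>(1) by (smt (verit) mult_nonneg_nonneg norm_ge_zero)
    then have "(norm (w - w'))\<^sup>2 \<le> D / mn" using mn by (simp add: pos_le_divide_eq mult.commute)
    also have "\<dots> \<le> (D / mn + 1)\<^sup>2"
    proof -
      have "r \<le> (r + 1)\<^sup>2" if "0 \<le> r" for r :: real using that by (simp add: power2_eq_square algebra_simps)
      then show ?thesis using D0 mn by simp
    qed
    finally have "norm (w - w') \<le> D / mn + 1" using D0 mn by (intro power2_le_imp_le[of "norm (w - w')" "D / mn + 1"]) auto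
    moreover have "norm w' \<le> norm w + norm (w - w')" by (metis norm_triangle_sub norm_minus_commute)
    ultimately show "norm w' \<le> R2" using 1 by (simp add: R2_def)
  qed
  define L where "L = (cball 0 R1 \<inter> K) \<times> (cball 0 R2 \<inter> K)"
  have cL: "compact L" unfolding L_def using K(1) by (intro compact_Times compact_Int_closed) auto
  have z1L: "(z1, z1') \<in> L" using inL[OF z1] z1 by (simp add: L_def \<Phi>1_def)
  have LO: "L \<subseteq> \<Omega> \<times> \<Omega>" using K(2) by (auto simp: L_def)
  have "usc_on (\<Omega> \<times> \<Omega>) (\<lambda>p. u (fst p) + ((- v (snd p)) + (- q (fst p) (snd p) - \<beta> * jb (fst p))))"
  proof (intro usc_on_add)
    show "usc_on (\<Omega> \<times> \<Omega>) (\<lambda>p. u (fst p))" by (rule usc_on_compose[OF u]) (auto intro: isCont_fst continuous_ident)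
    show "usc_on (\<Omega> \<times> \<Omega>) (\<lambda>p. - v (snd p))"
      by (rule usc_on_compose[where u="\<lambda>z. - v z"]) (use v in \<open>auto simp: lsc_on_def intro: isCont_snd continuous_ident\<close>)
    have "usc_on UNIV (\<lambda>p. - q (fst p) (snd p) - \<beta> * jb (fst p))"
      unfolding q_def jb_def by (rule continuous_imp_usc_on) (auto intro!: continuous_intros)
    then show "usc_on (\<Omega> \<times> \<Omega>) (\<lambda>p. - q (fst p) (snd p) - \<beta> * jb (fst p))" by (rule usc_on_subset) simp
  qed
  then obtain p where p: "p \<in> L" "\<And>y. y \<in> L \<Longrightarrow> u (fst y) + ((- v (snd y)) + (- q (fst y) (snd y) - \<beta> * jb (fst y)))
     \<le> u (fst p) + ((- v (snd p)) + (- q (fst p) (snd p) - \<beta> * jb (fst p)))"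
    using usc_on_attains_max[OF _ cL _ LO] z1L by blast
  obtain z z' where zz: "p = (z, z')" by (cases p)
  have zK: "z \<in> K" "z' \<in> K" using p(1) by (auto simp: zz L_def)
  have maxL: "\<Phi> w w' \<le> \<Phi> z z'" if "(w, w') \<in> L" for w w' using p(2)[OF that] by (simp add: zz \<Phi>_def)
  have max: "\<Phi> w w' \<le> \<Phi> z z'" if "w \<in> K" "w' \<in> K" for w w'
  proof (cases "\<Phi>1 \<le> \<Phi> w w'")
    case True
    then show ?thesis using inL[OF that] that by (intro maxL) (simp add: L_def)
  next
    case False
    then show ?thesis using maxL[OF z1L] by (simp add: \<Phi>1_def)
  qed
  have "s - \<sigma> \<le> \<Phi> z z'" using maxL[OF z1L] s \<beta>1 by (simp add: \<Phi>_def)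
  then show ?thesis using \<beta> zK max unfolding \<Phi>_def by blast
qed

context hj begin

text \<open>\<open>near\<close> asks for differences of at least \<open>m\<close> at arbitrarily
  close pairs. This follows from such a difference at a single point, but is also what the failure
  of a uniform estimate provides. \<open>off\<close> keeps these pairs inside \<open>K\<close>, away
  from the boundary. For \<open>\<alpha> = 0\<close> the conclusion reads
  \<open>0 \<le> a - b\<close>, which is contradictory once the inequalities have been made
  strict.\<close>

lemma uniform_comparison:
  assumes \<Omega>: "open \<Omega>" and K: "closed K" "K \<subseteq> \<Omega>"
    and u: "usc_on \<Omega> u" "subsol (HJ G \<alpha> a) \<Omega> u" and v: "lsc_on \<Omega> v" "supsol (HJ G \<alpha> b) \<Omega> v"
    and \<alpha>: "0 \<le> \<alpha>"
    and ub: "\<And>z. z \<in> K \<Longrightarrow> u z \<le> B" and vb: "\<And>z. z \<in> K \<Longrightarrow> - B \<le> v z"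
    and \<delta>0: "\<delta>0 > 0" and off: "\<And>z z'. z \<in> \<Omega> \<Longrightarrow> z' \<in> \<Omega> \<Longrightarrow> dist z z' < \<delta>0 \<Longrightarrow> z \<notin> K \<or> z' \<notin> K \<Longrightarrow> u z - v z' \<le> c"
    and cm: "c < m" and near: "\<And>\<delta>. \<delta> > 0 \<Longrightarrow> \<exists>z\<in>\<Omega>. \<exists>z'\<in>\<Omega>. dist z z' < \<delta> \<and> m \<le> u z - v z'"
  shows "\<alpha> * m \<le> a - b"
proof -
  define q where "q k N z z' = k * (norm (fst z - fst z'))\<^sup>2 + N * (norm (snd z - snd z'))\<^sup>2" for k N :: real and z z' :: "'n spt"
  \<comment> \<open>The weight on \<open>x\<close> is \<open>Suc k\<close>, hence positive for every
    \<open>k\<close>; \<open>N\<close> weighs y and t together.\<close>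
  define S where "S k N = (SUP p\<in>K \<times> K. u (fst p) - v (snd p) - q (real (Suc k)) N (fst p) (snd p))" for k :: nat and N
  have q0: "0 \<le> q k N z z'" if "0 \<le> k" "0 \<le> N" for k N z z' using that by (simp add: q_def)
  obtain y1 y1' where y1: "y1 \<in> \<Omega>" "y1' \<in> \<Omega>" "dist y1 y1' < \<delta>0" "m \<le> u y1 - v y1'" using near[OF \<delta>0] by blast
  have KK: "K \<times> K \<noteq> {}" using off[OF y1(1-3)] y1(4) cm by force
  have bdd: "bdd_above ((\<lambda>p. u (fst p) - v (snd p) - q (real (Suc k)) N (fst p) (snd p)) ` (K \<times> K))" if "0 < N" for k N
  proof (rule bdd_aboveI)
    fix x assume "x \<in> (\<lambda>p. u (fst p) - v (snd p) - q (real (Suc k)) N (fst p) (snd p)) ` (K \<times> K)"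
    then obtain z z' where z: "z \<in> K" "z' \<in> K" "x = u z - v z' - q (real (Suc k)) N z z'" by auto
    then show "x \<le> 2 * B" using ub[OF z(1)] vb[OF z(2)] q0[of "real (Suc k)" N z z'] that by simp
  qed
  have S_ge: "u z - v z' - q (real (Suc k)) N z z' \<le> S k N" if "0 < N" "z \<in> K" "z' \<in> K" for k N z z'
    unfolding S_def using cSUP_upper[OF _ bdd[OF that(1)], of "(z,z')" k] that by simp
  have mS: "m \<le> S k N" if N: "0 < N" for k N
  proof (rule field_le_epsilon)
    fix e :: real assume e: "e > 0"
    define r where "r = min \<delta>0 (min 1 (e / (real (Suc k) + N)))"
    have r: "r > 0" "r \<le> \<delta>0" "r \<le> 1" "(real (Suc k) + N) * r \<le> e"
    proof -
      show "r > 0" using \<delta>0 e N by (simp add: r_def add_pos_pos)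
      have "r \<le> e / (real (Suc k) + N)" by (simp add: r_def)
      then show "(real (Suc k) + N) * r \<le> e" using N by (simp add: pos_le_divide_eq add_pos_pos mult.commute)
    qed (auto simp: r_def)
    obtain z z' where z: "z \<in> \<Omega>" "z' \<in> \<Omega>" "dist z z' < r" "m \<le> u z - v z'" using near[OF r(1)] by blast
    have zK: "z \<in> K" "z' \<in> K" using off[OF z(1,2)] z r cm by force+
    have n: "norm (fst z - fst z') \<le> r" "norm (snd z - snd z') \<le> r"
      using z(3) dist_fst_le[of z z'] dist_snd_le[of z z'] by (auto simp: dist_norm)
    have sq: "x\<^sup>2 \<le> r" if "0 \<le> x" "x \<le> r" for x :: real
      using that r mult_mono[of x r x 1] by (simp add: power2_eq_square)
    have "q (real (Suc k)) N z z' \<le> real (Suc k) * r + N * r"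
      unfolding q_def using n N by (intro add_mono mult_left_mono sq) auto
    then have "q (real (Suc k)) N z z' \<le> e" using r(4) by (simp add: distrib_right)
    then show "m \<le> S k N + e" using S_ge[OF N zK, of k] z(4) by linarith
  qed
  have Sk: "S k' N \<le> S k N" if kk: "k \<le> k'" and N: "0 < N" for k k' N
    unfolding S_def
  proof (rule cSUP_mono[OF KK bdd[OF N]])
    fix p assume p: "p \<in> K \<times> K"
    have "q (real (Suc k)) N (fst p) (snd p) \<le> q (real (Suc k')) N (fst p) (snd p)"
      unfolding q_def using kk by (intro add_mono mult_right_mono) auto
    then show "\<exists>p'\<in>K \<times> K. u (fst p) - v (snd p) - q (real (Suc k')) N (fst p) (snd p)
       \<le> u (fst p') - v (snd p') - q (real (Suc k)) N (fst p') (snd p')" using p by force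
  qed
  have SN: "S k N' \<le> S k N" if N: "0 < N" and NN: "N \<le> N'" for k N N'
    unfolding S_def
  proof (rule cSUP_mono[OF KK bdd[OF N]])
    fix p assume p: "p \<in> K \<times> K"
    have "q (real (Suc k)) N (fst p) (snd p) \<le> q (real (Suc k)) N' (fst p) (snd p)"
      unfolding q_def using NN by (intro add_mono mult_right_mono) auto
    then show "\<exists>p'\<in>K \<times> K. u (fst p) - v (snd p) - q (real (Suc k)) N' (fst p) (snd p)
       \<le> u (fst p') - v (snd p') - q (real (Suc k)) N (fst p') (snd p')" using p by force
  qed
  \<comment> \<open>\<open>A0\<close> bounds the terms other than the time slope in the upper bound
    \<open>Y\<close> for \<open>G\<close>. \<open>Cc\<close> collects the errors: 2 from the shift
    in x and from the slope of \<open>jb\<close>, then those in t and in y, and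
    \<open>\<alpha>\<close> from \<open>m - \<epsilon>\<close> in place of \<open>m\<close>.\<close>
  define A0 where "A0 = \<bar>a\<bar> + \<alpha> * (\<bar>B\<bar> + \<bar>m\<bar> + 1) + 2"
  define Cc where "Cc = 2 + 2 * C4 * (1 + A0 + 16) + C3 * (8 + \<bar>l\<bar>) + \<alpha>"
  \<comment> \<open>The middle entry ensures \<open>C4 * \<epsilon> \<le> 1 / 2\<close>, the range
    where \<open>t_incr\<close> is valid; the last one keeps the maximum pair closer than
    \<open>\<delta>0\<close>.\<close>
  define \<epsilon>0 where "\<epsilon>0 = min 1 (min (1 / (2 * (C4 + 1))) (\<delta>0 / 4))"
  have \<epsilon>0: "\<epsilon>0 > 0" using C4 \<delta>0 by (simp add: \<epsilon>0_def)
  have main: "\<alpha> * m \<le> a - b + Cc * \<epsilon>" if \<epsilon>: "0 < \<epsilon>" "\<epsilon> \<le> \<epsilon>0" for \<epsilon>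
  proof -
    have \<epsilon>1: "\<epsilon> \<le> 1" "\<epsilon> \<le> \<delta>0 / 4" using \<epsilon> by (auto simp: \<epsilon>0_def)
    have C4\<epsilon>: "C4 * \<epsilon> \<le> 1 / 2"
    proof -
      have "\<epsilon> \<le> 1 / (2 * (C4 + 1))" using \<epsilon> by (auto simp: \<epsilon>0_def)
      then have "\<epsilon> * (2 * (C4 + 1)) \<le> 1" using C4 by (simp add: pos_le_divide_eq)
      then show ?thesis using \<epsilon> by (simp add: algebra_simps)
    qed
    (* Comparing the suprema for the weights N and 2 * N bounds N d^2 at a maximum point for 2 * N. *)
    obtain N k0 where N: "2 / \<epsilon> \<le> N" "0 < N" and k0: "\<And>k. k \<ge> k0 \<Longrightarrow> S k N - S k (2 * N) \<le> \<epsilon>"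
      using doubling_parameter[of S m \<epsilon> "2 / \<epsilon>", OF Sk SN mS \<epsilon>(1)] by blast
    define Cq where "Cq = 2 * \<bar>B\<bar> + \<bar>m\<bar> + 1"
    have Cq: "Cq > 0" by (simp add: Cq_def add_nonneg_pos)
    \<comment> \<open>Bounds both components of the penalty gradient in (y, t): the weight is
      \<open>2 * N\<close>, so they are at most \<open>4 * N * d\<close>, and
      \<open>d \<le> \<epsilon>\<close> will hold.\<close>
    define R0 where "R0 = 4 * N * \<epsilon>"
    have R0: "R0 > 0" using N \<epsilon> by (simp add: R0_def)
    define M1 where "M1 = A0 + R0 + 1"
    obtain Q where Q: "\<And>x y t px py. \<bar>py\<bar> \<le> R0 + 1 \<Longrightarrow> Q \<le> norm px \<Longrightarrow> M1 + 1 \<le> G x y t px py"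
      using coercive R0 unfolding coercive_px_def by (metis add_pos_pos zero_less_one)
    define R where "R = max (\<bar>Q\<bar> + 1) R0 + 1"
    obtain \<delta>1 where \<delta>1: "\<delta>1 > 0" "\<And>x x' y t p p' q q'. dist x x' < \<delta>1 \<Longrightarrow> dist p p' < \<delta>1 \<Longrightarrow> dist q q' < \<delta>1 \<Longrightarrow>
      norm p \<le> R \<Longrightarrow> norm p' \<le> R \<Longrightarrow> \<bar>q\<bar> \<le> R \<Longrightarrow> \<bar>q'\<bar> \<le> R \<Longrightarrow> \<bar>G x y t p q - G x' y t p' q'\<bar> < \<epsilon>"
      using G_uniform[OF \<epsilon>(1), of R] by blast
    define \<sigma> where "\<sigma> = min (min \<epsilon> 1) (min (\<delta>1 / 2) (m - c)) / 2"
    have \<sigma>: "\<sigma> > 0" "\<sigma> < \<epsilon>" "\<sigma> < 1" "\<sigma> < \<delta>1" "\<sigma> < m - c" using \<epsilon> \<delta>1(1) cm by (auto simp: \<sigma>_def)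
    define \<mu> where "\<mu> = min \<delta>1 (\<delta>0 / 2)"
    have \<mu>: "\<mu> > 0" using \<delta>1(1) \<delta>0 by (simp add: \<mu>_def)
    \<comment> \<open>Only here is the weight on \<open>x\<close> chosen. \<open>R\<close> and
      \<open>\<delta>1\<close> depend on \<open>N\<close> and \<open>\<epsilon>\<close> but not on
      \<open>k\<close>, so a large weight brings the x-components within \<open>\<delta>1\<close>
      while the gradient in x stays in the ball of radius \<open>R\<close>.\<close>
    obtain k1 :: nat where k1: "Cq / \<mu>\<^sup>2 < real k1" using reals_Archimedean2 by blast
    define k where "k = max k0 k1"
    define \<kappa> where "\<kappa> = real (Suc k)"
    have \<kappa>: "\<kappa> > 0" "Cq / \<mu>\<^sup>2 < \<kappa>" using k1 by (auto simp: \<kappa>_def k_def)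
    have N2: "0 < 2 * N" using N by simp
    have "S k (2 * N) - \<sigma> / 2 < S k (2 * N)" using \<sigma> by simp
    then obtain p where p: "p \<in> K \<times> K" "S k (2 * N) - \<sigma> / 2 < u (fst p) - v (snd p) - q \<kappa> (2 * N) (fst p) (snd p)"
      unfolding \<kappa>_def S_def[of k "2 * N"] using less_cSUP_iff[OF KK bdd[OF N2]] by blast
    have "\<exists>\<beta> z z'. 0 < \<beta> \<and> \<beta> \<le> \<sigma> / 2 \<and> z \<in> K \<and> z' \<in> K \<and>
     (\<forall>w\<in>K. \<forall>w'\<in>K. u w - v w' - q \<kappa> (2*N) w w' - \<beta> * jb w \<le> u z - v z' - q \<kappa> (2*N) z z' - \<beta> * jb z) \<and>
     S k (2 * N) - \<sigma> / 2 - \<sigma> / 2 \<le> u z - v z' - q \<kappa> (2*N) z z' - \<beta> * jb z"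
    proof -
      have p': "fst p \<in> K" "snd p \<in> K" "S k (2 * N) - \<sigma> / 2 \<le> u (fst p) - v (snd p) -
          (\<kappa> * (norm (fst (fst p) - fst (snd p)))\<^sup>2 + 2 * N * (norm (snd (fst p) - snd (snd p)))\<^sup>2)"
        using p by (auto simp: q_def)
      have "0 < \<sigma> / 2" using \<sigma>(1) by simp
      then show ?thesis
        unfolding q_def using doubling_maximum[OF u(1) v(1) K ub vb \<kappa>(1) N2 _ p'] by blast
    qed
    then obtain \<beta> z z' where \<beta>: "0 < \<beta>" "\<beta> \<le> \<sigma> / 2" and z: "z \<in> K" "z' \<in> K" and
      mx: "\<And>w w'. w \<in> K \<Longrightarrow> w' \<in> K \<Longrightarrow> u w - v w' - q \<kappa> (2*N) w w' - \<beta> * jb w \<le> u z - v z' - q \<kappa> (2*N) z z' - \<beta> * jb z"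
      and mge: "S k (2 * N) - \<sigma> / 2 - \<sigma> / 2 \<le> u z - v z' - q \<kappa> (2*N) z z' - \<beta> * jb z"
      by blast
    define \<Phi> where "\<Phi> w w' = u w - v w' - q \<kappa> (2*N) w w' - \<beta> * jb w" for w w'
    have \<beta>jb: "0 \<le> \<beta> * jb w" for w :: "'n spt" using \<beta>(1) jb_pos[of w] by simp
    have \<Phi>m: "m - \<sigma> \<le> \<Phi> z z'" using mge mS[OF N2, of k] by (simp add: \<Phi>_def)
    have qq0: "0 \<le> q \<kappa> (2*N) w w'" for w w' using \<kappa> N2 by (intro q0) auto
    have \<Phi>le: "\<Phi> w w' \<le> u w - v w'" for w w' using \<beta>jb[of w] qq0[of w w'] by (simp add: \<Phi>_def)
    have qC: "q \<kappa> (2*N) z z' \<le> Cq"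
      using \<Phi>m \<beta>jb[of z] ub[OF z(1)] vb[OF z(2)] \<sigma>(3) by (simp add: \<Phi>_def Cq_def)
    define d where "d = norm (snd z - snd z')"
    have d0: "d \<ge> 0" by (simp add: d_def)
    have Nd: "N * d\<^sup>2 \<le> 2 * \<epsilon>"
    proof -
      have "u z - v z' - q \<kappa> N z z' \<le> S k N" using S_ge[OF N(2) z, of k] by (simp add: \<kappa>_def)
      moreover have "q \<kappa> (2*N) z z' = q \<kappa> N z z' + N * d\<^sup>2" by (simp add: q_def d_def)
      ultimately have "N * d\<^sup>2 \<le> S k N - S k (2*N) + \<sigma>" using mge \<beta>jb[of z] by linarith
      then show ?thesis using k0[of k] \<sigma>(2) by (simp add: k_def)
    qed
    \<comment> \<open>The lower bound \<open>2 / \<epsilon> \<le> N\<close> turns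
      \<open>N * d\<^sup>2 \<le> 2 * \<epsilon>\<close> into
      \<open>d \<le> \<epsilon>\<close>.\<close>
    have d\<epsilon>: "d \<le> \<epsilon>"
    proof -
      have "2 / \<epsilon> * d\<^sup>2 \<le> N * d\<^sup>2" using N by (intro mult_right_mono) auto
      then have "2 / \<epsilon> * d\<^sup>2 \<le> 2 * \<epsilon>" using Nd by linarith
      then have "d\<^sup>2 \<le> \<epsilon>\<^sup>2" using \<epsilon>(1) by (simp add: field_simps power2_eq_square)
      then show ?thesis by (rule power2_le_imp_le) (use \<epsilon> in simp)
    qed
    have xx: "norm (fst z - fst z') < \<mu>"
    proof -
      have "\<kappa> * (norm (fst z - fst z'))\<^sup>2 \<le> Cq" using qC N2 unfolding q_def by (smt (verit) mult_nonneg_nonneg zero_le_power2)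
      also have "Cq < \<kappa> * \<mu>\<^sup>2" using \<kappa>(2) \<mu> by (simp add: pos_divide_less_eq)
      finally have "(norm (fst z - fst z'))\<^sup>2 < \<mu>\<^sup>2" using \<kappa>(1) by simp
      then show ?thesis by (rule power2_less_imp_less) (use \<mu> in simp)
    qed
    have dzz: "dist z z' < \<delta>0"
    proof -
      have "dist z z' \<le> norm (fst z - fst z') + d"
        unfolding d_def by (metis dist_norm dist_prod_def sqrt_sum_squares_le_sum norm_ge_zero)
      then show ?thesis using xx d\<epsilon> \<epsilon>1(2) \<delta>0 by (auto simp: \<mu>_def)
    qed
    have zO: "z \<in> \<Omega>" "z' \<in> \<Omega>" using z K(2) by auto
    have c\<Phi>: "c < \<Phi> z z'" using \<Phi>m \<sigma>(5) by simp
    define r where "r = \<delta>0 - dist z z'"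
    have r: "r > 0" using dzz by (simp add: r_def)
    have max1: "\<Phi> w z' \<le> \<Phi> z z'" if "w \<in> ball z r" "w \<in> \<Omega>" for w
    proof (cases "w \<in> K")
      case True
      then show ?thesis using mx[OF True z(2)] by (simp add: \<Phi>_def)
    next
      case False
      have "dist w z' \<le> dist w z + dist z z'" by (rule dist_triangle)
      then have "dist w z' < \<delta>0" using that(1) by (auto simp: r_def dist_commute)
      then have "u w - v z' \<le> c" using off[OF that(2) zO(2)] False by blast
      then show ?thesis using \<Phi>le[of w z'] c\<Phi> by linarith
    qed
    have max2: "\<Phi> z w \<le> \<Phi> z z'" if "w \<in> ball z' r" "w \<in> \<Omega>" for w
    proof (cases "w \<in> K")
      case True
      then show ?thesis using mx[OF z(1) True] by (simp add: \<Phi>_def)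
    next
      case False
      have "dist z w \<le> dist z z' + dist z' w" by (rule dist_triangle)
      then have "dist z w < \<delta>0" using that(1) by (auto simp: r_def)
      then have "u z - v w \<le> c" using off[OF zO(1) that(2)] False by blast
      then show ?thesis using \<Phi>le[of z w] c\<Phi> by linarith
    qed
    \<comment> \<open>\<open>\<xi>\<close> and \<open>s\<close> are common to both inequalities;
      only \<open>bb\<close>, of norm at most \<open>\<sigma>\<close>, distinguishes the two
      gradients.\<close>
    define \<xi> where "\<xi> = (2 * \<kappa>) *\<^sub>R (fst z - fst z')"
    define s where "s = (4 * N) *\<^sub>R (snd z - snd z')"
    define bb where "bb = \<beta> *\<^sub>R ((1 / jb z) *\<^sub>R z)"
    have t1: "test_fun (\<lambda>w. (\<kappa> * (norm (fst w - fst z'))\<^sup>2 + (2*N) * (norm (snd w - snd z'))\<^sup>2) + \<beta> * jb w)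
       (\<lambda>w. (\<kappa> *\<^sub>R (2 *\<^sub>R (fst w - fst z'), 0) + (2*N) *\<^sub>R (0, 2 *\<^sub>R (snd w - snd z'))) + \<beta> *\<^sub>R ((1 / jb w) *\<^sub>R w))"
      by (intro test_fun_add test_fun_cmult test_fun_sqdist_fst test_fun_sqdist_snd test_fun_jb)
    have t2: "test_fun (\<lambda>w. - (\<kappa> * (norm (fst w - fst z))\<^sup>2 + (2*N) * (norm (snd w - snd z))\<^sup>2))
       (\<lambda>w. - (\<kappa> *\<^sub>R (2 *\<^sub>R (fst w - fst z), 0) + (2*N) *\<^sub>R (0, 2 *\<^sub>R (snd w - snd z))))"
      by (intro test_fun_minus test_fun_add test_fun_cmult test_fun_sqdist_fst test_fun_sqdist_snd)
    have "HJ G \<alpha> a z (u z) ((\<kappa> *\<^sub>R (2 *\<^sub>R (fst z - fst z'), 0) + (2*N) *\<^sub>R (0, 2 *\<^sub>R (snd z - snd z'))) + \<beta> *\<^sub>R ((1 / jb z) *\<^sub>R z)) \<le> 0"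
    proof (rule subsolD[OF u(2) zO(1) t1 r])
      fix w assume "w \<in> ball z r" "w \<in> \<Omega>"
      from max1[OF this] show "u w - ((\<kappa> * (norm (fst w - fst z'))\<^sup>2 + (2*N) * (norm (snd w - snd z'))\<^sup>2) + \<beta> * jb w)
         \<le> u z - ((\<kappa> * (norm (fst z - fst z'))\<^sup>2 + (2*N) * (norm (snd z - snd z'))\<^sup>2) + \<beta> * jb z)"
        by (simp add: \<Phi>_def q_def)
    qed
    also have "(\<kappa> *\<^sub>R (2 *\<^sub>R (fst z - fst z'), 0) + (2*N) *\<^sub>R (0, 2 *\<^sub>R (snd z - snd z'))) + \<beta> *\<^sub>R ((1 / jb z) *\<^sub>R z) = (\<xi>, s) + bb"
      by (simp add: \<xi>_def s_def bb_def)
    finally have sub: "HJ G \<alpha> a z (u z) ((\<xi>, s) + bb) \<le> 0" .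
    have "0 \<le> HJ G \<alpha> b z' (v z') (- (\<kappa> *\<^sub>R (2 *\<^sub>R (fst z' - fst z), 0) + (2*N) *\<^sub>R (0, 2 *\<^sub>R (snd z' - snd z))))"
    proof (rule supsolD[OF v(2) zO(2) t2 r])
      fix w assume "w \<in> ball z' r" "w \<in> \<Omega>"
      from max2[OF this] show "v z' - - (\<kappa> * (norm (fst z' - fst z))\<^sup>2 + (2*N) * (norm (snd z' - snd z))\<^sup>2)
         \<le> v w - - (\<kappa> * (norm (fst w - fst z))\<^sup>2 + (2*N) * (norm (snd w - snd z))\<^sup>2)"
        by (simp add: \<Phi>_def q_def norm_minus_commute)
    qed
    also have "- (\<kappa> *\<^sub>R (2 *\<^sub>R (fst z' - fst z), 0) + (2*N) *\<^sub>R (0, 2 *\<^sub>R (snd z' - snd z))) = (\<xi>, s)"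
      by (simp add: \<xi>_def s_def algebra_simps)
    finally have sup: "0 \<le> HJ G \<alpha> b z' (v z') (\<xi>, s)" .
    obtain x y t where zx: "z = (x, y, t)" by (cases z) auto
    obtain x' y' t' where zx': "z' = (x', y', t')" by (cases z') auto
    obtain sy st where ss: "s = (sy, st)" by (cases s)
    obtain bx byy bt where bx: "bb = (bx, byy, bt)" by (cases bb) auto
    have nbb: "norm bb \<le> \<sigma>"
    proof -
      have "norm bb = \<beta> * (norm z / jb z)" using \<beta>(1) jb_pos[of z] by (simp add: bb_def)
      also have "\<dots> \<le> \<beta> * 1" using \<beta>(1) jb_ge_norm[of z] jb_pos[of z] by (intro mult_left_mono) (auto simp: pos_divide_le_eq)
      finally show ?thesis using \<beta>(2) \<sigma>(1) by simp
    qed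
    have nb: "norm bx \<le> \<sigma>" "\<bar>byy\<bar> \<le> \<sigma>" "\<bar>bt\<bar> \<le> \<sigma>"
      using nbb norm_fst_le[of "bx" "(byy,bt)"] norm_snd_le[of "(byy,bt)" bx] norm_fst_le[of byy bt] norm_snd_le[of bt byy]
      by (auto simp: bx)
    have yt: "\<bar>y' - y\<bar> \<le> d" "\<bar>t' - t\<bar> \<le> d"
      using norm_fst_le[of "y - y'" "t - t'"] norm_snd_le[of "t - t'" "y - y'"] by (auto simp: d_def zx zx')
    have syt: "sy = 4 * N * (y - y')" "st = 4 * N * (t - t')" using ss by (auto simp: s_def zx zx')
    have sN: "\<bar>sy\<bar> \<le> 4 * N * d" "\<bar>st\<bar> \<le> 4 * N * d" using yt N(2) by (auto simp: syt abs_mult abs_minus_commute)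
    have "4 * N * d \<le> R0" unfolding R0_def using N(2) d\<epsilon> by (intro mult_left_mono) auto
    then have sR: "\<bar>sy\<bar> \<le> R0" "\<bar>st\<bar> \<le> R0" using sN by auto
    have u_abs: "\<bar>u z\<bar> \<le> \<bar>B\<bar> + \<bar>m\<bar> + 1"
      using ub[OF z(1)] \<Phi>le[of z z'] \<Phi>m vb[OF z(2)] \<sigma>(3) by linarith
    have \<alpha>u: "\<bar>\<alpha> * u z\<bar> \<le> \<alpha> * (\<bar>B\<bar> + \<bar>m\<bar> + 1)" using u_abs \<alpha> by (simp add: abs_mult mult_left_mono)
    have sub': "st + bt + G x y t (\<xi> + bx) (sy + byy) + \<alpha> * u z - a \<le> 0" using sub by (simp add: HJ_def zx ss bx)
    have sup': "0 \<le> st + G x' y' t' \<xi> sy + \<alpha> * v z' - b" using sup by (simp add: HJ_def zx' ss)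
    have Gle: "G x y t (\<xi> + bx) (sy + byy) \<le> a - \<alpha> * u z - st - bt" using sub' by linarith
    \<comment> \<open>The coercive step: the subsolution inequality bounds \<open>G\<close> by
      \<open>M1\<close>, independently of \<open>k\<close>, although \<open>\<xi>\<close> carries
      the factor \<open>\<kappa>\<close>.\<close>
    have "norm (\<xi> + bx) < Q"
    proof (rule ccontr)
      assume "\<not> ?thesis"
      then have "M1 + 1 \<le> G x y t (\<xi> + bx) (sy + byy)" using sR nb \<sigma>(3) by (intro Q) auto
      moreover have "a - \<alpha> * u z - st - bt \<le> M1" using \<alpha>u sR nb \<sigma>(3) unfolding M1_def A0_def by linarith
      ultimately show False using Gle by linarith
    qed
    then have n\<xi>: "norm (\<xi> + bx) \<le> R" "norm \<xi> \<le> R"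
      using norm_triangle_ineq4[of "\<xi> + bx" bx] nb \<sigma>(3) by (auto simp: R_def)
    have "\<bar>G x y t (\<xi> + bx) (sy + byy) - G x' y t \<xi> sy\<bar> < \<epsilon>"
    proof (rule \<delta>1(2))
      show "dist x x' < \<delta>1" using xx by (simp add: zx zx' dist_norm \<mu>_def)
      show "dist (\<xi> + bx) \<xi> < \<delta>1" "dist (sy + byy) sy < \<delta>1" using nb \<sigma>(4) by (auto simp: dist_norm)
      show "\<bar>sy + byy\<bar> \<le> R" "\<bar>sy\<bar> \<le> R" using sR nb \<sigma>(3) by (auto simp: R_def)
    qed (use n\<xi> in auto)
    \<comment> \<open>An upper bound for \<open>G\<close> at \<open>x'\<close> with the common
      gradient. One \<open>\<epsilon>\<close> pays for the change of x and of the gradient, the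
      other for \<open>bt\<close>.\<close>
    define Y where "Y = a - \<alpha> * u z - st + 2 * \<epsilon>"
    have GY: "G x' y t \<xi> sy \<le> Y"
      using \<open>\<bar>G x y t (\<xi> + bx) (sy + byy) - G x' y t \<xi> sy\<bar> < \<epsilon>\<close> Gle nb \<sigma>(2) by (auto simp: Y_def)
    have C4t: "C4 * \<bar>t' - t\<bar> \<le> 1 / 2"
    proof -
      have "C4 * \<bar>t' - t\<bar> \<le> C4 * \<epsilon>" using yt d\<epsilon> C4 by (intro mult_left_mono) auto
      then show ?thesis using C4\<epsilon> by simp
    qed
    have G1: "G x' y t' \<xi> sy \<le> Y + 2 * C4 * (1 + \<bar>sy\<bar> + \<bar>Y\<bar>) * \<bar>t' - t\<bar>" by (rule t_incr_le[OF GY C4t])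
    have G2: "G x' y' t' \<xi> sy \<le> G x' y t' \<xi> sy + C3 * \<bar>sy + l\<bar> * \<bar>y' - y\<bar>" using y_incr[of x' y' t' \<xi> sy y] by linarith
    have Yab: "\<bar>Y\<bar> \<le> A0 + 4 * N * d" using \<alpha>u sN \<epsilon>1 \<epsilon>(1) by (auto simp: Y_def A0_def)
    \<comment> \<open>Multiplied by a displacement of size \<open>d\<close>, the large slopes of
      size \<open>4 * N * d\<close> in y and t contribute \<open>O(\<epsilon>)\<close>; this defeats
      the factor |p_y| in both structure conditions.\<close>
    have NdD: "4 * N * d * d \<le> 8 * \<epsilon>" using Nd by (simp add: power2_eq_square)
    have E1: "2 * C4 * (1 + \<bar>sy\<bar> + \<bar>Y\<bar>) * \<bar>t' - t\<bar> \<le> 2 * C4 * (1 + A0 + 16) * \<epsilon>"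
    proof -
      have A0p: "0 \<le> A0" using \<alpha> by (simp add: A0_def)
      have "(1 + \<bar>sy\<bar> + \<bar>Y\<bar>) * \<bar>t' - t\<bar> \<le> (1 + A0 + 2 * (4 * N * d)) * d"
        using sN Yab yt d0 A0p N(2) by (intro mult_mono) auto
      also have "\<dots> = (1 + A0) * d + 2 * (4 * N * d * d)" by (simp add: algebra_simps)
      also have "\<dots> \<le> (1 + A0) * \<epsilon> + 2 * (8 * \<epsilon>)" using NdD d\<epsilon> A0p by (intro add_mono mult_left_mono) auto
      finally have "(1 + \<bar>sy\<bar> + \<bar>Y\<bar>) * \<bar>t' - t\<bar> \<le> (1 + A0 + 16) * \<epsilon>" by (simp add: algebra_simps)
      then have "2 * C4 * ((1 + \<bar>sy\<bar> + \<bar>Y\<bar>) * \<bar>t' - t\<bar>) \<le> 2 * C4 * ((1 + A0 + 16) * \<epsilon>)" using C4 by (intro mult_left_mono) auto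
      then show ?thesis by (simp add: mult.assoc)
    qed
    have E2: "C3 * \<bar>sy + l\<bar> * \<bar>y' - y\<bar> \<le> C3 * (8 + \<bar>l\<bar>) * \<epsilon>"
    proof -
      have "\<bar>sy + l\<bar> * \<bar>y' - y\<bar> \<le> (4 * N * d + \<bar>l\<bar>) * d" using sN yt d0 N(2) by (intro mult_mono) auto
      also have "\<dots> = 4 * N * d * d + \<bar>l\<bar> * d" by (simp add: algebra_simps)
      also have "\<dots> \<le> 8 * \<epsilon> + \<bar>l\<bar> * \<epsilon>" using NdD d\<epsilon> by (intro add_mono mult_left_mono) auto
      finally have "C3 * (\<bar>sy + l\<bar> * \<bar>y' - y\<bar>) \<le> C3 * (8 * \<epsilon> + \<bar>l\<bar> * \<epsilon>)" using C3 by (intro mult_left_mono) auto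
      then show ?thesis by (simp add: algebra_simps)
    qed
    have "\<alpha> * (m - \<epsilon>) \<le> \<alpha> * (u z - v z')"
      using \<Phi>le[of z z'] \<Phi>m \<sigma>(2) \<alpha> by (intro mult_left_mono) auto
    then have "\<alpha> * m \<le> \<alpha> * u z - \<alpha> * v z' + \<alpha> * \<epsilon>" by (simp add: algebra_simps)
    then have "\<alpha> * m \<le> a - b + 2 * \<epsilon> + 2 * C4 * (1 + A0 + 16) * \<epsilon> + C3 * (8 + \<bar>l\<bar>) * \<epsilon> + \<alpha> * \<epsilon>"
      using sup' G1 G2 E1 E2 unfolding Y_def by linarith
    then show ?thesis unfolding Cc_def by (simp add: distrib_right)
  qed
  show ?thesis
  proof (rule field_le_epsilon)
    fix e :: real assume e: "e > 0"
    define \<epsilon> where "\<epsilon> = min \<epsilon>0 (e / (\<bar>Cc\<bar> + 1))"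
    have "\<epsilon> > 0" "\<epsilon> \<le> \<epsilon>0" using \<epsilon>0 e by (auto simp: \<epsilon>_def)
    moreover have "Cc * \<epsilon> \<le> e"
    proof -
      have "\<epsilon> \<le> e / (\<bar>Cc\<bar> + 1)" by (simp add: \<epsilon>_def)
      then have "\<epsilon> * (\<bar>Cc\<bar> + 1) \<le> e" by (simp add: pos_le_divide_eq)
      moreover have "Cc * \<epsilon> \<le> \<bar>Cc\<bar> * \<epsilon>" using \<open>\<epsilon> > 0\<close> by (intro mult_right_mono) auto
      moreover have "\<epsilon> * (\<bar>Cc\<bar> + 1) = \<bar>Cc\<bar> * \<epsilon> + \<epsilon>" by (simp add: algebra_simps)
      ultimately show ?thesis using \<open>\<epsilon> > 0\<close> by linarith
    qed
    ultimately show "\<alpha> * m \<le> a - b + e" using main[of \<epsilon>] by linarith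
  qed
qed

end

section \<open>The discounted problem\<close>

lemma C1_test_imp_test_fun:
  assumes "C1_test \<phi> \<phi>'"
  shows "\<exists>g. test_fun \<phi> g \<and> (\<forall>z. \<phi>' z = (\<lambda>h. g z \<bullet> h))"
proof -
  define g where "g z = (\<Sum>b\<in>Basis. \<phi>' z b *\<^sub>R b)" for z
  have eq: "\<phi>' z h = g z \<bullet> h" for z h
  proof -
    interpret bounded_linear "\<phi>' z" using assms unfolding C1_test_def has_derivative_def by blast
    have "\<phi>' z h = \<phi>' z (\<Sum>b\<in>Basis. (h \<bullet> b) *\<^sub>R b)" by (simp add: euclidean_representation)
    also have "\<dots> = (\<Sum>b\<in>Basis. (h \<bullet> b) * \<phi>' z b)" by (simp add: sum scaleR)
    also have "\<dots> = g z \<bullet> h"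
      unfolding g_def inner_sum_left inner_scaleR_left by (rule sum.cong) (simp_all add: inner_commute mult.commute)
    finally show ?thesis .
  qed
  have "test_fun \<phi> g"
  proof (rule test_funI[OF _ eq])
    show "(\<phi> has_derivative \<phi>' z) (at z)" for z using assms by (simp add: C1_test_def)
    show "continuous_on UNIV g" unfolding g_def
      using assms by (intro continuous_intros) (auto simp: C1_test_def)
  qed
  then show ?thesis using eq by blast
qed

lemma test_fun_imp_C1_test: "test_fun \<phi> g \<Longrightarrow> C1_test \<phi> (\<lambda>z h. g z \<bullet> h)"
  by (auto simp: C1_test_def test_fun_def intro!: continuous_intros)

lemma eqF_eq_HJ: "eqF G \<alpha> c z r (\<lambda>h. g \<bullet> h) = HJ G \<alpha> c z r g"
proof -
  obtain x y t where z: "z = (x, y, t)" by (cases z) auto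
  obtain px py pt where g: "g = (px, py, pt)" by (cases g) auto
  have "(\<chi> i. px \<bullet> axis i 1) = px" by (simp add: vec_eq_iff inner_axis)
  then show ?thesis by (simp add: eqF_def HJ_def z g inner_prod_def)
qed

lemma visc_sub_iff_subsol: "visc_sub (eqF G \<alpha> c) \<Omega> U \<longleftrightarrow> subsol (HJ G \<alpha> c) \<Omega> (usc_env \<Omega> U)"
proof
  assume v: "visc_sub (eqF G \<alpha> c) \<Omega> U"
  show "subsol (HJ G \<alpha> c) \<Omega> (usc_env \<Omega> U)" unfolding subsol_def
  proof (intro ballI allI impI)
    fix z \<phi> g assume z: "z \<in> \<Omega>" and *: "test_fun \<phi> g \<and> (\<exists>e>0. \<forall>w\<in>ball z e \<inter> \<Omega>. usc_env \<Omega> U w - \<phi> w \<le> usc_env \<Omega> U z - \<phi> z)"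
    then have "eqF G \<alpha> c z (usc_env \<Omega> U z) ((\<lambda>z h. g z \<bullet> h) z) \<le> 0"
      using v test_fun_imp_C1_test[of \<phi> g] unfolding visc_sub_def by blast
    then show "HJ G \<alpha> c z (usc_env \<Omega> U z) (g z) \<le> 0" by (simp only: eqF_eq_HJ)
  qed
next
  assume v: "subsol (HJ G \<alpha> c) \<Omega> (usc_env \<Omega> U)"
  show "visc_sub (eqF G \<alpha> c) \<Omega> U" unfolding visc_sub_def
  proof (intro ballI allI impI)
    fix z \<phi> \<phi>' assume z: "z \<in> \<Omega>" and *: "C1_test \<phi> \<phi>' \<and> (\<exists>e>0. \<forall>w\<in>ball z e \<inter> \<Omega>. usc_env \<Omega> U w - \<phi> w \<le> usc_env \<Omega> U z - \<phi> z)"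
    obtain g where g: "test_fun \<phi> g" "\<And>z. \<phi>' z = (\<lambda>h. g z \<bullet> h)" using C1_test_imp_test_fun * by blast
    then show "eqF G \<alpha> c z (usc_env \<Omega> U z) (\<phi>' z) \<le> 0"
      using v z * unfolding subsol_def g(2) eqF_eq_HJ by blast
  qed
qed

lemma visc_super_iff_supsol: "visc_super (eqF G \<alpha> c) \<Omega> U \<longleftrightarrow> supsol (HJ G \<alpha> c) \<Omega> (lsc_env \<Omega> U)"
proof
  assume v: "visc_super (eqF G \<alpha> c) \<Omega> U"
  show "supsol (HJ G \<alpha> c) \<Omega> (lsc_env \<Omega> U)"
  proof (rule supsolI)
    fix z \<phi> g e assume z: "z \<in> \<Omega>" and t: "test_fun \<phi> g" and e: "(e::real) > 0"
      and "\<And>w. w \<in> ball z e \<Longrightarrow> w \<in> \<Omega> \<Longrightarrow> lsc_env \<Omega> U z - \<phi> z \<le> lsc_env \<Omega> U w - \<phi> w"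
    then have "\<exists>e>0. \<forall>w\<in>ball z e \<inter> \<Omega>. lsc_env \<Omega> U z - \<phi> z \<le> lsc_env \<Omega> U w - \<phi> w" by blast
    then have "0 \<le> eqF G \<alpha> c z (lsc_env \<Omega> U z) ((\<lambda>z h. g z \<bullet> h) z)"
      using v z test_fun_imp_C1_test[OF t] unfolding visc_super_def by blast
    then show "0 \<le> HJ G \<alpha> c z (lsc_env \<Omega> U z) (g z)" by (simp only: eqF_eq_HJ)
  qed
next
  assume v: "supsol (HJ G \<alpha> c) \<Omega> (lsc_env \<Omega> U)"
  show "visc_super (eqF G \<alpha> c) \<Omega> U" unfolding visc_super_def
  proof (intro ballI allI impI)
    fix z \<phi> \<phi>' assume z: "z \<in> \<Omega>" and *: "C1_test \<phi> \<phi>' \<and> (\<exists>e>0. \<forall>w\<in>ball z e \<inter> \<Omega>. lsc_env \<Omega> U z - \<phi> z \<le> lsc_env \<Omega> U w - \<phi> w)"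
    obtain g where g: "test_fun \<phi> g" "\<And>z. \<phi>' z = (\<lambda>h. g z \<bullet> h)" using C1_test_imp_test_fun * by blast
    obtain e where e: "e > 0" "\<And>w. w\<in>ball z e \<Longrightarrow> w \<in> \<Omega> \<Longrightarrow> lsc_env \<Omega> U z - \<phi> z \<le> lsc_env \<Omega> U w - \<phi> w"
      using * by blast
    show "0 \<le> eqF G \<alpha> c z (lsc_env \<Omega> U z) (\<phi>' z)"
      unfolding g(2) eqF_eq_HJ by (rule supsolD[OF v z g(1) e])
  qed
qed

lemma subsol_cong:
  assumes "\<And>z. z \<in> \<Omega> \<Longrightarrow> u z = v z" shows "subsol F \<Omega> u \<longleftrightarrow> subsol F \<Omega> v"
  using assms unfolding subsol_def by auto

lemma supsol_cong:
  assumes "\<And>z. z \<in> \<Omega> \<Longrightarrow> u z = v z" shows "supsol F \<Omega> u \<longleftrightarrow> supsol F \<Omega> v"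
  unfolding supsol_def by (rule subsol_cong) (use assms in simp)

lemma visc_sol_iff:
  assumes "open \<Omega>"
  shows "visc_sol (eqF G \<alpha> c) \<Omega> U \<longleftrightarrow>
    continuous_on \<Omega> U \<and> subsol (HJ G \<alpha> c) \<Omega> U \<and> supsol (HJ G \<alpha> c) \<Omega> U"
proof (cases "continuous_on \<Omega> U")
  case True
  then show ?thesis
    unfolding visc_sol_def visc_sub_iff_subsol visc_super_iff_supsol
    using subsol_cong[of \<Omega> "usc_env \<Omega> U" U] supsol_cong[of \<Omega> "lsc_env \<Omega> U" U] usc_env_continuous[OF assms]
    by simp
qed (simp add: visc_sol_def)

lemma usc_lsc_imp_continuous_on:
  assumes "open \<Omega>" "usc_on \<Omega> u" "lsc_on \<Omega> u" shows "continuous_on \<Omega> u"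
proof -
  have "isCont u z" if z: "z \<in> \<Omega>" for z
  proof -
    have "\<forall>\<^sub>F w in nhds z. dist (u w) (u z) < e" if e: "e > 0" for e
    proof -
    have "\<forall>\<^sub>F w in nhds z. u w < u z + e" "\<forall>\<^sub>F w in nhds z. - u w < - u z + e"
      using usc_onD[OF assms(2) z e] usc_onD[OF assms(3)[unfolded lsc_on_def] z e] by auto
      then show ?thesis by eventually_elim (auto simp: dist_real_def)
    qed
    then have "(u \<longlongrightarrow> u z) (nhds z)" by (simp add: tendsto_iff)
    then show ?thesis by (simp add: isCont_def tendsto_at_iff_tendsto_nhds)
  qed
  then show ?thesis by (simp add: continuous_at_imp_continuous_on)
qed

lemma subsol_shift:
  assumes F: "\<And>z r p. F (z + k) r p = F z r p" and u: "subsol F UNIV u"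
  shows "subsol F UNIV (\<lambda>z. u (z + k))"
proof (rule subsolI)
  fix z \<phi> g and e :: real assume t: "test_fun \<phi> g" and e: "e > 0"
    and max: "\<And>w. w \<in> ball z e \<Longrightarrow> w \<in> UNIV \<Longrightarrow> u (w + k) - \<phi> w \<le> u (z + k) - \<phi> z"
  have "F (z + k) (u (z + k)) (g (z + k + - k)) \<le> 0"
  proof (rule subsolD[OF u UNIV_I test_fun_shift[OF t, of "- k"] e])
    fix w assume "w \<in> ball (z + k) e"
    then have "w - k \<in> ball z e" by (simp add: dist_norm algebra_simps)
    from max[OF this] show "u w - \<phi> (w + - k) \<le> u (z + k) - \<phi> (z + k + - k)" by simp
  qed
  then show "F z (u (z + k)) (g z) \<le> 0" by (simp add: F)
qed

lemma supsol_shift: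
  assumes "\<And>z r p. F (z + k) r p = F z r p" "supsol F UNIV u"
  shows "supsol F UNIV (\<lambda>z. u (z + k))"
  using subsol_shift[of "dual_eq F" k "\<lambda>z. - u z"] assms by (simp add: supsol_def dual_eq_def)

section \<open>Functions periodic under the space-time lattice\<close>

definition lattice_pt :: "('n::finite) spt \<Rightarrow> bool" where
  "lattice_pt k \<longleftrightarrow> int_vec (fst k) \<and> fst (snd k) \<in> \<int> \<and> snd (snd k) \<in> \<int>"

definition per_fun :: "(('n::finite) spt \<Rightarrow> real) \<Rightarrow> bool" where
  "per_fun W \<longleftrightarrow> (\<forall>z k. lattice_pt k \<longrightarrow> W (z + k) = W z)"

lemma per_funD: "per_fun W \<Longrightarrow> lattice_pt k \<Longrightarrow> W (z + k) = W z"
  unfolding per_fun_def by blast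

lemma st_periodic_iff: "st_periodic w \<longleftrightarrow> per_fun (uncurry3 w)"
proof
  assume w: "st_periodic w"
  show "per_fun (uncurry3 w)" unfolding per_fun_def
  proof (intro allI impI)
    fix z k :: "'a spt" assume k: "lattice_pt k"
    obtain x y t where z: "z = (x, y, t)" by (cases z) auto
    obtain kx i j where kk: "k = (kx, of_int i, of_int j)" "int_vec kx"
      using k by (cases k) (auto simp: lattice_pt_def elim!: Ints_cases)
    have "w (x + kx) (y + of_int i) (t + of_int j) = w (x + kx) y (t + of_int j)"
      using w by (intro periodic_int[of "\<lambda>y. w (x + kx) y (t + of_int j)"]) (simp add: st_periodic_def)
    also have "\<dots> = w (x + kx) y t" using w by (intro periodic_int[of "\<lambda>t. w (x + kx) y t"]) (simp add: st_periodic_def)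
    also have "\<dots> = w x y t" using w kk by (simp add: st_periodic_def)
    finally show "uncurry3 w (z + k) = uncurry3 w z" by (simp add: uncurry3_def z kk)
  qed
next
  assume w: "per_fun (uncurry3 w)"
  have "int_vec (0 :: real^'a)" by (simp add: int_vec_def)
  then have "w (x + k) y t = w x y t" if "int_vec k" for x y t k
    using per_funD[OF w, of "(k, 0, 0)" "(x, y, t)"] that by (simp add: lattice_pt_def uncurry3_def)
  moreover have "w x (y + 1) t = w x y t" "w x y (t + 1) = w x y t" for x y t
    using per_funD[OF w, of "(0, 1, 0)" "(x, y, t)"] per_funD[OF w, of "(0, 0, 1)" "(x, y, t)"] \<open>int_vec 0\<close>
    by (simp_all add: lattice_pt_def uncurry3_def)
  ultimately show "st_periodic w" by (simp add: st_periodic_def)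
qed

text \<open>Three periods wide in every direction, so that a single lattice shift carries a point
  together with its open unit ball into the cell.\<close>

definition pcell :: "('n::finite) spt set" where
  "pcell = cbox (\<chi> i. -1) (\<chi> i. 2) \<times> {-1..2} \<times> {-1..2}"

lemma compact_pcell: "compact pcell"
  unfolding pcell_def by (intro compact_Times compact_cbox compact_Icc)

lemma lattice_shift_into_pcell:
  fixes z :: "('n::finite) spt"
  shows "\<exists>k. lattice_pt k \<and> (\<forall>z'. dist z z' < 1 \<longrightarrow> z' + k \<in> pcell)"
proof -
  obtain x y t where z: "z = (x, y, t)" by (cases z) auto
  define k :: "'n spt" where "k = ((\<chi> i. - of_int \<lfloor>x $ i\<rfloor>), - of_int \<lfloor>y\<rfloor>, - of_int \<lfloor>t\<rfloor>)"
  have near: "- 1 \<le> b - of_int \<lfloor>a\<rfloor> \<and> b - of_int \<lfloor>a\<rfloor> \<le> 2" if "\<bar>a - b\<bar> < 1" for a b :: real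
    using that of_int_floor_le[of a] real_of_int_floor_add_one_gt[of a] by linarith
  have "z' + k \<in> pcell" if d: "dist z z' < 1" for z'
  proof -
    obtain x' y' t' where z': "z' = (x', y', t')" by (cases z') auto
    have dx: "norm (x - x') < 1" and d2: "norm (y - y', t - t') < 1"
      using d norm_fst_le[of "x - x'" "(y - y', t - t')"] norm_snd_le[of "(y - y', t - t')" "x - x'"] by (auto simp: z z' dist_norm)
    have "\<bar>x $ i - x' $ i\<bar> < 1" for i using component_le_norm_cart[of "x - x'" i] dx by simp
    moreover have "\<bar>y - y'\<bar> < 1" "\<bar>t - t'\<bar> < 1"
      using d2 norm_fst_le[of "y - y'" "t - t'"] norm_snd_le[of "t - t'" "y - y'"] by auto
    ultimately show ?thesis using near[of "x $ _" "x' $ _"] near[of y y'] near[of t t']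
      by (simp add: pcell_def k_def z' mem_box_cart)
  qed
  moreover have "lattice_pt k" by (simp add: lattice_pt_def k_def int_vec_def)
  ultimately show ?thesis by blast
qed

lemma per_fun_bounded:
  fixes W :: "('n::finite) spt \<Rightarrow> real"
  assumes c: "continuous_on UNIV W" and p: "per_fun W"
  shows "\<exists>B. \<forall>z. \<bar>W z\<bar> \<le> B"
proof -
  have "bounded (W ` pcell)"
    by (intro compact_imp_bounded compact_continuous_image continuous_on_subset[OF c] compact_pcell) auto
  then obtain B where B: "\<forall>b\<in>W ` pcell. norm b \<le> B" unfolding bounded_iff by blast
  have "\<bar>W z\<bar> \<le> B" for z
  proof -
    obtain k :: "'n spt" where k: "lattice_pt k" "z + k \<in> pcell" using lattice_shift_into_pcell[of z] by (metis dist_self zero_less_one)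
    then have "norm (W (z + k)) \<le> B" using B by blast
    then show ?thesis using per_funD[OF p k(1)] by simp
  qed
  then show ?thesis by blast
qed

lemma per_fun_uniformly_continuous:
  fixes W :: "('n::finite) spt \<Rightarrow> real"
  assumes c: "continuous_on UNIV W" and p: "per_fun W"
  shows "uniformly_continuous_on UNIV W"
  unfolding uniformly_continuous_on_def
proof (intro allI impI)
  fix e :: real assume e: "e > 0"
  have "uniformly_continuous_on pcell W"
    by (rule compact_uniformly_continuous[OF continuous_on_subset[OF c] compact_pcell]) simp
  then obtain d where d: "d > 0" "\<And>a b. a \<in> pcell \<Longrightarrow> b \<in> pcell \<Longrightarrow> dist b a < d \<Longrightarrow> dist (W b) (W a) < e"
    unfolding uniformly_continuous_on_def using e by metis
  show "\<exists>d>0. \<forall>x\<in>UNIV. \<forall>x'\<in>UNIV. dist x' x < d \<longrightarrow> dist (W x') (W x) < e"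
  proof (intro exI[of _ "min d 1"] conjI ballI impI)
    fix z z' :: "'n spt" assume *: "dist z' z < min d 1"
    obtain k :: "'n spt" where k: "lattice_pt k" "\<And>z'. dist z z' < 1 \<Longrightarrow> z' + k \<in> pcell" using lattice_shift_into_pcell[of z] by blast
    have "dist (W (z' + k)) (W (z + k)) < e"
      using * by (intro d(2) k(2)) (auto simp: dist_commute)
    then show "dist (W z') (W z) < e" using per_funD[OF p k(1)] by simp
  qed (use d in auto)
qed

section \<open>Comparison, uniqueness and existence for the discounted equation\<close>

context hj begin

lemma HJ_shift: "lattice_pt k \<Longrightarrow> HJ G \<alpha> c (z + k) r p = HJ G \<alpha> c z r p"
  unfolding lattice_pt_def HJ_def by (auto elim!: Ints_cases simp: G_shift)

lemma HJ_continuous: "continuous_on UNIV (\<lambda>(z, r, p). HJ G \<alpha> c z r p)"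
proof -
  have "continuous_on UNIV (\<lambda>a. (\<lambda>(x, y, t, p, q). G x y t p q)
     (fst (fst a), fst (snd (fst a)), snd (snd (fst a)), fst (snd (snd a)), fst (snd (snd (snd a)))))"
    by (rule continuous_on_compose2[OF cont]) (auto intro!: continuous_intros)
  then show ?thesis unfolding HJ_def case_prod_unfold by (intro continuous_intros) simp_all
qed

text \<open>With \<open>K\<close> the whole space, \<open>off\<close> is vacuous and any value below
  \<open>m\<close> serves as \<open>c\<close>; \<open>near\<close> holds by pairing \<open>z\<close>
  with itself.\<close>

lemma comparison_UNIV:
  assumes u: "usc_on UNIV u" "subsol (HJ G \<alpha> a) UNIV u" and v: "lsc_on UNIV v" "supsol (HJ G \<alpha> b) UNIV v"
    and \<alpha>: "0 \<le> \<alpha>" and B: "\<And>z. u z \<le> B" "\<And>z. - B \<le> v z"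
  shows "\<alpha> * (u z - v z) \<le> a - b"
proof (rule uniform_comparison[OF open_UNIV closed_UNIV _ u v \<alpha> B zero_less_one, of "u z - v z - 1"])
  show "\<exists>z'\<in>UNIV. \<exists>z''\<in>UNIV. dist z' z'' < \<delta> \<and> u z - v z \<le> u z' - v z''" if "\<delta> > 0" for \<delta>
    using that by (intro bexI[of _ z]) auto
qed auto

lemma subsol_const:
  assumes "\<And>x y t. G x y t 0 0 + \<alpha> * r \<le> c" shows "subsol (HJ G \<alpha> c) UNIV (\<lambda>_. r)"
proof (rule subsolI)
  fix z :: "'n spt" and \<phi> g and e :: real assume *: "test_fun \<phi> g" "e > 0" "\<And>w. w \<in> ball z e \<Longrightarrow> w \<in> UNIV \<Longrightarrow> r - \<phi> w \<le> r - \<phi> z"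
  have "0 = g z" by (rule test_fun_unique_gradient[OF test_fun_const[of r] *(1,2)]) (use *(3) in auto)
  then show "HJ G \<alpha> c z r (g z) \<le> 0" using assms[of "fst z" "fst (snd z)" "snd (snd z)"] by (simp add: HJ_def flip: \<open>0 = g z\<close>)
qed

lemma supsol_const:
  assumes "\<And>x y t. c \<le> G x y t 0 0 + \<alpha> * r" shows "supsol (HJ G \<alpha> c) UNIV (\<lambda>_. r)"
proof (rule supsolI)
  fix z :: "'n spt" and \<phi> g and e :: real assume *: "test_fun \<phi> g" "e > 0" "\<And>w. w \<in> ball z e \<Longrightarrow> w \<in> UNIV \<Longrightarrow> r - \<phi> z \<le> r - \<phi> w"
  have "g z = 0" by (rule test_fun_unique_gradient[OF *(1) test_fun_const[of r] *(2)]) (use *(3) in auto)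
  then have "0 = g z" by simp
  then show "0 \<le> HJ G \<alpha> c z r (g z)" using assms[of "fst z" "fst (snd z)" "snd (snd z)"] by (simp add: HJ_def flip: \<open>0 = g z\<close>)
qed

lemma discounted_sol_iff: "discounted_sol G \<alpha> w \<longleftrightarrow> continuous_on UNIV (uncurry3 w) \<and> per_fun (uncurry3 w) \<and>
    subsol (HJ G \<alpha> 0) UNIV (uncurry3 w) \<and> supsol (HJ G \<alpha> 0) UNIV (uncurry3 w)"
  unfolding discounted_sol_def st_periodic_iff visc_sol_iff[OF open_UNIV] by auto

lemma bounded_solution_le:
  assumes \<alpha>: "\<alpha> > 0"
    and U: "continuous_on UNIV U" "subsol (HJ G \<alpha> 0) UNIV U" "\<And>z. \<bar>U z\<bar> \<le> B"
    and V: "continuous_on UNIV V" "supsol (HJ G \<alpha> 0) UNIV V" "\<And>z. \<bar>V z\<bar> \<le> B"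
  shows "U z \<le> V z"
proof -
  have "\<alpha> * (U z - V z) \<le> 0 - 0"
  proof (rule comparison_UNIV)
    show "U z \<le> B" "- B \<le> V z" for z using U(3)[of z] V(3)[of z] by auto
  qed (use assms in \<open>auto intro: continuous_imp_usc_on continuous_imp_lsc_on\<close>)
  then show ?thesis using \<alpha> by (simp add: mult_le_0_iff)
qed

lemma discounted_sol_unique:
  assumes \<alpha>: "\<alpha> > 0" and w: "discounted_sol G \<alpha> w" "discounted_sol G \<alpha> w'"
  shows "w = w'"
proof -
  obtain B B' where B: "\<And>z. \<bar>uncurry3 w z\<bar> \<le> B" "\<And>z. \<bar>uncurry3 w' z\<bar> \<le> B'"
    using w per_fun_bounded[of "uncurry3 w"] per_fun_bounded[of "uncurry3 w'"] unfolding discounted_sol_iff by blast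
  define M where "M = max B B'"
  have M: "\<bar>uncurry3 w z\<bar> \<le> M" "\<bar>uncurry3 w' z\<bar> \<le> M" for z using B[of z] by (auto simp: M_def)
  have "uncurry3 w z = uncurry3 w' z" for z
    using bounded_solution_le[OF \<alpha>, of "uncurry3 w" M "uncurry3 w'" z] bounded_solution_le[OF \<alpha>, of "uncurry3 w'" M "uncurry3 w" z]
      w M unfolding discounted_sol_iff by (auto intro: antisym)
  then have "w x y t = w' x y t" for x y t by (metis uncurry3_def case_prod_conv)
  then show ?thesis by (simp add: fun_eq_iff)
qed

text \<open>Constants of size \<open>C0 / \<alpha>\<close> are barriers. Perron's pair coincides by
  comparison, hence is continuous, and periodicity follows from uniqueness among bounded solutions
  because lattice shifts preserve the equation.\<close>

lemma discounted_sol_exists: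
  assumes \<alpha>: "\<alpha> > 0" shows "\<exists>w. discounted_sol G \<alpha> w"
proof -
  obtain C0 where C0: "\<And>x y t. \<bar>G x y t 0 0\<bar> \<le> C0" using G_bounded[of 0] by auto
  define r where "r = C0 / \<alpha>"
  have \<alpha>r: "\<alpha> * r = C0" using \<alpha> by (simp add: r_def)
  have r0: "r \<ge> 0" using C0[of 0 0 0] \<alpha> by (simp add: r_def)
  have C0': "G x y t 0 0 \<le> C0" "- C0 \<le> G x y t 0 0" for x y t using C0[of x y t] by auto
  have s: "subsol (HJ G \<alpha> 0) UNIV (\<lambda>_. - r)" by (rule subsol_const) (use C0' \<alpha>r in simp)
  have p: "supsol (HJ G \<alpha> 0) UNIV (\<lambda>_. r)" 
  proof (rule supsol_const)
    show "0 \<le> G x y t 0 0 + \<alpha> * r" for x y t using C0'(2)[of x y t] \<alpha>r by linarith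
  qed
  obtain U V where UV: "usc_on UNIV U" "lsc_on UNIV V" "subsol (HJ G \<alpha> 0) UNIV U" "supsol (HJ G \<alpha> 0) UNIV V"
    "\<And>z. - r \<le> V z \<and> V z \<le> U z \<and> U z \<le> r"
    using perron[OF HJ_continuous[of \<alpha> 0] open_UNIV continuous_on_const s continuous_on_const p] r0 by auto
  have "\<alpha> * (U z - V z) \<le> 0 - 0" for z
    by (rule comparison_UNIV[OF UV(1,3,2,4)]) (use UV(5) \<alpha> in auto)
  then have "U z \<le> V z" for z using \<alpha> by (simp add: mult_le_0_iff)
  then have eq: "U = V" using UV(5) by (intro ext antisym) auto
  have c: "continuous_on UNIV U" using UV(1,2) eq by (intro usc_lsc_imp_continuous_on) auto
  have ab: "\<bar>U z\<bar> \<le> r" for z using UV(5)[of z] by auto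
  have "per_fun U" unfolding per_fun_def
  proof (intro allI impI)
    fix z k :: "'n spt" assume k: "lattice_pt k"
    have c': "continuous_on UNIV (\<lambda>z. U (z + k))" by (intro continuous_intros continuous_on_compose2[OF c]) auto
    have s': "subsol (HJ G \<alpha> 0) UNIV (\<lambda>z. U (z + k))" by (rule subsol_shift[OF HJ_shift[OF k] UV(3)])
    have p': "supsol (HJ G \<alpha> 0) UNIV (\<lambda>z. U (z + k))" using supsol_shift[OF HJ_shift[OF k] UV(4)] eq by simp
    show "U (z + k) = U z"
      by (rule antisym; rule bounded_solution_le[OF \<alpha>, where B=r]) (use c c' s' p' UV eq ab in auto)
  qed
  then have "discounted_sol G \<alpha> (\<lambda>x y t. U (x, y, t))"
    unfolding discounted_sol_iff using c UV eq by (simp add: uncurry3_def case_prod_unfold)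
  then show ?thesis by blast
qed

text \<open>Translation by an arbitrary time is now a symmetry of the equation, so uniqueness
  identifies the solution with its time translates.\<close>

lemma discounted_sol_t_indep:
  assumes \<alpha>: "\<alpha> > 0" and ti: "t_indep G" and w: "discounted_sol G \<alpha> w"
  shows "w x y t = w x y s"
proof -
  define W where "W = uncurry3 w"
  have W: "continuous_on UNIV W" "per_fun W" "subsol (HJ G \<alpha> 0) UNIV W" "supsol (HJ G \<alpha> 0) UNIV W"
    using w unfolding discounted_sol_iff W_def by auto
  obtain B where B: "\<And>z. \<bar>W z\<bar> \<le> B" using per_fun_bounded W by blast
  define k :: "'n spt" where "k = (0, 0, s - t)"
  have F: "HJ G \<alpha> 0 (z + k) r p = HJ G \<alpha> 0 z r p" for z r p
    using ti unfolding t_indep_def HJ_def by (simp add: k_def)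
  have c': "continuous_on UNIV (\<lambda>z. W (z + k))" by (intro continuous_intros continuous_on_compose2[OF W(1)]) auto
  have "W ((x, y, t) + k) = W (x, y, t)"
    by (rule antisym; rule bounded_solution_le[OF \<alpha>, where B=B]) (use W c' B subsol_shift[OF F W(3)] supsol_shift[OF F W(4)] in auto)
  then show ?thesis by (simp add: W_def uncurry3_def k_def)
qed

end

section \<open>Oscillation bounds\<close>

lemma test_fun_compose:
  assumes \<rho>: "test_fun \<rho> g" and h: "\<And>w. (h has_real_derivative h' (\<rho> w)) (at (\<rho> w))"
    and h': "continuous_on UNIV (\<lambda>w. h' (\<rho> w))"
  shows "test_fun (\<lambda>w. h (\<rho> w)) (\<lambda>w. h' (\<rho> w) *\<^sub>R g w)"
proof (rule test_funI)
  show "((\<lambda>w. h (\<rho> w)) has_derivative (\<lambda>k. h' (\<rho> z) * (g z \<bullet> k))) (at z)" for z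
    using has_derivative_compose[OF test_funD[OF \<rho>, of z] h[of z, unfolded has_field_derivative_def]] .
  show "continuous_on UNIV (\<lambda>w. h' (\<rho> w) *\<^sub>R g w)"
    by (intro continuous_intros h' test_fun_contD[OF \<rho>])
qed simp

lemma test_fun_time: "test_fun (\<lambda>w::('n::finite) spt. c * (snd (snd w) - t0)) (\<lambda>w. (0, 0, c))"
proof (rule test_funI)
  show "((\<lambda>w::'n spt. c * (snd (snd w) - t0)) has_derivative (\<lambda>h. c * (snd (snd h) - 0))) (at w)" for w
    by (rule derivative_eq_intros refl)+ simp
qed (auto simp: inner_prod_def)

lemma test_fun_time_sq: "test_fun (\<lambda>w::('n::finite) spt. (snd (snd w) - t0)\<^sup>2) (\<lambda>w. (0, 0, 2 * (snd (snd w) - t0)))"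
proof (rule test_funI)
  show "((\<lambda>w::'n spt. (snd (snd w) - t0)\<^sup>2) has_derivative (\<lambda>h. 2 * (snd (snd w) - t0) * snd (snd h))) (at w)" for w
    by (rule derivative_eq_intros refl)+ (simp add: fun_eq_iff algebra_simps)
qed (auto simp: inner_prod_def intro!: continuous_intros)

text \<open>The squared positive part is a C^1 cut-off: it allows penalties that vanish identically
  on one side while remaining global test functions.\<close>

lemma max0_square_deriv: "((\<lambda>r::real. (max 0 r)\<^sup>2) has_real_derivative 2 * max 0 r) (at r)"
proof -
  consider "r < 0" | "r > 0" | "r = 0" by linarith
  then show ?thesis
  proof cases
    case 1
    have "((\<lambda>_::real. 0::real) has_real_derivative 0) (at r)" by simp
    moreover have "\<forall>\<^sub>F x in nhds r. (max 0 x)\<^sup>2 = 0"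
      using 1 eventually_nhds_in_open[of "{..<0}" r] by (auto elim!: eventually_mono)
    ultimately show ?thesis
      using 1 DERIV_cong_ev[of r r "\<lambda>r. (max 0 r)\<^sup>2" "\<lambda>_. 0" "2 * max 0 r" 0] by simp
  next
    case 2
    have "((\<lambda>r::real. r\<^sup>2) has_real_derivative 2 * r) (at r)" by (auto intro!: derivative_eq_intros)
    moreover have "\<forall>\<^sub>F x in nhds r. (max 0 x)\<^sup>2 = x\<^sup>2"
      using 2 eventually_nhds_in_open[of "{0<..}" r] by (auto elim!: eventually_mono)
    ultimately show ?thesis
      using 2 DERIV_cong_ev[of r r "\<lambda>r. (max 0 r)\<^sup>2" "\<lambda>r. r\<^sup>2" "2 * max 0 r" "2 * r"] by simp
  next
    case 3
    have "((\<lambda>h::real. ((max 0 (0 + h))\<^sup>2 - (max 0 0)\<^sup>2) / h) \<longlongrightarrow> 0) (at 0)"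
    proof (rule Lim_null_comparison)
      show "\<forall>\<^sub>F h in at (0::real). norm (((max 0 (0 + h))\<^sup>2 - (max 0 0)\<^sup>2) / h) \<le> \<bar>h\<bar>"
        by (rule always_eventually) (auto simp: max_def power2_eq_square)
      show "((\<lambda>h::real. \<bar>h\<bar>) \<longlongrightarrow> 0) (at 0)" by (intro tendsto_rabs_zero tendsto_ident_at)
    qed
    then show ?thesis using 3 by (simp add: DERIV_def)
  qed
qed

text \<open>On the level set above \<open>\<theta>\<close>, \<open>x\<close> and \<open>t\<close>
  are confined by growth, while \<open>y\<close> is confined by periodicity. The test functions used
  are constant in \<open>y\<close> and therefore never confine it themselves.\<close>

lemma space_time_max:
  fixes f :: "('n::finite) spt \<Rightarrow> real"
  assumes f: "continuous_on UNIV f" and per: "\<And>x y t i. f (x, y + of_int i, t) = f (x, y, t)" and T: "closed T"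
    and coer: "\<And>x y t. t \<in> T \<Longrightarrow> \<theta> < f (x, y, t) \<Longrightarrow> norm (x - x0) \<le> R \<and> \<bar>t - t0\<bar> \<le> R"
    and z1: "t1 \<in> T" "\<theta> < f (x1, y1, t1)"
  shows "\<exists>x y t. t \<in> T \<and> \<theta> < f (x, y, t) \<and> (\<forall>x' y' t'. t' \<in> T \<longrightarrow> f (x', y', t') \<le> f (x, y, t))"
proof -
  define L where "L = cball x0 R \<times> {0..1::real} \<times> (cball t0 R \<inter> T)"
  have cL: "compact L" unfolding L_def using T by (intro compact_Times compact_cball compact_Icc compact_Int_closed)
  have inL: "(x, y + of_int (- \<lfloor>y\<rfloor>), t) \<in> L" if "t \<in> T" "\<theta> < f (x, y, t)" for x y t
  proof -
    have "y + of_int (- \<lfloor>y\<rfloor>) \<in> {0..1}"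
      using of_int_floor_le[of y] real_of_int_floor_add_one_gt[of y] unfolding atLeastAtMost_iff of_int_minus by linarith
    then show ?thesis using coer[OF that] that(1) by (simp add: L_def dist_norm norm_minus_commute abs_minus_commute)
  qed
  have "L \<noteq> {}" using inL[OF z1] by blast
  then obtain z where z: "z \<in> L" "\<And>w. w \<in> L \<Longrightarrow> f w \<le> f z"
    using continuous_attains_sup[OF cL _ continuous_on_subset[OF f subset_UNIV]] by blast
  obtain x y t where zx: "z = (x, y, t)" by (cases z) auto
  have 1: "f (x1, y1, t1) \<le> f (x, y, t)" using z(2)[OF inL[OF z1]] per by (simp add: zx del: of_int_minus)
  have "f (x', y', t') \<le> f (x, y, t)" if "t' \<in> T" for x' y' t'
  proof (cases "\<theta> < f (x', y', t')")
    case True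
    then show ?thesis using z(2)[OF inL[OF that True]] per by (simp add: zx del: of_int_minus)
  next
    case False
    then show ?thesis using 1 z1 by linarith
  qed
  moreover have "t \<in> T" using z(1) by (simp add: L_def zx)
  ultimately show ?thesis using 1 z1(2) by (meson less_le_trans)
qed

text \<open>Each coordinate of the difference is shifted into the unit interval, so
  \<open>CARD('n)\<close> bounds the sum of the coordinates and hence the norm. Time can be placed
  in any prescribed interval of length 1.\<close>

lemma lattice_shift_near:
  fixes x0 x1 :: "real^('n::finite)"
  shows "\<exists>k. lattice_pt k \<and> norm (x1 + fst k - x0) \<le> CARD('n) \<and> fst (snd k) = 0 \<and>
     a \<le> t1 + snd (snd k) \<and> t1 + snd (snd k) \<le> a + 1"
proof -
  define kx :: "real^'n" where "kx = (\<chi> i. - of_int \<lfloor>x1 $ i - x0 $ i\<rfloor>)"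
  define j where "j = - \<lfloor>t1 - a\<rfloor>"
  have "norm (x1 + kx - x0) \<le> (\<Sum>i\<in>UNIV. \<bar>(x1 + kx - x0) $ i\<bar>)" by (rule norm_le_l1_cart)
  also have "\<dots> \<le> (\<Sum>i\<in>(UNIV::'n set). 1)"
  proof (rule sum_mono)
    fix i :: 'n
    show "\<bar>(x1 + kx - x0) $ i\<bar> \<le> 1"
      using of_int_floor_le[of "x1 $ i - x0 $ i"] real_of_int_floor_add_one_gt[of "x1 $ i - x0 $ i"]
      by (simp add: kx_def abs_le_iff) linarith
  qed
  finally have 1: "norm (x1 + kx - x0) \<le> CARD('n)" by simp
  have 2: "a \<le> t1 + of_int j" "t1 + of_int j \<le> a + 1"
    using of_int_floor_le[of "t1 - a"] real_of_int_floor_add_one_gt[of "t1 - a"] unfolding j_def of_int_minus by linarith+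
  have "lattice_pt (kx, 0, of_int j)" by (simp add: lattice_pt_def int_vec_def kx_def)
  then show ?thesis using 1 2 by (intro exI[of _ "(kx, 0, of_int j)"]) simp
qed

section \<open>Oscillation of a discounted solution, uniform in \<alpha>\<close>

locale hj_discounted = hj G l C3 C4 for G :: "('n::finite) ham" and l C3 C4 +
  fixes \<alpha> :: real and W :: "'n spt \<Rightarrow> real" and C0 :: real
  assumes \<alpha>: "0 < \<alpha>" and W_cont: "continuous_on UNIV W" and W_per: "per_fun W"
    and W_sub: "subsol (HJ G \<alpha> 0) UNIV W" and W_sup: "supsol (HJ G \<alpha> 0) UNIV W"
    and C0: "\<bar>G x y t 0 0\<bar> \<le> C0"
begin

lemma W_shift_y: "W (x, y + of_int i, t) = W (x, y, t)"
  using per_funD[OF W_per, of "(0, of_int i, 0)" "(x, y, t)"] by (simp add: lattice_pt_def int_vec_def)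

text \<open>Comparison with the constants \<open>C0 / \<alpha>\<close> and its negative. The product
  \<open>\<alpha> * W\<close> is thus controlled uniformly in \<open>\<alpha>\<close>, which makes
  the oscillation estimates independent of the discount.\<close>

lemma W_bound: "\<alpha> * W z \<le> C0" "- C0 \<le> \<alpha> * W z"
proof -
  obtain B where B: "\<And>z. \<bar>W z\<bar> \<le> B" using per_fun_bounded[OF W_cont W_per] by blast
  define r where "r = C0 / \<alpha>"
  have \<alpha>r: "\<alpha> * r = C0" using \<alpha> by (simp add: r_def)
  define M where "M = max B \<bar>r\<bar>"
  have M: "\<bar>W z\<bar> \<le> M" "\<bar>r\<bar> \<le> M" "\<bar>- r\<bar> \<le> M" for z using B[of z] by (auto simp: M_def)
  have C0': "G x y t 0 0 \<le> C0" "- C0 \<le> G x y t 0 0" for x y t using C0[of x y t] by linarith+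
  have s: "subsol (HJ G \<alpha> 0) UNIV (\<lambda>_. - r)"
  proof (rule subsol_const)
    show "G x y t 0 0 + \<alpha> * - r \<le> 0" for x y t using C0'(1)[of x y t] \<alpha>r by simp
  qed
  have p: "supsol (HJ G \<alpha> 0) UNIV (\<lambda>_. r)"
  proof (rule supsol_const)
    show "0 \<le> G x y t 0 0 + \<alpha> * r" for x y t using C0'(2)[of x y t] \<alpha>r by linarith
  qed
  have "W z \<le> r" by (rule bounded_solution_le[OF \<alpha> W_cont W_sub M(1) continuous_on_const p M(2)])
  then have "\<alpha> * W z \<le> \<alpha> * r" using \<alpha> by (intro mult_left_mono) auto
  then show "\<alpha> * W z \<le> C0" using \<alpha>r by simp
  have "- r \<le> W z" by (rule bounded_solution_le[OF \<alpha> continuous_on_const s M(3) W_cont W_sup M(1)])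
  then have "\<alpha> * - r \<le> \<alpha> * W z" using \<alpha> by (intro mult_left_mono) auto
  then show "- C0 \<le> \<alpha> * W z" using \<alpha>r by simp
qed

text \<open>At \<open>l = 0\<close> the value 1 rather than 0 is chosen, so that shifts along
  \<open>sg\<close> always cover a whole period in y.\<close>

definition sg :: real where "sg = (if 0 \<le> l then 1 else - 1)"

lemma sg: "sg * \<bar>l\<bar> = l" "\<bar>sg\<bar> = 1" "sg * sg = 1"
  by (auto simp: sg_def)

definition sh :: "real \<Rightarrow> 'n spt" where "sh r = (0, sg * r, 0)"

text \<open>Shifts up to one period suffice: \<open>r = 1\<close> returns to the value of
  \<open>W\<close> at a cost of |l|, and so is never better than \<open>r = 0\<close>. Compactness
  of the range makes the infimum attained.\<close>

definition W_hat :: "'n spt \<Rightarrow> real" where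
  "W_hat z = (INF r\<in>{0..1}. W (z + sh r) + \<bar>l\<bar> * r)"

lemma W_hat_props:
  shows "s \<in> {0..1} \<Longrightarrow> W_hat z \<le> W (z + sh s) + \<bar>l\<bar> * s"
    and "\<exists>r\<in>{0..1}. W_hat z = W (z + sh r) + \<bar>l\<bar> * r"
proof -
  have c: "continuous_on {0..1} (\<lambda>r. W (z + sh r) + \<bar>l\<bar> * r)"
    unfolding sh_def by (intro continuous_intros continuous_on_compose2[OF W_cont]) auto
  then obtain r where r: "r \<in> {0..1}" "\<And>s. s \<in> {0..1} \<Longrightarrow> W (z + sh r) + \<bar>l\<bar> * r \<le> W (z + sh s) + \<bar>l\<bar> * s"
    using continuous_attains_inf[of "{0..1::real}" "\<lambda>r. W (z + sh r) + \<bar>l\<bar> * r"] by auto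
  have "W_hat z = W (z + sh r) + \<bar>l\<bar> * r"
    unfolding W_hat_def by (rule cInf_eq_minimum) (use r in auto)
  then show "\<exists>r\<in>{0..1}. W_hat z = W (z + sh r) + \<bar>l\<bar> * r" "s \<in> {0..1} \<Longrightarrow> W_hat z \<le> W (z + sh s) + \<bar>l\<bar> * s"
    using r by auto
qed

lemma W_hat_le: "W_hat z \<le> W z"
  using W_hat_props(1)[of 0 z] by (simp add: sh_def zero_prod_def[symmetric])

lemma W_hat_continuous: "continuous_on UNIV W_hat"
proof (rule uniformly_continuous_imp_continuous, unfold uniformly_continuous_on_def, intro allI impI)
  fix e :: real assume e: "e > 0"
  obtain d where d: "d > 0" "\<And>a b. dist a b < d \<Longrightarrow> dist (W a) (W b) < e"
    using per_fun_uniformly_continuous[OF W_cont W_per] e unfolding uniformly_continuous_on_def by (metis UNIV_I)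
  have le: "W_hat z < W_hat z' + e" if "dist z z' < d" for z z'
  proof -
    obtain r where r: "r \<in> {0..1}" "W_hat z' = W (z' + sh r) + \<bar>l\<bar> * r" using W_hat_props(2) by blast
    have "dist (W (z + sh r)) (W (z' + sh r)) < e" by (rule d(2)) (use that in simp)
    then show ?thesis using W_hat_props(1)[OF r(1), of z] r(2) by (simp add: dist_real_def)
  qed
  show "\<exists>d>0. \<forall>x\<in>UNIV. \<forall>x'\<in>UNIV. dist x' x < d \<longrightarrow> dist (W_hat x') (W_hat x) < e"
  proof (intro exI[of _ d] conjI ballI impI)
    fix x x' :: "'n spt" assume "dist x' x < d"
    then show "dist (W_hat x') (W_hat x) < e" using le[of x x'] le[of x' x] by (simp add: dist_real_def dist_commute)
  qed (use d in auto)
qed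

lemma W_hat_supsol: "supsol (HJ G \<alpha> 0) UNIV W_hat"
proof (rule supsolI)
  fix z :: "'n spt" and \<phi> g and e :: real assume t: "test_fun \<phi> g" and e: "e > 0"
    and min: "\<And>w. w \<in> ball z e \<Longrightarrow> w \<in> UNIV \<Longrightarrow> W_hat z - \<phi> z \<le> W_hat w - \<phi> w"
  obtain r where r: "r \<in> {0..1}" "W_hat z = W (z + sh r) + \<bar>l\<bar> * r" using W_hat_props(2) by blast
  show "0 \<le> HJ G \<alpha> 0 z (W_hat z) (g z)"
  proof (cases "r = 0 \<or> r = 1")
    case True
    \<comment> \<open>At either end of the range \<open>W_hat\<close> equals \<open>W\<close> at
      \<open>z\<close>; being below \<open>W\<close> elsewhere, it passes every test function from
      below on to \<open>W\<close>.\<close>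
    have eq: "W_hat z = W z"
    proof (cases "r = 0")
      case True
      then show ?thesis using r(2) by (simp add: sh_def zero_prod_def[symmetric])
    next
      case False
      then have r1: "r = 1" using \<open>r = 0 \<or> r = 1\<close> by simp
      have "W (z + sh 1) = W z" by (rule per_funD[OF W_per]) (simp add: lattice_pt_def sh_def int_vec_def sg_def)
      then show ?thesis using r(2) r1 W_hat_le[of z] by simp
    qed
    have "0 \<le> HJ G \<alpha> 0 z (W z) (g z)"
    proof (rule supsolD[OF W_sup UNIV_I t e])
      fix w assume "w \<in> ball z e"
      then show "W z - \<phi> z \<le> W w - \<phi> w" using min[of w] W_hat_le[of w] eq by simp
    qed
    then show ?thesis by (simp add: eq)
  next
    case False
    then have r01: "0 < r" "r < 1" using r(1) by auto
    have main: "0 \<le> HJ G \<alpha> 0 (z + sh r) (W (z + sh r)) (g (z + sh r + - sh r))"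
    proof (rule supsolD[OF W_sup UNIV_I test_fun_shift[OF t, of "- sh r"] e])
      fix w assume "w \<in> ball (z + sh r) e"
      then have "w - sh r \<in> ball z e" by (simp add: dist_norm algebra_simps)
      from min[OF this] W_hat_props(1)[OF r(1), of "w - sh r"]
      show "W (z + sh r) - \<phi> (z + sh r + - sh r) \<le> W w - \<phi> (w + - sh r)" using r(2) by simp
    qed
    define h0 :: "'n spt" where "h0 = (0, sg, 0)"
    define s0 where "s0 = min e (min r (1 - r))"
    have s0: "s0 > 0" using e r01 by (simp add: s0_def)
    have nh: "norm h0 = 1" using sg(2) by (simp add: h0_def norm_prod_def)
    (* Moving z and r in opposite directions keeps z + sh r fixed; for an interior r this forces p_y = - l. *)
    have inc: "\<phi> (z + s *\<^sub>R h0) - \<phi> z \<le> - \<bar>l\<bar> * s" if "\<bar>s\<bar> < s0" for s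
    proof -
      have "z + s *\<^sub>R h0 \<in> ball z e" using that nh by (simp add: dist_norm s0_def)
      then have "\<phi> (z + s *\<^sub>R h0) - \<phi> z \<le> W_hat (z + s *\<^sub>R h0) - W_hat z" using min[of "z + s *\<^sub>R h0"] by simp
      also have "W_hat (z + s *\<^sub>R h0) \<le> W (z + s *\<^sub>R h0 + sh (r - s)) + \<bar>l\<bar> * (r - s)"
        by (rule W_hat_props(1)) (use that in \<open>auto simp: s0_def\<close>)
      also have "z + s *\<^sub>R h0 + sh (r - s) = z + sh r" by (simp add: h0_def sh_def algebra_simps)
      finally show ?thesis using r(2) by (simp add: algebra_simps)
    qed
    have "\<bar>l\<bar> \<le> - g z \<bullet> h0"
    proof (rule test_fun_directional[OF test_fun_minus[OF t] s0])
      fix s assume "0 < s" "s < s0"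
      then show "\<bar>l\<bar> * s \<le> - \<phi> (z + s *\<^sub>R h0) - - \<phi> z" using inc[of s] by simp
    qed
    moreover have "- \<bar>l\<bar> \<le> - g z \<bullet> - h0"
    proof (rule test_fun_directional[OF test_fun_minus[OF t] s0])
      fix s assume "0 < s" "s < s0"
      then show "- \<bar>l\<bar> * s \<le> - \<phi> (z + s *\<^sub>R - h0) - - \<phi> z" using inc[of "- s"] by simp
    qed
    ultimately have gh: "g z \<bullet> h0 = - \<bar>l\<bar>" by simp
    obtain px py pt where gz: "g z = (px, py, pt)" by (cases "g z") auto
    have "py * sg = - \<bar>l\<bar>" using gh by (simp add: gz h0_def inner_prod_def)
    then have "py * (sg * sg) = - (sg * \<bar>l\<bar>)" by (simp add: mult.assoc[symmetric] mult.commute)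
    then have py: "py = - l" using sg by simp
    obtain x y t where zx: "z = (x, y, t)" by (cases z) auto
    have "G x (y + sg * r) t px (- l) = G x y t px (- l)" using y_incr[of x "y + sg * r" t px "- l" y] by simp
    moreover have "z + sh r = (x, y + sg * r, t)" by (simp add: zx sh_def)
    ultimately have "HJ G \<alpha> 0 (z + sh r) (W (z + sh r)) (g z) = HJ G \<alpha> 0 z (W (z + sh r)) (g z)"
      unfolding HJ_def gz py by (simp add: zx)
    \<comment> \<open>The discount term has the favourable sign: \<open>W_hat z\<close> exceeds the
      shifted value of \<open>W\<close> by \<open>\<bar>l\<bar> * r \<ge> 0\<close>.\<close>
    also have "\<dots> \<le> HJ G \<alpha> 0 z (W_hat z) (g z)"
      using \<alpha> r01 by (simp add: HJ_def r(2) distrib_left)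
    finally show ?thesis using main by simp
  qed
qed

lemma W_le_W_hat: "W z \<le> W_hat z"
proof -
  obtain B where B: "\<And>z. \<bar>W z\<bar> \<le> B" using per_fun_bounded[OF W_cont W_per] by blast
  have b1: "\<bar>W_hat z\<bar> \<le> B + \<bar>l\<bar>" for z
  proof -
    obtain r where r: "r \<in> {0..1}" "W_hat z = W (z + sh r) + \<bar>l\<bar> * r" using W_hat_props(2) by blast
    have "\<bar>l\<bar> * r \<le> \<bar>l\<bar> * 1" using r(1) by (intro mult_left_mono) auto
    moreover have "0 \<le> \<bar>l\<bar> * r" using r(1) by simp
    ultimately show ?thesis using r(2) B[of "z + sh r"] by (simp add: abs_le_iff)
  qed
  have b2: "\<bar>W z\<bar> \<le> B + \<bar>l\<bar>" for z using B[of z] by simp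
  show ?thesis
    by (rule bounded_solution_le[OF \<alpha> W_cont W_sub b2 W_hat_continuous W_hat_supsol b1])
qed

text \<open>Modulo integers, \<open>y'\<close> is reached from \<open>y\<close> by moving the
  fractional part \<open>s\<close> of \<open>sg * (y' - y)\<close> in the direction
  \<open>sg\<close>, and \<open>W \<le> W_hat\<close> charges at most
  \<open>\<bar>l\<bar> * s\<close> for that.\<close>

lemma W_osc_y: "W (x, y, t) \<le> W (x, y', t) + \<bar>l\<bar>"
proof -
  define a where "a = sg * (y' - y)"
  define s where "s = a - of_int \<lfloor>a\<rfloor>"
  have s: "s \<in> {0..1}" using of_int_floor_le[of a] real_of_int_floor_add_one_gt[of a] unfolding s_def atLeastAtMost_iff by linarith
  have "sg * a = y' - y" unfolding a_def by (simp add: mult.assoc[symmetric] sg(3))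
  then have ys: "y + sg * s = y' + - (sg * of_int \<lfloor>a\<rfloor>)" by (simp add: s_def right_diff_distrib)
  have "W (x, y, t) \<le> W ((x, y, t) + sh s) + \<bar>l\<bar> * s"
    using W_le_W_hat[of "(x,y,t)"] W_hat_props(1)[OF s, of "(x,y,t)"] by simp
  also have "(x, y, t) + sh s = (x, y', t) + (0, - (sg * of_int \<lfloor>a\<rfloor>), 0)" by (simp add: sh_def ys)
  also have "W \<dots> = W (x, y', t)"
    by (rule per_funD[OF W_per]) (simp add: lattice_pt_def int_vec_def sg_def)
  also have "\<bar>l\<bar> * s \<le> \<bar>l\<bar> * 1" using s by (intro mult_left_mono) auto
  finally show ?thesis by simp
qed

text \<open>Uniform continuity handles x and \<open>W_osc_y\<close> handles y; the summand 1 makes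
  the bound strict. The radius \<open>\<kappa>\<close> may depend on the solution, so the final
  constants must not contain it.\<close>

lemma near_x0:
  "\<exists>\<kappa>>0. \<kappa> \<le> 1 \<and> (\<forall>x y. norm (x - x0) < \<kappa> \<longrightarrow> W (x, y, t0) < W (x0, y0, t0) + \<bar>l\<bar> + 1)"
proof -
  obtain d where d: "d > 0" "\<And>a b. dist a b < d \<Longrightarrow> dist (W a) (W b) < 1"
    using per_fun_uniformly_continuous[OF W_cont W_per] unfolding uniformly_continuous_on_def by (metis UNIV_I zero_less_one)
  show ?thesis
  proof (intro exI[of _ "min d 1"] conjI allI impI)
    fix x and y :: real assume "norm (x - x0) < min d 1"
    then have "dist (x, y, t0) (x0, y, t0) < d" by (simp add: dist_Pair_Pair dist_norm)
    then have "dist (W (x, y, t0)) (W (x0, y, t0)) < 1" by (rule d(2))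
    then show "W (x, y, t0) < W (x0, y0, t0) + \<bar>l\<bar> + 1" using W_osc_y[of x0 y t0 y0] by (simp add: dist_real_def)
  qed (use d in auto)
qed

text \<open>\<open>W\<close> is held below \<open>\<theta>\<close> plus a cone of slope
  \<open>Q'\<close> in x. A maximum above \<open>\<theta>\<close> would sit at distance at least
  \<open>\<kappa>\<close> from \<open>x0\<close>, where the slope of the cone is already at least
  \<open>Q\<close> and p_y = 0; then \<open>G \<ge> C0 + 1\<close>, against the bound
  \<open>G \<le> C0\<close> from the equation.\<close>

lemma osc_t_indep:
  assumes ti: "\<And>x y t s. W (x, y, t) = W (x, y, s)"
    and Q: "\<And>x y t p. Q \<le> norm p \<Longrightarrow> C0 + 1 \<le> G x y t p 0"
  shows "W z1 - W z0 \<le> \<bar>l\<bar> + 1 + 2 * max 1 Q * (1 + CARD('n))"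
proof -
  obtain x0 y0 t0 where z0: "z0 = (x0, y0, t0)" by (cases z0) auto
  obtain \<kappa> where \<kappa>: "0 < \<kappa>" "\<kappa> \<le> 1" "\<And>x y. norm (x - x0) < \<kappa> \<Longrightarrow> W (x, y, t0) < W (x0, y0, t0) + \<bar>l\<bar> + 1"
    using near_x0[of x0 t0 y0] by blast
  obtain B where B: "\<And>z. \<bar>W z\<bar> \<le> B" using per_fun_bounded[OF W_cont W_per] by blast
  \<comment> \<open>The factor 2 compensates for the smoothing: for \<open>\<kappa> \<le> dd\<close>
    the slope of the smoothed cone is at least half of \<open>Q'\<close>. The maximum with 1 keeps
    the cone coercive when \<open>Q\<close> is small or negative.\<close>
  define Q' where "Q' = 2 * max 1 Q"
  have Q': "Q' \<ge> 2" "Q' \<ge> 2 * Q" by (auto simp: Q'_def)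
  define \<theta> where "\<theta> = W z0 + \<bar>l\<bar> + 1"
  \<comment> \<open>Smoothing at scale \<open>\<kappa>\<close> makes the cone C^1 at its apex, and
    the unsmooth region is exactly where \<open>near_x0\<close> already gives the bound.\<close>
  define rt where "rt r = sqrt (\<kappa>\<^sup>2 + r)" for r
  define \<phi> where "\<phi> w = Q' * rt ((norm (fst w - x0))\<^sup>2) + (snd (snd w) - t0)\<^sup>2" for w :: "'n spt"
  have pos: "0 < \<kappa>\<^sup>2 + r\<^sup>2" for r using \<kappa>(1) by (simp add: add_pos_nonneg)
  have rt_pos: "0 < rt (r\<^sup>2)" for r using pos[of r] by (simp add: rt_def)
  have rt_ge: "\<bar>r\<bar> \<le> rt (r\<^sup>2)" for r unfolding rt_def by (rule real_le_rsqrt) simp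
  have rt_le: "rt (r\<^sup>2) \<le> \<kappa> + r" if "0 \<le> r" for r unfolding rt_def using sqrt_sum_squares_le_sum[of \<kappa> r] \<kappa>(1) that by simp
  have t\<phi>: "test_fun \<phi> (\<lambda>w. Q' *\<^sub>R ((1 / (2 * rt ((norm (fst w - x0))\<^sup>2))) *\<^sub>R (2 *\<^sub>R (fst w - x0), 0)) + (0, 0, 2 * (snd (snd w) - t0)))"
    unfolding \<phi>_def
  proof (intro test_fun_add test_fun_cmult test_fun_time_sq test_fun_compose[OF test_fun_sqdist_fst])
    show "(rt has_real_derivative 1 / (2 * rt ((norm (fst w - x0))\<^sup>2))) (at ((norm (fst w - x0))\<^sup>2))" for w :: "'n spt"
      unfolding rt_def using pos[of "norm (fst w - x0)"] by (auto intro!: derivative_eq_intros simp: field_simps)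
    have "continuous_on UNIV (\<lambda>w :: 'n spt. rt ((norm (fst w - x0))\<^sup>2))" unfolding rt_def by (intro continuous_intros)
    moreover have "2 * rt ((norm (fst w - x0))\<^sup>2) \<noteq> 0" for w :: "'n spt" using rt_pos[of "norm (fst w - x0)"] by simp
    ultimately show "continuous_on UNIV (\<lambda>w :: 'n spt. 1 / (2 * rt ((norm (fst w - x0))\<^sup>2)))"
      by (intro continuous_intros) auto
  qed
  have \<phi>0: "0 \<le> \<phi> w" for w using Q' rt_pos[of "norm (fst w - x0)"] by (simp add: \<phi>_def)
  have claim: "W (x, y, t) - \<phi> (x, y, t) \<le> \<theta>" for x y t
  proof (rule ccontr)
    assume "\<not> ?thesis"
    then have gt: "\<theta> < W (x, y, t) - \<phi> (x, y, t)" by simp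
    define D where "D = B - \<theta>"
    have "\<exists>x y t. t \<in> UNIV \<and> \<theta> < W (x, y, t) - \<phi> (x, y, t) \<and>
        (\<forall>x' y' t'. t' \<in> UNIV \<longrightarrow> W (x', y', t') - \<phi> (x', y', t') \<le> W (x, y, t) - \<phi> (x, y, t))"
    proof (rule space_time_max[where f="\<lambda>z. W z - \<phi> z" and \<theta>=\<theta>, OF _ _ closed_UNIV _ UNIV_I gt])
      show "continuous_on UNIV (\<lambda>z. W z - \<phi> z)" by (intro continuous_intros W_cont test_fun_continuous(1)[OF t\<phi>])
      show "W (x, y + of_int i, t) - \<phi> (x, y + of_int i, t) = W (x, y, t) - \<phi> (x, y, t)" for x y t i
        by (simp add: W_shift_y \<phi>_def)
      show "norm (x - x0) \<le> D + 1 \<and> \<bar>t - t0\<bar> \<le> D + 1" if "\<theta> < W (x, y, t) - \<phi> (x, y, t)" for x y t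
      proof -
        have le: "Q' * rt ((norm (x - x0))\<^sup>2) + (t - t0)\<^sup>2 \<le> D" using that B[of "(x, y, t)"] by (simp add: \<phi>_def D_def)
        have r1: "norm (x - x0) \<le> rt ((norm (x - x0))\<^sup>2)" using rt_ge[of "norm (x - x0)"] by simp
        have "1 * rt ((norm (x - x0))\<^sup>2) \<le> Q' * rt ((norm (x - x0))\<^sup>2)" using Q' rt_pos[of "norm (x - x0)"] by (intro mult_right_mono) auto
        then have 1: "norm (x - x0) \<le> D" "(t - t0)\<^sup>2 \<le> D" using le r1 rt_pos[of "norm (x - x0)"] zero_le_power2[of "t - t0"] by linarith+
        have "\<bar>t - t0\<bar> \<le> D + 1"
        proof (rule ccontr)
          assume "\<not> ?thesis"
          then have "D + 1 < \<bar>t - t0\<bar>" by simp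
          moreover have "0 \<le> D" using 1(1) norm_ge_zero[of "x - x0"] by linarith
          ultimately have "1 * \<bar>t - t0\<bar> \<le> \<bar>t - t0\<bar> * \<bar>t - t0\<bar>" by (intro mult_right_mono) auto
          then have "\<bar>t - t0\<bar> \<le> (t - t0)\<^sup>2" by (simp add: power2_eq_square)
          then show False using 1(2) \<open>D + 1 < \<bar>t - t0\<bar>\<close> by linarith
        qed
        then show ?thesis using 1(1) by simp
      qed
    qed
    then obtain x y t where m: "\<theta> < W (x, y, t) - \<phi> (x, y, t)"
      "\<And>x' y' t'. W (x', y', t') - \<phi> (x', y', t') \<le> W (x, y, t) - \<phi> (x, y, t)" by blast
    \<comment> \<open>Time is penalised only for compactness. As \<open>W\<close> does not depend on
      t, the maximum lies at \<open>t0\<close> and the time slope of the test function vanishes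
      there.\<close>
    have "W (x, y, t0) - \<phi> (x, y, t0) \<le> W (x, y, t) - \<phi> (x, y, t)" by (rule m(2))
    then have "(t - t0)\<^sup>2 \<le> 0" using ti[of x y t0 t] by (simp add: \<phi>_def)
    then have t: "t = t0" by simp
    define dd where "dd = norm (x - x0)"
    have "\<theta> < W (x, y, t0)" using m(1) \<phi>0[of "(x, y, t)"] t by simp
    then have d: "\<kappa> \<le> dd" using \<kappa>(3)[of x y] by (cases "dd < \<kappa>") (auto simp: dd_def \<theta>_def z0)
    have dd: "dd > 0" using d \<kappa>(1) by simp
    define px where "px = (Q' / rt (dd\<^sup>2)) *\<^sub>R (x - x0)"
    have "HJ G \<alpha> 0 (x, y, t) (W (x, y, t)) (Q' *\<^sub>R ((1 / (2 * rt ((norm (fst (x, y, t) - x0))\<^sup>2))) *\<^sub>R (2 *\<^sub>R (fst (x, y, t) - x0), 0)) + (0, 0, 2 * (snd (snd (x, y, t)) - t0))) \<le> 0"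
    proof (rule subsolD[OF W_sub UNIV_I t\<phi> zero_less_one])
      fix w :: "'n spt"
      show "W w - \<phi> w \<le> W (x, y, t) - \<phi> (x, y, t)" using m(2)[of "fst w" "fst (snd w)" "snd (snd w)"] by simp
    qed
    also have "Q' *\<^sub>R ((1 / (2 * rt ((norm (fst (x, y, t) - x0))\<^sup>2))) *\<^sub>R (2 *\<^sub>R (fst (x, y, t) - x0), 0)) + (0, 0, 2 * (snd (snd (x, y, t)) - t0)) = (px, 0, 0)"
      by (simp add: px_def dd_def t zero_prod_def)
    finally have "G x y t px 0 + \<alpha> * W (x, y, t) \<le> 0" by (simp add: HJ_def)
    then have Gle: "G x y t px 0 \<le> C0" using W_bound(2)[of "(x, y, t)"] by simp
    have "norm px = Q' * (dd / rt (dd\<^sup>2))" using Q' rt_pos[of dd] by (simp add: px_def dd_def[symmetric])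
    moreover have "1 / 2 \<le> dd / rt (dd\<^sup>2)" using rt_le[of dd] d dd rt_pos[of dd] by (simp add: pos_le_divide_eq)
    then have "Q' * (1 / 2) \<le> Q' * (dd / rt (dd\<^sup>2))" using Q' by (intro mult_left_mono) auto
    ultimately have "Q \<le> norm px" using Q' by linarith
    then show False using Q[of px x y t] Gle by simp
  qed
  \<comment> \<open>By periodicity it suffices to evaluate the cone within distance
    \<open>CARD('n)\<close> of \<open>x0\<close>, where it is at most
    \<open>Q' * (1 + CARD('n))\<close> because \<open>\<kappa> \<le> 1\<close>.\<close>
  obtain k where k: "lattice_pt k" "norm (fst z1 + fst k - x0) \<le> CARD('n)"
    using lattice_shift_near[of "fst z1" x0 0 0] by blast
  obtain x y t where zk: "z1 + k = (x, y, t)" by (cases "z1 + k") auto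
  have xk: "norm (x - x0) \<le> CARD('n)" using k(2) arg_cong[OF zk, of fst] by simp
  have "W z1 = W (x, y, t0)" using per_funD[OF W_per k(1), of z1] ti[of x y t t0] zk by simp
  also have "\<dots> \<le> \<theta> + \<phi> (x, y, t0)" using claim[of x y t0] by simp
  also have "\<phi> (x, y, t0) \<le> Q' * (1 + CARD('n))"
    unfolding \<phi>_def using rt_le[of "norm (x - x0)"] \<kappa>(2) xk Q'(1) by (auto intro!: mult_left_mono)
  finally show ?thesis by (simp add: \<theta>_def Q'_def algebra_simps)
qed

text \<open>For p_y = 0 the equation reads as W_t + C1 |D_x W| at most \<open>C2 + C0\<close>, so an
  upper bound near \<open>(x0, t0)\<close> spreads with speed \<open>C1\<close> and grows at rate
  below \<open>C\<close>. Once the cone covers a period cell, the bound holds everywhere by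
  periodicity.\<close>

lemma osc_t_dep:
  assumes C1: "0 < C1" and C2: "0 < C2" and lin: "\<And>x y t p. C1 * norm p - C2 \<le> G x y t p 0"
  shows "W z1 - W z0 \<le> \<bar>l\<bar> + 1 + (C2 + C0 + 1) * (CARD('n) / C1 + 1)"
proof -
  obtain x0 y0 t0 where z0: "z0 = (x0, y0, t0)" by (cases z0) auto
  obtain \<kappa> where \<kappa>: "0 < \<kappa>" "\<kappa> \<le> 1" "\<And>x y. norm (x - x0) < \<kappa> \<Longrightarrow> W (x, y, t0) < W (x0, y0, t0) + \<bar>l\<bar> + 1"
    using near_x0[of x0 t0 y0] by blast
  obtain B where B: "\<And>z. \<bar>W z\<bar> \<le> B" using per_fun_bounded[OF W_cont W_per] by blast
  have B0: "0 \<le> B" using B[of z0] by simp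
  have C00: "0 \<le> C0" using C0[of x0 y0 t0] by simp
  define C where "C = C2 + C0 + 1"
  have C: "1 \<le> C" using C2 C00 by (simp add: C_def)
  \<comment> \<open>So steep that at time \<open>t0\<close> the penalty outside the ball of radius
    \<open>\<kappa>\<close>, which is at least \<open>L * (\<kappa>\<^sup>2)\<^sup>2\<close>,
    exceeds every possible difference of values of \<open>W\<close>. It disappears later because the
    penalty vanishes inside the cone.\<close>
  define L where "L = 2 * B / (\<kappa>\<^sup>2)\<^sup>2 + 1"
  have L: "1 \<le> L" "2 * B \<le> L * (\<kappa>\<^sup>2)\<^sup>2" using B0 \<kappa>(1) by (auto simp: L_def field_simps)
  define \<theta> where "\<theta> = W z0 + \<bar>l\<bar> + 1"
  (* \<rho> > 0 is the outside of the cone of speed C1 at (x0, t0); there \<rho>_t + C1 |D_x \<rho>| > 0, so \<phi> is a strict supersolution. *)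
  define \<rho> where "\<rho> w = (norm (fst w - x0))\<^sup>2 + - (C1\<^sup>2) * (snd (snd w) - t0)\<^sup>2" for w :: "'n spt"
  define \<phi> where "\<phi> w = C * (snd (snd w) - t0) + L * (max 0 (\<rho> w))\<^sup>2" for w :: "'n spt"
  have t\<rho>: "test_fun \<rho> (\<lambda>w. (2 *\<^sub>R (fst w - x0), 0) + (- (C1\<^sup>2)) *\<^sub>R (0, 0, 2 * (snd (snd w) - t0)))"
    unfolding \<rho>_def by (intro test_fun_add test_fun_cmult test_fun_time_sq test_fun_sqdist_fst)
  have t\<phi>: "test_fun \<phi> (\<lambda>w. (0, 0, C) + L *\<^sub>R ((2 * max 0 (\<rho> w)) *\<^sub>R ((2 *\<^sub>R (fst w - x0), 0) + (- (C1\<^sup>2)) *\<^sub>R (0, 0, 2 * (snd (snd w) - t0)))))"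
    unfolding \<phi>_def
  proof (intro test_fun_add test_fun_cmult test_fun_time test_fun_compose[OF t\<rho>, where h="\<lambda>r. (max 0 r)\<^sup>2" and h'="\<lambda>r. 2 * max 0 r"])
    show "((\<lambda>r. (max 0 r)\<^sup>2) has_real_derivative 2 * max 0 (\<rho> w)) (at (\<rho> w))" for w by (rule max0_square_deriv)
    show "continuous_on UNIV (\<lambda>w. 2 * max 0 (\<rho> w))" by (intro continuous_intros test_fun_continuous(1)[OF t\<rho>])
  qed
  have claim: "W (x, y, t) - \<phi> (x, y, t) \<le> \<theta>" if t: "t0 \<le> t" for x y t
  proof (rule ccontr)
    assume "\<not> ?thesis"
    then have gt: "\<theta> < W (x, y, t) - \<phi> (x, y, t)" by simp
    define D where "D = B - \<theta>"
    define R where "R = D + (D + 1 + C1\<^sup>2 * D\<^sup>2) + 1"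
    have "\<exists>x y t. t \<in> {t0..} \<and> \<theta> < W (x, y, t) - \<phi> (x, y, t) \<and>
        (\<forall>x' y' t'. t' \<in> {t0..} \<longrightarrow> W (x', y', t') - \<phi> (x', y', t') \<le> W (x, y, t) - \<phi> (x, y, t))"
    proof (rule space_time_max[where f="\<lambda>z. W z - \<phi> z" and \<theta>=\<theta>, OF _ _ closed_atLeast _ _ gt])
      show "continuous_on UNIV (\<lambda>z. W z - \<phi> z)" by (intro continuous_intros W_cont test_fun_continuous(1)[OF t\<phi>])
      show "W (x, y + of_int i, t) - \<phi> (x, y + of_int i, t) = W (x, y, t) - \<phi> (x, y, t)" for x y t i
        by (simp add: W_shift_y \<phi>_def \<rho>_def)
      show "norm (x - x0) \<le> R \<and> \<bar>t - t0\<bar> \<le> R" if tt: "t \<in> {t0..}" and g: "\<theta> < W (x, y, t) - \<phi> (x, y, t)" for x y t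
      proof -
        define m where "m = max 0 (\<rho> (x, y, t))"
        define \<tau> where "\<tau> = t - t0"
        have \<tau>: "0 \<le> \<tau>" using tt by (simp add: \<tau>_def)
        have le: "C * \<tau> + L * m\<^sup>2 \<le> D" using g B[of "(x, y, t)"] by (simp add: \<phi>_def D_def m_def \<tau>_def)
        have c1: "1 * \<tau> \<le> C * \<tau>" "1 * m\<^sup>2 \<le> L * m\<^sup>2" by (rule mult_right_mono[OF C \<tau>], rule mult_right_mono[OF L(1)]) simp
        then have \<tau>D: "\<tau> \<le> D" "m\<^sup>2 \<le> D" using le \<tau> zero_le_power2[of m] by linarith+
        have D0: "0 \<le> D" using \<tau>D \<tau> by simp
        have sq1: "r \<le> r\<^sup>2 + 1" for r :: real
        proof -
          have "2 * r \<le> r\<^sup>2 + 1" using zero_le_power2[of "r - 1"] by (simp add: power2_eq_square algebra_simps)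
          then show ?thesis using zero_le_power2[of r] by linarith
        qed
        have mD: "m \<le> D + 1" using sq1[of m] \<tau>D by simp
        have "(norm (x - x0))\<^sup>2 = \<rho> (x, y, t) + C1\<^sup>2 * \<tau>\<^sup>2" by (simp add: \<rho>_def \<tau>_def)
        also have "\<dots> \<le> m + C1\<^sup>2 * D\<^sup>2" using \<tau>D \<tau> by (intro add_mono mult_left_mono power_mono) (auto simp: m_def)
        finally have "norm (x - x0) \<le> D + 1 + C1\<^sup>2 * D\<^sup>2 + 1" using sq1[of "norm (x - x0)"] mD by simp
        moreover have "0 \<le> C1\<^sup>2 * D\<^sup>2" by simp
        ultimately show ?thesis using \<tau>D(1) \<tau> D0 unfolding R_def \<tau>_def by (intro conjI; linarith)
      qed
    qed (use t in simp)
    then obtain x y t where m: "t0 \<le> t" "\<theta> < W (x, y, t) - \<phi> (x, y, t)"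
      "\<And>x' y' t'. t0 \<le> t' \<Longrightarrow> W (x', y', t') - \<phi> (x', y', t') \<le> W (x, y, t) - \<phi> (x, y, t)" by auto
    show False
    proof (cases "t = t0")
      case True
      have "0 \<le> \<phi> (x, y, t)" using True L(1) by (simp add: \<phi>_def)
      then have "\<theta> < W (x, y, t0)" using m(2) True by simp
      then have "\<kappa> \<le> norm (x - x0)" using \<kappa>(3)[of x y] by (cases "norm (x - x0) < \<kappa>") (auto simp: \<theta>_def z0)
      then have "\<kappa>\<^sup>2 \<le> max 0 (\<rho> (x, y, t))" using \<kappa>(1) True by (simp add: \<rho>_def le_max_iff_disj power_mono)
      then have "(\<kappa>\<^sup>2)\<^sup>2 \<le> (max 0 (\<rho> (x, y, t)))\<^sup>2" by (intro power_mono) auto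
      then have "L * (\<kappa>\<^sup>2)\<^sup>2 \<le> L * (max 0 (\<rho> (x, y, t)))\<^sup>2" using L(1) by (intro mult_left_mono) auto
      then have "2 * B \<le> \<phi> (x, y, t)" using L(2) True by (simp add: \<phi>_def)
      then show False using m(2) B[of "(x, y, t)"] B[of z0] by (simp add: \<theta>_def)
    next
      case False
      define \<tau> where "\<tau> = t - t0"
      have \<tau>: "0 < \<tau>" using False m(1) by (simp add: \<tau>_def)
      define mm where "mm = max 0 (\<rho> (x, y, t))"
      have mm0: "0 \<le> mm" by (simp add: mm_def)
      define px where "px = (4 * L * mm) *\<^sub>R (x - x0)"
      define pt where "pt = C - 4 * L * mm * (C1\<^sup>2 * \<tau>)"
      have "HJ G \<alpha> 0 (x, y, t) (W (x, y, t)) ((0, 0, C) + L *\<^sub>R ((2 * max 0 (\<rho> (x, y, t))) *\<^sub>R ((2 *\<^sub>R (fst (x, y, t) - x0), 0) + (- (C1\<^sup>2)) *\<^sub>R (0, 0, 2 * (snd (snd (x, y, t)) - t0))))) \<le> 0"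
      \<comment> \<open>The maximum is known only among times from \<open>t0\<close> on; the ball of
        radius \<open>\<tau>\<close> stays in that half-space.\<close>
      proof (rule subsolD[OF W_sub UNIV_I t\<phi> \<tau>])
        fix w :: "'n spt" assume w: "w \<in> ball (x, y, t) \<tau>"
        have "\<bar>t - snd (snd w)\<bar> < \<tau>"
          using w dist_snd_le[of "(x, y, t)" w] dist_snd_le[of "(y, t)" "snd w"] by (simp add: dist_real_def)
        then have "t0 \<le> snd (snd w)" by (simp add: \<tau>_def)
        then show "W w - \<phi> w \<le> W (x, y, t) - \<phi> (x, y, t)" using m(3)[of "snd (snd w)" "fst w" "fst (snd w)"] by simp
      qed
      also have "(0, 0, C) + L *\<^sub>R ((2 * max 0 (\<rho> (x, y, t))) *\<^sub>R ((2 *\<^sub>R (fst (x, y, t) - x0), 0) + (- (C1\<^sup>2)) *\<^sub>R (0, 0, 2 * (snd (snd (x, y, t)) - t0)))) = (px, 0, pt)"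
        unfolding mm_def[symmetric] by (simp add: px_def pt_def \<tau>_def zero_prod_def algebra_simps)
      finally have "pt + G x y t px 0 + \<alpha> * W (x, y, t) \<le> 0" by (simp add: HJ_def)
      then have le: "pt + C1 * norm px - C2 \<le> C0" using lin[of px x y t] W_bound(2)[of "(x, y, t)"] by linarith
      have npx: "norm px = 4 * L * mm * norm (x - x0)" using L(1) mm0 by (simp add: px_def)
      \<comment> \<open>Where the penalty is active, the point lies outside the cone, so the gain in
        |p_x| times \<open>C1\<close> outweighs the loss in p_t. Elsewhere both corrections
        vanish.\<close>
      have "0 \<le> 4 * L * mm * (C1 * (norm (x - x0) - C1 * \<tau>))"
      proof (cases "mm = 0")
        case False
        then have "0 < \<rho> (x, y, t)" by (simp add: mm_def max_def split: if_splits)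
        then have "(C1 * \<tau>)\<^sup>2 < (norm (x - x0))\<^sup>2" by (simp add: \<rho>_def \<tau>_def power_mult_distrib)
        then have "C1 * \<tau> < norm (x - x0)" by (rule power2_less_imp_less) simp
        then show ?thesis using L(1) mm0 C1 by simp
      qed simp
      then have "C \<le> pt + C1 * norm px" by (simp add: npx pt_def algebra_simps power2_eq_square)
      then show False using le by (simp add: C_def)
    qed
  qed
  define n where "n = real CARD('n)"
  \<comment> \<open>A representative inside the cone: waiting the time \<open>n / C1\<close> reaches
    distance \<open>n\<close>, and the time lattice costs at most one unit more. This is the origin
    of the factor \<open>CARD('n) / C1 + 1\<close>.\<close>
  obtain k where k: "lattice_pt k" "norm (fst z1 + fst k - x0) \<le> n"
    "t0 + n / C1 \<le> snd (snd z1) + snd (snd k)" "snd (snd z1) + snd (snd k) \<le> t0 + n / C1 + 1"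
    using lattice_shift_near[of "fst z1" x0 "t0 + n / C1" "snd (snd z1)"] unfolding n_def by blast
  obtain x y t where zk: "z1 + k = (x, y, t)" by (cases "z1 + k") auto
  have xk: "norm (x - x0) \<le> n" "t0 + n / C1 \<le> t" "t \<le> t0 + n / C1 + 1"
    using k(2-4) arg_cong[OF zk, of fst] arg_cong[OF zk, of "\<lambda>z. snd (snd z)"] by simp_all
  have n0: "0 \<le> n / C1" using C1 by (simp add: n_def)
  have "\<rho> (x, y, t) \<le> 0"
  proof -
    have "n \<le> C1 * (t - t0)" using xk(2) C1 by (simp add: field_simps)
    then have "norm (x - x0) \<le> C1 * (t - t0)" using xk(1) by simp
    then have "(norm (x - x0))\<^sup>2 \<le> (C1 * (t - t0))\<^sup>2" by (intro power_mono) auto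
    then show ?thesis by (simp add: \<rho>_def power_mult_distrib)
  qed
  then have \<phi>1: "\<phi> (x, y, t) = C * (t - t0)" by (simp add: \<phi>_def)
  have "W z1 = W (x, y, t)" using per_funD[OF W_per k(1), of z1] zk by simp
  also have "\<dots> \<le> \<theta> + \<phi> (x, y, t)" using claim[of t x y] xk(2) n0 by simp
  also have "\<phi> (x, y, t) \<le> C * (n / C1 + 1)" unfolding \<phi>1 using xk(3) C by (intro mult_left_mono) auto
  finally show ?thesis by (simp add: \<theta>_def C_def n_def)
qed

end

section \<open>The ergodic constant\<close>

lemma LIMSEQ_inverse_Suc: "(\<lambda>n. 1 / real (Suc n)) \<longlonglongrightarrow> 0"
  by (intro LIMSEQ_Suc lim_1_over_n)

lemma dist_less_inverse_Suc_LIMSEQ: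
  fixes z :: "'a::metric_space"
  assumes "\<And>n::nat. dist (zs n) z < 1 / Suc n" shows "zs \<longlonglongrightarrow> z"
proof (rule tendsto_dist_iff[THEN iffD2], rule tendsto_sandwich[OF _ _ tendsto_const LIMSEQ_inverse_Suc])
  show "\<forall>\<^sub>F n in sequentially. dist (zs n) z \<le> 1 / real (Suc n)" using assms by (simp add: less_imp_le)
qed simp

text \<open>The supremum is over later indices and nearby points at once, then the infimum over the
  scale. The third and fourth conclusions are the assumptions \<open>S1\<close> and
  \<open>S2\<close> of \<open>subsol_limit\<close>.\<close>

lemma upper_relaxed_limit:
  fixes u :: "nat \<Rightarrow> 'a::euclidean_space \<Rightarrow> real"
  assumes b: "\<And>k w. \<bar>u k w\<bar> \<le> K"
  shows "\<exists>U. usc_on UNIV U \<and> (\<forall>z. \<bar>U z\<bar> \<le> K) \<and>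
    (\<forall>w e. 0 < e \<longrightarrow> (\<exists>d>0. \<exists>N::nat. \<forall>k\<ge>N. \<forall>w'\<in>ball w d. u k w' \<le> U w + e)) \<and>
    (\<forall>z. \<exists>k zs. (\<forall>n. n \<le> k n) \<and> zs \<longlonglongrightarrow> z \<and> (\<lambda>n. u (k n) (zs n)) \<longlonglongrightarrow> U z)"
proof -
  define A where "A n z = {u k w |k w. n \<le> k \<and> dist w z < 1 / Suc n}" for n :: nat and z
  define S where "S n z = Sup (A n z)" for n z
  define U where "U z = (INF n. S n z)" for z
  have ne: "u n z \<in> A n z" for n z unfolding A_def by force
  have bd: "bdd_above (A n z)" for n z
    by (rule bdd_aboveI[of _ K]) (use b in \<open>auto simp: A_def abs_le_iff\<close>)
  have uS: "u k w \<le> S n z" if "n \<le> k" "dist w z < 1 / Suc n" for n k w z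
    unfolding S_def by (rule cSup_upper[OF _ bd]) (use that in \<open>auto simp: A_def\<close>)
  have SK: "- K \<le> S n z" "S n z \<le> K" for n z
  proof -
    show "- K \<le> S n z" using uS[of n n z z] b[of n z] by simp
    show "S n z \<le> K" unfolding S_def
    proof (rule cSup_least)
      show "A n z \<noteq> {}" using ne[of n z] by blast
      show "x \<le> K" if "x \<in> A n z" for x using that b by (auto simp: A_def abs_le_iff)
    qed
  qed
  have bS: "bdd_below (range (\<lambda>n. S n z))" for z by (rule bdd_belowI[of _ "- K"]) (use SK in auto)
  have US: "U z \<le> S n z" for n z unfolding U_def by (rule cINF_lower[OF bS]) simp
  have UK: "\<bar>U z\<bar> \<le> K" for z
  proof -
    have "- K \<le> U z" unfolding U_def by (rule cINF_greatest) (use SK in auto)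
    then show ?thesis using US[of z 0] SK(2)[of 0 z] by simp
  qed
  have S1: "\<exists>d>0. \<exists>N::nat. \<forall>k\<ge>N. \<forall>w'\<in>ball w d. u k w' \<le> U w + e" if e: "0 < e" for w e
  proof -
    have "(INF n. S n w) < U w + e" using e by (simp add: U_def)
    then obtain N where N: "S N w < U w + e" using bS by (subst (asm) cINF_less_iff) auto
    have "u k w' \<le> U w + e" if "k \<ge> N" "w' \<in> ball w (1 / Suc N)" for k w'
      using uS[of N k w' w] N that by (simp add: dist_commute)
    then show ?thesis by (intro exI[of _ "1 / Suc N"] conjI exI[of _ N]) auto
  qed
  have S2: "\<exists>k zs. (\<forall>n. n \<le> k n) \<and> zs \<longlonglongrightarrow> z \<and> (\<lambda>n. u (k n) (zs n)) \<longlonglongrightarrow> U z" for z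
  proof -
    have "\<exists>k w. n \<le> k \<and> dist w z < 1 / Suc n \<and> U z - 1 / Suc n < u k w" for n
    proof -
      have "U z - 1 / Suc n < S n z"
      proof -
        have "0 < 1 / real (Suc n)" by simp
        then show ?thesis using US[of z n] by linarith
      qed
      then obtain x where "x \<in> A n z" "U z - 1 / Suc n < x"
        unfolding S_def using less_cSup_iff[OF _ bd, of n z] ne[of n z] by blast
      then show ?thesis by (auto simp: A_def)
    qed
    then obtain k zs where kz: "\<And>n. n \<le> k n" "\<And>n. dist (zs n) z < 1 / Suc n" "\<And>n. U z - 1 / Suc n < u (k n) (zs n)"
      by metis
    have zl: "zs \<longlonglongrightarrow> z" by (rule dist_less_inverse_Suc_LIMSEQ[OF kz(2)])
    have "(\<lambda>n. u (k n) (zs n)) \<longlonglongrightarrow> U z"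
    proof (rule order_tendstoI)
      fix a assume a: "a < U z"
      have "(\<lambda>n. U z - 1 / Suc n) \<longlonglongrightarrow> U z - 0" by (intro tendsto_intros LIMSEQ_inverse_Suc)
      then have "\<forall>\<^sub>F n in sequentially. a < U z - 1 / Suc n" by (rule order_tendstoD(1)) (use a in simp)
      then show "\<forall>\<^sub>F n in sequentially. a < u (k n) (zs n)" by eventually_elim (use kz(3) less_trans in blast)
    next
      fix a assume a: "U z < a"
      obtain d N where dN: "d > 0" "\<And>k w'. k \<ge> N \<Longrightarrow> w' \<in> ball z d \<Longrightarrow> u k w' \<le> U z + (a - U z) / 2"
      proof -
        have "0 < (a - U z) / 2" using a by simp
        from S1[OF this, of z] show ?thesis using that by blast
      qed
      have "\<forall>\<^sub>F n in sequentially. zs n \<in> ball z d" using dN(1) by (intro topological_tendstoD[OF zl]) auto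
      moreover have "\<forall>\<^sub>F n in sequentially. N \<le> n" by (rule eventually_ge_at_top)
      ultimately show "\<forall>\<^sub>F n in sequentially. u (k n) (zs n) < a"
      proof eventually_elim
        case (elim n)
        have "N \<le> k n" using elim(2) kz(1)[of n] by simp
        then have "u (k n) (zs n) \<le> U z + (a - U z) / 2" using elim(1) by (rule dN(2))
        then show ?case using a by (simp add: field_simps)
      qed
    qed
    then show ?thesis using kz(1) zl by blast
  qed
  have "usc_on UNIV U" unfolding usc_on_def
  proof (intro ballI allI impI)
    fix z and e :: real assume e: "e > 0"
    obtain d N where dN: "d > 0" "\<And>k w'. k \<ge> N \<Longrightarrow> w' \<in> ball z d \<Longrightarrow> u k w' \<le> U z + e / 2"
    proof -
      have "0 < e / 2" using e by simp
      from S1[OF this, of z] show ?thesis using that by blast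
    qed
    have "U w < U z + e" if w: "dist w z < d" for w
    proof -
      obtain k zs where kz: "\<And>n. n \<le> k n" "zs \<longlonglongrightarrow> w" "(\<lambda>n. u (k n) (zs n)) \<longlonglongrightarrow> U w" using S2 by blast
      have "\<forall>\<^sub>F n in sequentially. zs n \<in> ball z d" using w by (intro topological_tendstoD[OF kz(2)]) (auto simp: dist_commute)
      moreover have "\<forall>\<^sub>F n in sequentially. N \<le> n" by (rule eventually_ge_at_top)
      ultimately have "\<forall>\<^sub>F n in sequentially. u (k n) (zs n) \<le> U z + e / 2"
      proof eventually_elim
        case (elim n)
        have "N \<le> k n" using elim(2) kz(1)[of n] by simp
        then show ?case using elim(1) by (rule dN(2))
      qed
      then have "U w \<le> U z + e / 2" by (intro tendsto_upperbound[OF kz(3)]) auto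
      then show ?thesis using e by simp
    qed
    then show "\<forall>\<^sub>F w in nhds z. U w < U z + e" unfolding eventually_nhds_metric using dN(1) by blast
  qed
  then show ?thesis using UK S1 S2 by blast
qed

text \<open>\<open>Fc\<close> admits every index map with \<open>n \<le> r n\<close>: the indices of
  a recovery sequence tend to infinity but need not increase.\<close>

lemma subsol_relaxed_limit:
  fixes u :: "nat \<Rightarrow> 'a::euclidean_space \<Rightarrow> real"
  assumes b: "\<And>k w. \<bar>u k w\<bar> \<le> K" and u: "\<And>k. usc_on UNIV (u k)" "\<And>k. subsol (Fk k) UNIV (u k)"
    and Fc: "\<And>r xs rs ps z q p. (\<And>n. n \<le> r n) \<Longrightarrow> xs \<longlonglongrightarrow> z \<Longrightarrow> rs \<longlonglongrightarrow> q \<Longrightarrow> ps \<longlonglongrightarrow> p \<Longrightarrow>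
        (\<lambda>k. Fk (r k) (xs k) (rs k) (ps k)) \<longlonglongrightarrow> F z q p"
  shows "\<exists>U. usc_on UNIV U \<and> (\<forall>z. \<bar>U z\<bar> \<le> K) \<and> subsol F UNIV U"
proof -
  obtain U where U: "usc_on UNIV U" "\<And>z. \<bar>U z\<bar> \<le> K"
    "\<And>w e. 0 < e \<Longrightarrow> \<exists>d>0. \<exists>N::nat. \<forall>k\<ge>N. \<forall>w'\<in>ball w d. u k w' \<le> U w + e"
    "\<And>z. \<exists>k zs. (\<forall>n. n \<le> k n) \<and> zs \<longlonglongrightarrow> z \<and> (\<lambda>n. u (k n) (zs n)) \<longlonglongrightarrow> U z"
    using upper_relaxed_limit[of u K, OF b] by blast
  have "subsol F UNIV U"
  proof (rule subsolI)
    fix z \<phi> g and e :: real assume t: "test_fun \<phi> g" and e: "e > 0"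
      and max: "\<And>w. w \<in> ball z e \<Longrightarrow> w \<in> UNIV \<Longrightarrow> U w - \<phi> w \<le> U z - \<phi> z"
    obtain k zs where kz: "\<And>n. n \<le> k n" "zs \<longlonglongrightarrow> z" "(\<lambda>n. u (k n) (zs n)) \<longlonglongrightarrow> U z" using U(4) by blast
    show "F z (U z) (g z) \<le> 0"
    proof (rule subsol_limit[where U=U and u="\<lambda>n. u (k n)" and Fk="\<lambda>n. Fk (k n)" and F=F, OF open_UNIV UNIV_I u _ _ kz(2,3) t e])
      show "(\<lambda>j. Fk (k (r j)) (xs j) (rs j) (ps j)) \<longlonglongrightarrow> F z (U z) p"
        if "strict_mono r" "xs \<longlonglongrightarrow> z" "rs \<longlonglongrightarrow> U z" "ps \<longlonglongrightarrow> p" for r xs rs ps p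
      proof (rule Fc[OF _ that(2-4)])
        show "n \<le> k (r n)" for n using kz(1)[of "r n"] seq_suble[OF that(1), of n] by simp
      qed
      show "\<exists>d>0. \<exists>N. \<forall>n\<ge>N. \<forall>w'\<in>ball w d. u (k n) w' \<le> U w + \<epsilon>" if "0 < \<epsilon>" for w \<epsilon>
        using U(3)[OF that, of w] kz(1) by (meson le_trans)
    qed (use max in auto)
  qed
  then show ?thesis using U by blast
qed

section \<open>Admissible constants through semicontinuous functions\<close>

lemma usc_env_bound:
  fixes u :: "'a::euclidean_space \<Rightarrow> real"
  assumes b: "\<And>w. \<bar>u w\<bar> \<le> B"
  shows "loc_bdd UNIV u" "\<bar>usc_env UNIV u z\<bar> \<le> B"
proof -
  show l: "loc_bdd UNIV u" unfolding loc_bdd_def using b zero_less_one by blast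
  have "usc_env UNIV u z \<le> B"
    by (rule usc_env_le_of_le[where g="\<lambda>_. B", OF open_UNIV UNIV_I l]) (use b abs_le_D1 in auto)
  moreover have "- B \<le> usc_env UNIV u z" using usc_env_ge[OF open_UNIV UNIV_I l, of z] b[of z] by simp
  ultimately show "\<bar>usc_env UNIV u z\<bar> \<le> B" by simp
qed

lemma usc_env_eq_self:
  fixes u :: "'a::euclidean_space \<Rightarrow> real"
  assumes u: "usc_on UNIV u" and l: "loc_bdd UNIV u"
  shows "usc_env UNIV u z = u z"
proof (rule antisym)
  show "usc_env UNIV u z \<le> u z"
  proof (rule field_le_epsilon)
    fix e :: real assume e: "e > 0"
    obtain d where d: "d > 0" "\<And>w. dist w z < d \<Longrightarrow> u w < u z + e / 2"
      using usc_onD[OF u UNIV_I, of "e / 2" z] e unfolding eventually_nhds_metric by auto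
    obtain w where w: "w \<in> ball z d" "usc_env UNIV u z - e / 2 < u w"
      using usc_env_approx[OF open_UNIV UNIV_I l, of "e / 2" d z] e d(1) by auto
    have "u w < u z + e / 2" by (rule d(2)) (use w(1) in \<open>simp add: dist_commute\<close>)
    then show "usc_env UNIV u z \<le> u z + e" using w(2) by linarith
  qed
  show "u z \<le> usc_env UNIV u z" by (rule usc_env_ge[OF open_UNIV UNIV_I l])
qed

lemma bounded_fun_iff: "bounded_fun u \<longleftrightarrow> (\<exists>B. \<forall>z. \<bar>uncurry3 u z\<bar> \<le> B)"
  by (auto simp: bounded_fun_def uncurry3_def)

text \<open>Envelopes of bounded functions are semicontinuous with the same bound, and a
  semicontinuous bounded function is its own envelope. Hence discontinuous sub- and supersolutions
  may be replaced by semicontinuous ones, to which comparison applies.\<close>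

lemma ergodic_admissible_iff:
  fixes G :: "('n::finite) ham"
  shows "ergodic_admissible G lam \<longleftrightarrow>
    (\<exists>U V B. usc_on UNIV U \<and> subsol (HJ G 0 lam) UNIV U \<and> lsc_on UNIV V \<and> supsol (HJ G 0 lam) UNIV V \<and>
       (\<forall>z. \<bar>U z\<bar> \<le> B) \<and> (\<forall>z. \<bar>V z\<bar> \<le> B))"
proof
  assume "ergodic_admissible G lam"
  then obtain u v B1 B2 where u: "\<And>z. \<bar>uncurry3 u z\<bar> \<le> B1" "subsol (HJ G 0 lam) UNIV (usc_env UNIV (uncurry3 u))"
    and v: "\<And>z. \<bar>uncurry3 v z\<bar> \<le> B2" "supsol (HJ G 0 lam) UNIV (lsc_env UNIV (uncurry3 v))"
    unfolding ergodic_admissible_def visc_sub_iff_subsol visc_super_iff_supsol bounded_fun_iff by blast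
  define B where "B = max B1 B2"
  have b: "\<bar>uncurry3 u z\<bar> \<le> B" "\<bar>- uncurry3 v z\<bar> \<le> B" for z using u(1)[of z] v(1)[of z] by (auto simp: B_def)
  have "lsc_on UNIV (lsc_env UNIV (uncurry3 v))" unfolding lsc_on_def lsc_env_eq minus_minus
    by (rule usc_on_usc_env[OF open_UNIV usc_env_bound(1)[OF b(2)]])
  moreover have "\<bar>lsc_env UNIV (uncurry3 v) z\<bar> \<le> B" for z
    unfolding lsc_env_eq abs_minus_cancel by (rule usc_env_bound(2)[OF b(2)])
  moreover have "usc_on UNIV (usc_env UNIV (uncurry3 u))"
    by (rule usc_on_usc_env[OF open_UNIV usc_env_bound(1)[OF b(1)]])
  moreover have "\<bar>usc_env UNIV (uncurry3 u) z\<bar> \<le> B" for z by (rule usc_env_bound(2)[OF b(1)])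
  ultimately show "\<exists>U V B. usc_on UNIV U \<and> subsol (HJ G 0 lam) UNIV U \<and> lsc_on UNIV V \<and> supsol (HJ G 0 lam) UNIV V \<and>
       (\<forall>z. \<bar>U z\<bar> \<le> B) \<and> (\<forall>z. \<bar>V z\<bar> \<le> B)"
    using u(2) v(2) by blast
next
  assume "\<exists>U V B. usc_on UNIV U \<and> subsol (HJ G 0 lam) UNIV U \<and> lsc_on UNIV V \<and> supsol (HJ G 0 lam) UNIV V \<and>
       (\<forall>z. \<bar>U z\<bar> \<le> B) \<and> (\<forall>z. \<bar>V z\<bar> \<le> B)"
  then obtain U V B where U: "usc_on UNIV U" "subsol (HJ G 0 lam) UNIV U" and V: "lsc_on UNIV V" "supsol (HJ G 0 lam) UNIV V"
    and B: "\<And>z. \<bar>U z\<bar> \<le> B" "\<And>z. \<bar>V z\<bar> \<le> B" by blast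
  define u where "u x y t = U (x, y, t)" for x y t
  define v where "v x y t = V (x, y, t)" for x y t
  have uv: "uncurry3 u = U" "uncurry3 v = V" by (auto simp: uncurry3_def u_def v_def)
  have mV: "\<bar>- V z\<bar> \<le> B" for z using B(2)[of z] by simp
  have "usc_env UNIV U = U" using usc_env_eq_self[OF U(1) usc_env_bound(1)[OF B(1)]] by (rule ext)
  moreover have "lsc_env UNIV V = V"
  proof
    fix z
    have "usc_env UNIV (\<lambda>z. - V z) z = - V z"
      using V(1) by (intro usc_env_eq_self usc_env_bound(1)[OF mV]) (simp add: lsc_on_def)
    then show "lsc_env UNIV V z = V z" by (simp add: lsc_env_eq)
  qed
  ultimately have "visc_sub (eqF G 0 lam) UNIV (uncurry3 u)" "visc_super (eqF G 0 lam) UNIV (uncurry3 v)"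
    unfolding visc_sub_iff_subsol visc_super_iff_supsol uv using U V by simp_all
  moreover have "bounded_fun u" "bounded_fun v" unfolding bounded_fun_iff uv using B by blast+
  ultimately show "ergodic_admissible G lam" unfolding ergodic_admissible_def by blast
qed

text \<open>The discount converts a subtracted constant into a change of the right-hand side; for
  \<open>\<alpha> = 0\<close> constants can be added freely.\<close>

lemma HJ_subsol_diff_const:
  "subsol (HJ G \<alpha> c) \<Omega> u \<Longrightarrow> subsol (HJ G \<alpha> (c - \<alpha> * d)) \<Omega> (\<lambda>z. u z - d)"
proof (rule subsolI)
  fix z \<phi> g and e :: real assume u: "subsol (HJ G \<alpha> c) \<Omega> u" and z: "z \<in> \<Omega>" and t: "test_fun \<phi> g" and e: "e > 0"
    and max: "\<And>w. w \<in> ball z e \<Longrightarrow> w \<in> \<Omega> \<Longrightarrow> u w - d - \<phi> w \<le> u z - d - \<phi> z"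
  have "HJ G \<alpha> c z (u z) (g z) \<le> 0" by (rule subsolD[OF u z t e]) (use max in force)
  then show "HJ G \<alpha> (c - \<alpha> * d) z (u z - d) (g z) \<le> 0" by (simp add: HJ_def algebra_simps)
qed

lemma HJ_supsol_diff_const:
  "supsol (HJ G \<alpha> c) \<Omega> u \<Longrightarrow> supsol (HJ G \<alpha> (c - \<alpha> * d)) \<Omega> (\<lambda>z. u z - d)"
proof (rule supsolI)
  fix z \<phi> g and e :: real assume u: "supsol (HJ G \<alpha> c) \<Omega> u" and z: "z \<in> \<Omega>" and t: "test_fun \<phi> g" and e: "e > 0"
    and max: "\<And>w. w \<in> ball z e \<Longrightarrow> w \<in> \<Omega> \<Longrightarrow> u z - d - \<phi> z \<le> u w - d - \<phi> w"
  have "0 \<le> HJ G \<alpha> c z (u z) (g z)" by (rule supsolD[OF u z t e]) (use max in force)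
  then show "0 \<le> HJ G \<alpha> (c - \<alpha> * d) z (u z - d) (g z)" by (simp add: HJ_def algebra_simps)
qed

section \<open>Existence and uniqueness of the ergodic constant\<close>

context hj begin

lemma HJ_tendsto:
  assumes "as \<longlonglongrightarrow> \<alpha>" "cs \<longlonglongrightarrow> c" "xs \<longlonglongrightarrow> z" "rs \<longlonglongrightarrow> q" "ps \<longlonglongrightarrow> p"
  shows "(\<lambda>k. HJ G (as k) (cs k) (xs k) (rs k) (ps k)) \<longlonglongrightarrow> HJ G \<alpha> c z q p"
proof -
  have "isCont (\<lambda>(z, r, p). HJ G 0 0 z r p) (z, q, p)"
    using HJ_continuous continuous_on_eq_continuous_at[OF open_UNIV] by blast
  from isCont_tendsto_compose[OF this tendsto_Pair[OF assms(3) tendsto_Pair[OF assms(4,5)]]]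
  have "(\<lambda>k. HJ G 0 0 (xs k) (rs k) (ps k)) \<longlonglongrightarrow> HJ G 0 0 z q p" by simp
  then have "(\<lambda>k. HJ G 0 0 (xs k) (rs k) (ps k) + as k * rs k - cs k) \<longlonglongrightarrow> HJ G 0 0 z q p + \<alpha> * q - c"
    by (intro tendsto_intros assms)
  then show ?thesis by (simp add: HJ_def)
qed

text \<open>The normalised functions are bounded independently of the discount but have no common
  modulus of continuity. So upper and lower relaxed limits are taken separately, which is why only a
  bounded subsolution and a bounded supersolution result.\<close>

lemma ergodic_exists:
  assumes osc: "\<And>\<alpha> w z z'. 0 < \<alpha> \<Longrightarrow> discounted_sol G \<alpha> w \<Longrightarrow> uncurry3 w z - uncurry3 w z' \<le> K"
  shows "\<exists>lam. ergodic_admissible G lam"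
proof -
  obtain C0 where C0: "\<And>x y t. \<bar>G x y t 0 0\<bar> \<le> C0" using G_bounded[of 0] by auto
  define al where "al k = 1 / real (Suc k)" for k
  have al: "0 < al k" for k by (simp add: al_def)
  obtain w where w: "\<And>k. discounted_sol G (al k) (w k)" using discounted_sol_exists[OF al] by metis
  define W where "W k = uncurry3 (w k)" for k
  have W: "continuous_on UNIV (W k)" "per_fun (W k)" "subsol (HJ G (al k) 0) UNIV (W k)" "supsol (HJ G (al k) 0) UNIV (W k)" for k
    using w[of k] unfolding discounted_sol_iff W_def by auto
  \<comment> \<open>Subtracting \<open>W k 0\<close> moves the discount of that constant to the
    right-hand side; the candidate constants are bounded by \<open>W_bound\<close>. The leading
    \<open>0 -\<close> matches the form of \<open>HJ_subsol_diff_const\<close>.\<close>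
  define lm where "lm k = 0 - al k * W k 0" for k
  have "\<bar>lm k\<bar> \<le> C0" for k
  proof -
    interpret hj_discounted G l C3 C4 "al k" "W k" C0
      by unfold_locales (use al W C0 in auto)
    show ?thesis using W_bound[of 0] by (auto simp: lm_def)
  qed
  then have "bounded (range lm)" by (auto simp: bounded_iff)
  then obtain lam r where r: "strict_mono r" "(lm \<circ> r) \<longlonglongrightarrow> lam"
    using bounded_imp_convergent_subsequence[of lm] by blast
  define u where "u j z = W (r j) z - W (r j) 0" for j z
  define K' where "K' = max K 0"
  have ub: "\<bar>u j z\<bar> \<le> K'" for j z
    using osc[OF al w, of "r j" z 0] osc[OF al w, of "r j" 0 z] by (auto simp: u_def W_def K'_def abs_le_iff)
  have uc: "continuous_on UNIV (u j)" for j unfolding u_def by (intro continuous_intros W)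
  define Fk where "Fk j = HJ G (al (r j)) (lm (r j))" for j
  have usub: "subsol (Fk j) UNIV (u j)" for j
    unfolding u_def Fk_def lm_def by (rule HJ_subsol_diff_const[OF W(3)])
  have usup: "supsol (Fk j) UNIV (u j)" for j
    unfolding u_def Fk_def lm_def by (rule HJ_supsol_diff_const[OF W(4)])
  have Fc: "(\<lambda>k. Fk (s k) (xs k) (rs k) (ps k)) \<longlonglongrightarrow> HJ G 0 lam z q p"
    if s: "\<And>n. n \<le> s n" and l: "xs \<longlonglongrightarrow> z" "rs \<longlonglongrightarrow> q" "ps \<longlonglongrightarrow> p" for s xs rs ps z q p
    unfolding Fk_def
  proof (rule HJ_tendsto[OF _ _ l])
    have fs: "filterlim s at_top sequentially"
      by (rule filterlim_at_top_mono[OF filterlim_ident]) (simp add: s)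
    have "(\<lambda>k. al (r k)) \<longlonglongrightarrow> 0" using LIMSEQ_subseq_LIMSEQ[OF LIMSEQ_inverse_Suc r(1)] by (simp add: al_def o_def)
    from filterlim_compose[OF this fs] show "(\<lambda>k. al (r (s k))) \<longlonglongrightarrow> 0" .
    from filterlim_compose[OF r(2) fs] show "(\<lambda>k. lm (r (s k))) \<longlonglongrightarrow> lam" by (simp add: o_def)
  qed
  obtain U where U: "usc_on UNIV U" "\<And>z. \<bar>U z\<bar> \<le> K'" "subsol (HJ G 0 lam) UNIV U"
    using subsol_relaxed_limit[of u K' Fk "HJ G 0 lam", OF ub continuous_imp_usc_on[OF open_UNIV uc] usub Fc] by blast
  have mub: "\<bar>- u j z\<bar> \<le> K'" for j z using ub[of j z] by simp
  have muc: "usc_on UNIV (\<lambda>z. - u j z)" for j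
    by (intro continuous_imp_usc_on open_UNIV continuous_intros uc)
  have musub: "subsol (dual_eq (Fk j)) UNIV (\<lambda>z. - u j z)" for j using usup[of j] by (simp add: supsol_def)
  have mFc: "(\<lambda>k. dual_eq (Fk (s k)) (xs k) (rs k) (ps k)) \<longlonglongrightarrow> dual_eq (HJ G 0 lam) z q p"
    if s: "\<And>n. n \<le> s n" and l: "xs \<longlonglongrightarrow> z" "rs \<longlonglongrightarrow> q" "ps \<longlonglongrightarrow> p" for s xs rs ps z q p
    unfolding dual_eq_def by (intro tendsto_minus Fc s l)
  obtain V where V: "usc_on UNIV V" "\<And>z. \<bar>V z\<bar> \<le> K'" "subsol (dual_eq (HJ G 0 lam)) UNIV V"
    using subsol_relaxed_limit[of "\<lambda>j z. - u j z" K' "\<lambda>j. dual_eq (Fk j)" "dual_eq (HJ G 0 lam)", OF mub muc musub mFc] by blast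
  have "lsc_on UNIV (\<lambda>z. - V z)" "supsol (HJ G 0 lam) UNIV (\<lambda>z. - V z)"
    using V by (simp_all add: lsc_on_def supsol_def)
  moreover have "\<bar>- V z\<bar> \<le> K'" for z using V(2)[of z] by simp
  ultimately have "ergodic_admissible G lam" unfolding ergodic_admissible_iff using U by blast
  then show ?thesis by blast
qed

text \<open>Comparison without discount: a bounded subsolution for \<open>a\<close> and a bounded
  supersolution for \<open>b\<close> already force \<open>0 \<le> a - b\<close>.\<close>

lemma ergodic_le:
  assumes "ergodic_admissible G a" "ergodic_admissible G b" shows "b \<le> a"
proof -
  obtain U B where U: "usc_on UNIV U" "subsol (HJ G 0 a) UNIV U" "\<And>z. \<bar>U z\<bar> \<le> B"
    using assms(1) unfolding ergodic_admissible_iff by blast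
  obtain V B' where V: "lsc_on UNIV V" "supsol (HJ G 0 b) UNIV V" "\<And>z. \<bar>V z\<bar> \<le> B'"
    using assms(2) unfolding ergodic_admissible_iff by blast
  have "0 * (U 0 - V 0) \<le> a - b"
  proof (rule comparison_UNIV[OF U(1,2) V(1,2), where B="max B B'"])
    show "U z \<le> max B B'" "- max B B' \<le> V z" for z using U(3)[of z] V(3)[of z] by (auto simp: abs_le_iff max_def)
  qed simp
  then show ?thesis by simp
qed

end

section \<open>The Cauchy problem\<close>

text \<open>Inf-convolution with a multiple of the distance: an infimum of
  \<open>L\<close>-Lipschitz functions, never above \<open>v0\<close>.\<close>

lemma lipschitz_approximation:
  fixes v0 :: "'a::metric_space \<Rightarrow> real"
  assumes b: "\<And>X. \<bar>v0 X\<bar> \<le> M" and uc: "uniformly_continuous_on UNIV v0" and e: "0 < e"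
  shows "\<exists>V L. 0 \<le> L \<and> (\<forall>X Y. \<bar>V X - V Y\<bar> \<le> L * dist X Y) \<and> (\<forall>X. \<bar>V X - v0 X\<bar> \<le> e)"
proof -
  obtain d where d: "d > 0" "\<And>X Y. dist X Y < d \<Longrightarrow> \<bar>v0 X - v0 Y\<bar> < e"
    using uc e unfolding uniformly_continuous_on_def dist_real_def by (metis UNIV_I)
  have M0: "0 \<le> M" using b[of undefined] by linarith
  \<comment> \<open>From distance \<open>d\<close> on, the penalty is at least \<open>2 * M\<close>,
    the largest possible gain from a lower value of \<open>v0\<close>; closer points gain less than
    \<open>e\<close>.\<close>
  define L where "L = 2 * M / d"
  have L: "0 \<le> L" "L * d = 2 * M" using M0 d(1) by (auto simp: L_def)
  define V where "V X = (INF Y. v0 Y + L * dist X Y)" for X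
  have lo: "- M \<le> v0 Y + L * dist X Y" for X Y
  proof -
    have "0 \<le> L * dist X Y" using L by simp
    then show ?thesis using b[of Y] by linarith
  qed
  have bb: "bdd_below (range (\<lambda>Y. v0 Y + L * dist X Y))" for X by (rule bdd_belowI[of _ "- M"]) (use lo in auto)
  have Vle: "V X \<le> v0 Y + L * dist X Y" for X Y unfolding V_def by (rule cINF_lower[OF bb]) simp
  have lip: "V X \<le> V Y + L * dist X Y" for X Y
  proof -
    have "V X - L * dist X Y \<le> V Y" unfolding V_def[of Y]
    proof (rule cINF_greatest)
      fix Z
      have "L * dist X Z \<le> L * (dist X Y + dist Y Z)" using L(1) by (intro mult_left_mono dist_triangle)
      then show "V X - L * dist X Y \<le> v0 Z + L * dist Y Z" using Vle[of X Z] by (simp add: distrib_left)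
    qed simp
    then show ?thesis by simp
  qed
  have "v0 X - e \<le> V X" for X unfolding V_def
  proof (rule cINF_greatest)
    fix Y
    show "v0 X - e \<le> v0 Y + L * dist X Y"
    proof (cases "dist X Y < d")
      case True
      have "0 \<le> L * dist X Y" using L by simp
      then show ?thesis using d(2)[OF True] by linarith
    next
      case False
      then have "L * d \<le> L * dist X Y" using L by (intro mult_left_mono) auto
      then show ?thesis using b[of X] b[of Y] L(2) e by linarith
    qed
  qed simp
  moreover have "V X \<le> v0 X" for X using Vle[of X X] by simp
  ultimately have "\<bar>V X - v0 X\<bar> \<le> e" for X using e by (smt (verit))
  moreover have "\<bar>V X - V Y\<bar> \<le> L * dist X Y" for X Y using lip[of X Y] lip[of Y X] by (simp add: dist_commute abs_le_iff)
  ultimately show ?thesis using L(1) by blast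
qed

section \<open>Space and time parts, shifts by functions of time, and barriers\<close>

lemma open_pos_time: "open pos_time"
  unfolding pos_time_def by (intro open_Collect_less continuous_intros)

definition spc :: "('n::finite) spt \<Rightarrow> (real^'n) \<times> real" where "spc z = (fst z, fst (snd z))"

definition tm :: "('n::finite) spt \<Rightarrow> real" where "tm z = snd (snd z)"

lemma pos_time_iff: "z \<in> pos_time \<longleftrightarrow> 0 < tm z"
  by (simp add: pos_time_def tm_def)

lemma dist_tm: "\<bar>tm z - tm z'\<bar> \<le> dist z z'"
  using dist_snd_le[of z z'] dist_snd_le[of "snd z" "snd z'"] by (simp add: tm_def dist_real_def)

lemma dist_spc: "dist (spc z) (spc z') \<le> dist z z'"
proof -
  have "(dist (fst (snd z)) (fst (snd z')))\<^sup>2 \<le> (dist (snd z) (snd z'))\<^sup>2"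
    by (intro power_mono dist_fst_le) simp
  then show ?thesis unfolding spc_def dist_Pair_Pair dist_prod_def[of z z'] by (intro real_sqrt_le_mono add_left_mono)
qed

text \<open>A function of time with slope at least \<open>\<gamma>\<close> gains
  \<open>\<gamma>\<close> in the inequality, since it affects the gradient in the time component
  only. This supplies strictness where no discount is present.\<close>

lemma HJ_subsol_minus_time:
  assumes u: "subsol (HJ G 0 c) \<Omega> u" and t: "test_fun \<rho> (\<lambda>w. (0, 0, h w))" and h: "\<And>w. w \<in> \<Omega> \<Longrightarrow> \<gamma> \<le> h w"
  shows "subsol (HJ G 0 (c - \<gamma>)) \<Omega> (\<lambda>z. u z - \<rho> z)"
proof (rule subsolI)
  fix z \<phi> g and e :: real assume z: "z \<in> \<Omega>" and t': "test_fun \<phi> g" and e: "e > 0"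
    and max: "\<And>w. w \<in> ball z e \<Longrightarrow> w \<in> \<Omega> \<Longrightarrow> u w - \<rho> w - \<phi> w \<le> u z - \<rho> z - \<phi> z"
  have "HJ G 0 c z (u z) ((0, 0, h z) + g z) \<le> 0"
    by (rule subsolD[OF u z test_fun_add[OF t t'] e]) (use max in \<open>force simp: algebra_simps\<close>)
  then show "HJ G 0 (c - \<gamma>) z (u z - \<rho> z) (g z) \<le> 0" using h[OF z] by (simp add: HJ_def)
qed

lemma HJ_supsol_minus_time:
  assumes u: "supsol (HJ G 0 c) \<Omega> u" and t: "test_fun \<rho> (\<lambda>w. (0, 0, h w))" and h: "\<And>w. w \<in> \<Omega> \<Longrightarrow> h w \<le> \<gamma>"
  shows "supsol (HJ G 0 (c - \<gamma>)) \<Omega> (\<lambda>z. u z - \<rho> z)"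
proof (rule supsolI)
  fix z \<phi> g and e :: real assume z: "z \<in> \<Omega>" and t': "test_fun \<phi> g" and e: "e > 0"
    and max: "\<And>w. w \<in> ball z e \<Longrightarrow> w \<in> \<Omega> \<Longrightarrow> u z - \<rho> z - \<phi> z \<le> u w - \<rho> w - \<phi> w"
  have "0 \<le> HJ G 0 c z (u z) ((0, 0, h z) + g z)"
    by (rule supsolD[OF u z test_fun_add[OF t t'] e]) (use max in \<open>force simp: algebra_simps\<close>)
  then show "0 \<le> HJ G 0 (c - \<gamma>) z (u z - \<rho> z) (g z)" using h[OF z] by (simp add: HJ_def)
qed

text \<open>Moving along a direction, the touched function changes by no less than the Lipschitz
  bound allows. The test gradient inherits this: its space part is at most \<open>L\<close>, and in
  time, where the function is exactly linear, both directions give equality.\<close>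

lemma lipschitz_touch:
  fixes V0 :: "(real^('n::finite)) \<times> real \<Rightarrow> real" and z :: "'n spt"
  assumes V0: "\<And>X Y. \<bar>V0 X - V0 Y\<bar> \<le> L * dist X Y" and \<Omega>: "open \<Omega>" "z \<in> \<Omega>"
    and t: "test_fun \<phi> g" and e: "e > 0"
    and max: "\<And>w. w \<in> ball z e \<Longrightarrow> w \<in> \<Omega> \<Longrightarrow> (V0 (spc w) + c * tm w) - \<phi> w \<le> (V0 (spc z) + c * tm z) - \<phi> z"
  shows "norm (fst (g z)) \<le> L" "\<bar>fst (snd (g z))\<bar> \<le> L" "snd (snd (g z)) = c"
proof -
  obtain px py pt where g: "g z = (px, py, pt)" by (cases "g z") auto
  obtain d where d: "d > 0" "ball z d \<subseteq> \<Omega>" using \<Omega> openE by blast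
  have dir: "- L * norm (hx, hy) + c * ht \<le> g z \<bullet> (hx, hy, ht)" for hx hy ht
  proof -
    define h where "h = (hx, hy, ht)"
    define s0 where "s0 = min e d / (norm h + 1)"
    have s0: "s0 > 0" using e d by (simp add: s0_def add_nonneg_pos)
    have "- L * norm (hx, hy) + c * ht \<le> g z \<bullet> h"
    proof (rule test_fun_directional[OF t s0])
      fix s assume s: "0 < s" "s < s0"
      have "s * norm h \<le> s * (norm h + 1)" using s by simp
      also have "\<dots> < s0 * (norm h + 1)" using s by (intro mult_strict_right_mono) (auto simp: add_nonneg_pos)
      also have "\<dots> = min e d" by (simp add: s0_def add_nonneg_eq_0_iff)
      finally have "dist z (z + s *\<^sub>R h) < min e d" using s by (simp add: dist_norm)
      then have w: "z + s *\<^sub>R h \<in> ball z e" "z + s *\<^sub>R h \<in> \<Omega>" using d by auto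
      have sp: "spc (z + s *\<^sub>R h) = spc z + s *\<^sub>R (hx, hy)" "tm (z + s *\<^sub>R h) = tm z + s * ht"
        by (auto simp: spc_def tm_def h_def)
      have dn: "dist (a + s *\<^sub>R b) a = s * norm b" for a b :: "(real^'n) \<times> real"
        using s(1) by (simp add: dist_norm)
      have "dist (spc z + s *\<^sub>R (hx, hy)) (spc z) = s * norm (hx, hy)" by (rule dn)
      then have "V0 (spc z) - V0 (spc z + s *\<^sub>R (hx, hy)) \<le> L * (s * norm (hx, hy))"
        using V0[of "spc z + s *\<^sub>R (hx, hy)" "spc z"] by simp
      then show "(- L * norm (hx, hy) + c * ht) * s \<le> \<phi> (z + s *\<^sub>R h) - \<phi> z"
        using max[OF w] unfolding sp by (simp add: algebra_simps)
    qed
    then show ?thesis by (simp add: h_def)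
  qed
  have "snd (snd (g z)) = pt" by (simp add: g)
  moreover have "c \<le> pt" using dir[of 0 0 1] by (simp add: g inner_prod_def zero_prod_def[symmetric])
  moreover have "pt \<le> c" using dir[of 0 0 "-1"] by (simp add: g inner_prod_def zero_prod_def[symmetric])
  ultimately show "snd (snd (g z)) = c" by simp
  have "(norm (px, py))\<^sup>2 \<le> L * norm (px, py)"
  proof -
    have "norm (- px, - py) = norm (px, py)" by (simp add: norm_prod_def)
    moreover have "g z \<bullet> (- px, - py, 0) = - (norm (px, py))\<^sup>2" by (simp add: g inner_prod_def power2_norm_eq_inner)
    ultimately show ?thesis using dir[of "- px" "- py" 0] by simp
  qed
  then have "norm (px, py) \<le> L"
  proof (cases "norm (px, py) = 0")
    case True
    have "0 \<le> L * dist (0::(real^'n) \<times> real) (0, 1)" using V0[of 0 "(0,1)"] by linarith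
    then have "0 \<le> L" by (simp add: dist_prod_def zero_prod_def)
    then show ?thesis using True by simp
  next
    case False
    assume "(norm (px, py))\<^sup>2 \<le> L * norm (px, py)"
    then have "norm (px, py) * norm (px, py) \<le> L * norm (px, py)" by (simp add: power2_eq_square)
    then show ?thesis using False by (simp add: mult_le_cancel_right)
  qed
  then show "norm (fst (g z)) \<le> L" "\<bar>fst (snd (g z))\<bar> \<le> L"
    using norm_fst_le[of px py] norm_snd_le[of py px] by (auto simp: g)
qed

section \<open>Comparison, existence and long-time behaviour for the Cauchy problem\<close>

context hj begin

text \<open>Comparing pairs of points, not just values at one point, means that inserting the same
  solution twice yields a modulus of continuity. Failure of the claim is exactly the hypothesis
  \<open>near\<close> of \<open>uniform_comparison\<close>, and the slope \<open>\<gamma>\<close>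
  then gives \<open>0 \<le> - \<gamma>\<close>.\<close>

lemma cauchy_comparison:
  assumes u: "usc_on pos_time u" "subsol (HJ G 0 0) pos_time u" and v: "lsc_on pos_time v" "supsol (HJ G 0 0) pos_time v"
    and bnd: "\<And>T. \<exists>B. \<forall>z\<in>pos_time. tm z \<le> T \<longrightarrow> u z \<le> B \<and> - B \<le> v z"
    and init: "\<And>e. 0 < e \<Longrightarrow> \<exists>\<delta>>0. \<forall>z\<in>pos_time. \<forall>z'\<in>pos_time. dist z z' < \<delta> \<and> tm z < \<delta> \<longrightarrow> u z - v z' \<le> e"
    and e: "0 < e"
  shows "\<exists>\<delta>>0. \<forall>z\<in>pos_time. \<forall>z'\<in>pos_time. tm z \<le> T \<and> dist z z' < \<delta> \<longrightarrow> u z - v z' < e"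
proof (rule ccontr)
  assume neg: "\<not> ?thesis"
  have near0: "\<exists>z\<in>pos_time. \<exists>z'\<in>pos_time. tm z \<le> T \<and> dist z z' < \<delta> \<and> e \<le> u z - v z'" if "\<delta> > 0" for \<delta>
    using neg that by (meson not_le)
  have T: "0 < T" using near0[of 1] by (auto simp: pos_time_iff)
  obtain B0 where "\<And>z. z \<in> pos_time \<Longrightarrow> tm z \<le> T + 3 \<Longrightarrow> u z \<le> B0 \<and> - B0 \<le> v z" using bnd by blast
  then have B0: "z \<in> pos_time \<Longrightarrow> tm z \<le> T + 3 \<Longrightarrow> u z \<le> max B0 0 \<and> - max B0 0 \<le> v z" for z by fastforce
  define B where "B = max B0 0"
  have B: "0 \<le> B" "\<And>z. z \<in> pos_time \<Longrightarrow> tm z \<le> T + 3 \<Longrightarrow> u z \<le> B" "\<And>z. z \<in> pos_time \<Longrightarrow> tm z \<le> T + 3 \<Longrightarrow> - B \<le> v z"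
    using B0 by (auto simp: B_def)
  \<comment> \<open>Up to time \<open>T\<close> the linear term costs at most \<open>e / 4\<close>,
    so the difference \<open>e\<close> stays at least \<open>3 * e / 4\<close>, above the initial
    level \<open>e / 2\<close>.\<close>
  define \<gamma> where "\<gamma> = e / (4 * (T + 1))"
  have \<gamma>: "0 < \<gamma>" "\<gamma> * T \<le> e / 4"
  proof -
    show "0 < \<gamma>" using e T by (simp add: \<gamma>_def)
    have "T + 1 \<noteq> 0" using T by simp
    then have "\<gamma> * (T + 1) = e / 4" unfolding \<gamma>_def by (simp add: divide_simps)
    then show "\<gamma> * T \<le> e / 4" using \<open>0 < \<gamma>\<close> by (simp add: distrib_left)
  qed
  \<comment> \<open>Half a unit after \<open>T\<close> the quadratic term equals at least
    \<open>2 * B + 1\<close>, more than any difference of \<open>u\<close> and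
    \<open>v\<close>.\<close>
  define A where "A = 4 * (2 * B + 1)"
  have A: "0 < A" using B(1) by (simp add: A_def)
  (* The quadratic term keeps the maximum away from the final time without leaving the class of global C^1 tests. *)
  define \<rho> where "\<rho> w = \<gamma> * (snd (snd w) - 0) + A * (max 0 (1 * (snd (snd w) - T)))\<^sup>2" for w :: "'n spt"
  define h where "h w = \<gamma> + A * (2 * max 0 (1 * (snd (snd w) - T)))" for w :: "'n spt"
  have "test_fun \<rho> (\<lambda>w. (0, 0, \<gamma>) + A *\<^sub>R ((2 * max 0 (1 * (snd (snd w) - T))) *\<^sub>R (0, 0, 1)))"
    unfolding \<rho>_def
  proof (intro test_fun_add test_fun_cmult test_fun_time test_fun_compose[OF test_fun_time[of 1], where h="\<lambda>r. (max 0 r)\<^sup>2" and h'="\<lambda>r. 2 * max 0 r"])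
    show "((\<lambda>r. (max 0 r)\<^sup>2) has_real_derivative 2 * max 0 (1 * (snd (snd w) - T))) (at (1 * (snd (snd w) - T)))" for w :: "'n spt"
      by (rule max0_square_deriv)
  qed (intro continuous_intros)
  moreover have "(\<lambda>w :: 'n spt. (0, 0, \<gamma>) + A *\<^sub>R ((2 * max 0 (1 * (snd (snd w) - T))) *\<^sub>R (0, 0, 1))) = (\<lambda>w. (0, 0, h w))"
    by (simp add: h_def fun_eq_iff)
  ultimately have t\<rho>: "test_fun \<rho> (\<lambda>w. (0, 0, h w))" by (rule back_subst[where P="test_fun \<rho>"])
  have h\<gamma>: "\<gamma> \<le> h w" for w using A by (simp add: h_def)
  define \<Omega> where "\<Omega> = {z :: 'n spt. 0 < tm z \<and> tm z < T + 2}"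
  have "\<Omega> = {z. 0 < snd (snd z)} \<inter> {z. snd (snd z) < T + 2}" by (auto simp: \<Omega>_def tm_def)
  then have \<Omega>o: "open \<Omega>" by (auto intro!: open_Int open_Collect_less continuous_intros)
  have \<Omega>p: "\<Omega> \<subseteq> pos_time" by (auto simp: \<Omega>_def pos_time_iff)
  have ut: "usc_on \<Omega> (\<lambda>z. u z - \<rho> z)"
  proof -
    have "usc_on \<Omega> (\<lambda>z. u z + - \<rho> z)"
      by (intro usc_on_add usc_on_subset[OF u(1) \<Omega>p] continuous_imp_usc_on[OF \<Omega>o] continuous_intros
          continuous_on_subset[OF test_fun_continuous(1)[OF t\<rho>] subset_UNIV])
    then show ?thesis by simp
  qed
  have us: "subsol (HJ G 0 (0 - \<gamma>)) \<Omega> (\<lambda>z. u z - \<rho> z)"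
    by (rule HJ_subsol_minus_time[OF subsol_subset[OF u(2) \<Omega>o \<Omega>p] t\<rho> h\<gamma>])
  have vt: "lsc_on \<Omega> v" using v(1) usc_on_subset[OF _ \<Omega>p] unfolding lsc_on_def by blast
  have vs: "supsol (HJ G 0 0) \<Omega> v" by (rule supsol_subset[OF v(2) \<Omega>o \<Omega>p])
  obtain \<delta> where \<delta>: "\<delta> > 0" "\<And>z z'. z \<in> pos_time \<Longrightarrow> z' \<in> pos_time \<Longrightarrow> dist z z' < \<delta> \<Longrightarrow> tm z < \<delta> \<Longrightarrow> u z - v z' \<le> e / 2"
    using init[of "e / 2"] e by auto
  define \<delta>1 where "\<delta>1 = min \<delta> 1 / 2"
  have \<delta>1: "0 < \<delta>1" "\<delta>1 \<le> \<delta> / 2" "\<delta>1 \<le> 1 / 2" using \<delta>(1) by (auto simp: \<delta>1_def)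
  \<comment> \<open>Times below \<open>\<delta>1\<close> are governed by \<open>init\<close>, those
    near \<open>T + 1\<close> by the quadratic term. A pair leaving \<open>K\<close> at distance
    less than \<open>\<delta>1\<close> has either its first time below \<open>\<delta>\<close> or
    that time at least \<open>T + 1 / 2\<close>.\<close>
  define K where "K = {z :: 'n spt. \<delta>1 \<le> tm z \<and> tm z \<le> T + 1}"
  have "K = {z. \<delta>1 \<le> snd (snd z)} \<inter> {z. snd (snd z) \<le> T + 1}" by (auto simp: K_def tm_def)
  then have Kc: "closed K" by (auto intro!: closed_Int closed_Collect_le continuous_intros)
  have K\<Omega>: "K \<subseteq> \<Omega>" using \<delta>1 by (auto simp: K_def \<Omega>_def)
  have \<rho>0: "0 \<le> \<rho> z" if "z \<in> \<Omega>" for z using that \<gamma> A by (simp add: \<rho>_def \<Omega>_def tm_def)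
  have "0 * (3 * e / 4) \<le> (0 - \<gamma>) - 0"
  proof (rule uniform_comparison[OF \<Omega>o Kc K\<Omega> ut us vt vs order_refl, where B=B and ?\<delta>0.0=\<delta>1 and c="e/2"])
    fix z assume z: "z \<in> K"
    then have zp: "z \<in> pos_time" "tm z \<le> T + 3" "z \<in> \<Omega>" using K\<Omega> \<Omega>p by (auto simp: K_def)
    show "u z - \<rho> z \<le> B" using B(2)[OF zp(1,2)] \<rho>0[OF zp(3)] by simp
    show "- B \<le> v z" by (rule B(3)[OF zp(1,2)])
  next
    fix z z' assume z: "z \<in> \<Omega>" "z' \<in> \<Omega>" and d: "dist z z' < \<delta>1" and off: "z \<notin> K \<or> z' \<notin> K"
    have zp: "z \<in> pos_time" "z' \<in> pos_time" using z \<Omega>p by auto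
    have td: "\<bar>tm z - tm z'\<bar> < \<delta>1" using dist_tm[of z z'] d by simp
    show "u z - \<rho> z - v z' \<le> e / 2"
    proof (cases "tm z < \<delta>")
      case True
      have "u z - v z' \<le> e / 2" by (rule \<delta>(2)[OF zp]) (use d \<delta>1 \<delta>(1) True in auto)
      then show ?thesis using \<rho>0[OF z(1)] by simp
    next
      case False
      then have "T + 1 / 2 \<le> tm z" using off td \<delta>1 by (auto simp: K_def)
      then have r: "1 / 2 \<le> max 0 (1 * (snd (snd z) - T))" by (simp add: tm_def)
      have "(1 / 2)\<^sup>2 \<le> (max 0 (1 * (snd (snd z) - T)))\<^sup>2" by (rule power_mono[OF r]) simp
      then have "A * (1 / 2)\<^sup>2 \<le> A * (max 0 (1 * (snd (snd z) - T)))\<^sup>2" by (rule mult_left_mono) (use A in simp)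
      moreover have "0 \<le> \<gamma> * (snd (snd z) - 0)" using \<gamma>(1) z(1) by (simp add: \<Omega>_def tm_def)
      ultimately have "2 * B + 1 \<le> \<rho> z" unfolding \<rho>_def A_def by (simp add: power2_eq_square)
      then show ?thesis using B(2)[OF zp(1)] B(3)[OF zp(2)] z e by (simp add: \<Omega>_def)
    qed
  next
    fix \<delta>' :: real assume "\<delta>' > 0"
    then obtain z z' where z: "z \<in> pos_time" "z' \<in> pos_time" "tm z \<le> T" "dist z z' < min \<delta>' 1" "e \<le> u z - v z'"
      using near0[of "min \<delta>' 1"] by auto
    have "z \<in> \<Omega>" "z' \<in> \<Omega>" using z dist_tm[of z z'] by (auto simp: \<Omega>_def pos_time_iff)
    moreover have "3 * e / 4 \<le> u z - \<rho> z - v z'"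
    proof -
      have "\<gamma> * tm z \<le> \<gamma> * T" using z(3) \<gamma>(1) by simp
      moreover have "\<rho> z = \<gamma> * tm z" using z(3) by (simp add: \<rho>_def tm_def)
      ultimately show ?thesis using z(5) \<gamma>(2) by simp
    qed
    ultimately show "\<exists>z\<in>\<Omega>. \<exists>z'\<in>\<Omega>. dist z z' < \<delta>' \<and> 3 * e / 4 \<le> u z - \<rho> z - v z'" using z(4) by auto
  qed (use \<delta>1 e in auto)
  then show False using \<gamma>(1) by simp
qed

lemma cauchy_comparison_le:
  assumes u: "usc_on pos_time u" "subsol (HJ G 0 0) pos_time u" and v: "lsc_on pos_time v" "supsol (HJ G 0 0) pos_time v"
    and bnd: "\<And>T. \<exists>B. \<forall>z\<in>pos_time. tm z \<le> T \<longrightarrow> u z \<le> B \<and> - B \<le> v z"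
    and init: "\<And>e. 0 < e \<Longrightarrow> \<exists>\<delta>>0. \<forall>z\<in>pos_time. \<forall>z'\<in>pos_time. dist z z' < \<delta> \<and> tm z < \<delta> \<longrightarrow> u z - v z' \<le> e"
    and z: "z \<in> pos_time"
  shows "u z \<le> v z"
proof (rule field_le_epsilon)
  fix e :: real assume "e > 0"
  from cauchy_comparison[OF u v bnd init this, of "tm z"] obtain \<delta> where "\<delta> > 0"
    "\<forall>z'\<in>pos_time. \<forall>z''\<in>pos_time. tm z' \<le> tm z \<and> dist z' z'' < \<delta> \<longrightarrow> u z' - v z'' < e" by blast
  then have "u z - v z < e" using z by simp
  then show "u z \<le> v z + e" by simp
qed

text \<open>A description on positive times only, with the initial datum attained uniformly in
  space. Uniform continuity is not part of it but is recovered from comparison, so limits of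
  solutions are easy to handle.\<close>

definition csol :: "((real^'n) \<times> real \<Rightarrow> real) \<Rightarrow> ('n spt \<Rightarrow> real) \<Rightarrow> bool" where
  "csol v0 U \<longleftrightarrow> continuous_on pos_time U \<and> subsol (HJ G 0 0) pos_time U \<and> supsol (HJ G 0 0) pos_time U \<and>
     (\<forall>T. \<exists>B. \<forall>z\<in>pos_time. tm z \<le> T \<longrightarrow> \<bar>U z\<bar> \<le> B) \<and>
     (\<forall>e>0. \<exists>\<delta>>0. \<forall>z\<in>pos_time. tm z < \<delta> \<longrightarrow> \<bar>U z - v0 (spc z)\<bar> \<le> e)"

lemma csolD:
  assumes "csol v0 U"
  shows "continuous_on pos_time U" "subsol (HJ G 0 0) pos_time U" "supsol (HJ G 0 0) pos_time U"
    "usc_on pos_time U" "lsc_on pos_time U"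
    "\<exists>B. \<forall>z\<in>pos_time. tm z \<le> T \<longrightarrow> \<bar>U z\<bar> \<le> B"
    "e > 0 \<Longrightarrow> \<exists>\<delta>>0. \<forall>z\<in>pos_time. tm z < \<delta> \<longrightarrow> \<bar>U z - v0 (spc z)\<bar> \<le> e"
  using assms continuous_imp_usc_on[OF open_pos_time] continuous_imp_lsc_on[OF open_pos_time]
  unfolding csol_def by auto

lemma csol_init:
  assumes U: "csol v0 U" and U': "csol v0' U'" and uc: "uniformly_continuous_on UNIV v0"
    and le: "\<And>X. v0 X \<le> v0' X + d" and e: "0 < e"
  shows "\<exists>\<delta>>0. \<forall>z\<in>pos_time. \<forall>z'\<in>pos_time. dist z z' < \<delta> \<and> tm z < \<delta> \<longrightarrow> U z - (U' z' + d) \<le> e"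
proof -
  have e3: "e / 3 > 0" using e by simp
  obtain d1 where d1: "d1 > 0" "\<And>z. z \<in> pos_time \<Longrightarrow> tm z < d1 \<Longrightarrow> \<bar>U z - v0 (spc z)\<bar> \<le> e / 3"
    using csolD(7)[OF U e3] by blast
  obtain d2 where d2: "d2 > 0" "\<And>z. z \<in> pos_time \<Longrightarrow> tm z < d2 \<Longrightarrow> \<bar>U' z - v0' (spc z)\<bar> \<le> e / 3"
    using csolD(7)[OF U' e3] by blast
  obtain d3 where d3: "d3 > 0" "\<And>X Y. dist X Y < d3 \<Longrightarrow> \<bar>v0 X - v0 Y\<bar> < e / 3"
    using uc e3 unfolding uniformly_continuous_on_def dist_real_def by (metis UNIV_I)
  define \<delta> where "\<delta> = min (d1 / 2) (min (d2 / 2) d3)"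
  have \<delta>: "0 < \<delta>" "\<delta> \<le> d1 / 2" "\<delta> \<le> d2 / 2" "\<delta> \<le> d3" using d1 d2 d3 by (auto simp: \<delta>_def)
  have "U z - (U' z' + d) \<le> e" if z: "z \<in> pos_time" "z' \<in> pos_time" "dist z z' < \<delta>" "tm z < \<delta>" for z z'
  proof -
    have "\<bar>U z - v0 (spc z)\<bar> \<le> e / 3" by (rule d1(2)[OF z(1)]) (use z \<delta> d1 in auto)
    moreover have "\<bar>U' z' - v0' (spc z')\<bar> \<le> e / 3" by (rule d2(2)[OF z(2)]) (use z \<delta> d2 dist_tm[of z z'] in auto)
    moreover have "\<bar>v0 (spc z) - v0 (spc z')\<bar> < e / 3" by (rule d3(2)) (use z \<delta> dist_spc[of z z'] in auto)
    ultimately show ?thesis using le[of "spc z'"] by linarith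
  qed
  then show ?thesis using \<delta>(1) by blast
qed

lemma csol_bounds:
  assumes U: "csol v0 U" and U': "csol v0' U'"
  shows "\<exists>B. \<forall>z\<in>pos_time. tm z \<le> T \<longrightarrow> U z \<le> B \<and> - B \<le> U' z + d"
proof -
  obtain B B' where B: "\<And>z. z \<in> pos_time \<Longrightarrow> tm z \<le> T \<Longrightarrow> \<bar>U z\<bar> \<le> B"
    "\<And>z. z \<in> pos_time \<Longrightarrow> tm z \<le> T \<Longrightarrow> \<bar>U' z\<bar> \<le> B'" using csolD(6)[OF U] csolD(6)[OF U'] by meson
  have "U z \<le> max B (B' + \<bar>d\<bar>) \<and> - max B (B' + \<bar>d\<bar>) \<le> U' z + d" if "z \<in> pos_time" "tm z \<le> T" for z
    using B(1)[OF that] B(2)[OF that] by linarith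
  then show ?thesis by blast
qed

text \<open>A uniform gap \<open>d\<close> between the data persists, since without discount
  constants may be added to a solution. It gives uniqueness and the contraction behind the
  approximation argument.\<close>

lemma csol_le:
  assumes U: "csol v0 U" and U': "csol v0' U'" and uc: "uniformly_continuous_on UNIV v0"
    and le: "\<And>X. v0 X \<le> v0' X + d" and z: "z \<in> pos_time"
  shows "U z \<le> U' z + d"
proof (rule cauchy_comparison_le[OF csolD(4,2)[OF U] _ _ csol_bounds[OF U U'] csol_init[OF U U' uc le] z])
  show "lsc_on pos_time (\<lambda>z. U' z + d)"
    by (intro continuous_imp_lsc_on[OF open_pos_time] continuous_intros csolD(1)[OF U'])
  show "supsol (HJ G 0 0) pos_time (\<lambda>z. U' z + d)"
    using HJ_supsol_diff_const[OF csolD(3)[OF U'], of "- d"] by simp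
qed

text \<open>The datum plus or minus \<open>C * tm z\<close> are barriers, because their test
  gradients stay in the ball where |G| is at most \<open>C\<close>. They meet at time 0, which
  yields both the initial condition and the initial estimate for comparing Perron's pair.\<close>

lemma csol_lipschitz:
  assumes V0: "\<And>X Y. \<bar>V0 X - V0 Y\<bar> \<le> L * dist X Y" and b: "\<And>X. \<bar>V0 X\<bar> \<le> M"
  shows "\<exists>U. csol V0 U"
proof -
  have L0: "0 \<le> L"
  proof -
    have "0 \<le> L * dist (0::(real^'n) \<times> real) (0, 1)" using V0[of 0 "(0,1)"] by linarith
    then show ?thesis by (simp add: dist_prod_def zero_prod_def)
  qed
  obtain C0 where C0: "\<And>x y t p q. norm p \<le> L \<Longrightarrow> \<bar>q\<bar> \<le> L \<Longrightarrow> \<bar>G x y t p q\<bar> \<le> C0" using G_bounded[of L] by blast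
  define C where "C = max C0 0"
  have C: "0 \<le> C" "\<And>x y t p q. norm p \<le> L \<Longrightarrow> \<bar>q\<bar> \<le> L \<Longrightarrow> \<bar>G x y t p q\<bar> \<le> C" using C0 by (auto simp: C_def le_max_iff_disj)
  define f where "f z = V0 (spc z) + - C * tm z" for z
  define g where "g z = V0 (spc z) + C * tm z" for z
  have V0uc: "continuous_on UNIV V0"
    by (rule lipschitz_on_continuous_on[of L], rule lipschitz_onI) (use V0 L0 in \<open>auto simp: dist_real_def\<close>)
  have fc: "continuous_on pos_time f" "continuous_on pos_time g"
    unfolding f_def g_def spc_def tm_def by (auto intro!: continuous_intros continuous_on_compose2[OF V0uc])
  have fs: "subsol (HJ G 0 0) pos_time f"
  proof (rule subsolI)
    fix z \<phi> gr and e :: real assume z: "z \<in> pos_time" and t: "test_fun \<phi> gr" and e: "e > 0"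
      and max: "\<And>w. w \<in> ball z e \<Longrightarrow> w \<in> pos_time \<Longrightarrow> f w - \<phi> w \<le> f z - \<phi> z"
    note lt = lipschitz_touch[OF V0 open_pos_time z t e max[unfolded f_def]]
    show "HJ G 0 0 z (f z) (gr z) \<le> 0"
      using C(2)[OF lt(1,2), of "fst z" "fst (snd z)" "snd (snd z)"] lt(3) by (simp add: HJ_def)
  qed
  have gs: "supsol (HJ G 0 0) pos_time g"
  proof (rule supsolI)
    fix z \<phi> gr and e :: real assume z: "z \<in> pos_time" and t: "test_fun \<phi> gr" and e: "e > 0"
      and max: "\<And>w. w \<in> ball z e \<Longrightarrow> w \<in> pos_time \<Longrightarrow> g z - \<phi> z \<le> g w - \<phi> w"
    have mV0: "\<bar>- V0 X - - V0 Y\<bar> \<le> L * dist X Y" for X Y using V0[of X Y] by (simp add: abs_minus_commute)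
    have max': "- V0 (spc w) + - C * tm w - - \<phi> w \<le> - V0 (spc z) + - C * tm z - - \<phi> z" if "w \<in> ball z e" "w \<in> pos_time" for w
      using max[OF that] by (simp add: g_def)
    note lt = lipschitz_touch[OF mV0 open_pos_time z test_fun_minus[OF t] e max']
    show "0 \<le> HJ G 0 0 z (g z) (gr z)"
      using C(2)[of "fst (gr z)" "fst (snd (gr z))" "fst z" "fst (snd z)" "snd (snd z)"] lt by (simp add: HJ_def)
  qed
  have fg: "f z \<le> g z" if "z \<in> pos_time" for z
  proof -
    have "0 \<le> C * tm z" using that C(1) by (simp add: pos_time_iff)
    then show ?thesis by (simp add: f_def g_def)
  qed
  obtain U V where UV: "usc_on pos_time U" "lsc_on pos_time V" "subsol (HJ G 0 0) pos_time U" "supsol (HJ G 0 0) pos_time V"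
    "\<And>z. z \<in> pos_time \<Longrightarrow> f z \<le> V z" "\<And>z. z \<in> pos_time \<Longrightarrow> V z \<le> U z" "\<And>z. z \<in> pos_time \<Longrightarrow> U z \<le> g z"
    using perron[OF HJ_continuous open_pos_time fc(1) fs fc(2) gs fg] by blast
  have Ct: "\<bar>C * tm z\<bar> \<le> C * T" if "z \<in> pos_time" "tm z \<le> T" for z T
    using that C(1) by (simp add: pos_time_iff abs_mult mult_left_mono)
  have UVb: "U z \<le> V0 (spc z) + C * tm z" "V0 (spc z) - C * tm z \<le> V z" if "z \<in> pos_time" for z
    using UV(5,7)[OF that] by (simp_all add: f_def g_def)
  have UleV: "U z \<le> V z" if z: "z \<in> pos_time" for z
  proof (rule cauchy_comparison_le[OF UV(1,3,2,4) _ _ z])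
    show "\<exists>B. \<forall>z\<in>pos_time. tm z \<le> T \<longrightarrow> U z \<le> B \<and> - B \<le> V z" for T
    proof (intro exI ballI impI)
      fix z :: "'n spt" assume z: "z \<in> pos_time" "tm z \<le> T"
      show "U z \<le> M + C * T \<and> - (M + C * T) \<le> V z"
        using UVb[OF z(1)] Ct[OF z] b[of "spc z"] by linarith
    qed
    fix e :: real assume e: "e > 0"
    \<comment> \<open>The datum contributes \<open>L * \<delta>\<close>, the upper barrier
      \<open>C * \<delta>\<close>, and the lower one \<open>2 * C * \<delta>\<close>, as the second
      time is below \<open>2 * \<delta>\<close>.\<close>
    define \<delta> where "\<delta> = e / (L + 3 * C + 1)"
    have den: "0 < L + 3 * C + 1" using L0 C(1) by simp
    have \<delta>: "0 < \<delta>" "(L + 3 * C) * \<delta> \<le> e"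
    proof -
      show "0 < \<delta>" using e den by (simp add: \<delta>_def)
      have "(L + 3 * C + 1) * \<delta> = e" using den by (simp add: \<delta>_def)
      then show "(L + 3 * C) * \<delta> \<le> e" using \<open>0 < \<delta>\<close> by (simp add: distrib_right)
    qed
    have "U z - V z' \<le> e" if z: "z \<in> pos_time" "z' \<in> pos_time" "dist z z' < \<delta>" "tm z < \<delta>" for z z'
    proof -
      have "L * dist (spc z) (spc z') \<le> L * \<delta>" using L0 dist_spc[of z z'] z by (intro mult_left_mono) auto
      then have "V0 (spc z) - V0 (spc z') \<le> L * \<delta>" using V0[of "spc z" "spc z'"] by linarith
      moreover have "C * tm z \<le> C * \<delta>" "C * tm z' \<le> C * (2 * \<delta>)"
        using C(1) z dist_tm[of z z'] by (auto intro!: mult_left_mono)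
      ultimately have "U z - V z' \<le> L * \<delta> + C * \<delta> + C * (2 * \<delta>)" using UVb(1)[OF z(1)] UVb(2)[OF z(2)] by linarith
      also have "\<dots> = (L + 3 * C) * \<delta>" by (simp add: algebra_simps)
      finally show ?thesis using \<delta>(2) by simp
    qed
    then show "\<exists>\<delta>>0. \<forall>z\<in>pos_time. \<forall>z'\<in>pos_time. dist z z' < \<delta> \<and> tm z < \<delta> \<longrightarrow> U z - V z' \<le> e" using \<delta>(1) by blast
  qed
  have eq: "U z = V z" if "z \<in> pos_time" for z using UleV[OF that] UV(6)[OF that] by simp
  have "lsc_on pos_time U" unfolding lsc_on_def usc_on_def
  proof (intro ballI allI impI)
    fix z :: "'n spt" and e :: real assume z: "z \<in> pos_time" and e: "e > 0"
    have "\<forall>\<^sub>F w in nhds z. - V w < - V z + e" using UV(2) z e unfolding lsc_on_def usc_on_def by blast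
    moreover have "\<forall>\<^sub>F w in nhds z. w \<in> pos_time" by (rule eventually_nhds_in_open[OF open_pos_time z])
    ultimately show "\<forall>\<^sub>F w in nhds z. - U w < - U z + e" by eventually_elim (use eq z in simp)
  qed
  then have "continuous_on pos_time U" by (rule usc_lsc_imp_continuous_on[OF open_pos_time UV(1)])
  moreover have "supsol (HJ G 0 0) pos_time U" using UV(4) supsol_cong[of pos_time U V] eq by blast
  moreover have "\<exists>B. \<forall>z\<in>pos_time. tm z \<le> T \<longrightarrow> \<bar>U z\<bar> \<le> B" for T
  proof (intro exI ballI impI)
    fix z :: "'n spt" assume z: "z \<in> pos_time" "tm z \<le> T"
    show "\<bar>U z\<bar> \<le> M + C * T" using UVb[OF z(1)] Ct[OF z] b[of "spc z"] eq[OF z(1)] by linarith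
  qed
  moreover have "\<exists>\<delta>>0. \<forall>z\<in>pos_time. tm z < \<delta> \<longrightarrow> \<bar>U z - V0 (spc z)\<bar> \<le> e" if e: "e > 0" for e
  proof (intro exI[of _ "e / (C + 1)"] conjI ballI impI)
    show "0 < e / (C + 1)" using e C(1) by simp
    fix z :: "'n spt" assume z: "z \<in> pos_time" "tm z < e / (C + 1)"
    have "tm z * (C + 1) < e" using z(2) C(1) by (simp add: pos_less_divide_eq)
    moreover have "0 < tm z" using z(1) by (simp add: pos_time_iff)
    ultimately have "C * tm z \<le> e" by (simp add: algebra_simps)
    then show "\<bar>U z - V0 (spc z)\<bar> \<le> e" using UVb[OF z(1)] eq[OF z(1)] by linarith
  qed
  ultimately show ?thesis unfolding csol_def using UV(3) by blast
qed

end

text \<open>Under uniform convergence the constant sequence recovers \<open>U z\<close>, and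
  continuity of the limit supplies the local upper bound required by
  \<open>subsol_limit\<close>.\<close>

lemma subsol_uniform_limit:
  fixes F :: "'a::euclidean_space \<Rightarrow> real \<Rightarrow> 'a \<Rightarrow> real"
  assumes F: "continuous_on UNIV (\<lambda>(z, r, p). F z r p)" and \<Omega>: "open \<Omega>"
    and u: "\<And>k. continuous_on \<Omega> (u k)" "\<And>k. subsol F \<Omega> (u k)" and U: "continuous_on \<Omega> U"
    and lim: "\<And>k z. z \<in> \<Omega> \<Longrightarrow> \<bar>u k z - U z\<bar> \<le> \<epsilon> k" "\<epsilon> \<longlonglongrightarrow> 0"
  shows "subsol F \<Omega> U"
proof (rule subsolI)
  fix z \<phi> g and e :: real assume z: "z \<in> \<Omega>" and t: "test_fun \<phi> g" and e: "e > 0"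
    and max: "\<And>w. w \<in> ball z e \<Longrightarrow> w \<in> \<Omega> \<Longrightarrow> U w - \<phi> w \<le> U z - \<phi> z"
  show "F z (U z) (g z) \<le> 0"
  proof (rule subsol_limit[where U=U and u=u and Fk="\<lambda>k. F" and F=F, OF \<Omega> z continuous_imp_usc_on[OF \<Omega> u(1)] u(2) _ _ tendsto_const _ t e])
    show "(\<lambda>k. F (xs k) (rs k) (ps k)) \<longlonglongrightarrow> F z (U z) p"
      if "xs \<longlonglongrightarrow> z" "rs \<longlonglongrightarrow> U z" "ps \<longlonglongrightarrow> p" for xs rs ps p
    proof -
      have "isCont (\<lambda>(z, r, p). F z r p) (z, U z, p)"
        using F continuous_on_eq_continuous_at[OF open_UNIV] by blast
      from isCont_tendsto_compose[OF this tendsto_Pair[OF that(1) tendsto_Pair[OF that(2,3)]]]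
      show ?thesis by simp
    qed
    show "(\<lambda>k. u k z) \<longlonglongrightarrow> U z"
    proof (rule LIM_zero_cancel, rule Lim_null_comparison[OF _ lim(2)])
      show "\<forall>\<^sub>F k in sequentially. norm (u k z - U z) \<le> \<epsilon> k" using lim(1)[OF z] by simp
    qed
    show "\<exists>d>0. \<exists>N::nat. \<forall>k\<ge>N. \<forall>w'\<in>ball w d. u k w' \<le> U w + c" if w: "w \<in> \<Omega>" and c: "c > 0" for w c
    proof -
      have "\<forall>\<^sub>F w' in nhds w. U w' < U w + c / 2 \<and> w' \<in> \<Omega>"
        using usc_onD[OF continuous_imp_usc_on[OF \<Omega> U] w, of "c / 2"] c \<Omega> w by (intro eventually_conj eventually_nhds_in_open) auto
      then obtain d where d: "d > 0" "\<And>w'. dist w' w < d \<Longrightarrow> U w' < U w + c / 2 \<and> w' \<in> \<Omega>"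
        unfolding eventually_nhds_metric by blast
      have "\<forall>\<^sub>F k in sequentially. \<epsilon> k < c / 2" by (rule order_tendstoD(2)[OF lim(2)]) (use c in simp)
      then obtain N where N: "\<And>k. k \<ge> N \<Longrightarrow> \<epsilon> k < c / 2" unfolding eventually_sequentially by blast
      have "u k w' \<le> U w + c" if "k \<ge> N" "w' \<in> ball w d" for k w'
      proof -
        have "dist w' w < d" using that(2) by (simp add: dist_commute)
        then have "U w' < U w + c / 2" "w' \<in> \<Omega>" using d(2) by auto
        then show ?thesis using lim(1)[of w' k] N[OF that(1)] by linarith
      qed
      then show ?thesis using d(1) by blast
    qed
  qed (use max in auto)
qed

lemma dual_eq_continuous:
  assumes "continuous_on UNIV (\<lambda>(z, r, p). F z r p)"
  shows "continuous_on UNIV (\<lambda>(z, r, p). dual_eq F z r p)"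
proof -
  have "continuous_on UNIV (\<lambda>a. (\<lambda>(z, r, p). F z r p) (fst a, - fst (snd a), - snd (snd a)))"
    by (rule continuous_on_compose2[OF assms]) (auto intro!: continuous_intros)
  then show ?thesis unfolding dual_eq_def case_prod_unfold by (intro continuous_intros) simp
qed

context hj begin

text \<open>Barriers need a Lipschitz datum. For a general one, solutions for Lipschitz
  approximations are Cauchy uniformly in space and time by \<open>csol_le\<close>, and every clause
  of \<open>csol\<close> survives the uniform limit.\<close>

lemma csol_exists:
  assumes b: "\<And>X. \<bar>v0 X\<bar> \<le> M" and uc: "uniformly_continuous_on UNIV v0"
  shows "\<exists>U. csol v0 U"
proof -
  define \<epsilon> where "\<epsilon> k = 1 / real (Suc k)" for k
  have \<epsilon>: "0 < \<epsilon> k" for k by (simp add: \<epsilon>_def)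
  have \<epsilon>lim: "\<epsilon> \<longlonglongrightarrow> 0" unfolding \<epsilon>_def by (rule LIMSEQ_inverse_Suc)
  have "\<exists>V L. 0 \<le> L \<and> (\<forall>X Y. \<bar>V X - V Y\<bar> \<le> L * dist X Y) \<and> (\<forall>X. \<bar>V X - v0 X\<bar> \<le> \<epsilon> k)" for k
    by (rule lipschitz_approximation[OF b uc \<epsilon>])
  then obtain V L where V: "\<And>k. 0 \<le> L k" "\<And>k X Y. \<bar>V k X - V k Y\<bar> \<le> L k * dist X Y" "\<And>k X. \<bar>V k X - v0 X\<bar> \<le> \<epsilon> k"
    by metis
  have Vb: "\<bar>V k X\<bar> \<le> M + \<epsilon> k" for k X using V(3)[of k X] b[of X] by linarith
  have Vuc: "uniformly_continuous_on UNIV (V k)" for k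
    by (rule lipschitz_on_uniformly_continuous[of "L k"], rule lipschitz_onI) (use V in \<open>auto simp: dist_real_def\<close>)
  obtain u where u: "\<And>k. csol (V k) (u k)" using csol_lipschitz[OF V(2) Vb] by metis
  have le: "u k z \<le> u j z + (\<epsilon> k + \<epsilon> j)" if z: "z \<in> pos_time" for k j z
  proof (rule csol_le[OF u u Vuc _ z])
    show "V k X \<le> V j X + (\<epsilon> k + \<epsilon> j)" for X using V(3)[of k X] V(3)[of j X] by linarith
  qed
  have conv: "\<exists>l. (\<lambda>k. u k z) \<longlonglongrightarrow> l" if z: "z \<in> pos_time" for z
  proof -
    have "Cauchy (\<lambda>k. u k z)"
    proof (rule metric_CauchyI)
      fix e :: real assume e: "e > 0"
      have "\<forall>\<^sub>F k in sequentially. \<epsilon> k < e / 2" by (rule order_tendstoD(2)[OF \<epsilon>lim]) (use e in simp)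
      then obtain N where N: "\<And>k. k \<ge> N \<Longrightarrow> \<epsilon> k < e / 2" unfolding eventually_sequentially by blast
      have "dist (u m z) (u n z) < e" if "m \<ge> N" "n \<ge> N" for m n
        using le[OF z, of m n] le[OF z, of n m] N[OF that(1)] N[OF that(2)] unfolding dist_real_def by linarith
      then show "\<exists>N. \<forall>m\<ge>N. \<forall>n\<ge>N. dist (u m z) (u n z) < e" by blast
    qed
    then show ?thesis by (simp add: Cauchy_convergent_iff convergent_def)
  qed
  define U where "U z = (if z \<in> pos_time then lim (\<lambda>k. u k z) else 0)" for z
  have Ulim: "(\<lambda>k. u k z) \<longlonglongrightarrow> U z" if "z \<in> pos_time" for z
    using conv[OF that] that by (auto simp: U_def limI)
  have near: "\<bar>u k z - U z\<bar> \<le> \<epsilon> k" if z: "z \<in> pos_time" for k z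
  proof -
    have l: "(\<lambda>j. \<bar>u k z - u j z\<bar>) \<longlonglongrightarrow> \<bar>u k z - U z\<bar>" by (intro tendsto_intros Ulim z)
    have r: "(\<lambda>j. \<epsilon> k + \<epsilon> j) \<longlonglongrightarrow> \<epsilon> k + 0" by (intro tendsto_intros \<epsilon>lim)
    have "\<bar>u k z - u j z\<bar> \<le> \<epsilon> k + \<epsilon> j" for j using le[OF z, of k j] le[OF z, of j k] by linarith
    then have "\<bar>u k z - U z\<bar> \<le> \<epsilon> k + 0" by (intro LIMSEQ_le[OF l r]) auto
    then show ?thesis by simp
  qed
  have "uniform_limit pos_time u U sequentially"
  proof (rule uniform_limitI)
    fix e :: real assume e: "e > 0"
    have "\<forall>\<^sub>F k in sequentially. \<epsilon> k < e" by (rule order_tendstoD(2)[OF \<epsilon>lim e])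
    then show "\<forall>\<^sub>F k in sequentially. \<forall>z\<in>pos_time. dist (u k z) (U z) < e"
    proof eventually_elim
      case (elim k)
      then show ?case using near[of _ k] unfolding dist_real_def by (meson le_less_trans)
    qed
  qed
  then have Uc: "continuous_on pos_time U"
    by (rule uniform_limit_theorem[rotated]) (use csolD(1)[OF u] in simp_all)
  have Usub: "subsol (HJ G 0 0) pos_time U"
    by (rule subsol_uniform_limit[OF HJ_continuous open_pos_time csolD(1)[OF u] csolD(2)[OF u] Uc near \<epsilon>lim])
  have "subsol (dual_eq (HJ G 0 0)) pos_time (\<lambda>z. - U z)"
  proof (rule subsol_uniform_limit[OF dual_eq_continuous[OF HJ_continuous] open_pos_time, where u="\<lambda>k z. - u k z" and \<epsilon>=\<epsilon>])
    show "subsol (dual_eq (HJ G 0 0)) pos_time (\<lambda>z. - u k z)" for k using csolD(3)[OF u[of k]] by (simp add: supsol_def)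
    show "\<bar>- u k z - - U z\<bar> \<le> \<epsilon> k" if "z \<in> pos_time" for k z using near[OF that, of k] by linarith
  qed (use csolD(1)[OF u] Uc \<epsilon>lim in \<open>auto intro!: continuous_intros\<close>)
  then have Usup: "supsol (HJ G 0 0) pos_time U" by (simp add: supsol_def)
  have Ub: "\<exists>B. \<forall>z\<in>pos_time. tm z \<le> T \<longrightarrow> \<bar>U z\<bar> \<le> B" for T
  proof -
    obtain B where B: "\<And>z. z \<in> pos_time \<Longrightarrow> tm z \<le> T \<Longrightarrow> \<bar>u 0 z\<bar> \<le> B" using csolD(6)[OF u] by blast
    have "\<bar>U z\<bar> \<le> B + \<epsilon> 0" if "z \<in> pos_time" "tm z \<le> T" for z using B[OF that] near[OF that(1), of 0] by linarith
    then show ?thesis by blast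
  qed
  have Ui: "\<exists>\<delta>>0. \<forall>z\<in>pos_time. tm z < \<delta> \<longrightarrow> \<bar>U z - v0 (spc z)\<bar> \<le> e" if e: "e > 0" for e
  proof -
    have "\<forall>\<^sub>F k in sequentially. \<epsilon> k < e / 3" by (rule order_tendstoD(2)[OF \<epsilon>lim]) (use e in simp)
    then obtain k where k: "\<epsilon> k < e / 3" unfolding eventually_sequentially by blast
    have "e / 3 > 0" using e by simp
    from csolD(7)[OF u[of k] this] obtain \<delta> where \<delta>: "\<delta> > 0" "\<And>z. z \<in> pos_time \<Longrightarrow> tm z < \<delta> \<Longrightarrow> \<bar>u k z - V k (spc z)\<bar> \<le> e / 3"
      by blast
    have "\<bar>U z - v0 (spc z)\<bar> \<le> e" if "z \<in> pos_time" "tm z < \<delta>" for z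
      using \<delta>(2)[OF that] near[OF that(1), of k] V(3)[of k "spc z"] k by linarith
    then show ?thesis using \<delta>(1) by blast
  qed
  show ?thesis unfolding csol_def using Uc Usub Usup Ub Ui by blast
qed

text \<open>Uniform continuity is read off from comparison of the solution with itself when both
  times are positive, and from the uniform initial condition with the modulus of the datum when one
  of them is 0.\<close>

lemma csol_imp_cauchy_sol:
  assumes U: "csol (\<lambda>(x, y). v0 x y) U" and b: "\<And>x y. \<bar>v0 x y\<bar> \<le> M" and uc: "uniformly_continuous_on UNIV (\<lambda>(x, y). v0 x y)"
  shows "cauchy_sol G v0 (\<lambda>x y t. if 0 < t then U (x, y, t) else v0 x y)"
proof -
  let ?V0 = "\<lambda>(x, y). v0 x y"
  define v where "v = (\<lambda>x y t. if 0 < t then U (x, y, t) else v0 x y)"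
  have v_pos: "uncurry3 v z = U z" if "z \<in> pos_time" for z
    using that by (cases z) (simp add: uncurry3_def v_def pos_time_def)
  have v_neg: "uncurry3 v z = ?V0 (spc z)" if "z \<notin> pos_time" for z
    using that by (cases z) (simp add: uncurry3_def v_def pos_time_def spc_def)
  have "continuous_on pos_time (uncurry3 v)" using csolD(1)[OF U] continuous_on_cong[of pos_time pos_time "uncurry3 v" U] v_pos by simp
  then have 1: "visc_sol (eqF G 0 0) pos_time (uncurry3 v)"
    unfolding visc_sol_iff[OF open_pos_time]
    using csolD(2,3)[OF U] subsol_cong[of pos_time "uncurry3 v" U] supsol_cong[of pos_time "uncurry3 v" U] v_pos by blast
  have 2: "bounded (uncurry3 v ` {z. 0 \<le> snd (snd z) \<and> snd (snd z) \<le> T})" for T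
  proof -
    obtain B where B: "\<And>z. z \<in> pos_time \<Longrightarrow> tm z \<le> T \<Longrightarrow> \<bar>U z\<bar> \<le> B" using csolD(6)[OF U] by blast
    have "\<bar>uncurry3 v z\<bar> \<le> max B M" if "snd (snd z) \<le> T" for z
    proof (cases "z \<in> pos_time")
      case True
      then show ?thesis using B[OF True] that by (auto simp: v_pos tm_def)
    next
      case False
      then show ?thesis using b[of "fst z" "fst (snd z)"] by (auto simp: v_neg spc_def)
    qed
    then show ?thesis unfolding bounded_iff by (intro exI[of _ "max B M"]) auto
  qed
  have 3: "uniformly_continuous_on {z. 0 \<le> snd (snd z) \<and> snd (snd z) \<le> T} (uncurry3 v)" for T
    unfolding uniformly_continuous_on_def
  proof (intro allI impI)
    fix e :: real assume e: "e > 0"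
    have "\<exists>\<delta>>0. \<forall>z\<in>pos_time. \<forall>z'\<in>pos_time. tm z \<le> T \<and> dist z z' < \<delta> \<longrightarrow> U z - U z' < e"
    proof (rule cauchy_comparison[OF csolD(4,2,5,3)[OF U] _ _ e])
      show "\<exists>B. \<forall>z\<in>pos_time. tm z \<le> T \<longrightarrow> U z \<le> B \<and> - B \<le> U z" for T using csol_bounds[OF U U, of T 0] by simp
      show "\<exists>\<delta>>0. \<forall>z\<in>pos_time. \<forall>z'\<in>pos_time. dist z z' < \<delta> \<and> tm z < \<delta> \<longrightarrow> U z - U z' \<le> e'" if "0 < e'" for e'
        using csol_init[OF U U uc, of 0 e'] that by simp
    qed
    then obtain d1 where d1: "d1 > 0" "\<And>z z'. z \<in> pos_time \<Longrightarrow> z' \<in> pos_time \<Longrightarrow> tm z \<le> T \<Longrightarrow> dist z z' < d1 \<Longrightarrow> U z - U z' < e"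
      by blast
    have e2: "e / 2 > 0" using e by simp
    obtain d2 where d2: "d2 > 0" "\<And>z. z \<in> pos_time \<Longrightarrow> tm z < d2 \<Longrightarrow> \<bar>U z - ?V0 (spc z)\<bar> \<le> e / 2"
      using csolD(7)[OF U e2] by blast
    obtain d3 where d3: "d3 > 0" "\<And>X Y. dist X Y < d3 \<Longrightarrow> \<bar>?V0 X - ?V0 Y\<bar> < e / 2"
      using uc e2 unfolding uniformly_continuous_on_def dist_real_def by (metis UNIV_I)
    define d where "d = min d1 (min d2 d3)"
    have d: "0 < d" "d \<le> d1" "d \<le> d2" "d \<le> d3" using d1 d2 d3 by (auto simp: d_def)
    have key: "dist (uncurry3 v z) (uncurry3 v z') < e" if z0: "z \<notin> pos_time" "0 \<le> tm z" and dz: "dist z z' < d" "0 \<le> tm z'" for z z'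
    proof -
      have V: "\<bar>?V0 (spc z) - ?V0 (spc z')\<bar> < e / 2" by (rule d3(2)) (use dist_spc[of z z'] dz d in linarith)
      show ?thesis
      proof (cases "z' \<in> pos_time")
        case True
        have "tm z' < d2" using dist_tm[of z z'] z0 dz d by (auto simp: pos_time_iff)
        then have "\<bar>U z' - ?V0 (spc z')\<bar> \<le> e / 2" by (rule d2(2)[OF True])
        then show ?thesis using V unfolding v_pos[OF True] v_neg[OF z0(1)] dist_real_def by linarith
      next
        case False
        then show ?thesis using V e unfolding v_neg[OF False] v_neg[OF z0(1)] dist_real_def by linarith
      qed
    qed
    have "dist (uncurry3 v z') (uncurry3 v z) < e"
      if zz: "0 \<le> tm z" "tm z \<le> T" "0 \<le> tm z'" "tm z' \<le> T" "dist z' z < d" for z z'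
    proof (cases "z \<in> pos_time \<and> z' \<in> pos_time")
      case True
      have "U z - U z' < e" "U z' - U z < e" using True zz d by (auto intro!: d1(2) simp: dist_commute)
      then show ?thesis using True by (simp add: v_pos dist_real_def abs_less_iff)
    next
      case False
      then show ?thesis using key[of z z'] key[of z' z] zz by (auto simp: dist_commute)
    qed
    then show "\<exists>d>0. \<forall>x\<in>{z. 0 \<le> snd (snd z) \<and> snd (snd z) \<le> T}. \<forall>x'\<in>{z. 0 \<le> snd (snd z) \<and> snd (snd z) \<le> T}.
        dist x' x < d \<longrightarrow> dist (uncurry3 v x') (uncurry3 v x) < e"
      using d(1) unfolding tm_def by blast
  qed
  have "v x y 0 = v0 x y" for x y by (simp add: v_def)
  then show ?thesis using 1 2 3 unfolding cauchy_sol_def v_def[symmetric] by blast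
qed

lemma cauchy_sol_imp_csol:
  assumes v: "cauchy_sol G v0 v" shows "csol (\<lambda>(x, y). v0 x y) (uncurry3 v)"
proof -
  have s: "continuous_on pos_time (uncurry3 v)" "subsol (HJ G 0 0) pos_time (uncurry3 v)" "supsol (HJ G 0 0) pos_time (uncurry3 v)"
    using v unfolding cauchy_sol_def visc_sol_iff[OF open_pos_time] by auto
  have "\<exists>B. \<forall>z\<in>pos_time. tm z \<le> T \<longrightarrow> \<bar>uncurry3 v z\<bar> \<le> B" for T
  proof -
    have "bounded (uncurry3 v ` {z. 0 \<le> snd (snd z) \<and> snd (snd z) \<le> max T 1})"
      using v unfolding cauchy_sol_def by (meson less_max_iff_disj zero_less_one)
    then obtain B where "\<forall>b\<in>uncurry3 v ` {z. 0 \<le> snd (snd z) \<and> snd (snd z) \<le> max T 1}. norm b \<le> B"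
      unfolding bounded_iff by blast
    moreover have "z \<in> {z. 0 \<le> snd (snd z) \<and> snd (snd z) \<le> max T 1}" if "z \<in> pos_time" "tm z \<le> T" for z
      using that by (auto simp: pos_time_def tm_def)
    ultimately have "norm (uncurry3 v z) \<le> B" if "z \<in> pos_time" "tm z \<le> T" for z using that by blast
    then show ?thesis unfolding real_norm_def by blast
  qed
  moreover have "\<exists>\<delta>>0. \<forall>z\<in>pos_time. tm z < \<delta> \<longrightarrow> \<bar>uncurry3 v z - (\<lambda>(x, y). v0 x y) (spc z)\<bar> \<le> e" if e: "e > 0" for e
  proof -
    have "uniformly_continuous_on {z. 0 \<le> snd (snd z) \<and> snd (snd z) \<le> 1} (uncurry3 v)"
      using v unfolding cauchy_sol_def by (meson zero_less_one)
    then obtain d where d: "d > 0" "\<And>z z'. 0 \<le> snd (snd z) \<Longrightarrow> snd (snd z) \<le> 1 \<Longrightarrow> 0 \<le> snd (snd z') \<Longrightarrow> snd (snd z') \<le> 1 \<Longrightarrow>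
       dist z' z < d \<Longrightarrow> dist (uncurry3 v z') (uncurry3 v z) < e"
      unfolding uniformly_continuous_on_def using e by (metis (mono_tags, lifting) mem_Collect_eq)
    have "\<bar>uncurry3 v z - (\<lambda>(x, y). v0 x y) (spc z)\<bar> \<le> e" if z: "z \<in> pos_time" "tm z < min d 1" for z
    proof -
      obtain x y t where zx: "z = (x, y, t)" by (cases z) auto
      have t: "0 < t" "t < d" "t < 1" using z by (auto simp: zx pos_time_iff tm_def)
      have "dist (uncurry3 v (x, y, t)) (uncurry3 v (x, y, 0)) < e"
        by (rule d(2)) (use t in \<open>auto simp: dist_Pair_Pair\<close>)
      moreover have "uncurry3 v (x, y, 0) = v0 x y" using v by (simp add: cauchy_sol_def uncurry3_def)
      ultimately show ?thesis by (simp add: zx spc_def dist_real_def)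
    qed
    then show ?thesis using d(1) by (intro exI[of _ "min d 1"]) auto
  qed
  ultimately show ?thesis unfolding csol_def using s by blast
qed

text \<open>Subtracting \<open>lam * t\<close> turns the ergodic sub- and supersolution into a sub-
  and supersolution of the Cauchy equation. Bounded corrections order them at time 0, and comparison
  traps the solution between them for all times.\<close>

lemma csol_long_time:
  assumes U: "csol v0 U" and b: "\<And>X. \<bar>v0 X\<bar> \<le> M" and lam: "ergodic_admissible G lam"
  shows "\<exists>K. \<forall>z\<in>pos_time. \<bar>U z + lam * tm z\<bar> \<le> K"
proof -
  obtain S V B where S: "usc_on UNIV S" "subsol (HJ G 0 lam) UNIV S" and V: "lsc_on UNIV V" "supsol (HJ G 0 lam) UNIV V"
    and B: "\<And>z. \<bar>S z\<bar> \<le> B" "\<And>z. \<bar>V z\<bar> \<le> B"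
    using lam unfolding ergodic_admissible_iff by blast
  define \<rho> where "\<rho> w = lam * (snd (snd w) - 0)" for w :: "'n spt"
  have \<rho>: "\<rho> z = lam * tm z" for z by (simp add: \<rho>_def tm_def)
  have t\<rho>: "test_fun \<rho> (\<lambda>w. (0, 0, lam))" unfolding \<rho>_def by (rule test_fun_time)
  have \<rho>c: "continuous_on X \<rho>" for X by (rule continuous_on_subset[OF test_fun_continuous(1)[OF t\<rho>]]) simp
  have lamT: "\<bar>lam * tm z\<bar> \<le> \<bar>lam\<bar> * T" if "z \<in> pos_time" "tm z \<le> T" for z T
    using that by (simp add: pos_time_iff abs_mult mult_left_mono)
  \<comment> \<open>The largest initial gap between a function bounded by \<open>B\<close> and a
    datum bounded by \<open>M\<close>.\<close>
  define D where "D = B + M"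
  have init0: "\<exists>\<delta>>0. \<forall>z\<in>pos_time. tm z < \<delta> \<longrightarrow> \<bar>U z\<bar> \<le> M + e \<and> \<bar>lam * tm z\<bar> \<le> e" if e: "e > 0" for e
  proof -
    obtain \<delta> where \<delta>: "\<delta> > 0" "\<And>z. z \<in> pos_time \<Longrightarrow> tm z < \<delta> \<Longrightarrow> \<bar>U z - v0 (spc z)\<bar> \<le> e" using csolD(7)[OF U e] by blast
    define d where "d = min \<delta> (e / (\<bar>lam\<bar> + 1))"
    have "\<bar>U z\<bar> \<le> M + e \<and> \<bar>lam * tm z\<bar> \<le> e" if z: "z \<in> pos_time" "tm z < d" for z
    proof -
      have "\<bar>U z - v0 (spc z)\<bar> \<le> e" by (rule \<delta>(2)) (use z in \<open>auto simp: d_def\<close>)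
      moreover have "\<bar>lam * tm z\<bar> \<le> \<bar>lam\<bar> * (e / (\<bar>lam\<bar> + 1))" by (rule lamT) (use z in \<open>auto simp: d_def\<close>)
      moreover have "\<bar>lam\<bar> * (e / (\<bar>lam\<bar> + 1)) \<le> e" using e by (simp add: divide_simps)
      ultimately show ?thesis using b[of "spc z"] by linarith
    qed
    moreover have "d > 0" using \<delta>(1) e by (simp add: d_def)
    ultimately show ?thesis by blast
  qed
  have lo: "S z - \<rho> z \<le> U z + D" if z: "z \<in> pos_time" for z
  proof (rule cauchy_comparison_le[OF _ _ _ _ _ _ z])
    have "usc_on pos_time (\<lambda>z. S z + - \<rho> z)"
      by (intro usc_on_add usc_on_subset[OF S(1)] continuous_imp_usc_on[OF open_pos_time] continuous_intros \<rho>c) simp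
    then show "usc_on pos_time (\<lambda>z. S z - \<rho> z)" by simp
    show "subsol (HJ G 0 0) pos_time (\<lambda>z. S z - \<rho> z)"
      using HJ_subsol_minus_time[OF subsol_subset[OF S(2) open_pos_time subset_UNIV] t\<rho>, of lam] by simp
    show "lsc_on pos_time (\<lambda>z. U z + D)"
      by (intro continuous_imp_lsc_on[OF open_pos_time] continuous_intros csolD(1)[OF U])
    show "supsol (HJ G 0 0) pos_time (\<lambda>z. U z + D)" using HJ_supsol_diff_const[OF csolD(3)[OF U], of "- D"] by simp
    show "\<exists>B. \<forall>z\<in>pos_time. tm z \<le> T \<longrightarrow> S z - \<rho> z \<le> B \<and> - B \<le> U z + D" for T
    proof -
      obtain B' where B': "\<And>z. z \<in> pos_time \<Longrightarrow> tm z \<le> T \<Longrightarrow> \<bar>U z\<bar> \<le> B'" using csolD(6)[OF U] by blast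
      have "S z - \<rho> z \<le> B + \<bar>lam\<bar> * T + B' + \<bar>D\<bar> \<and> - (B + \<bar>lam\<bar> * T + B' + \<bar>D\<bar>) \<le> U z + D" if "z \<in> pos_time" "tm z \<le> T" for z
        using B(1)[of z] B'[OF that] lamT[OF that] unfolding \<rho> by linarith
      then show ?thesis by blast
    qed
    fix e :: real assume "e > 0"
    then have e2: "e / 2 > 0" by simp
    obtain \<delta> where \<delta>: "\<delta> > 0" "\<And>z. z \<in> pos_time \<Longrightarrow> tm z < \<delta> \<Longrightarrow> \<bar>U z\<bar> \<le> M + e / 2 \<and> \<bar>lam * tm z\<bar> \<le> e / 2"
      using init0[OF e2] by blast
    have "S z - \<rho> z - (U z' + D) \<le> e" if z: "z \<in> pos_time" "z' \<in> pos_time" "dist z z' < \<delta> / 2" "tm z < \<delta> / 2" for z z'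
    proof -
      have "tm z' < \<delta>" "tm z < \<delta>" using dist_tm[of z z'] z \<delta>(1) by auto
      then show ?thesis using \<delta>(2)[OF z(1)] \<delta>(2)[OF z(2)] B(1)[of z] unfolding \<rho> D_def by linarith
    qed
    then show "\<exists>\<delta>>0. \<forall>z\<in>pos_time. \<forall>z'\<in>pos_time. dist z z' < \<delta> \<and> tm z < \<delta> \<longrightarrow> S z - \<rho> z - (U z' + D) \<le> e"
      using \<delta>(1) by (intro exI[of _ "\<delta> / 2"]) auto
  qed
  have hi: "U z - D \<le> V z - \<rho> z" if z: "z \<in> pos_time" for z
  proof (rule cauchy_comparison_le[OF _ _ _ _ _ _ z])
    show "usc_on pos_time (\<lambda>z. U z - D)"
      by (intro continuous_imp_usc_on[OF open_pos_time] continuous_intros csolD(1)[OF U])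
    show "subsol (HJ G 0 0) pos_time (\<lambda>z. U z - D)" using HJ_subsol_diff_const[OF csolD(2)[OF U], of D] by simp
    have "usc_on pos_time (\<lambda>z. - V z + \<rho> z)"
      by (rule usc_on_add[OF usc_on_subset[OF V(1)[unfolded lsc_on_def] subset_UNIV] continuous_imp_usc_on[OF open_pos_time \<rho>c]])
    then show "lsc_on pos_time (\<lambda>z. V z - \<rho> z)" by (simp add: lsc_on_def algebra_simps)
    show "supsol (HJ G 0 0) pos_time (\<lambda>z. V z - \<rho> z)"
      using HJ_supsol_minus_time[OF supsol_subset[OF V(2) open_pos_time subset_UNIV] t\<rho>, of lam] by simp
    show "\<exists>B. \<forall>z\<in>pos_time. tm z \<le> T \<longrightarrow> U z - D \<le> B \<and> - B \<le> V z - \<rho> z" for T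
    proof -
      obtain B' where B': "\<And>z. z \<in> pos_time \<Longrightarrow> tm z \<le> T \<Longrightarrow> \<bar>U z\<bar> \<le> B'" using csolD(6)[OF U] by blast
      have "U z - D \<le> B + \<bar>lam\<bar> * T + B' + \<bar>D\<bar> \<and> - (B + \<bar>lam\<bar> * T + B' + \<bar>D\<bar>) \<le> V z - \<rho> z" if "z \<in> pos_time" "tm z \<le> T" for z
        using B(2)[of z] B'[OF that] lamT[OF that] unfolding \<rho> by linarith
      then show ?thesis by blast
    qed
    fix e :: real assume "e > 0"
    then have e2: "e / 2 > 0" by simp
    obtain \<delta> where \<delta>: "\<delta> > 0" "\<And>z. z \<in> pos_time \<Longrightarrow> tm z < \<delta> \<Longrightarrow> \<bar>U z\<bar> \<le> M + e / 2 \<and> \<bar>lam * tm z\<bar> \<le> e / 2"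
      using init0[OF e2] by blast
    have "U z - D - (V z' - \<rho> z') \<le> e" if z: "z \<in> pos_time" "z' \<in> pos_time" "dist z z' < \<delta> / 2" "tm z < \<delta> / 2" for z z'
    proof -
      have "tm z' < \<delta>" "tm z < \<delta>" using dist_tm[of z z'] z \<delta>(1) by auto
      then show ?thesis using \<delta>(2)[OF z(1)] \<delta>(2)[OF z(2)] B(2)[of z'] unfolding \<rho> D_def by linarith
    qed
    then show "\<exists>\<delta>>0. \<forall>z\<in>pos_time. \<forall>z'\<in>pos_time. dist z z' < \<delta> \<and> tm z < \<delta> \<longrightarrow> U z - D - (V z' - \<rho> z') \<le> e"
      using \<delta>(1) by (intro exI[of _ "\<delta> / 2"]) auto
  qed
  have "\<bar>U z + lam * tm z\<bar> \<le> B + \<bar>D\<bar>" if z: "z \<in> pos_time" for z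
    using lo[OF z] hi[OF z] B(1)[of z] B(2)[of z] unfolding \<rho> by linarith
  then show ?thesis by blast
qed

lemma cauchy_sol_average:
  assumes v: "cauchy_sol G v0 v" and b: "\<And>x y. \<bar>v0 x y\<bar> \<le> M" and lam: "ergodic_admissible G lam"
  shows "uniform_limit UNIV (\<lambda>t (x, y). v x y t / t) (\<lambda>_. - lam) at_top"
proof -
  have b': "\<bar>(\<lambda>(x, y). v0 x y) X\<bar> \<le> M" for X using b[of "fst X" "snd X"] by (simp add: case_prod_unfold)
  obtain K where K: "\<And>z. z \<in> pos_time \<Longrightarrow> \<bar>uncurry3 v z + lam * tm z\<bar> \<le> K"
    using csol_long_time[OF cauchy_sol_imp_csol[OF v] b' lam] by blast
  show ?thesis
  proof (rule uniform_limitI)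
    fix e :: real assume e: "e > 0"
    have "\<forall>\<^sub>F t in at_top. max 0 (K / e) < (t :: real)" by (rule eventually_gt_at_top)
    then show "\<forall>\<^sub>F t in at_top. \<forall>X\<in>UNIV. dist ((\<lambda>(x, y). v x y t / t) X) (- lam) < e"
    proof eventually_elim
      case (elim t)
      then have t: "0 < t" "K < e * t" using e by (auto simp: pos_divide_less_eq mult.commute)
      show ?case
      proof
        fix X :: "(real^'n) \<times> real"
        obtain x y where X: "X = (x, y)" by (cases X)
        have "\<bar>v x y t + lam * t\<bar> \<le> K" using K[of "(x, y, t)"] t(1) by (simp add: pos_time_iff tm_def uncurry3_def)
        then have "\<bar>v x y t + lam * t\<bar> / t < e" using t by (simp add: pos_divide_less_eq)
        moreover have "\<bar>v x y t / t - - lam\<bar> = \<bar>v x y t + lam * t\<bar> / t" using t(1) by (simp add: field_simps abs_if)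
        ultimately show "dist ((\<lambda>(x, y). v x y t / t) X) (- lam) < e" by (simp add: X dist_real_def)
      qed
    qed
  qed
qed

end

section \<open>From the hypotheses to the locale, and the assembly\<close>

lemma coercive_px_of_lin:
  fixes G :: "('n::finite) ham"
  assumes lin: "lin_coercive G C1 C2" and C1: "0 < C1" and C5: "0 \<le> C5"
    and q: "\<And>x y t p q q'. \<bar>G x y t p q' - G x y t p q\<bar> \<le> C5 * \<bar>q' - q\<bar>"
  shows "coercive_px G"
  unfolding coercive_px_def
proof (intro allI impI)
  fix R M :: real assume R: "R > 0"
  show "\<exists>Q. \<forall>x y t px py. \<bar>py\<bar> \<le> R \<and> Q \<le> norm px \<longrightarrow> M \<le> G x y t px py"
  \<comment> \<open>Changing p_y from 0 to a value of size at most \<open>R\<close> lowers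
    \<open>G\<close> by at most \<open>C5 * R\<close>; the linear growth must beat this together
    with \<open>C2\<close> and \<open>M\<close>.\<close>
  proof (intro exI[of _ "(M + C2 + C5 * R) / C1"] allI impI)
    fix x px :: "real^'n" and y t py :: real assume *: "\<bar>py\<bar> \<le> R \<and> (M + C2 + C5 * R) / C1 \<le> norm px"
    then have "M + C2 + C5 * R \<le> C1 * norm px" using C1 by (simp add: pos_divide_le_eq mult.commute)
    moreover have "C1 * norm px - C2 \<le> G x y t px 0" using lin by (simp add: lin_coercive_def)
    moreover have "C5 * \<bar>py\<bar> \<le> C5 * R" using * C5 by (intro mult_left_mono) auto
    moreover have "\<bar>G x y t px py - G x y t px 0\<bar> \<le> C5 * \<bar>py\<bar>" using q[of x y t px py 0] by simp
    ultimately show "M \<le> G x y t px py" by linarith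
  qed
qed

lemma hj_of_coercive:
  assumes H1: "H1 G" and H3: "H3 G l" and c: "coercive_px G \<or> (\<exists>C1>0. \<exists>C2. lin_coercive G C1 C2)"
  shows "\<exists>C3 C4. hj G l C3 C4"
proof -
  obtain C3 C4 C5 where C: "0 \<le> C3" "0 \<le> C4" "0 \<le> C5"
    "\<And>x y y' t p q. \<bar>G x y' t p q - G x y t p q\<bar> \<le> C3 * \<bar>q + l\<bar> * \<bar>y' - y\<bar>"
    "\<And>x y t t' p q. C4 * \<bar>t' - t\<bar> \<le> 1 / 2 \<Longrightarrow> \<bar>G x y t' p q - G x y t p q\<bar> \<le> 2 * C4 * (1 + \<bar>q\<bar> + \<bar>G x y t p q\<bar>) * \<bar>t' - t\<bar>"
    "\<And>x y t p q q'. \<bar>G x y t p q' - G x y t p q\<bar> \<le> C5 * \<bar>q' - q\<bar>"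
    using H3_increments[OF H1 H3] by metis
  have "coercive_px G" using c coercive_px_of_lin[where G=G, OF _ _ C(3,6)] by blast
  then have "hj G l C3 C4"
    using H1 C unfolding H1_def by unfold_locales auto
  then show ?thesis by blast
qed

lemma hj_of_H: "H1 G \<Longrightarrow> H2 G \<Longrightarrow> H3 G l \<Longrightarrow> \<exists>C3 C4. hj G l C3 C4"
  by (rule hj_of_coercive) (auto simp: H2_def)

text \<open>Only one value of the modulus enters: gradients with p_y = 0, covered by the radius 1,
  at which \<open>G\<close> must exceed \<open>C0\<close>, whence the level \<open>C0 + 1\<close>.
  Neither \<open>\<alpha>\<close> nor the constants of the locale appear.\<close>

lemma oscillation_t_indep:
  fixes G :: "('n::finite) ham"
  assumes H: "H1 G" "t_indep G" "coercive_px_with G Q" "H3 G l" and C0: "\<And>x y t. \<bar>G x y t 0 0\<bar> \<le> C0"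
    and \<alpha>: "\<alpha> > 0" and w: "discounted_sol G \<alpha> w"
  shows "uncurry3 w z - uncurry3 w z' \<le> \<bar>l\<bar> + 1 + 2 * max 1 (Q 1 (C0 + 1)) * (1 + CARD('n))"
proof -
  have "coercive_px G" using H(3) unfolding coercive_px_def coercive_px_with_def by blast
  then obtain C3 C4 where "hj G l C3 C4" using hj_of_coercive[OF H(1,4)] by blast
  then interpret hj G l C3 C4 .
  interpret hj_discounted G l C3 C4 \<alpha> "uncurry3 w" C0
    by unfold_locales (use \<alpha> w C0 in \<open>auto simp: discounted_sol_iff\<close>)
  show ?thesis
  proof (rule osc_t_indep)
    show "uncurry3 w (x, y, t) = uncurry3 w (x, y, s)" for x y t s
      using discounted_sol_t_indep[OF \<alpha> H(2) w] by (simp add: uncurry3_def)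
    have "\<forall>x y t px py. \<bar>py\<bar> \<le> 1 \<and> Q 1 (C0 + 1) \<le> norm px \<longrightarrow> C0 + 1 \<le> G x y t px py"
      using H(3) unfolding coercive_px_with_def by (meson zero_less_one)
    then show "Q 1 (C0 + 1) \<le> norm p \<Longrightarrow> C0 + 1 \<le> G x y t p 0" for x y t p by simp
  qed
qed

lemma oscillation_t_dep:
  fixes G :: "('n::finite) ham"
  assumes H: "H1 G" "lin_coercive G C1 C2" "H3 G l" "0 < C1" "0 < C2" and C0: "\<And>x y t. \<bar>G x y t 0 0\<bar> \<le> C0"
    and \<alpha>: "\<alpha> > 0" and w: "discounted_sol G \<alpha> w"
  shows "uncurry3 w z - uncurry3 w z' \<le> \<bar>l\<bar> + 1 + (C2 + C0 + 1) * (CARD('n) / C1 + 1)"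
proof -
  obtain C3 C4 where "hj G l C3 C4" using hj_of_coercive[OF H(1,3)] H(2,4) by blast
  then interpret hj G l C3 C4 .
  interpret hj_discounted G l C3 C4 \<alpha> "uncurry3 w" C0
    by unfold_locales (use \<alpha> w C0 in \<open>auto simp: discounted_sol_iff\<close>)
  show ?thesis by (rule osc_t_dep[OF H(4,5)]) (use H(2) in \<open>simp add: lin_coercive_def\<close>)
qed

lemma oscillation_bounded:
  assumes H: "H1 G" "H2 G" "H3 G l"
  shows "\<exists>K. \<forall>\<alpha> w z z'. \<alpha> > 0 \<and> discounted_sol G \<alpha> w \<longrightarrow> uncurry3 w z - uncurry3 w z' \<le> K"
proof -
  obtain C3 C4 where "hj G l C3 C4" using hj_of_H[OF H] by blast
  then interpret hj G l C3 C4 .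
  obtain C0 where C0: "\<And>x y t. \<bar>G x y t 0 0\<bar> \<le> C0" using G_bounded[of 0] by auto
  show ?thesis
  proof (cases "t_indep G")
    case True
    then have "coercive_px G" using H(2) by (auto simp: H2_def)
    \<comment> \<open>A modulus of coercivity is chosen; the implication is placed inside the
      existential so that the choice is total in \<open>R\<close> as well.\<close>
    then have "\<forall>R M. \<exists>Q. R > 0 \<longrightarrow> (\<forall>x y t px py. \<bar>py\<bar> \<le> R \<and> Q \<le> norm px \<longrightarrow> M \<le> G x y t px py)"
      unfolding coercive_px_def by blast
    then obtain Q where "\<And>R M. R > 0 \<longrightarrow> (\<forall>x y t px py. \<bar>py\<bar> \<le> R \<and> Q R M \<le> norm px \<longrightarrow> M \<le> G x y t px py)" by metis
    then have "coercive_px_with G Q" unfolding coercive_px_with_def by blast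
    from oscillation_t_indep[OF H(1) True this H(3) C0] show ?thesis by blast
  next
    case False
    then obtain C1 C2 where "C1 > 0" "C2 > 0" "lin_coercive G C1 C2" using H(2) by (auto simp: H2_def)
    from oscillation_t_dep[OF H(1) this(3) H(3) this(1,2) C0] show ?thesis by blast
  qed
qed

theorem theorem1p1:
  shows
  \<comment> \<open>(i)\<close>
  "(\<forall>(G :: 'n ham) l. H1 G \<and> H2 G \<and> H3 G l \<longrightarrow>
      (\<forall>\<alpha>>0. (\<exists>!w. discounted_sol G \<alpha> w) \<and>
              (t_indep G \<longrightarrow> (\<forall>w. discounted_sol G \<alpha> w \<longrightarrow> (\<forall>x y t s. w x y t = w x y s)))))
   \<and>
   \<comment> \<open>(ii), t-independent case: K depends only on C0, l and the coercivity modulus Q\<close>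
   (\<forall>C0 l (Q :: real \<Rightarrow> real \<Rightarrow> real). \<exists>K. \<forall>(G :: 'n ham) \<alpha> w.
      H1 G \<and> t_indep G \<and> coercive_px_with G Q \<and> H3 G l \<and> (\<forall>x y t. \<bar>G x y t 0 0\<bar> \<le> C0) \<and>
      \<alpha> > 0 \<and> discounted_sol G \<alpha> w \<longrightarrow>
      (\<forall>x y t x' y' t'. w x y t - w x' y' t' \<le> K))
   \<and>
   \<comment> \<open>(ii), t-dependent case: K = K(C0, C1, C2, l)\<close>
   (\<forall>C0 l C1 C2. C1 > 0 \<and> C2 > 0 \<longrightarrow> (\<exists>K. \<forall>(G :: 'n ham) \<alpha> w.
      H1 G \<and> \<not> t_indep G \<and> lin_coercive G C1 C2 \<and> H3 G l \<and> (\<forall>x y t. \<bar>G x y t 0 0\<bar> \<le> C0) \<and>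
      \<alpha> > 0 \<and> discounted_sol G \<alpha> w \<longrightarrow>
      (\<forall>x y t x' y' t'. w x y t - w x' y' t' \<le> K)))
   \<and>
   \<comment> \<open>(iii) and (iv)\<close>
   (\<forall>(G :: 'n ham) l. H1 G \<and> H2 G \<and> H3 G l \<longrightarrow>
      (\<exists>!lam. ergodic_admissible G lam) \<and>
      (\<forall>lam. ergodic_admissible G lam \<longrightarrow>
         (\<forall>v0 :: real^'n \<Rightarrow> real \<Rightarrow> real.
            bounded (range (\<lambda>(x, y). v0 x y)) \<and> uniformly_continuous_on UNIV (\<lambda>(x, y). v0 x y) \<longrightarrow>
            (\<exists>v. cauchy_sol G v0 v \<and>
                 (\<forall>v'. cauchy_sol G v0 v' \<longrightarrow> (\<forall>x y t. 0 \<le> t \<longrightarrow> v' x y t = v x y t))) \<and>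
            (\<forall>v. cauchy_sol G v0 v \<longrightarrow>
                 uniform_limit UNIV (\<lambda>t (x, y). v x y t / t) (\<lambda>_. - lam) at_top))))"
proof (intro conjI allI impI)
  fix G :: "'n ham" and l \<alpha> :: real assume "H1 G \<and> H2 G \<and> H3 G l" and \<alpha>: "\<alpha> > 0"
  then obtain C3 C4 where "hj G l C3 C4" using hj_of_H by blast
  then interpret hj G l C3 C4 .
  show "\<exists>!w. discounted_sol G \<alpha> w" using discounted_sol_exists[OF \<alpha>] discounted_sol_unique[OF \<alpha>] by blast
  fix w x y t s assume "t_indep G" "discounted_sol G \<alpha> w"
  then show "w x y t = w x y s" by (rule discounted_sol_t_indep[OF \<alpha>])
next
  fix C0 l :: real and Q :: "real \<Rightarrow> real \<Rightarrow> real"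
  show "\<exists>K. \<forall>(G :: 'n ham) \<alpha> w.
      H1 G \<and> t_indep G \<and> coercive_px_with G Q \<and> H3 G l \<and> (\<forall>x y t. \<bar>G x y t 0 0\<bar> \<le> C0) \<and>
      \<alpha> > 0 \<and> discounted_sol G \<alpha> w \<longrightarrow>
      (\<forall>x y t x' y' t'. w x y t - w x' y' t' \<le> K)"
  proof (intro exI allI impI)
    fix G :: "'n ham" and \<alpha> w x y t x' y' t'
    assume "H1 G \<and> t_indep G \<and> coercive_px_with G Q \<and> H3 G l \<and> (\<forall>x y t. \<bar>G x y t 0 0\<bar> \<le> C0) \<and>
      \<alpha> > 0 \<and> discounted_sol G \<alpha> w"
    then show "w x y t - w x' y' t' \<le> \<bar>l\<bar> + 1 + 2 * max 1 (Q 1 (C0 + 1)) * (1 + CARD('n))"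
      using oscillation_t_indep[of G Q l C0 \<alpha> w "(x, y, t)" "(x', y', t')"] by (simp add: uncurry3_def)
  qed
next
  fix C0 l C1 C2 :: real assume C: "C1 > 0 \<and> C2 > 0"
  show "\<exists>K. \<forall>(G :: 'n ham) \<alpha> w.
      H1 G \<and> \<not> t_indep G \<and> lin_coercive G C1 C2 \<and> H3 G l \<and> (\<forall>x y t. \<bar>G x y t 0 0\<bar> \<le> C0) \<and>
      \<alpha> > 0 \<and> discounted_sol G \<alpha> w \<longrightarrow>
      (\<forall>x y t x' y' t'. w x y t - w x' y' t' \<le> K)"
  proof (intro exI allI impI)
    fix G :: "'n ham" and \<alpha> w x y t x' y' t'
    assume "H1 G \<and> \<not> t_indep G \<and> lin_coercive G C1 C2 \<and> H3 G l \<and> (\<forall>x y t. \<bar>G x y t 0 0\<bar> \<le> C0) \<and>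
      \<alpha> > 0 \<and> discounted_sol G \<alpha> w"
    then show "w x y t - w x' y' t' \<le> \<bar>l\<bar> + 1 + (C2 + C0 + 1) * (CARD('n) / C1 + 1)"
      using oscillation_t_dep[of G C1 C2 l C0 \<alpha> w "(x, y, t)" "(x', y', t')"] C by (simp add: uncurry3_def)
  qed
next
  fix G :: "'n ham" and l :: real assume H: "H1 G \<and> H2 G \<and> H3 G l"
  then obtain C3 C4 where "hj G l C3 C4" using hj_of_H by blast
  then interpret hj G l C3 C4 .
  obtain K where "\<forall>\<alpha> w z z'. \<alpha> > 0 \<and> discounted_sol G \<alpha> w \<longrightarrow> uncurry3 w z - uncurry3 w z' \<le> K"
    using oscillation_bounded H by blast
  then have "\<exists>lam. ergodic_admissible G lam" using ergodic_exists by blast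
  then show "\<exists>!lam. ergodic_admissible G lam" using ergodic_le by (meson antisym)
  fix lam and v0 :: "real^'n \<Rightarrow> real \<Rightarrow> real"
  assume lam: "ergodic_admissible G lam"
    and "bounded (range (\<lambda>(x, y). v0 x y)) \<and> uniformly_continuous_on UNIV (\<lambda>(x, y). v0 x y)"
  then have bd: "bounded (range (\<lambda>(x, y). v0 x y))" and uc: "uniformly_continuous_on UNIV (\<lambda>(x, y). v0 x y)" by auto
  obtain M where "\<forall>b\<in>range (\<lambda>(x, y). v0 x y). norm b \<le> M" using bd unfolding bounded_iff by blast
  then have M: "\<bar>v0 x y\<bar> \<le> M" for x y by force
  then have M': "\<bar>(\<lambda>(x, y). v0 x y) X\<bar> \<le> M" for X by (simp add: case_prod_unfold)
  show "\<exists>v. cauchy_sol G v0 v \<and> (\<forall>v'. cauchy_sol G v0 v' \<longrightarrow> (\<forall>x y t. 0 \<le> t \<longrightarrow> v' x y t = v x y t))"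
  proof -
    obtain U where U: "csol (\<lambda>(x, y). v0 x y) U" using csol_exists[OF M' uc] by blast
    define v where "v = (\<lambda>x y t. if 0 < t then U (x, y, t) else v0 x y)"
    have v: "cauchy_sol G v0 v" unfolding v_def by (rule csol_imp_cauchy_sol[OF U M uc])
    have "v' x y t = v x y t" if v': "cauchy_sol G v0 v'" and t: "0 \<le> t" for v' x y t
    \<comment> \<open>At time 0 the datum decides; for positive times comparison in both directions
      with gap 0 does. Nothing constrains values at negative times, hence agreement is claimed for
      \<open>0 \<le> t\<close> only.\<close>
    proof (cases "t = 0")
      case True
      then show ?thesis using v v' by (simp add: cauchy_sol_def)
    next
      case False
      then have z: "(x, y, t) \<in> pos_time" using t by (simp add: pos_time_def)
      note c = cauchy_sol_imp_csol[OF v] cauchy_sol_imp_csol[OF v']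
      have "uncurry3 v (x, y, t) \<le> uncurry3 v' (x, y, t) + 0" "uncurry3 v' (x, y, t) \<le> uncurry3 v (x, y, t) + 0"
        by (rule csol_le[OF c uc _ z], simp) (rule csol_le[OF c(2,1) uc _ z], simp)
      then show ?thesis by (simp add: uncurry3_def)
    qed
    then show ?thesis using v by blast
  qed
  fix v assume "cauchy_sol G v0 v"
  then show "uniform_limit UNIV (\<lambda>t (x, y). v x y t / t) (\<lambda>_. - lam) at_top"
    by (rule cauchy_sol_average[OF _ M lam])
qed

end
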